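(* Suppose assumptions (A1), (A2), (A4) of the context hold and that the component $q(\cdot)$ of the solution $(p,q)$ of the first-order adjoint equation is a bounded process. Let $u\in\mathcal U[0,T]$, let $E_\epsilon\subset[0,T]$ be measurable with Lebesgue measure $|E_\epsilon|=\epsilon$, $0<\epsilon<T$, and let $(X_1,Y_1,Z_1)$ be the unique solution of the first-order variational equation. Then $$Y_1(t)=p(t)X_1(t),\qquad Z_1(t)=K_1(t)X_1(t)+\Delta(t)I_{E_\epsilon}(t).$$
   Context: **Control problem.** $T>0$; $(\Omega,\mathcal F,P)$ is a complete probability space carrying a one-dimensional standard Brownian motion $B$; $\mathbb F=\{\mathcal F_t\}$ is the $P$-augmentation of its natural filtration. $U\subset\mathbb R^k$ is nonempty; $b,\sigma,g:[0,T]\times\mathbb R\times\mathbb R\times\mathbb R\times U\to\mathbb R$ (arguments $(t,x,y,z,u)$), $\phi:\mathbb R\to\mathbb R$, $x_0\in\mathbb R$. $\mathcal U[0,T]$ is the set of $\mathbb F$-adapted $U$-valued processes $u$ with $\sup_{0\le t\le T}\mathbb E[|u(t)|^8]<\infty$. For $u\in\mathcal U[0,T]$ the state $(X,Y,Z)$ is the (unique, under (A1)-(A2)) solution of $$dX=b(t,X,Y,Z,u)dt+\sigma(t,X,Y,Z,u)dB,\quad dY=-g(t,X,Y,Z,u)dt+Z\,dB,\quad X(0)=x_0,\ Y(T)=\phi(X(T)).$$ The cost is $J(u)=Y(0)$; $\bar u$ is a fixed optimal control ($J(\bar u)=\inf_{u\in\mathcal U[0,T]}J(u)$) with state $(\bar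 X,\bar Y,\bar Z)$. **(A1)** For $\psi=b,\sigma,g,\phi$: $\psi,\psi_x,\psi_y,\psi_z$ are continuous in $(x,y,z,u)$; $\psi_x,\psi_y,\psi_z$ are bounded; there is $L>0$ with $|\psi(t,x,y,z,u)|\le L(1+|x|+|y|+|z|+|u|)$ and $|\sigma(t,0,0,z,u)-\sigma(t,0,0,z,u')|\le L(1+|u|+|u'|)$. **(A2)** Set $L_1=\max\{\|b_x\|_\infty,\|\sigma_x\|_\infty,\|g_x\|_\infty,\|g_y\|_\infty,\|g_z\|_\infty,\|\phi_x\|_\infty\}$, $L_2=\max\{\|b_y\|_\infty,\|b_z\|_\infty,\|\sigma_y\|_\infty\}$, $L_3=\|\sigma_z\|_\infty$, $c_1=\max\{L_2,L_3\}$. For every $2\le\beta\le8$, $\Lambda_\beta:=C_\beta2^{\beta+1}(1+T^\beta)c_1^\beta<1$. Here $C_\beta$ is a fixed constant, depending only on $L_1,\beta,T$, such that for every decoupled system $dX=\tilde b(t,X,y,z)dt+\tilde\sigma(t,X,y,z)dB$, $dY=-\tilde g(t,X,Y,Z)dt+Z\,dB$, $X(0)=x_0$, $Y(T)=\tilde\phi(X(T))$, with $(y,z)$ a given adapted pair, random adapted coefficients, $\tilde b,\tilde\sigma$ $L_1$-Lipschitz in $x$, $|\tilde g(t,x_1,y_1,z_1)-\tilde g(t,x_2,y_2,z_2)|\le L_1(|x_1-x_2|+|y_1-y_2|+|z_1-z_2|)$, $\tilde\phi$ $L_1$-Lipschitz, one has $\mathbb E[\sup_t(|X|^\beta+|Y|^\beta)+(\int_0^T|Z|^2dt)^{\beta/2}]\le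 C_\beta\mathbb E[(\int_0^T(|\tilde b(t,0,y,z)|+|\tilde g(t,0,0,0)|)dt)^\beta+(\int_0^T|\tilde\sigma(t,0,y,z)|^2dt)^{\beta/2}+|\tilde\phi(0)|^\beta+|x_0|^\beta]$ whenever the right side is finite. **(A4)** There is $\beta_0\in(0,1)$ such that, with $$G(y)=L_1+(L_2+L_1+\beta_0^{-1}L_1L_2)|y|+[L_2+\beta_0^{-1}(L_1L_2+L_2^2)]y^2+\beta_0^{-1}L_2^2|y|^3,$$ $t^*:=\big(T-\int_{-\infty}^{-L_1}\frac{dy}{G(y)}\big)\vee\big(T-\int_{L_1}^\infty\frac{dy}{G(y)}\big)<0$, and $[s(0)\vee(-l(0))]L_3\le1-\beta_0$, where $s$ is the maximal solution of $s(t)=L_1+\int_t^TG(s(r))dr$ and $l$ the minimal solution of $l(t)=-L_1-\int_t^TG(l(r))dr$ on $[0,T]$. **Notation.** $\psi(t)=\psi(t,\bar X(t),\bar Y(t),\bar Z(t),\bar u(t))$, similarly $\psi_x(t),\psi_y(t),\psi_z(t)$; $\delta\sigma(t,\Delta)=\sigma(t,\bar X(t),\bar Y(t),\bar Z(t)+\Delta(t),u(t))-\sigma(t)$. **First-order adjoint equation.** $(p,q)$, with $|p(t)|\le s(0)\vee(-l(0))$, solves $$dp=-\{g_x+g_yp+g_zK_1+b_xp+b_yp^2+b_zK_1p+\sigma_xq+\sigma_ypq+\sigma_zK_1q\}dt+q\,dB,\quad p(T)=\phi_x(\bar X(T)),$$ $$K_1(t)=(1-p(t)\sigma_z(t))^{-1}[\sigma_x(t)p(t)+\sigma_y(t)p^2(t)+q(t)].$$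 $\Delta(\cdot)$ is the unique adapted solution of $\Delta(t)=p(t)\,\delta\sigma(t,\Delta)$, $t\in[0,T]$. **First-order variational equation.** $$dX_1=[b_xX_1+b_yY_1+b_z(Z_1-\Delta I_{E_\epsilon})]dt+[\sigma_xX_1+\sigma_yY_1+\sigma_z(Z_1-\Delta I_{E_\epsilon})+\delta\sigma(t,\Delta)I_{E_\epsilon}]dB,\quad X_1(0)=0,$$ $$dY_1=-[g_xX_1+g_yY_1+g_z(Z_1-\Delta I_{E_\epsilon})-q\,\delta\sigma(t,\Delta)I_{E_\epsilon}]dt+Z_1dB,\quad Y_1(T)=\phi_x(\bar X(T))X_1(T).$$ *)

theory Defs
  imports "HOL-Probability.Probability"
begin

section \<open>Brownian motion, augmented filtration, processes\<close>

text \<open>Processes are functions \<open>X t \<omega>\<close>; only their values for \<open>t \<in> {0..T}\<close> and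
  \<open>\<omega> \<in> space M\<close> are relevant.\<close>

definition brownian_motion :: "'a measure \<Rightarrow> (real \<Rightarrow> 'a \<Rightarrow> real) \<Rightarrow> real \<Rightarrow> bool" where
  "brownian_motion M B T \<longleftrightarrow>
     (\<forall>t\<in>{0..T}. B t \<in> borel_measurable M) \<and>
     (AE \<omega> in M. B 0 \<omega> = 0) \<and>
     (AE \<omega> in M. continuous_on {0..T} (\<lambda>t. B t \<omega>)) \<and>
     (\<forall>s t. 0 \<le> s \<and> s < t \<and> t \<le> T \<longrightarrow>
        distributed M lborel (\<lambda>\<omega>. B t \<omega> - B s \<omega>) (normal_density 0 (sqrt (t - s)))) \<and>
     (\<forall>(n::nat) \<tau>. 0 \<le> \<tau> 0 \<and> (\<forall>i<n. \<tau> i < \<tau> (Suc i)) \<and> \<tau> n \<le> T \<longrightarrow>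
        prob_space.indep_vars M (\<lambda>_. borel) (\<lambda>i \<omega>. B (\<tau> (Suc i)) \<omega> - B (\<tau> i) \<omega>) {..<n})"

definition augmented_filtration :: "'a measure \<Rightarrow> (real \<Rightarrow> 'a \<Rightarrow> real) \<Rightarrow> real \<Rightarrow> 'a measure" where
  "augmented_filtration M B t =
     sigma (space M) ({B s -` A \<inter> space M | s A. s \<in> {0..t} \<and> A \<in> sets borel} \<union> null_sets M)"

text \<open>``Adapted'' is read, as usual in stochastic control, as progressively measurable.  The time
  interval carries the Lebesgue (not just the Borel) sets, so that the indicator of an
  arbitrary Lebesgue measurable set of times is an adapted process.\<close>

definition progressive ::
  "'a measure \<Rightarrow> (real \<Rightarrow> 'a \<Rightarrow> real) \<Rightarrow> real \<Rightarrow> (real \<Rightarrow> 'a \<Rightarrow> 'b::topological_space) \<Rightarrow> bool" where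
  "progressive M B T X \<longleftrightarrow>
     (\<forall>t\<in>{0..T}. (\<lambda>(s, \<omega>). X s \<omega>) \<in>
        borel_measurable (lebesgue_on {0..t} \<Otimes>\<^sub>M augmented_filtration M B t))"

definition continuous_process ::
  "'a measure \<Rightarrow> (real \<Rightarrow> 'a \<Rightarrow> real) \<Rightarrow> real \<Rightarrow> (real \<Rightarrow> 'a \<Rightarrow> real) \<Rightarrow> bool" where
  "continuous_process M B T X \<longleftrightarrow>
     progressive M B T X \<and> (AE \<omega> in M. continuous_on {0..T} (\<lambda>t. X t \<omega>))"

abbreviation time_prob :: "'a measure \<Rightarrow> real \<Rightarrow> (real \<times> 'a) measure" where
  "time_prob M T \<equiv> lebesgue_on {0..T} \<Otimes>\<^sub>M M"

definition square_sup_integrable :: "'a measure \<Rightarrow> real \<Rightarrow> (real \<Rightarrow> 'a \<Rightarrow> real) \<Rightarrow> bool" where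
  "square_sup_integrable M T X \<longleftrightarrow>
     (\<integral>\<^sup>+ \<omega>. (SUP t\<in>{0..T}. ennreal ((X t \<omega>)\<^sup>2)) \<partial>M) < \<infinity>"

definition square_integrable_process :: "'a measure \<Rightarrow> real \<Rightarrow> (real \<Rightarrow> 'a \<Rightarrow> real) \<Rightarrow> bool" where
  "square_integrable_process M T Z \<longleftrightarrow>
     (\<integral>\<^sup>+ \<omega>. (\<integral>\<^sup>+ t. ennreal ((Z t \<omega>)\<^sup>2) \<partial>lebesgue_on {0..T}) \<partial>M) < \<infinity>"


section \<open>Ito integral\<close>

definition simple_data :: "'a measure \<Rightarrow> (real \<Rightarrow> 'a \<Rightarrow> real) \<Rightarrow> real \<Rightarrow>
    nat \<Rightarrow> (nat \<Rightarrow> real) \<Rightarrow> (nat \<Rightarrow> 'a \<Rightarrow> real) \<Rightarrow> bool" where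
  "simple_data M B T n \<tau> \<xi> \<longleftrightarrow>
     0 \<le> \<tau> 0 \<and> (\<forall>i<n. \<tau> i \<le> \<tau> (Suc i)) \<and> \<tau> n \<le> T \<and>
     (\<forall>i<n. \<xi> i \<in> borel_measurable (augmented_filtration M B (\<tau> i)) \<and>
            (\<exists>C. \<forall>\<omega>\<in>space M. \<bar>\<xi> i \<omega>\<bar> \<le> C))"

definition simple_process ::
  "nat \<Rightarrow> (nat \<Rightarrow> real) \<Rightarrow> (nat \<Rightarrow> 'a \<Rightarrow> real) \<Rightarrow> real \<Rightarrow> 'a \<Rightarrow> real" where
  "simple_process n \<tau> \<xi> t \<omega> = (\<Sum>i<n. \<xi> i \<omega> * indicator {\<tau> i<..\<tau> (Suc i)} t)"

definition simple_integral :: "(real \<Rightarrow> 'a \<Rightarrow> real) \<Rightarrow>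
    nat \<Rightarrow> (nat \<Rightarrow> real) \<Rightarrow> (nat \<Rightarrow> 'a \<Rightarrow> real) \<Rightarrow> real \<Rightarrow> 'a \<Rightarrow> real" where
  "simple_integral B n \<tau> \<xi> t \<omega> =
     (\<Sum>i<n. \<xi> i \<omega> * (B (min (\<tau> (Suc i)) t) \<omega> - B (min (\<tau> i) t) \<omega>))"

text \<open>\<open>has_ito_integral M B T H I\<close>: the process \<open>I\<close> is (a continuous version of)
  \<open>\<integral>\<^sub>0\<^sup>t H dB\<close>, for progressive \<open>H\<close> with almost surely square integrable paths.  It is the limit,
  uniformly on \<open>{0..T}\<close> in probability, of the integrals of simple processes converging to
  \<open>H\<close> in \<open>L\<^sup>2(0,T)\<close> in probability; this determines \<open>I\<close> up to indistinguishability.\<close>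

definition has_ito_integral :: "'a measure \<Rightarrow> (real \<Rightarrow> 'a \<Rightarrow> real) \<Rightarrow> real \<Rightarrow>
    (real \<Rightarrow> 'a \<Rightarrow> real) \<Rightarrow> (real \<Rightarrow> 'a \<Rightarrow> real) \<Rightarrow> bool" where
  "has_ito_integral M B T H I \<longleftrightarrow>
     progressive M B T H \<and>
     (AE \<omega> in M. (\<integral>\<^sup>+ s. ennreal ((H s \<omega>)\<^sup>2) \<partial>lebesgue_on {0..T}) < \<infinity>) \<and>
     continuous_process M B T I \<and>
     (\<exists>n \<tau> \<xi>. (\<forall>k::nat. simple_data M B T (n k) (\<tau> k) (\<xi> k)) \<and>
        (\<forall>e>0. (\<lambda>k. measure M {\<omega> \<in> space M.
            (\<integral>\<^sup>+ s. ennreal ((simple_process (n k) (\<tau> k) (\<xi> k) s \<omega> - H s \<omega>)\<^sup>2)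
               \<partial>lebesgue_on {0..T}) > ennreal e}) \<longlonglongrightarrow> 0) \<and>
        (\<forall>e>0. (\<lambda>k. measure M {\<omega> \<in> space M.
            \<exists>t\<in>{0..T}. \<bar>simple_integral B (n k) (\<tau> k) (\<xi> k) t \<omega> - I t \<omega>\<bar> > e}) \<longlonglongrightarrow> 0))"

text \<open>\<open>ito_process M B T X a c\<close>: \<open>dX = a dt + c dB\<close> on \<open>{0..T}\<close>.\<close>

definition ito_process :: "'a measure \<Rightarrow> (real \<Rightarrow> 'a \<Rightarrow> real) \<Rightarrow> real \<Rightarrow>
    (real \<Rightarrow> 'a \<Rightarrow> real) \<Rightarrow> (real \<Rightarrow> 'a \<Rightarrow> real) \<Rightarrow> (real \<Rightarrow> 'a \<Rightarrow> real) \<Rightarrow> bool" where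
  "ito_process M B T X a c \<longleftrightarrow>
     continuous_process M B T X \<and>
     progressive M B T a \<and>
     (AE \<omega> in M. integrable (lebesgue_on {0..T}) (\<lambda>s. a s \<omega>)) \<and>
     (\<exists>I. has_ito_integral M B T c I \<and>
        (AE \<omega> in M. \<forall>t\<in>{0..T}.
           X t \<omega> = X 0 \<omega> + (\<integral>s. a s \<omega> \<partial>lebesgue_on {0..t}) + I t \<omega>))"

text \<open>\<open>(X, Y, Z)\<close> solves \<open>dX = a dt + c dB\<close>, \<open>dY = - f dt + Z dB\<close>, \<open>X(0) = x0\<close>, \<open>Y(T) = \<eta>\<close>
  in the usual class where \<open>E sup |X|\<^sup>2\<close>, \<open>E sup |Y|\<^sup>2\<close> and \<open>E \<integral> |Z|\<^sup>2 dt\<close> are finite.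
  \<open>a\<close>, \<open>c\<close>, \<open>f\<close> are the coefficients already evaluated along the solution.\<close>

definition fbsde_solution :: "'a measure \<Rightarrow> (real \<Rightarrow> 'a \<Rightarrow> real) \<Rightarrow> real \<Rightarrow>
    (real \<Rightarrow> 'a \<Rightarrow> real) \<Rightarrow> (real \<Rightarrow> 'a \<Rightarrow> real) \<Rightarrow> (real \<Rightarrow> 'a \<Rightarrow> real) \<Rightarrow> real \<Rightarrow> ('a \<Rightarrow> real) \<Rightarrow>
    (real \<Rightarrow> 'a \<Rightarrow> real) \<Rightarrow> (real \<Rightarrow> 'a \<Rightarrow> real) \<Rightarrow> (real \<Rightarrow> 'a \<Rightarrow> real) \<Rightarrow> bool" where
  "fbsde_solution M B T a c f x0 \<eta> X Y Z \<longleftrightarrow>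
     ito_process M B T X a c \<and>
     ito_process M B T Y (\<lambda>t \<omega>. - f t \<omega>) Z \<and>
     (AE \<omega> in M. X 0 \<omega> = x0) \<and>
     (AE \<omega> in M. Y T \<omega> = \<eta> \<omega>) \<and>
     square_sup_integrable M T X \<and>
     square_sup_integrable M T Y \<and>
     square_integrable_process M T Z"


section \<open>The control problem\<close>

type_synonym 'u coef = "real \<Rightarrow> real \<Rightarrow> real \<Rightarrow> real \<Rightarrow> 'u \<Rightarrow> real"

definition along :: "'u coef \<Rightarrow> (real \<Rightarrow> 'a \<Rightarrow> real) \<Rightarrow> (real \<Rightarrow> 'a \<Rightarrow> real) \<Rightarrow> (real \<Rightarrow> 'a \<Rightarrow> real) \<Rightarrow>
    (real \<Rightarrow> 'a \<Rightarrow> 'u) \<Rightarrow> real \<Rightarrow> 'a \<Rightarrow> real" where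
  "along \<psi> X Y Z u t \<omega> = \<psi> t (X t \<omega>) (Y t \<omega>) (Z t \<omega>) (u t \<omega>)"

definition D\<^sub>x :: "'u coef \<Rightarrow> 'u coef" where
  "D\<^sub>x \<psi> t x y z u = deriv (\<lambda>r. \<psi> t r y z u) x"

definition D\<^sub>y :: "'u coef \<Rightarrow> 'u coef" where
  "D\<^sub>y \<psi> t x y z u = deriv (\<lambda>r. \<psi> t x r z u) y"

definition D\<^sub>z :: "'u coef \<Rightarrow> 'u coef" where
  "D\<^sub>z \<psi> t x y z u = deriv (\<lambda>r. \<psi> t x y r u) z"

definition admissible :: "'a measure \<Rightarrow> (real \<Rightarrow> 'a \<Rightarrow> real) \<Rightarrow> real \<Rightarrow>
    'u::euclidean_space set \<Rightarrow> (real \<Rightarrow> 'a \<Rightarrow> 'u) set" where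
  "admissible M B T U = {u. progressive M B T u \<and>
     (\<forall>t\<in>{0..T}. \<forall>\<omega>\<in>space M. u t \<omega> \<in> U) \<and>
     (SUP t\<in>{0..T}. \<integral>\<^sup>+ \<omega>. ennreal (norm (u t \<omega>) ^ 8) \<partial>M) < \<infinity>}"

definition state :: "'a measure \<Rightarrow> (real \<Rightarrow> 'a \<Rightarrow> real) \<Rightarrow> real \<Rightarrow>
    'u coef \<Rightarrow> 'u coef \<Rightarrow> 'u coef \<Rightarrow> (real \<Rightarrow> real) \<Rightarrow> real \<Rightarrow> (real \<Rightarrow> 'a \<Rightarrow> 'u) \<Rightarrow>
    (real \<Rightarrow> 'a \<Rightarrow> real) \<Rightarrow> (real \<Rightarrow> 'a \<Rightarrow> real) \<Rightarrow> (real \<Rightarrow> 'a \<Rightarrow> real) \<Rightarrow> bool" where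
  "state M B T b \<sigma> g \<phi> x0 u X Y Z \<longleftrightarrow>
     fbsde_solution M B T (along b X Y Z u) (along \<sigma> X Y Z u) (along g X Y Z u)
       x0 (\<lambda>\<omega>. \<phi> (X T \<omega>)) X Y Z"

text \<open>\<open>Y(0)\<close> is measurable for the augmented time-zero algebra, hence almost surely constant.\<close>

definition cost :: "'a measure \<Rightarrow> (real \<Rightarrow> 'a \<Rightarrow> real) \<Rightarrow> real \<Rightarrow>
    'u coef \<Rightarrow> 'u coef \<Rightarrow> 'u coef \<Rightarrow> (real \<Rightarrow> real) \<Rightarrow> real \<Rightarrow> (real \<Rightarrow> 'a \<Rightarrow> 'u) \<Rightarrow> real" where
  "cost M B T b \<sigma> g \<phi> x0 u =
     (THE j. \<exists>X Y Z. state M B T b \<sigma> g \<phi> x0 u X Y Z \<and> (AE \<omega> in M. Y 0 \<omega> = j))"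

definition optimal_control :: "'a measure \<Rightarrow> (real \<Rightarrow> 'a \<Rightarrow> real) \<Rightarrow> real \<Rightarrow>
    'u::euclidean_space set \<Rightarrow> 'u coef \<Rightarrow> 'u coef \<Rightarrow> 'u coef \<Rightarrow> (real \<Rightarrow> real) \<Rightarrow> real \<Rightarrow>
    (real \<Rightarrow> 'a \<Rightarrow> 'u) \<Rightarrow> bool" where
  "optimal_control M B T U b \<sigma> g \<phi> x0 u \<longleftrightarrow>
     u \<in> admissible M B T U \<and>
     (\<forall>v\<in>admissible M B T U. cost M B T b \<sigma> g \<phi> x0 u \<le> cost M B T b \<sigma> g \<phi> x0 v)"


section \<open>Assumption (A1)\<close>

definition continuous_in_xyzu :: "real \<Rightarrow> 'u::euclidean_space set \<Rightarrow> 'u coef \<Rightarrow> bool" where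
  "continuous_in_xyzu T U \<psi> \<longleftrightarrow>
     (\<forall>t\<in>{0..T}. continuous_on (UNIV \<times> UNIV \<times> UNIV \<times> U) (\<lambda>(x, y, z, u). \<psi> t x y z u))"

definition bounded_coef :: "real \<Rightarrow> 'u set \<Rightarrow> 'u coef \<Rightarrow> bool" where
  "bounded_coef T U \<psi> \<longleftrightarrow> (\<exists>K. \<forall>t\<in>{0..T}. \<forall>x y z. \<forall>u\<in>U. \<bar>\<psi> t x y z u\<bar> \<le> K)"

text \<open>Measurability in \<open>t\<close> is tacit in the usual formulation, where only the regularity in
  \<open>(x, y, z, u)\<close> is spelled out.\<close>

definition A1_coef :: "real \<Rightarrow> 'u::euclidean_space set \<Rightarrow> real \<Rightarrow> 'u coef \<Rightarrow> bool" where
  "A1_coef T U L \<psi> \<longleftrightarrow>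
     (\<forall>x y z. \<forall>u\<in>U. (\<lambda>t. \<psi> t x y z u) \<in> borel_measurable (lebesgue_on {0..T})) \<and>
     (\<forall>t\<in>{0..T}. \<forall>x y z. \<forall>u\<in>U.
        (\<lambda>r. \<psi> t r y z u) field_differentiable at x \<and>
        (\<lambda>r. \<psi> t x r z u) field_differentiable at y \<and>
        (\<lambda>r. \<psi> t x y r u) field_differentiable at z) \<and>
     continuous_in_xyzu T U \<psi> \<and> continuous_in_xyzu T U (D\<^sub>x \<psi>) \<and>
     continuous_in_xyzu T U (D\<^sub>y \<psi>) \<and> continuous_in_xyzu T U (D\<^sub>z \<psi>) \<and>
     bounded_coef T U (D\<^sub>x \<psi>) \<and> bounded_coef T U (D\<^sub>y \<psi>) \<and> bounded_coef T U (D\<^sub>z \<psi>) \<and>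
     (\<forall>t\<in>{0..T}. \<forall>x y z. \<forall>u\<in>U.
        \<bar>\<psi> t x y z u\<bar> \<le> L * (1 + \<bar>x\<bar> + \<bar>y\<bar> + \<bar>z\<bar> + norm u))"

definition A1 :: "real \<Rightarrow> 'u::euclidean_space set \<Rightarrow>
    'u coef \<Rightarrow> 'u coef \<Rightarrow> 'u coef \<Rightarrow> (real \<Rightarrow> real) \<Rightarrow> bool" where
  "A1 T U b \<sigma> g \<phi> \<longleftrightarrow>
     (\<exists>L>0. A1_coef T U L b \<and> A1_coef T U L \<sigma> \<and> A1_coef T U L g \<and>
        (\<forall>x. \<phi> field_differentiable at x) \<and> continuous_on UNIV (deriv \<phi>) \<and>
        (\<exists>K. \<forall>x. \<bar>deriv \<phi> x\<bar> \<le> K) \<and> (\<forall>x. \<bar>\<phi> x\<bar> \<le> L * (1 + \<bar>x\<bar>)) \<and>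
        (\<forall>t\<in>{0..T}. \<forall>z. \<forall>u\<in>U. \<forall>u'\<in>U.
           \<bar>\<sigma> t 0 0 z u - \<sigma> t 0 0 z u'\<bar> \<le> L * (1 + norm u + norm u')))"


section \<open>Assumption (A2)\<close>

definition sup_norm :: "real \<Rightarrow> 'u set \<Rightarrow> 'u coef \<Rightarrow> real" where
  "sup_norm T U \<psi> = (SUP (t, x, y, z, u) \<in> {0..T} \<times> UNIV \<times> UNIV \<times> UNIV \<times> U. \<bar>\<psi> t x y z u\<bar>)"

definition L\<^sub>1 :: "real \<Rightarrow> 'u set \<Rightarrow> 'u coef \<Rightarrow> 'u coef \<Rightarrow> 'u coef \<Rightarrow> (real \<Rightarrow> real) \<Rightarrow> real" where
  "L\<^sub>1 T U b \<sigma> g \<phi> = Max {sup_norm T U (D\<^sub>x b), sup_norm T U (D\<^sub>x \<sigma>),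
     sup_norm T U (D\<^sub>x g), sup_norm T U (D\<^sub>y g), sup_norm T U (D\<^sub>z g), (SUP x. \<bar>deriv \<phi> x\<bar>)}"

definition L\<^sub>2 :: "real \<Rightarrow> 'u set \<Rightarrow> 'u coef \<Rightarrow> 'u coef \<Rightarrow> real" where
  "L\<^sub>2 T U b \<sigma> = Max {sup_norm T U (D\<^sub>y b), sup_norm T U (D\<^sub>z b), sup_norm T U (D\<^sub>y \<sigma>)}"

definition L\<^sub>3 :: "real \<Rightarrow> 'u set \<Rightarrow> 'u coef \<Rightarrow> real" where
  "L\<^sub>3 T U \<sigma> = sup_norm T U (D\<^sub>z \<sigma>)"

definition enn_powr :: "ennreal \<Rightarrow> real \<Rightarrow> ennreal" where
  "enn_powr a r = (if a = \<infinity> then \<infinity> else ennreal (enn2real a powr r))"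

text \<open>Random coefficients \<open>h t \<omega> x y z\<close>, progressively measurable jointly in all arguments.\<close>

definition progressive_field :: "'a measure \<Rightarrow> (real \<Rightarrow> 'a \<Rightarrow> real) \<Rightarrow> real \<Rightarrow>
    (real \<Rightarrow> 'a \<Rightarrow> real \<Rightarrow> real \<Rightarrow> real \<Rightarrow> real) \<Rightarrow> bool" where
  "progressive_field M B T h \<longleftrightarrow>
     (\<forall>t\<in>{0..T}. (\<lambda>((s, \<omega>), (x, y, z)). h s \<omega> x y z) \<in> borel_measurable
        ((lebesgue_on {0..t} \<Otimes>\<^sub>M augmented_filtration M B t) \<Otimes>\<^sub>M
         (borel :: (real \<times> real \<times> real) measure)))"

text \<open>\<open>C\<close> is an admissible constant in the \<open>L\<^sup>\<beta>\<close> a priori estimate for decoupled systems whose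
  Lipschitz constants are \<open>K\<close>.  The initial value \<open>\<xi>0\<close> is part of the data of the system.\<close>

definition decoupled_estimate :: "'a measure \<Rightarrow> (real \<Rightarrow> 'a \<Rightarrow> real) \<Rightarrow> real \<Rightarrow>
    real \<Rightarrow> real \<Rightarrow> real \<Rightarrow> bool" where
  "decoupled_estimate M B T K \<beta> C \<longleftrightarrow>
     (\<forall>bt \<sigma>t gt \<phi>t y z \<xi>0 X Y Z.
        progressive M B T y \<and> progressive M B T z \<and>
        progressive_field M B T bt \<and> progressive_field M B T \<sigma>t \<and> progressive_field M B T gt \<and>
        (\<lambda>(\<omega>, x). \<phi>t \<omega> x) \<in> borel_measurable (augmented_filtration M B T \<Otimes>\<^sub>M borel) \<and>
        (\<forall>t\<in>{0..T}. \<forall>\<omega>\<in>space M. \<forall>x1 x2 y z.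
           \<bar>bt t \<omega> x1 y z - bt t \<omega> x2 y z\<bar> \<le> K * \<bar>x1 - x2\<bar> \<and>
           \<bar>\<sigma>t t \<omega> x1 y z - \<sigma>t t \<omega> x2 y z\<bar> \<le> K * \<bar>x1 - x2\<bar>) \<and>
        (\<forall>t\<in>{0..T}. \<forall>\<omega>\<in>space M. \<forall>x1 x2 y1 y2 z1 z2.
           \<bar>gt t \<omega> x1 y1 z1 - gt t \<omega> x2 y2 z2\<bar> \<le> K * (\<bar>x1 - x2\<bar> + \<bar>y1 - y2\<bar> + \<bar>z1 - z2\<bar>)) \<and>
        (\<forall>\<omega>\<in>space M. \<forall>x1 x2. \<bar>\<phi>t \<omega> x1 - \<phi>t \<omega> x2\<bar> \<le> K * \<bar>x1 - x2\<bar>) \<and>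
        fbsde_solution M B T
          (\<lambda>t \<omega>. bt t \<omega> (X t \<omega>) (y t \<omega>) (z t \<omega>))
          (\<lambda>t \<omega>. \<sigma>t t \<omega> (X t \<omega>) (y t \<omega>) (z t \<omega>))
          (\<lambda>t \<omega>. gt t \<omega> (X t \<omega>) (Y t \<omega>) (Z t \<omega>))
          \<xi>0 (\<lambda>\<omega>. \<phi>t \<omega> (X T \<omega>)) X Y Z
        \<longrightarrow>
        (let rhs = (\<integral>\<^sup>+ \<omega>.
               enn_powr (\<integral>\<^sup>+ t. ennreal (\<bar>bt t \<omega> 0 (y t \<omega>) (z t \<omega>)\<bar> + \<bar>gt t \<omega> 0 0 0\<bar>)
                          \<partial>lebesgue_on {0..T}) \<beta>
             + enn_powr (\<integral>\<^sup>+ t. ennreal (\<bar>\<sigma>t t \<omega> 0 (y t \<omega>) (z t \<omega>)\<bar>\<^sup>2)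
                          \<partial>lebesgue_on {0..T}) (\<beta> / 2)
             + ennreal (\<bar>\<phi>t \<omega> 0\<bar> powr \<beta>) + ennreal (\<bar>\<xi>0\<bar> powr \<beta>) \<partial>M)
         in rhs < \<infinity> \<longrightarrow>
            (\<integral>\<^sup>+ \<omega>.
               (SUP t\<in>{0..T}. ennreal (\<bar>X t \<omega>\<bar> powr \<beta> + \<bar>Y t \<omega>\<bar> powr \<beta>))
             + enn_powr (\<integral>\<^sup>+ t. ennreal (\<bar>Z t \<omega>\<bar>\<^sup>2) \<partial>lebesgue_on {0..T}) (\<beta> / 2) \<partial>M)
            \<le> ennreal C * rhs))"

definition A2 :: "'a measure \<Rightarrow> (real \<Rightarrow> 'a \<Rightarrow> real) \<Rightarrow> real \<Rightarrow> 'u set \<Rightarrow>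
    'u coef \<Rightarrow> 'u coef \<Rightarrow> 'u coef \<Rightarrow> (real \<Rightarrow> real) \<Rightarrow> (real \<Rightarrow> real) \<Rightarrow> bool" where
  "A2 M B T U b \<sigma> g \<phi> C \<longleftrightarrow>
     (\<forall>\<beta>\<in>{2..8}. decoupled_estimate M B T (L\<^sub>1 T U b \<sigma> g \<phi>) \<beta> (C \<beta>) \<and>
        C \<beta> * 2 powr (\<beta> + 1) * (1 + T powr \<beta>) *
          max (L\<^sub>2 T U b \<sigma>) (L\<^sub>3 T U \<sigma>) powr \<beta> < 1)"


section \<open>Assumption (A4)\<close>

definition G_fun :: "real \<Rightarrow> real \<Rightarrow> real \<Rightarrow> real \<Rightarrow> real" where
  "G_fun l1 l2 \<beta>0 y =
     l1 + (l2 + l1 + l1 * l2 / \<beta>0) * \<bar>y\<bar> + (l2 + (l1 * l2 + l2\<^sup>2) / \<beta>0) * y\<^sup>2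
        + l2\<^sup>2 / \<beta>0 * \<bar>y\<bar> ^ 3"

definition s_solution :: "(real \<Rightarrow> real) \<Rightarrow> real \<Rightarrow> real \<Rightarrow> (real \<Rightarrow> real) \<Rightarrow> bool" where
  "s_solution G l1 T s \<longleftrightarrow> continuous_on {0..T} s \<and>
     (\<forall>t\<in>{0..T}. s t = l1 + integral {t..T} (\<lambda>r. G (s r)))"

definition l_solution :: "(real \<Rightarrow> real) \<Rightarrow> real \<Rightarrow> real \<Rightarrow> (real \<Rightarrow> real) \<Rightarrow> bool" where
  "l_solution G l1 T l \<longleftrightarrow> continuous_on {0..T} l \<and>
     (\<forall>t\<in>{0..T}. l t = - l1 - integral {t..T} (\<lambda>r. G (l r)))"

definition maximal_s :: "(real \<Rightarrow> real) \<Rightarrow> real \<Rightarrow> real \<Rightarrow> (real \<Rightarrow> real) \<Rightarrow> bool" where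
  "maximal_s G l1 T s \<longleftrightarrow> s_solution G l1 T s \<and>
     (\<forall>s'. s_solution G l1 T s' \<longrightarrow> (\<forall>t\<in>{0..T}. s' t \<le> s t))"

definition minimal_l :: "(real \<Rightarrow> real) \<Rightarrow> real \<Rightarrow> real \<Rightarrow> (real \<Rightarrow> real) \<Rightarrow> bool" where
  "minimal_l G l1 T l \<longleftrightarrow> l_solution G l1 T l \<and>
     (\<forall>l'. l_solution G l1 T l' \<longrightarrow> (\<forall>t\<in>{0..T}. l t \<le> l' t))"

text \<open>The integrals of \<open>1 / G\<close> are taken in \<open>[0, \<infinity>]\<close>, with \<open>1 / 0 = \<infinity>\<close>.\<close>

definition t_star :: "(real \<Rightarrow> real) \<Rightarrow> real \<Rightarrow> real \<Rightarrow> ereal" where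
  "t_star G l1 T =
     max (ereal T - enn2ereal (\<integral>\<^sup>+ y\<in>{..- l1}. inverse (ennreal (G y)) \<partial>lborel))
         (ereal T - enn2ereal (\<integral>\<^sup>+ y\<in>{l1..}. inverse (ennreal (G y)) \<partial>lborel))"

definition A4 :: "real \<Rightarrow> 'u set \<Rightarrow> 'u coef \<Rightarrow> 'u coef \<Rightarrow> 'u coef \<Rightarrow> (real \<Rightarrow> real) \<Rightarrow>
    real \<Rightarrow> (real \<Rightarrow> real) \<Rightarrow> (real \<Rightarrow> real) \<Rightarrow> bool" where
  "A4 T U b \<sigma> g \<phi> \<beta>0 s l \<longleftrightarrow>
     (let l1 = L\<^sub>1 T U b \<sigma> g \<phi>; G = G_fun l1 (L\<^sub>2 T U b \<sigma>) \<beta>0 in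
        0 < \<beta>0 \<and> \<beta>0 < 1 \<and> t_star G l1 T < 0 \<and>
        maximal_s G l1 T s \<and> minimal_l G l1 T l \<and>
        max (s 0) (- l 0) * L\<^sub>3 T U \<sigma> \<le> 1 - \<beta>0)"


section \<open>Adjoint and variational equations\<close>

text \<open>The arguments \<open>bx\<close>, \<open>by'\<close>, \<open>bz\<close>, ... are processes: the partial derivatives of the
  coefficients evaluated along the optimal state and control.\<close>

definition K\<^sub>1 :: "(real \<Rightarrow> 'a \<Rightarrow> real) \<Rightarrow> (real \<Rightarrow> 'a \<Rightarrow> real) \<Rightarrow> (real \<Rightarrow> 'a \<Rightarrow> real) \<Rightarrow>
    (real \<Rightarrow> 'a \<Rightarrow> real) \<Rightarrow> (real \<Rightarrow> 'a \<Rightarrow> real) \<Rightarrow> real \<Rightarrow> 'a \<Rightarrow> real" where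
  "K\<^sub>1 \<sigma>x \<sigma>y \<sigma>z p q t \<omega> =
     inverse (1 - p t \<omega> * \<sigma>z t \<omega>) * (\<sigma>x t \<omega> * p t \<omega> + \<sigma>y t \<omega> * (p t \<omega>)\<^sup>2 + q t \<omega>)"

definition adjoint_solution :: "'a measure \<Rightarrow> (real \<Rightarrow> 'a \<Rightarrow> real) \<Rightarrow> real \<Rightarrow>
    'u coef \<Rightarrow> 'u coef \<Rightarrow> 'u coef \<Rightarrow> (real \<Rightarrow> real) \<Rightarrow>
    (real \<Rightarrow> 'a \<Rightarrow> real) \<Rightarrow> (real \<Rightarrow> 'a \<Rightarrow> real) \<Rightarrow> (real \<Rightarrow> 'a \<Rightarrow> real) \<Rightarrow> (real \<Rightarrow> 'a \<Rightarrow> 'u) \<Rightarrow>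
    (real \<Rightarrow> 'a \<Rightarrow> real) \<Rightarrow> (real \<Rightarrow> 'a \<Rightarrow> real) \<Rightarrow> bool" where
  "adjoint_solution M B T b \<sigma> g \<phi> X Y Z u p q \<longleftrightarrow>
     (let bx = along (D\<^sub>x b) X Y Z u; by' = along (D\<^sub>y b) X Y Z u; bz = along (D\<^sub>z b) X Y Z u;
          \<sigma>x = along (D\<^sub>x \<sigma>) X Y Z u; \<sigma>y = along (D\<^sub>y \<sigma>) X Y Z u; \<sigma>z = along (D\<^sub>z \<sigma>) X Y Z u;
          gx = along (D\<^sub>x g) X Y Z u; gy = along (D\<^sub>y g) X Y Z u; gz = along (D\<^sub>z g) X Y Z u;
          K = K\<^sub>1 \<sigma>x \<sigma>y \<sigma>z p q
      in ito_process M B T p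
           (\<lambda>t \<omega>. - (gx t \<omega> + gy t \<omega> * p t \<omega> + gz t \<omega> * K t \<omega>
                    + bx t \<omega> * p t \<omega> + by' t \<omega> * (p t \<omega>)\<^sup>2 + bz t \<omega> * K t \<omega> * p t \<omega>
                    + \<sigma>x t \<omega> * q t \<omega> + \<sigma>y t \<omega> * p t \<omega> * q t \<omega> + \<sigma>z t \<omega> * K t \<omega> * q t \<omega>))
           q \<and>
         (AE \<omega> in M. p T \<omega> = deriv \<phi> (X T \<omega>)))"

text \<open>\<open>\<delta>\<sigma> \<sigma> X Y Z ubar u \<Delta>\<close> is the process \<open>\<delta>\<sigma>(t, \<Delta>)\<close>.\<close>

definition \<delta>\<sigma> :: "'u coef \<Rightarrow> (real \<Rightarrow> 'a \<Rightarrow> real) \<Rightarrow> (real \<Rightarrow> 'a \<Rightarrow> real) \<Rightarrow> (real \<Rightarrow> 'a \<Rightarrow> real) \<Rightarrow>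
    (real \<Rightarrow> 'a \<Rightarrow> 'u) \<Rightarrow> (real \<Rightarrow> 'a \<Rightarrow> 'u) \<Rightarrow> (real \<Rightarrow> 'a \<Rightarrow> real) \<Rightarrow> real \<Rightarrow> 'a \<Rightarrow> real" where
  "\<delta>\<sigma> \<sigma> X Y Z ubar u \<Delta> t \<omega> =
     \<sigma> t (X t \<omega>) (Y t \<omega>) (Z t \<omega> + \<Delta> t \<omega>) (u t \<omega>) - \<sigma> t (X t \<omega>) (Y t \<omega>) (Z t \<omega>) (ubar t \<omega>)"

definition variational_solution :: "'a measure \<Rightarrow> (real \<Rightarrow> 'a \<Rightarrow> real) \<Rightarrow> real \<Rightarrow>
    'u coef \<Rightarrow> 'u coef \<Rightarrow> 'u coef \<Rightarrow> (real \<Rightarrow> real) \<Rightarrow>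
    (real \<Rightarrow> 'a \<Rightarrow> real) \<Rightarrow> (real \<Rightarrow> 'a \<Rightarrow> real) \<Rightarrow> (real \<Rightarrow> 'a \<Rightarrow> real) \<Rightarrow> (real \<Rightarrow> 'a \<Rightarrow> 'u) \<Rightarrow>
    (real \<Rightarrow> 'a \<Rightarrow> 'u) \<Rightarrow> (real \<Rightarrow> 'a \<Rightarrow> real) \<Rightarrow> (real \<Rightarrow> 'a \<Rightarrow> real) \<Rightarrow> real set \<Rightarrow>
    (real \<Rightarrow> 'a \<Rightarrow> real) \<Rightarrow> (real \<Rightarrow> 'a \<Rightarrow> real) \<Rightarrow> (real \<Rightarrow> 'a \<Rightarrow> real) \<Rightarrow> bool" where
  "variational_solution M B T b \<sigma> g \<phi> X Y Z ubar u q \<Delta> E X1 Y1 Z1 \<longleftrightarrow>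
     (let bx = along (D\<^sub>x b) X Y Z ubar; by' = along (D\<^sub>y b) X Y Z ubar;
          bz = along (D\<^sub>z b) X Y Z ubar;
          \<sigma>x = along (D\<^sub>x \<sigma>) X Y Z ubar; \<sigma>y = along (D\<^sub>y \<sigma>) X Y Z ubar;
          \<sigma>z = along (D\<^sub>z \<sigma>) X Y Z ubar;
          gx = along (D\<^sub>x g) X Y Z ubar; gy = along (D\<^sub>y g) X Y Z ubar;
          gz = along (D\<^sub>z g) X Y Z ubar;
          ds = \<delta>\<sigma> \<sigma> X Y Z ubar u \<Delta>
      in fbsde_solution M B T
           (\<lambda>t \<omega>. bx t \<omega> * X1 t \<omega> + by' t \<omega> * Y1 t \<omega>
                  + bz t \<omega> * (Z1 t \<omega> - \<Delta> t \<omega> * indicator E t))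
           (\<lambda>t \<omega>. \<sigma>x t \<omega> * X1 t \<omega> + \<sigma>y t \<omega> * Y1 t \<omega>
                  + \<sigma>z t \<omega> * (Z1 t \<omega> - \<Delta> t \<omega> * indicator E t) + ds t \<omega> * indicator E t)
           (\<lambda>t \<omega>. gx t \<omega> * X1 t \<omega> + gy t \<omega> * Y1 t \<omega>
                  + gz t \<omega> * (Z1 t \<omega> - \<Delta> t \<omega> * indicator E t) - q t \<omega> * ds t \<omega> * indicator E t)
           0 (\<lambda>\<omega>. deriv \<phi> (X T \<omega>) * X1 T \<omega>) X1 Y1 Z1)"

end

theory Submission imports Defs
begin

text \<open>
  Put \<open>W = Y1 - p * X1\<close>. The product rule gives \<open>dW = a dt + c dB\<close> with \<open>W(T) = 0\<close>. Let \<open>\<zeta> = Z1 - \<Delta>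
  I\<^sub>E - K\<^sub>1 X1\<close> be the deviation from the claimed formula for \<open>Z1\<close>. Because \<open>K\<^sub>1 (1 - p \<sigma>\<^sub>z) = \<sigma>\<^sub>x p
  + \<sigma>\<^sub>y p\<^sup>2 + q\<close> and \<open>\<Delta> = p \<delta>\<sigma>\<close>, all terms with \<open>X1\<close> or \<open>\<delta>\<sigma>\<close> cancel in \<open>c\<close>, and \<open>c = (1 - p \<sigma>\<^sub>z) \<zeta> -
  p \<sigma>\<^sub>y W\<close> (\<open>decoupling_diffusion\<close>). The adjoint equation is made exactly so that they cancel in the
  drift too, which becomes \<open>a = - ((g\<^sub>y + p b\<^sub>y + q \<sigma>\<^sub>y) W + (g\<^sub>z + p b\<^sub>z + q \<sigma>\<^sub>z) \<zeta>)\<close>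
  (\<open>decoupling_drift\<close>). Assumption (A4) and the bound on \<open>p\<close> give \<open>1 - p \<sigma>\<^sub>z \<ge> \<beta>0\<close>, so \<open>\<zeta>\<close> can be
  expressed by \<open>c\<close> and \<open>W\<close>; since \<open>p\<close>, \<open>q\<close> and the partial derivatives are bounded, \<open>\<bar>a\<bar> \<le> K (\<bar>W\<bar> +
  \<bar>c\<bar>)\<close>. Hence \<open>(W, c)\<close> solves a linear backward equation with terminal value \<open>0\<close> and vanishes; \<open>c =
  0\<close> and \<open>W = 0\<close> give \<open>\<zeta> = 0\<close>.

  That such equations have only the trivial solution is \<open>bsde_uniqueness\<close>. The finiteness of \<open>E sup
  W\<^sup>2\<close> is immediate, whereas \<open>c\<close> contains \<open>\<Delta>\<close> and \<open>\<delta>\<sigma>\<close>, whose moments would have to be estimated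
  first. The usual argument with \<open>W\<^sup>2\<close> and \<open>exp (L t)\<close> needs the stochastic integral \<open>\<integral> 2 W c dB\<close> to
  have mean zero. Multiplying \<open>W\<^sup>2\<close> by the additional weight \<open>exp (- (1/n) \<integral> W\<^sup>2 c\<^sup>2 ds)\<close> achieves this
  without stopping times or moments of \<open>c\<close>: the square of the weighted integrand has a bounded time
  integral. The price of the weight is at most a constant times \<open>E[sup W\<^sup>2 (1 - weight)]\<close>, which
  tends to zero as \<open>n\<close> grows.

  About Ito processes the proof needs that they form an algebra with the product rule
  (\<open>weak_ito_mult\<close>), that exponentials of time integrals belong to it (\<open>weak_ito_exp\<close>), and that
  stochastic integrals with bounded quadratic variation have mean zero (\<open>stoch_int_expectation\<close>).
  All this is developed for a weak notion of stochastic integral, \<open>stoch_int\<close>, which asks for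
  approximation by step processes on dyadic grids, in probability and at finitely many times only.
  The engine is an inequality of Lenglart type for sums \<open>\<Sum> \<eta>\<^sub>i (B(t\<^sub>i\<^sub>+\<^sub>1) - B(t\<^sub>i))\<close> with
  predictable coefficients (\<open>transform_prob_size\<close>): if the quadratic variation is small in
  probability, so is the sum. It rests on the \<open>L\<^sup>2\<close> isometry, and this on the independence of a
  Brownian increment from the augmented past (\<open>filtration_indep_increment\<close>). The product rule
  follows by polarization from its case of a square: that \<open>F(t)\<^sup>2 - F(0)\<^sup>2\<close> is \<open>2 \<integral> F dF\<close> plus the
  quadratic variation is an algebraic identity for sums over a grid, followed by a passage to the
  limit (\<open>quadratic_variation\<close>, \<open>weak_ito_square\<close>).
\<close>

section \<open>Brownian increments and the augmented filtration\<close>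

locale brownian_setting = prob_space M for M :: "'a measure" +
  fixes B :: "real \<Rightarrow> 'a \<Rightarrow> real" and T :: real
  assumes T_pos: "0 < T"
    and complete: "complete_measure M"
    and brownian: "brownian_motion M B T"
begin

abbreviation Filt :: "real \<Rightarrow> 'a measure" where
  "Filt t \<equiv> augmented_filtration M B t"

lemma B_measurable [measurable]: "0 \<le> t \<Longrightarrow> t \<le> T \<Longrightarrow> B t \<in> borel_measurable M"
  using brownian unfolding brownian_motion_def by auto

lemma filtration_generator_subset:
  "{B s -` A \<inter> space M | s A. s \<in> {0..t} \<and> A \<in> sets borel} \<union> null_sets M \<subseteq> Pow (space M)"
  by (auto dest: sets.sets_into_space)

lemma space_filtration [simp]: "space (Filt t) = space M"
  unfolding augmented_filtration_def by (rule space_measure_of[OF filtration_generator_subset])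

lemma sets_filtration:
  "sets (Filt t) = sigma_sets (space M)
     ({B s -` A \<inter> space M | s A. s \<in> {0..t} \<and> A \<in> sets borel} \<union> null_sets M)"
  unfolding augmented_filtration_def by (rule sets_measure_of[OF filtration_generator_subset])

lemma filtration_mono: "s \<le> t \<Longrightarrow> sets (Filt s) \<subseteq> sets (Filt t)"
  unfolding sets_filtration by (rule sigma_sets_mono') fastforce

lemma filtration_sub: assumes "t \<le> T" shows "sets (Filt t) \<subseteq> sets M"
  unfolding sets_filtration
proof (rule sets.sigma_sets_subset, rule Un_least)
  show "{B s -` A \<inter> space M | s A. s \<in> {0..t} \<and> A \<in> sets borel} \<subseteq> sets M"
    using assms by (auto intro!: measurable_sets[OF B_measurable])
qed auto

lemma filtration_measurable_mono:
  "f \<in> borel_measurable (Filt s) \<Longrightarrow> s \<le> t \<Longrightarrow> f \<in> borel_measurable (Filt t)"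
  using filtration_mono[of s t] by (auto simp: measurable_def)

lemma filtration_measurableD:
  "f \<in> borel_measurable (Filt s) \<Longrightarrow> s \<le> T \<Longrightarrow> f \<in> borel_measurable M"
  using filtration_sub[of s] by (auto simp: measurable_def)

lemma B_adapted: "0 \<le> s \<Longrightarrow> s \<le> t \<Longrightarrow> B s \<in> borel_measurable (Filt t)"
  by (rule measurableI) (auto simp: sets_filtration intro!: sigma_sets.Basic)

text \<open>
  Brownian motion is given with independent increments over partitions. This turns that into
  independence of a later increment from finitely many earlier positions.
\<close>

lemma cylinder_indep_increment:
  assumes st: "0 \<le> s" "s < t" "t \<le> T" and J: "finite J" "J \<subseteq> {0..s}"
    and A: "\<And>r. r \<in> J \<Longrightarrow> A r \<in> sets borel" and D: "D \<in> sets borel"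
  shows "prob ({\<omega> \<in> space M. \<forall>r\<in>J. B r \<omega> \<in> A r} \<inter> {\<omega> \<in> space M. B t \<omega> - B s \<omega> \<in> D}) =
    prob {\<omega> \<in> space M. \<forall>r\<in>J. B r \<omega> \<in> A r} * prob {\<omega> \<in> space M. B t \<omega> - B s \<omega> \<in> D}"
proof -
  \<comment> \<open>The times in \<open>J\<close> are completed by \<open>0\<close> and \<open>s\<close>, so that they, followed by \<open>t\<close>, are the partition to
     which independence of increments applies and \<open>B t - B s\<close> is its last increment.\<close>
  define J' where "J' = insert 0 (insert s J)"
  define xs where "xs = sorted_list_of_set J'"
  define n where "n = length xs - 1"
  have J': "finite J'" "J' \<subseteq> {0..s}" "J' \<noteq> {}" using J st by (auto simp: J'_def)
  have setxs: "set xs = J'" using J' by (simp add: xs_def)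
  have xsne: "xs \<noteq> []" using setxs J' by auto
  have len: "length xs = Suc n" using xsne by (simp add: n_def)
  have sd: "sorted_wrt (<) xs" by (simp add: xs_def)
  have lt: "xs ! i < xs ! j" if "i < j" "j \<le> n" for i j
    using sd that len by (auto simp: sorted_wrt_iff_nth_less)
  have bnd: "xs ! i \<in> {0..s}" if "i \<le> n" for i
    using J'(2) setxs len that nth_mem[of i xs] by (auto simp del: nth_mem)
  have x0: "xs ! 0 = 0"
  proof -
    have "0 \<in> set xs" by (simp add: setxs J'_def)
    then obtain i where i: "i \<le> n" "xs ! i = 0" using len by (auto simp: in_set_conv_nth less_Suc_eq_le)
    then show ?thesis using lt[of 0 i] bnd[of 0] by (cases i) auto
  qed
  have xn: "xs ! n = s"
  proof -
    have "s \<in> set xs" by (simp add: setxs J'_def)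
    then obtain i where i: "i \<le> n" "xs ! i = s" using len by (auto simp: in_set_conv_nth less_Suc_eq_le)
    then show ?thesis using lt[of i n] bnd[of n] by (cases "i = n") auto
  qed
  define \<tau> where "\<tau> i = (if i \<le> n then xs ! i else t)" for i
  define inc where "inc i \<omega> = B (\<tau> (Suc i)) \<omega> - B (\<tau> i) \<omega>" for i \<omega>
  have "0 \<le> \<tau> 0 \<and> (\<forall>i<Suc n. \<tau> i < \<tau> (Suc i)) \<and> \<tau> (Suc n) \<le> T"
    using lt bnd x0 xn st by (auto simp: \<tau>_def less_Suc_eq_le intro: le_less_trans)
  then have iv: "indep_vars (\<lambda>_. borel) inc {..<Suc n}"
    using brownian unfolding brownian_motion_def inc_def by blast
  have "indep_var (PiM {..<n} (\<lambda>_. borel)) (\<lambda>\<omega>. restrict (\<lambda>i. inc i \<omega>) {..<n})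
      (PiM {n} (\<lambda>_. borel)) (\<lambda>\<omega>. restrict (\<lambda>i. inc i \<omega>) {n})"
    by (rule indep_var_restrict[OF iv]) auto
  from indep_varD[OF this]
  have ind: "prob ((\<lambda>\<omega>. (restrict (\<lambda>i. inc i \<omega>) {..<n}, restrict (\<lambda>i. inc i \<omega>) {n})) -` (X \<times> Y) \<inter> space M) =
    prob ((\<lambda>\<omega>. restrict (\<lambda>i. inc i \<omega>) {..<n}) -` X \<inter> space M) * prob ((\<lambda>\<omega>. restrict (\<lambda>i. inc i \<omega>) {n}) -` Y \<inter> space M)"
    if "X \<in> sets (PiM {..<n} (\<lambda>_. borel))" "Y \<in> sets (PiM {n} (\<lambda>_. borel))" for X Y
    using that by blast
  define A' where "A' i = (if xs ! i \<in> J then A (xs ! i) else UNIV)" for i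
  \<comment> \<open>\<open>B r\<close> is almost surely the sum of the increments up to \<open>r\<close>, because \<open>B 0 = 0\<close>.\<close>
  define X where "X = {f \<in> space (PiM {..<n} (\<lambda>_. borel :: real measure)). \<forall>i\<in>{..n}. (\<Sum>l<i. f l) \<in> A' i}"
  define Y where "Y = {f \<in> space (PiM {n} (\<lambda>_. borel :: real measure)). f n \<in> D}"
  have A'[measurable]: "A' i \<in> sets borel" for i using A by (auto simp: A'_def)
  have X: "X \<in> sets (PiM {..<n} (\<lambda>_. borel))"
    unfolding X_def
  proof (rule sets.sets_Collect_finite_All')
    fix i assume "i \<in> {..n}"
    then have [measurable]: "(\<lambda>f. \<Sum>l<i. f l :: real) \<in> borel_measurable (PiM {..<n} (\<lambda>_. borel))"
      by (intro borel_measurable_sum measurable_component_singleton) auto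
    show "{f \<in> space (PiM {..<n} (\<lambda>_. borel)). (\<Sum>l<i. f l) \<in> A' i} \<in> sets (PiM {..<n} (\<lambda>_. borel))"
      by measurable
  qed auto
  have Y: "Y \<in> sets (PiM {n} (\<lambda>_. borel))"
    unfolding Y_def using D by measurable
  have tel: "(\<Sum>l<i. inc l \<omega>) = B (xs ! i) \<omega> - B 0 \<omega>" if "i \<le> n" for i \<omega>
    using that
  proof (induction i)
    case 0 then show ?case by (simp add: x0)
  next
    case (Suc i) then show ?case by (simp add: inc_def \<tau>_def)
  qed
  let ?C = "{\<omega> \<in> space M. \<forall>r\<in>J. B r \<omega> \<in> A r}"
  let ?E = "{\<omega> \<in> space M. B t \<omega> - B s \<omega> \<in> D}"
  let ?C' = "(\<lambda>\<omega>. restrict (\<lambda>i. inc i \<omega>) {..<n}) -` X \<inter> space M"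
  have inc_meas: "inc i \<in> borel_measurable M" if "i \<le> n" for i
    using iv that by (auto simp: indep_vars_def)
  have C': "?C' = {\<omega> \<in> space M. \<forall>i\<in>{..n}. B (xs ! i) \<omega> - B 0 \<omega> \<in> A' i}"
    using tel by (auto simp: X_def space_PiM)
  have E: "(\<lambda>\<omega>. restrict (\<lambda>i. inc i \<omega>) {n}) -` Y \<inter> space M = ?E"
    by (auto simp: Y_def space_PiM inc_def \<tau>_def xn)
  have prod: "(\<lambda>\<omega>. (restrict (\<lambda>i. inc i \<omega>) {..<n}, restrict (\<lambda>i. inc i \<omega>) {n})) -` (X \<times> Y) \<inter> space M = ?C' \<inter> ?E"
    unfolding E[symmetric] by auto
  have *: "prob (?C' \<inter> ?E) = prob ?C' * prob ?E"
    using ind[OF X Y] unfolding prod E .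
  have Jr: "r \<in> {0..T}" if "r \<in> J" for r using J that st by auto
  have Cm: "?C \<in> sets M"
  proof (cases "J = {}")
    case False
    show ?thesis
    proof (rule sets.sets_Collect_finite_All'[OF _ J(1) False])
      fix r assume r: "r \<in> J"
      show "{\<omega> \<in> space M. B r \<omega> \<in> A r} \<in> sets M"
        using measurable_sets[OF B_measurable A[OF r]] Jr[OF r] by (auto simp: vimage_def Int_def conj_commute)
    qed
  qed simp
  have C'm: "?C' \<in> sets M"
    using X by (intro measurable_sets[OF measurable_restrict]) (auto intro: inc_meas)
  have Em: "?E \<in> sets M"
  proof -
    have "(\<lambda>\<omega>. B t \<omega> - B s \<omega>) \<in> borel_measurable M" using st by (intro borel_measurable_diff B_measurable) auto
    from measurable_sets[OF this D] show ?thesis by (auto simp: vimage_def Int_def conj_commute)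
  qed
  have ae: "AE \<omega> in M. (\<omega> \<in> ?C) = (\<omega> \<in> ?C')"
  proof -
    have "AE \<omega> in M. B 0 \<omega> = 0" using brownian unfolding brownian_motion_def by auto
    then show ?thesis
    proof eventually_elim
      case (elim \<omega>)
      have "(\<forall>i\<in>{..n}. B (xs ! i) \<omega> \<in> A' i) \<longleftrightarrow> (\<forall>r\<in>J. B r \<omega> \<in> A r)"
      proof safe
        fix r assume r: "r \<in> J" and h: "\<forall>i\<in>{..n}. B (xs ! i) \<omega> \<in> A' i"
        have "r \<in> set xs" using r by (simp add: setxs J'_def)
        then obtain i where "i \<le> n" "xs ! i = r" using len by (auto simp: in_set_conv_nth less_Suc_eq_le)
        then show "B r \<omega> \<in> A r" using h r by (auto simp: A'_def dest!: bspec[of _ _ i])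
      qed (auto simp: A'_def)
      then show ?case unfolding C' using elim by auto
    qed
  qed
  have "prob ?C = prob ?C'" "prob (?C \<inter> ?E) = prob (?C' \<inter> ?E)"
    using ae Cm C'm Em by (auto intro!: measure_eq_AE elim!: eventually_mono)
  then show ?thesis using * by simp
qed

text \<open>
  Cylinder events together with the null sets form a generator of the augmented past that is stable
  under intersection, so independence extends from cylinders to the whole filtration.
\<close>

lemma filtration_indep_increment:
  assumes st: "0 \<le> s" "s < t" "t \<le> T" and \<theta>: "\<theta> \<in> borel_measurable (Filt s)"
  shows "indep_var borel \<theta> borel (\<lambda>\<omega>. B t \<omega> - B s \<omega>)"
proof -
  define cyl where "cyl = {{\<omega> \<in> space M. \<forall>r\<in>J. B r \<omega> \<in> A r} | J A. finite J \<and> J \<subseteq> {0..s} \<and> (\<forall>r\<in>J. A r \<in> sets borel)}"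
  define inc where "inc = {(\<lambda>\<omega>. B t \<omega> - B s \<omega>) -` D \<inter> space M | D. D \<in> sets borel}"
  have incm: "(\<lambda>\<omega>. B t \<omega> - B s \<omega>) \<in> borel_measurable M" using st by (intro borel_measurable_diff B_measurable) auto
  have cylf: "cyl \<subseteq> sets (Filt s)"
  proof
    fix C assume "C \<in> cyl"
    then obtain J A where J: "finite J" "J \<subseteq> {0..s}" "\<forall>r\<in>J. A r \<in> sets borel" and C: "C = {\<omega> \<in> space M. \<forall>r\<in>J. B r \<omega> \<in> A r}"
      unfolding cyl_def by blast
    have "{\<omega> \<in> space (Filt s). \<forall>r\<in>J. B r \<omega> \<in> A r} \<in> sets (Filt s)"
    proof (cases "J = {}")
      case False
      show ?thesis
      proof (rule sets.sets_Collect_finite_All'[OF _ J(1) False])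
        fix r assume r: "r \<in> J"
        then show "{\<omega> \<in> space (Filt s). B r \<omega> \<in> A r} \<in> sets (Filt s)"
          using measurable_sets[OF B_adapted[of r s], of "A r"] J by (auto simp: vimage_def Int_def conj_commute subset_iff)
      qed
    qed (use sets.top[of "Filt s"] in simp)
    then show "C \<in> sets (Filt s)" unfolding C by simp
  qed
  have cylm: "cyl \<subseteq> sets M" using cylf filtration_sub[of s] st by auto
  have incm': "inc \<subseteq> sets M" unfolding inc_def using measurable_sets[OF incm] by auto
  have ind: "indep_set (cyl \<union> null_sets M) inc"
    unfolding indep_sets2_eq
  proof (intro conjI ballI)
    fix a b assume a: "a \<in> cyl \<union> null_sets M" and b: "b \<in> inc"
    obtain D where D: "D \<in> sets borel" "b = {\<omega> \<in> space M. B t \<omega> - B s \<omega> \<in> D}"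
      using b unfolding inc_def by (auto simp: vimage_def Int_def conj_commute)
    show "prob (a \<inter> b) = prob a * prob b"
    proof (cases "a \<in> cyl")
      case True
      then show ?thesis unfolding cyl_def D(2) using cylinder_indep_increment[OF st _ _ _ D(1)] by auto
    next
      case False
      then have n: "a \<in> null_sets M" using a by auto
      moreover have "a \<inter> b \<in> null_sets M" using n b incm' by (intro null_set_Int2) auto
      ultimately show ?thesis by (simp add: measure_eq_0_null_sets)
    qed
  qed (use cylm incm' in auto)
  \<comment> \<open>Intersections of two cylinders are cylinders, and anything intersected with a null set is null.\<close>
  have st1: "Int_stable (cyl \<union> null_sets M)"
  proof (rule Int_stableI)
    fix a b assume a: "a \<in> cyl \<union> null_sets M" and b: "b \<in> cyl \<union> null_sets M"
    have m: "a \<in> sets M" "b \<in> sets M" using a b cylm by auto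
    show "a \<inter> b \<in> cyl \<union> null_sets M"
    proof (cases "a \<in> null_sets M \<or> b \<in> null_sets M")
      case True then show ?thesis using m by (auto intro: null_set_Int1 null_set_Int2)
    next
      case False
      then obtain J A J' A' where J: "finite J" "J \<subseteq> {0..s}" "\<forall>r\<in>J. A r \<in> sets borel" "a = {\<omega> \<in> space M. \<forall>r\<in>J. B r \<omega> \<in> A r}"
        and J': "finite J'" "J' \<subseteq> {0..s}" "\<forall>r\<in>J'. A' r \<in> sets borel" "b = {\<omega> \<in> space M. \<forall>r\<in>J'. B r \<omega> \<in> A' r}"
        using a b unfolding cyl_def by auto
      let ?A = "\<lambda>r. (if r \<in> J then A r else UNIV) \<inter> (if r \<in> J' then A' r else UNIV)"
      have "a \<inter> b = {\<omega> \<in> space M. \<forall>r\<in>J\<union>J'. B r \<omega> \<in> ?A r}"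
        unfolding J(4) J'(4) by auto
      moreover have "\<forall>r\<in>J\<union>J'. ?A r \<in> sets borel" using J(3) J'(3) by auto
      ultimately have "a \<inter> b \<in> cyl" unfolding cyl_def using J(1,2) J'(1,2)
        by (intro CollectI exI[of _ "J \<union> J'"] exI[of _ ?A]) auto
      then show ?thesis by simp
    qed
  qed
  have st2: "Int_stable inc"
  proof (rule Int_stableI)
    fix a b assume "a \<in> inc" "b \<in> inc"
    then obtain D D' where "D \<in> sets borel" "D' \<in> sets borel" "a = (\<lambda>\<omega>. B t \<omega> - B s \<omega>) -` D \<inter> space M" "b = (\<lambda>\<omega>. B t \<omega> - B s \<omega>) -` D' \<inter> space M"
      unfolding inc_def by auto
    then show "a \<inter> b \<in> inc" unfolding inc_def by (auto intro!: exI[of _ "D \<inter> D'"])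
  qed
  have i2: "indep_set (sigma_sets (space M) (cyl \<union> null_sets M)) (sigma_sets (space M) inc)"
    by (rule indep_set_sigma_sets[OF ind st1 st2])
  have gen: "sets (Filt s) \<subseteq> sigma_sets (space M) (cyl \<union> null_sets M)"
    unfolding sets_filtration
  proof (rule sigma_sets_mono', rule Un_mono)
    show "{B r -` A \<inter> space M |r A. r \<in> {0..s} \<and> A \<in> sets borel} \<subseteq> cyl"
    proof safe
      fix r A assume "r \<in> {0..s}" "A \<in> sets (borel :: real measure)"
      then show "B r -` A \<inter> space M \<in> cyl"
        unfolding cyl_def by (intro CollectI exI[of _ "{r}"] exI[of _ "\<lambda>_. A"]) auto
    qed
  qed auto
  have sub: "sigma_sets (space M) {\<theta> -` A \<inter> space M |A. A \<in> sets borel} \<subseteq> sets (Filt s)"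
    using measurable_sets[OF \<theta>] sets.sigma_sets_subset[of "{\<theta> -` A \<inter> space M |A. A \<in> sets borel}" "Filt s"] by auto
  show ?thesis
    unfolding indep_var_eq
  proof (intro conjI)
    show "indep_set (sigma_sets (space M) {\<theta> -` A \<inter> space M |A. A \<in> sets borel})
     (sigma_sets (space M) {(\<lambda>\<omega>. B t \<omega> - B s \<omega>) -` A \<inter> space M |A. A \<in> sets borel})"
      using i2 sub gen unfolding indep_sets2_eq inc_def[symmetric] by blast
  qed (use incm filtration_measurableD[OF \<theta>] st in auto)
qed

lemma increment_moments:
  assumes st: "0 \<le> s" "s < t" "t \<le> T"
  shows "integrable M (\<lambda>\<omega>. (B t \<omega> - B s \<omega>) ^ k)"
    and "expectation (\<lambda>\<omega>. B t \<omega> - B s \<omega>) = 0"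
    and "expectation (\<lambda>\<omega>. (B t \<omega> - B s \<omega>)\<^sup>2) = t - s"
    and "expectation (\<lambda>\<omega>. (B t \<omega> - B s \<omega>) ^ 4) = 3 * (t - s)\<^sup>2"
proof -
  let ?d = "normal_density 0 (sqrt (t - s))"
  have pos: "0 < sqrt (t - s)" using st by simp
  have d: "distributed M lborel (\<lambda>\<omega>. B t \<omega> - B s \<omega>) ?d"
    using brownian st unfolding brownian_motion_def by auto
  have I: "integrable lborel (\<lambda>x. ?d x * x ^ k)" for k
    using integrable_normal_moment[OF pos, of 0 k] by simp
  show "integrable M (\<lambda>\<omega>. (B t \<omega> - B s \<omega>) ^ k)"
    using distributed_integrable[OF d, of "\<lambda>x. x ^ k"] I[of k] by simp
  have E: "expectation (\<lambda>\<omega>. (B t \<omega> - B s \<omega>) ^ k) = (\<integral>x. ?d x * x ^ k \<partial>lborel)" for k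
    using distributed_integral[OF d, of "\<lambda>x. x ^ k"] by simp
  show "expectation (\<lambda>\<omega>. B t \<omega> - B s \<omega>) = 0"
    using E[of 1] integral_normal_moment_odd[OF pos, of 0 0] by simp
  show "expectation (\<lambda>\<omega>. (B t \<omega> - B s \<omega>)\<^sup>2) = t - s"
    using E[of 2] integral_normal_moment_even[OF pos, of 0 1] st by simp
  show "expectation (\<lambda>\<omega>. (B t \<omega> - B s \<omega>) ^ 4) = 3 * (t - s)\<^sup>2"
    using E[of 4] integral_normal_moment_even[OF pos, of 0 2] st
    by (simp add: fact_numeral power2_eq_square field_simps)
qed

lemma expectation_mult_increment:
  assumes st: "0 \<le> s" "s < t" "t \<le> T" and \<theta>: "\<theta> \<in> borel_measurable (Filt s)" "integrable M \<theta>"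
    and g: "g \<in> borel_measurable borel" "integrable M (\<lambda>\<omega>. g (B t \<omega> - B s \<omega>))"
  shows "integrable M (\<lambda>\<omega>. \<theta> \<omega> * g (B t \<omega> - B s \<omega>) :: real)"
    and "expectation (\<lambda>\<omega>. \<theta> \<omega> * g (B t \<omega> - B s \<omega>)) =
      expectation \<theta> * expectation (\<lambda>\<omega>. g (B t \<omega> - B s \<omega>))"
proof -
  have "indep_var borel (id \<circ> \<theta>) borel (g \<circ> (\<lambda>\<omega>. B t \<omega> - B s \<omega>))"
    by (rule indep_var_compose[OF filtration_indep_increment[OF st \<theta>(1)] _ g(1)]) auto
  then have i: "indep_var borel \<theta> borel (\<lambda>\<omega>. g (B t \<omega> - B s \<omega>))" by (simp add: comp_def)
  show "integrable M (\<lambda>\<omega>. \<theta> \<omega> * g (B t \<omega> - B s \<omega>))"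
    by (rule indep_var_integrable[OF i \<theta>(2) g(2)])
  show "expectation (\<lambda>\<omega>. \<theta> \<omega> * g (B t \<omega> - B s \<omega>)) =
      expectation \<theta> * expectation (\<lambda>\<omega>. g (B t \<omega> - B s \<omega>))"
    by (rule indep_var_lebesgue_integral[OF i \<theta>(2) g(2)])
qed

end

section \<open>Convergence in probability\<close>

context prob_space
begin

text \<open>
  The usual metric of convergence in probability. Working with this number instead of probabilities
  of deviations makes all limit arguments subadditive.
\<close>

definition prob_size :: "('a \<Rightarrow> real) \<Rightarrow> real" where
  "prob_size X = expectation (\<lambda>\<omega>. min 1 \<bar>X \<omega>\<bar>)"

lemma prob_size_integrable [intro]: "X \<in> borel_measurable M \<Longrightarrow> integrable M (\<lambda>\<omega>. min 1 \<bar>X \<omega> :: real\<bar>)"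
  by (rule integrable_const_bound[of _ 1]) auto

lemma prob_size_nonneg: "0 \<le> prob_size X"
  unfolding prob_size_def by (rule integral_nonneg_AE) auto

lemma prob_size_cong: "(\<And>\<omega>. \<omega> \<in> space M \<Longrightarrow> X \<omega> = Y \<omega>) \<Longrightarrow> prob_size X = prob_size Y"
  unfolding prob_size_def by (intro Bochner_Integration.integral_cong) auto

lemma prob_size_mono:
  assumes "X \<in> borel_measurable M" "Y \<in> borel_measurable M" "AE \<omega> in M. \<bar>X \<omega>\<bar> \<le> \<bar>Y \<omega>\<bar>"
  shows "prob_size X \<le> prob_size Y"
  unfolding prob_size_def
  using assms(3) by (intro integral_mono_AE prob_size_integrable assms(1,2)) (auto elim!: eventually_mono)

lemma prob_size_add:
  assumes [measurable]: "X \<in> borel_measurable M" "Y \<in> borel_measurable M"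
  shows "prob_size (\<lambda>\<omega>. X \<omega> + Y \<omega>) \<le> prob_size X + prob_size Y"
proof -
  have "prob_size (\<lambda>\<omega>. X \<omega> + Y \<omega>) \<le> expectation (\<lambda>\<omega>. min 1 \<bar>X \<omega>\<bar> + min 1 \<bar>Y \<omega>\<bar>)"
    unfolding prob_size_def by (intro integral_mono Bochner_Integration.integrable_add prob_size_integrable) auto
  also have "\<dots> = prob_size X + prob_size Y" unfolding prob_size_def by (intro Bochner_Integration.integral_add prob_size_integrable assms)
  finally show ?thesis .
qed

lemma prob_size_cmult: assumes [measurable]: "X \<in> borel_measurable M" shows "prob_size (\<lambda>\<omega>. k * X \<omega>) \<le> (1 + \<bar>k\<bar>) * prob_size X"
proof -
  have "min 1 \<bar>k * x\<bar> \<le> (1 + \<bar>k\<bar>) * min 1 \<bar>x\<bar>" for x :: real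
    by (cases "\<bar>x\<bar> \<le> 1") (auto simp: min_def abs_mult algebra_simps intro: order_trans[OF _ mult_right_mono])
  then have "prob_size (\<lambda>\<omega>. k * X \<omega>) \<le> expectation (\<lambda>\<omega>. (1 + \<bar>k\<bar>) * min 1 \<bar>X \<omega>\<bar>)"
    unfolding prob_size_def by (intro integral_mono prob_size_integrable integrable_mult_right) auto
  then show ?thesis unfolding prob_size_def by simp
qed

lemma prob_size_le_event:
  assumes [measurable]: "X \<in> borel_measurable M" "A \<in> sets M" and "0 \<le> \<delta>"
    and le: "\<And>\<omega>. \<omega> \<in> space M \<Longrightarrow> \<omega> \<notin> A \<Longrightarrow> \<bar>X \<omega>\<bar> \<le> \<delta>"
  shows "prob_size X \<le> \<delta> + prob A"
proof -
  have "prob_size X \<le> expectation (\<lambda>\<omega>. \<delta> + indicator A \<omega>)"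
    unfolding prob_size_def
  proof (intro integral_mono prob_size_integrable Bochner_Integration.integrable_add)
    fix \<omega> assume "\<omega> \<in> space M"
    then show "min 1 \<bar>X \<omega>\<bar> \<le> \<delta> + indicator A \<omega>" using le[of \<omega>] \<open>0 \<le> \<delta>\<close> by (auto simp: indicator_def)
  qed (auto intro!: integrable_real_indicator simp: emeasure_eq_measure)
  also have "\<dots> = \<delta> + prob A"
    by (subst Bochner_Integration.integral_add) (auto intro!: integrable_real_indicator simp: emeasure_eq_measure prob_space)
  finally show ?thesis .
qed

lemma prob_le_prob_size:
  assumes [measurable]: "X \<in> borel_measurable M" and d: "0 < \<delta>" "\<delta> \<le> 1"
  shows "prob {\<omega> \<in> space M. \<delta> < \<bar>X \<omega>\<bar>} \<le> prob_size X / \<delta>"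
proof -
  have "prob {\<omega> \<in> space M. \<delta> < \<bar>X \<omega>\<bar>} \<le> prob {\<omega> \<in> space M. \<delta> \<le> min 1 \<bar>X \<omega>\<bar>}"
    by (rule finite_measure_mono) (use d in auto)
  also have "\<dots> \<le> prob_size X / \<delta>"
    unfolding prob_size_def
    by (rule integral_Markov_inequality_measure[where A = "{}"]) (use d in \<open>auto intro!: prob_size_integrable\<close>)
  finally show ?thesis .
qed

lemma prob_size_le_second_moment:
  assumes [measurable]: "X \<in> borel_measurable M" and i: "integrable M (\<lambda>\<omega>. (X \<omega>)\<^sup>2)"
    and le: "expectation (\<lambda>\<omega>. (X \<omega>)\<^sup>2) \<le> \<delta>\<^sup>2" and "0 \<le> \<delta>"
  shows "prob_size X \<le> \<delta>"
proof -
  have i2: "integrable M (\<lambda>\<omega>. (min 1 \<bar>X \<omega>\<bar>)\<^sup>2)"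
    by (rule integrable_const_bound[of _ 1]) (auto intro!: power_le_one)
  have "(prob_size X)\<^sup>2 \<le> expectation (\<lambda>\<omega>. (min 1 \<bar>X \<omega>\<bar>)\<^sup>2)"
  proof -
    have "0 \<le> variance (\<lambda>\<omega>. min 1 \<bar>X \<omega>\<bar>)" by (rule variance_positive)
    also have "\<dots> = expectation (\<lambda>\<omega>. (min 1 \<bar>X \<omega>\<bar>)\<^sup>2) - (prob_size X)\<^sup>2"
      unfolding prob_size_def by (rule variance_eq[OF prob_size_integrable i2]) simp
    finally show ?thesis by simp
  qed
  also have "\<dots> \<le> expectation (\<lambda>\<omega>. (X \<omega>)\<^sup>2)"
  proof (intro integral_mono i i2)
    fix \<omega>
    have "(min 1 \<bar>X \<omega>\<bar>)\<^sup>2 \<le> \<bar>X \<omega>\<bar>\<^sup>2" by (intro power_mono) auto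
    then show "(min 1 \<bar>X \<omega>\<bar>)\<^sup>2 \<le> (X \<omega>)\<^sup>2" by simp
  qed
  finally show ?thesis using le \<open>0 \<le> \<delta>\<close> power2_le_imp_le[of "prob_size X" \<delta>] by linarith
qed

lemma prob_size_tendsto:
  assumes [measurable]: "\<And>l. X l \<in> borel_measurable M" "Y \<in> borel_measurable M"
    and lim: "AE \<omega> in M. (\<lambda>l. X l \<omega>) \<longlonglongrightarrow> Y \<omega>"
  shows "(\<lambda>l. prob_size (X l)) \<longlonglongrightarrow> prob_size Y"
  unfolding prob_size_def
proof (rule integral_dominated_convergence[of _ _ _ "\<lambda>_. 1"])
  show "AE \<omega> in M. (\<lambda>l. min 1 \<bar>X l \<omega>\<bar>) \<longlonglongrightarrow> min 1 \<bar>Y \<omega>\<bar>"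
    using lim by eventually_elim (intro tendsto_intros)
qed auto

lemma prob_size_LIMSEQ_I:
  assumes "\<And>e. 0 < e \<Longrightarrow> \<forall>\<^sub>F n in sequentially. prob_size (X n) < e"
  shows "(\<lambda>n. prob_size (X n)) \<longlonglongrightarrow> 0"
proof (rule order_tendstoI)
  fix e :: real assume "e < 0"
  then show "\<forall>\<^sub>F n in sequentially. e < prob_size (X n)"
    by (intro always_eventually allI) (rule order_less_le_trans[OF _ prob_size_nonneg])
qed (rule assms)

definition prob_null :: "(nat \<Rightarrow> 'a \<Rightarrow> real) \<Rightarrow> bool" where
  "prob_null X \<longleftrightarrow> (\<forall>n. X n \<in> borel_measurable M) \<and> (\<lambda>n. prob_size (X n)) \<longlonglongrightarrow> 0"

lemma prob_null_AE:
  assumes X: "\<And>n. X n \<in> borel_measurable M" and lim: "AE \<omega> in M. (\<lambda>n. X n \<omega>) \<longlonglongrightarrow> 0"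
  shows "prob_null X"
proof -
  have "(\<lambda>n. prob_size (X n)) \<longlonglongrightarrow> expectation (\<lambda>\<omega>. 0)"
    unfolding prob_size_def
  proof (rule integral_dominated_convergence[of _ _ _ "\<lambda>_. 1"])
    show "AE \<omega> in M. (\<lambda>n. min 1 \<bar>X n \<omega>\<bar>) \<longlonglongrightarrow> 0"
      using lim by eventually_elim (auto intro!: tendsto_eq_intros)
  qed (use X in auto)
  then show ?thesis using X by (simp add: prob_null_def)
qed

lemma prob_null_le:
  assumes "prob_null Y" and X: "\<And>n. X n \<in> borel_measurable M"
    and le: "\<And>n. AE \<omega> in M. \<bar>X n \<omega>\<bar> \<le> \<bar>Y n \<omega>\<bar>"
  shows "prob_null X"
  unfolding prob_null_def
proof (intro conjI allI X)
  have Y: "\<And>n. Y n \<in> borel_measurable M" "(\<lambda>n. prob_size (Y n)) \<longlonglongrightarrow> 0" using assms by (auto simp: prob_null_def)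
  show "(\<lambda>n. prob_size (X n)) \<longlonglongrightarrow> 0"
    by (rule real_tendsto_sandwich[OF _ _ tendsto_const Y(2)]) (auto intro!: prob_size_nonneg prob_size_mono X Y le always_eventually)
qed

lemma prob_null_add:
  assumes "prob_null X" "prob_null Y" shows "prob_null (\<lambda>n \<omega>. X n \<omega> + Y n \<omega>)"
proof -
  have X: "\<And>n. X n \<in> borel_measurable M" "(\<lambda>n. prob_size (X n)) \<longlonglongrightarrow> 0"
    and Y: "\<And>n. Y n \<in> borel_measurable M" "(\<lambda>n. prob_size (Y n)) \<longlonglongrightarrow> 0" using assms by (auto simp: prob_null_def)
  have "(\<lambda>n. prob_size (\<lambda>\<omega>. X n \<omega> + Y n \<omega>)) \<longlonglongrightarrow> 0"
    by (rule real_tendsto_sandwich[OF _ _ tendsto_const tendsto_add_zero[OF X(2) Y(2)]])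
       (auto intro!: prob_size_nonneg prob_size_add X Y always_eventually)
  then show ?thesis using X Y by (auto simp: prob_null_def)
qed

lemma prob_null_minus: "prob_null X \<Longrightarrow> prob_null (\<lambda>n \<omega>. - X n \<omega>)"
  by (rule prob_null_le) (auto simp: prob_null_def)

lemma prob_null_diff: "prob_null X \<Longrightarrow> prob_null Y \<Longrightarrow> prob_null (\<lambda>n \<omega>. X n \<omega> - Y n \<omega>)"
  using prob_null_add[OF _ prob_null_minus, of X Y] by simp

lemma prob_null_subseq:
  assumes "prob_null X"
  obtains r :: "nat \<Rightarrow> nat" where "strict_mono r" "AE \<omega> in M. (\<lambda>n. X (r n) \<omega>) \<longlonglongrightarrow> 0"
proof -
  have X: "\<And>n. X n \<in> borel_measurable M" "(\<lambda>n. prob_size (X n)) \<longlonglongrightarrow> 0" using assms by (auto simp: prob_null_def)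
  have "\<exists>r. strict_mono r \<and> (AE \<omega> in M. (\<lambda>n. min 1 \<bar>X (r n) \<omega>\<bar>) \<longlonglongrightarrow> 0)"
    by (rule tendsto_L1_AE_subseq) (use X in \<open>auto simp: prob_size_def\<close>)
  then obtain r where r: "strict_mono r" "AE \<omega> in M. (\<lambda>n. min 1 \<bar>X (r n) \<omega>\<bar>) \<longlonglongrightarrow> 0" by blast
  have "AE \<omega> in M. (\<lambda>n. X (r n) \<omega>) \<longlonglongrightarrow> 0"
    using r(2)
  proof eventually_elim
    case (elim \<omega>)
    have "eventually (\<lambda>n. min 1 \<bar>X (r n) \<omega>\<bar> < 1) sequentially"
      using order_tendstoD(2)[OF elim, of 1] by simp
    then have "eventually (\<lambda>n. min 1 \<bar>X (r n) \<omega>\<bar> = \<bar>X (r n) \<omega>\<bar>) sequentially"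
      by eventually_elim auto
    from tendsto_cong[OF this] elim show ?case by (simp add: tendsto_rabs_zero_iff)
  qed
  with r(1) show ?thesis by (rule that)
qed

lemma prob_null_subseqI:
  assumes X: "\<And>n. X n \<in> borel_measurable M"
    and sub: "\<And>r :: nat \<Rightarrow> nat. strict_mono r \<Longrightarrow> \<exists>r' :: nat \<Rightarrow> nat. strict_mono r' \<and> (AE \<omega> in M. (\<lambda>n. X (r (r' n)) \<omega>) \<longlonglongrightarrow> 0)"
  shows "prob_null X"
proof -
  have "(\<lambda>n. prob_size (X n)) \<longlonglongrightarrow> 0"
  proof (rule ccontr)
    assume "\<not> (\<lambda>n. prob_size (X n)) \<longlonglongrightarrow> 0"
    then obtain e where e: "e > 0" "\<exists>\<^sub>F n in sequentially. \<not> dist (prob_size (X n)) 0 < e"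
      unfolding tendsto_iff not_eventually[symmetric] frequently_def by auto
    from e(2) have "infinite {n. e \<le> prob_size (X n)}"
      unfolding frequently_sequentially infinite_nat_iff_unbounded_le using prob_size_nonneg by (auto simp: not_less dist_real_def)
    then obtain r :: "nat \<Rightarrow> nat" where r: "strict_mono r" "\<And>n. r n \<in> {n. e \<le> prob_size (X n)}"
      using infinite_enumerate by blast
    from sub[OF r(1)] obtain r' :: "nat \<Rightarrow> nat" where r': "strict_mono r'" "AE \<omega> in M. (\<lambda>n. X (r (r' n)) \<omega>) \<longlonglongrightarrow> 0" by blast
    have "prob_null (\<lambda>n. X (r (r' n)))" by (rule prob_null_AE[OF X r'(2)])
    then have "(\<lambda>n. prob_size (X (r (r' n)))) \<longlonglongrightarrow> 0" by (simp add: prob_null_def)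
    moreover have "\<And>n. e \<le> prob_size (X (r (r' n)))" using r(2) by auto
    ultimately have "e \<le> 0" by (meson LIMSEQ_le_const)
    then show False using e by simp
  qed
  then show ?thesis using X by (simp add: prob_null_def)
qed

lemma prob_null_strict_mono: "prob_null X \<Longrightarrow> strict_mono r \<Longrightarrow> prob_null (\<lambda>n. X (r n))"
  using LIMSEQ_subseq_LIMSEQ[of "\<lambda>n. prob_size (X n)" 0 r] by (auto simp: prob_null_def comp_def)

text \<open>
  Continuous mapping: convergence in probability is almost sure convergence along subsequences of
  subsequences, so implications between pathwise limits carry over.
\<close>

lemma prob_null_map:
  assumes X: "prob_null X" and Y: "\<And>n. Y n \<in> borel_measurable M"
    and map: "AE \<omega> in M. \<forall>r :: nat \<Rightarrow> nat. strict_mono r \<longrightarrow> (\<lambda>n. X (r n) \<omega>) \<longlonglongrightarrow> 0 \<longrightarrow> (\<lambda>n. Y (r n) \<omega>) \<longlonglongrightarrow> 0"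
  shows "prob_null Y"
proof (rule prob_null_subseqI[OF Y])
  fix r :: "nat \<Rightarrow> nat" assume r: "strict_mono r"
  obtain r' :: "nat \<Rightarrow> nat" where r': "strict_mono r'" "AE \<omega> in M. (\<lambda>n. X (r (r' n)) \<omega>) \<longlonglongrightarrow> 0"
    using prob_null_subseq[OF prob_null_strict_mono[OF X r]] by blast
  have sm: "strict_mono (\<lambda>n. r (r' n))" using r r'(1) by (simp add: strict_mono_def)
  have "AE \<omega> in M. (\<lambda>n. Y (r (r' n)) \<omega>) \<longlonglongrightarrow> 0"
    using map r'(2)
  proof eventually_elim
    case (elim \<omega>) then show ?case using sm by blast
  qed
  then show "\<exists>r'. strict_mono r' \<and> (AE \<omega> in M. (\<lambda>n. Y (r (r' n)) \<omega>) \<longlonglongrightarrow> 0)" using r' by blast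
qed

lemma prob_null_mult:
  assumes X: "prob_null X" and [measurable]: "Z \<in> borel_measurable M"
  shows "prob_null (\<lambda>n \<omega>. Z \<omega> * X n \<omega>)"
proof (rule prob_null_map[OF X])
  have [measurable]: "X n \<in> borel_measurable M" for n using X by (simp add: prob_null_def)
  show "(\<lambda>\<omega>. Z \<omega> * X n \<omega>) \<in> borel_measurable M" for n by measurable
qed (auto intro!: tendsto_mult_right_zero)

lemma prob_null_sqrt:
  assumes X: "prob_null (\<lambda>n \<omega>. X n \<omega> - Y \<omega>)" and m: "\<And>n. X n \<in> borel_measurable M" "Y \<in> borel_measurable M"
  shows "prob_null (\<lambda>n \<omega>. sqrt (X n \<omega>) - sqrt (Y \<omega>))"
proof (rule prob_null_map[OF X])
  show "(\<lambda>\<omega>. sqrt (X n \<omega>) - sqrt (Y \<omega>)) \<in> borel_measurable M" for n using m by measurable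
  have "(\<lambda>n. sqrt (X (r n) \<omega>) - sqrt (Y \<omega>)) \<longlonglongrightarrow> 0" if "(\<lambda>n. X (r n) \<omega> - Y \<omega>) \<longlonglongrightarrow> 0" for r :: "nat \<Rightarrow> nat" and \<omega>
    using that tendsto_real_sqrt[of "\<lambda>n. X (r n) \<omega>" "Y \<omega>"] by (simp add: LIM_zero_iff)
  then show "AE \<omega> in M. \<forall>r :: nat \<Rightarrow> nat. strict_mono r \<longrightarrow> (\<lambda>n. X (r n) \<omega> - Y \<omega>) \<longlonglongrightarrow> 0 \<longrightarrow> (\<lambda>n. sqrt (X (r n) \<omega>) - sqrt (Y \<omega>)) \<longlonglongrightarrow> 0" by auto
qed

lemma prob_null_of_sqrt:
  assumes X: "prob_null (\<lambda>n \<omega>. sqrt (X n \<omega>) - sqrt (Y \<omega>))" and m: "\<And>n. X n \<in> borel_measurable M" "Y \<in> borel_measurable M"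
    and nn: "\<And>n \<omega>. 0 \<le> X n \<omega>" "\<And>\<omega>. 0 \<le> Y \<omega>"
  shows "prob_null (\<lambda>n \<omega>. X n \<omega> - Y \<omega>)"
proof (rule prob_null_map[OF X])
  show "(\<lambda>\<omega>. X n \<omega> - Y \<omega>) \<in> borel_measurable M" for n using m by measurable
  have "(\<lambda>n. X (r n) \<omega> - Y \<omega>) \<longlonglongrightarrow> 0" if "(\<lambda>n. sqrt (X (r n) \<omega>) - sqrt (Y \<omega>)) \<longlonglongrightarrow> 0" for r :: "nat \<Rightarrow> nat" and \<omega>
    using that tendsto_power[of "\<lambda>n. sqrt (X (r n) \<omega>)" "sqrt (Y \<omega>)" _ 2] nn by (simp add: LIM_zero_iff)
  then show "AE \<omega> in M. \<forall>r :: nat \<Rightarrow> nat. strict_mono r \<longrightarrow> (\<lambda>n. sqrt (X (r n) \<omega>) - sqrt (Y \<omega>)) \<longlonglongrightarrow> 0 \<longrightarrow> (\<lambda>n. X (r n) \<omega> - Y \<omega>) \<longlonglongrightarrow> 0" by auto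
qed

text \<open>
  The form in which Lenglart type inequalities are used: \<open>\<delta>\<close> is chosen first, the index afterwards.
\<close>

lemma prob_null_from_bound:
  assumes X: "\<And>m. X m \<in> borel_measurable M" and Y: "prob_null Y"
    and le: "\<And>m \<delta>. 0 < \<delta> \<Longrightarrow> \<delta> \<le> 1 \<Longrightarrow> prob_size (X m) \<le> \<delta> + prob_size (Y m) / \<delta>"
  shows "prob_null X"
  unfolding prob_null_def
proof (intro conjI allI X prob_size_LIMSEQ_I)
  fix e :: real assume e: "0 < e"
  define d where "d = min (e / 3) 1"
  have d: "0 < d" "d \<le> 1" "3 * d \<le> e" using e by (auto simp: d_def)
  have "(\<lambda>m. prob_size (Y m)) \<longlonglongrightarrow> 0" using Y by (simp add: prob_null_def)
  from order_tendstoD(2)[OF this, of "d * d"] d have "\<forall>\<^sub>F m in sequentially. prob_size (Y m) < d * d" by simp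
  then show "\<forall>\<^sub>F m in sequentially. prob_size (X m) < e"
  proof eventually_elim
    case (elim m)
    then have "prob_size (Y m) / d < d" using d by (simp add: field_simps)
    then show ?case using le[OF d(1,2), of m] d by linarith
  qed
qed

text \<open>
  Boundedness in \<open>L\<^sup>2\<close> gives uniform integrability, so almost sure convergence implies convergence of
  means. The limit is square integrable by the lemma of Fatou.
\<close>

lemma L2_bounded_expectation_tendsto:
  fixes X :: "nat \<Rightarrow> 'a \<Rightarrow> real"
  assumes [measurable]: "\<And>l. X l \<in> borel_measurable M" "Y \<in> borel_measurable M"
    and lim: "AE \<omega> in M. (\<lambda>l. X l \<omega>) \<longlonglongrightarrow> Y \<omega>"
    and int: "\<And>l. integrable M (\<lambda>\<omega>. (X l \<omega>)\<^sup>2)" and bd: "\<And>l. expectation (\<lambda>\<omega>. (X l \<omega>)\<^sup>2) \<le> K"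
  shows "integrable M Y" "(\<lambda>l. expectation (X l)) \<longlonglongrightarrow> expectation Y"
proof -
  have K: "0 \<le> K" using order_trans[OF _ bd[of 0]] by simp
  have "(\<integral>\<^sup>+\<omega>. ennreal ((Y \<omega>)\<^sup>2) \<partial>M) = (\<integral>\<^sup>+\<omega>. liminf (\<lambda>l. ennreal ((X l \<omega>)\<^sup>2)) \<partial>M)"
  proof (rule nn_integral_cong_AE)
    show "AE \<omega> in M. ennreal ((Y \<omega>)\<^sup>2) = liminf (\<lambda>l. ennreal ((X l \<omega>)\<^sup>2))"
      using lim
    proof eventually_elim
      case (elim \<omega>)
      have "(\<lambda>l. ennreal ((X l \<omega>)\<^sup>2)) \<longlonglongrightarrow> ennreal ((Y \<omega>)\<^sup>2)"
        by (intro tendsto_ennrealI tendsto_power elim)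
      from lim_imp_Liminf[OF _ this] show ?case by simp
    qed
  qed
  also have "\<dots> \<le> liminf (\<lambda>l. \<integral>\<^sup>+\<omega>. ennreal ((X l \<omega>)\<^sup>2) \<partial>M)"
    by (rule nn_integral_liminf) measurable
  also have "\<dots> \<le> liminf (\<lambda>l. ennreal K)"
  proof (rule Liminf_mono, rule always_eventually, rule allI)
    fix l
    have "(\<integral>\<^sup>+\<omega>. ennreal ((X l \<omega>)\<^sup>2) \<partial>M) = ennreal (expectation (\<lambda>\<omega>. (X l \<omega>)\<^sup>2))"
      by (rule nn_integral_eq_integral[OF int]) auto
    also have "\<dots> \<le> ennreal K" by (rule ennreal_leI[OF bd])
    finally show "(\<integral>\<^sup>+\<omega>. ennreal ((X l \<omega>)\<^sup>2) \<partial>M) \<le> ennreal K" .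
  qed
  also have "\<dots> = ennreal K" by (simp add: Liminf_const)
  finally have le: "(\<integral>\<^sup>+\<omega>. ennreal ((Y \<omega>)\<^sup>2) \<partial>M) \<le> ennreal K" .
  have Y2: "integrable M (\<lambda>\<omega>. (Y \<omega>)\<^sup>2)"
    by (rule integrableI_bounded) (use le in \<open>auto simp: less_top[symmetric] top_unique intro: le_less_trans\<close>)
  have EY: "expectation (\<lambda>\<omega>. (Y \<omega>)\<^sup>2) \<le> K"
    using le K nn_integral_eq_integral[OF Y2] by (simp add: ennreal_le_iff)
  show Y: "integrable M Y" by (rule square_integrable_imp_integrable[OF _ Y2]) simp
  have Xi: "integrable M (X l)" for l by (rule square_integrable_imp_integrable[OF _ int]) simp
  define D where "D l \<omega> = X l \<omega> - Y \<omega>" for l \<omega>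
  have [measurable]: "D l \<in> borel_measurable M" for l unfolding D_def by measurable
  have Dle: "(D l \<omega>)\<^sup>2 \<le> 2 * (X l \<omega>)\<^sup>2 + 2 * (Y \<omega>)\<^sup>2" for l \<omega>
    using zero_le_power2[of "X l \<omega> + Y \<omega>"] unfolding D_def by (simp add: power2_diff power2_sum)
  have D2: "integrable M (\<lambda>\<omega>. (D l \<omega>)\<^sup>2)" for l
  proof (rule Bochner_Integration.integrable_bound)
    show "integrable M (\<lambda>\<omega>. 2 * (X l \<omega>)\<^sup>2 + 2 * (Y \<omega>)\<^sup>2)" using int Y2 by auto
    show "AE \<omega> in M. norm ((D l \<omega>)\<^sup>2) \<le> norm (2 * (X l \<omega>)\<^sup>2 + 2 * (Y \<omega>)\<^sup>2)" using Dle[of l] by auto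
  qed measurable
  have ED: "expectation (\<lambda>\<omega>. (D l \<omega>)\<^sup>2) \<le> 4 * K" for l
  proof -
    have "expectation (\<lambda>\<omega>. (D l \<omega>)\<^sup>2) \<le> expectation (\<lambda>\<omega>. 2 * (X l \<omega>)\<^sup>2 + 2 * (Y \<omega>)\<^sup>2)"
      using D2 int Y2 Dle by (intro integral_mono) auto
    also have "\<dots> \<le> 4 * K" using int Y2 bd[of l] EY by simp
    finally show ?thesis .
  qed
  have Di: "integrable M (D l)" for l unfolding D_def using Xi Y by auto
  have "(\<lambda>l. expectation (D l)) \<longlonglongrightarrow> 0"
  proof (rule LIMSEQ_I)
    fix e :: real assume e: "0 < e"
    \<comment> \<open>Beyond level \<open>R\<close> the second moment, at most \<open>4 * K\<close>, contributes at most \<open>4 * K / R\<close>, which is less than \<open>e / 2\<close>.\<close>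
    define R where "R = 8 * (K + 1) / e"
    have R: "0 < R" using K e by (simp add: R_def)
    have mi: "integrable M (\<lambda>\<omega>. min R \<bar>D l \<omega>\<bar>)" for l
      by (rule integrable_const_bound[of _ R]) (use R in auto)
    have "(\<lambda>l. expectation (\<lambda>\<omega>. min R \<bar>D l \<omega>\<bar>)) \<longlonglongrightarrow> expectation (\<lambda>\<omega>. 0)"
    proof (rule integral_dominated_convergence[of _ _ _ "\<lambda>_. R"])
      show "AE \<omega> in M. (\<lambda>l. min R \<bar>D l \<omega>\<bar>) \<longlonglongrightarrow> 0"
        using lim
      proof eventually_elim
        case (elim \<omega>)
        have "(\<lambda>l. D l \<omega>) \<longlonglongrightarrow> 0" unfolding D_def using elim by (simp add: LIM_zero)
        then have "(\<lambda>l. min R \<bar>D l \<omega>\<bar>) \<longlonglongrightarrow> min R \<bar>0\<bar>" by (intro tendsto_intros)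
        then show ?case using R by simp
      qed
    qed (use R in auto)
    then have "(\<lambda>l. expectation (\<lambda>\<omega>. min R \<bar>D l \<omega>\<bar>)) \<longlonglongrightarrow> 0" by simp
    from LIMSEQ_D[OF this, of "e / 2"] e obtain l0 where l0: "\<And>l. l \<ge> l0 \<Longrightarrow> \<bar>expectation (\<lambda>\<omega>. min R \<bar>D l \<omega>\<bar>)\<bar> < e / 2" by auto
    have "\<bar>expectation (D l)\<bar> < e" if l: "l \<ge> l0" for l
    proof -
      have "\<bar>expectation (D l)\<bar> \<le> expectation (\<lambda>\<omega>. \<bar>D l \<omega>\<bar>)" by (rule integral_abs_bound)
      also have "\<dots> \<le> expectation (\<lambda>\<omega>. min R \<bar>D l \<omega>\<bar> + (D l \<omega>)\<^sup>2 / R)"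
      proof (rule integral_mono)
        fix \<omega>
        show "\<bar>D l \<omega>\<bar> \<le> min R \<bar>D l \<omega>\<bar> + (D l \<omega>)\<^sup>2 / R"
        proof (cases "\<bar>D l \<omega>\<bar> \<le> R")
          case False
          then have "\<bar>D l \<omega>\<bar> * R \<le> \<bar>D l \<omega>\<bar> * \<bar>D l \<omega>\<bar>" by (intro mult_left_mono) auto
          then have "\<bar>D l \<omega>\<bar> * R \<le> (D l \<omega>)\<^sup>2" by (simp add: power2_eq_square)
          then have "\<bar>D l \<omega>\<bar> \<le> (D l \<omega>)\<^sup>2 / R" using R by (simp add: field_simps)
          then show ?thesis using R by (simp add: min_def)
        qed (use R in \<open>auto simp: min_def\<close>)
      qed (use Di D2 mi in auto)
      also have "\<dots> = expectation (\<lambda>\<omega>. min R \<bar>D l \<omega>\<bar>) + expectation (\<lambda>\<omega>. (D l \<omega>)\<^sup>2) / R"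
        using mi D2 by simp
      also have "\<dots> < e / 2 + e / 2"
      proof (rule add_less_le_mono)
        show "expectation (\<lambda>\<omega>. min R \<bar>D l \<omega>\<bar>) < e / 2" using l0[OF l] by linarith
        have "expectation (\<lambda>\<omega>. (D l \<omega>)\<^sup>2) / R \<le> 4 * (K + 1) / R" using ED[of l] R by (intro divide_right_mono) auto
        also have "\<dots> = e / 2" using K e by (simp add: R_def field_simps)
        finally show "expectation (\<lambda>\<omega>. (D l \<omega>)\<^sup>2) / R \<le> e / 2" .
      qed
      finally show ?thesis by simp
    qed
    then show "\<exists>no. \<forall>n\<ge>no. norm (expectation (D n) - 0) < e" by auto
  qed
  then have "(\<lambda>l. expectation (D l) + expectation Y) \<longlonglongrightarrow> 0 + expectation Y" by (intro tendsto_intros)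
  then show "(\<lambda>l. expectation (X l)) \<longlonglongrightarrow> expectation Y" unfolding D_def using Xi Y by simp
qed

end

section \<open>Dyadic grids and martingale transforms\<close>

lemma block_sums:
  fixes f :: "nat \<Rightarrow> 'b::comm_monoid_add"
  shows "(\<Sum>b<c. \<Sum>i\<in>{b * k..<Suc b * k}. f i) = (\<Sum>i<c * k. f i)"
  using sum.nat_group[of f k c] by (simp add: add.commute)

context brownian_setting
begin

text \<open>
  Each dyadic level refines the preceding ones. Step processes of one level remain step processes at
  all later levels, so two approximations never need a common refinement of unrelated partitions.
\<close>

definition grid :: "nat \<Rightarrow> nat \<Rightarrow> real" where "grid m i = real i * T / 2 ^ m"

definition grid_index :: "nat \<Rightarrow> real \<Rightarrow> nat" where "grid_index m t = nat \<lfloor>t * 2 ^ m / T\<rfloor>"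

definition grid_floor :: "nat \<Rightarrow> real \<Rightarrow> real" where "grid_floor m t = grid m (grid_index m t)"

abbreviation dB :: "nat \<Rightarrow> nat \<Rightarrow> 'a \<Rightarrow> real" where
  "dB m i \<omega> \<equiv> B (grid m (Suc i)) \<omega> - B (grid m i) \<omega>"

lemma grid_0 [simp]: "grid m 0 = 0" by (simp add: grid_def)
lemma grid_nonneg [simp]: "0 \<le> grid m i" using T_pos by (simp add: grid_def)
lemma grid_top [simp]: "grid m (2 ^ m) = T" by (simp add: grid_def)
lemma grid_less_iff [simp]: "grid m i < grid m j \<longleftrightarrow> i < j" using T_pos by (simp add: grid_def divide_simps)
lemma grid_le_iff [simp]: "grid m i \<le> grid m j \<longleftrightarrow> i \<le> j" using T_pos by (simp add: grid_def divide_simps)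
lemma grid_le_T: "i \<le> 2 ^ m \<Longrightarrow> grid m i \<le> T" using grid_le_iff[of m i "2^m"] by simp
lemma grid_Suc: "grid m (Suc i) = grid m i + T / 2 ^ m" by (simp add: grid_def field_simps)
lemma grid_refine: "grid (n + r) (i * 2 ^ r) = grid n i" by (simp add: grid_def power_add field_simps)

lemma grid_less_T: "i < 2 ^ m \<Longrightarrow> grid m i < T"
  using grid_less_iff[of m i "2^m"] by simp

lemma grid_index_eqI: assumes "grid m i \<le> t" "t < grid m (Suc i)" shows "grid_index m t = i"
proof -
  have "real i \<le> t * 2 ^ m / T" "t * 2 ^ m / T < real i + 1"
    using assms T_pos by (simp_all add: grid_def field_simps)
  then have "\<lfloor>t * 2 ^ m / T\<rfloor> = int i" by (simp add: floor_eq_iff)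
  then show ?thesis by (simp add: grid_index_def)
qed

lemma grid_index_grid [simp]: "grid_index m (grid m i) = i" by (rule grid_index_eqI) auto

lemma grid_index_bounds: assumes "0 \<le> t" shows "grid m (grid_index m t) \<le> t" "t < grid m (Suc (grid_index m t))"
proof -
  have "0 \<le> t * 2 ^ m / T" using assms T_pos by simp
  then have "real (grid_index m t) = of_int \<lfloor>t * 2 ^ m / T\<rfloor>" by (simp add: grid_index_def)
  then have "real (grid_index m t) \<le> t * 2 ^ m / T" "t * 2 ^ m / T < real (grid_index m t) + 1"
    by linarith+
  then show "grid m (grid_index m t) \<le> t" "t < grid m (Suc (grid_index m t))"
    using T_pos by (simp_all add: grid_def field_simps)
qed

lemma grid_floor_bounds: assumes "0 \<le> t" shows "grid_floor m t \<le> t" "t < grid_floor m t + T / 2 ^ m" "0 \<le> grid_floor m t"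
  using grid_index_bounds[OF assms, of m] by (auto simp: grid_floor_def grid_Suc)

lemma grid_floor_grid_floor [simp]: "grid_floor m (grid_floor m t) = grid_floor m t" by (simp add: grid_floor_def)

lemma grid_index_le: assumes "0 \<le> t" "t \<le> T" shows "grid_index m t \<le> 2 ^ m"
proof (rule ccontr)
  assume "\<not> ?thesis"
  then have "grid m (2 ^ m) < grid m (grid_index m t)" by (subst grid_less_iff) simp
  then show False using grid_index_bounds(1)[OF assms(1), of m] assms(2) by simp
qed

lemma grid_index_less: assumes "0 \<le> t" "t < T" shows "grid_index m t < 2 ^ m"
proof (rule ccontr)
  assume "\<not> ?thesis"
  then have "grid m (2 ^ m) \<le> grid m (grid_index m t)" by (subst grid_le_iff) simp
  then show False using grid_index_bounds(1)[OF assms(1), of m] assms(2) by simp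
qed

lemma mesh_tendsto: "(\<lambda>m. T / 2 ^ m) \<longlonglongrightarrow> 0"
  using LIMSEQ_divide_realpow_zero[of 2 T] by simp

lemma grid_floor_tendsto: assumes "0 \<le> t" shows "(\<lambda>m. grid_floor m t) \<longlonglongrightarrow> t"
proof (rule real_tendsto_sandwich)
  show "(\<lambda>m. t - T / 2 ^ m) \<longlonglongrightarrow> t" using tendsto_diff[OF tendsto_const mesh_tendsto, of t] by simp
  show "\<forall>\<^sub>F m in sequentially. t - T / 2 ^ m \<le> grid_floor m t"
    using grid_floor_bounds(2)[OF assms] by (intro always_eventually allI) (simp add: less_imp_le algebra_simps)
  show "\<forall>\<^sub>F m in sequentially. grid_floor m t \<le> t"
    using grid_floor_bounds(1)[OF assms] by (intro always_eventually allI) simp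
qed (rule tendsto_const)

lemma grid_floor_refine: "i < 2 ^ r \<Longrightarrow> grid_floor n (grid (n + r) (b * 2 ^ r + i)) = grid n b"
proof -
  assume i: "i < 2 ^ r"
  have "grid_index n (grid (n + r) (b * 2 ^ r + i)) = b"
  proof (rule grid_index_eqI)
    have "grid (n + r) (b * 2 ^ r) \<le> grid (n + r) (b * 2 ^ r + i)" by simp
    then show "grid n b \<le> grid (n + r) (b * 2 ^ r + i)" by (simp only: grid_refine)
    have "grid (n + r) (b * 2 ^ r + i) < grid (n + r) (Suc b * 2 ^ r)" using i by simp
    then show "grid (n + r) (b * 2 ^ r + i) < grid n (Suc b)" by (simp only: grid_refine)
  qed
  then show ?thesis by (simp add: grid_floor_def)
qed

lemma grid_index_refine: "grid_index (n + r) (grid n b) = b * 2 ^ r"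
  by (subst grid_refine[of n r b, symmetric]) (rule grid_index_grid)

lemma grid_floor_grid_floor_refine: assumes "0 \<le> s" shows "grid_floor n (grid_floor (n + r) s) = grid_floor n s"
proof -
  have "grid_index n (grid_floor (n + r) s) = grid_index n s"
  proof (rule grid_index_eqI)
    have "grid (n + r) (grid_index n s * 2 ^ r) \<le> s" unfolding grid_refine by (rule grid_index_bounds[OF assms])
    also have "s < grid (n + r) (Suc (grid_index (n + r) s))" by (rule grid_index_bounds[OF assms])
    finally have "grid_index n s * 2 ^ r \<le> grid_index (n + r) s" by simp
    then have "grid (n + r) (grid_index n s * 2 ^ r) \<le> grid_floor (n + r) s" unfolding grid_floor_def by simp
    then show "grid n (grid_index n s) \<le> grid_floor (n + r) s" unfolding grid_refine .
    show "grid_floor (n + r) s < grid n (Suc (grid_index n s))" using grid_floor_bounds(1)[OF assms, of "n + r"] grid_index_bounds(2)[OF assms, of n] by linarith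
  qed
  then show ?thesis by (simp add: grid_floor_def)
qed

lemma grid_floor_path_tendsto:
  fixes f :: "real \<Rightarrow> real"
  assumes f: "continuous_on {0..T} f" and s: "s \<in> {0..T}"
  shows "(\<lambda>m. f (grid_floor m s)) \<longlonglongrightarrow> f s"
proof -
  have "grid_floor m s \<in> {0..T}" for m using grid_floor_bounds[of s m] s by auto
  then show ?thesis using continuous_on_tendsto_compose[OF f grid_floor_tendsto[of s] s] s by auto
qed

lemma grid_next_path_tendsto:
  fixes f :: "real \<Rightarrow> real"
  assumes f: "continuous_on {0..T} f" and s: "s \<in> {0..<T}"
  shows "(\<lambda>m. f (grid m (Suc (grid_index m s)))) \<longlonglongrightarrow> f s"
proof -
  have m: "grid m (Suc (grid_index m s)) \<in> {0..T}" for m using grid_index_less[of s m] s by (auto intro!: grid_le_T)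
  have "(\<lambda>m. grid_floor m s + T / 2 ^ m) \<longlonglongrightarrow> s + 0" by (intro tendsto_add grid_floor_tendsto mesh_tendsto) (use s in auto)
  then have "(\<lambda>m. grid m (Suc (grid_index m s))) \<longlonglongrightarrow> s" by (simp add: grid_Suc grid_floor_def)
  from continuous_on_tendsto_compose[OF f this] m s show ?thesis by auto
qed

lemma continuous_path_bound:
  fixes f :: "real \<Rightarrow> real"
  assumes "continuous_on {0..T} f" obtains K where "\<And>t. t \<in> {0..T} \<Longrightarrow> \<bar>f t\<bar> \<le> K"
proof -
  have "bounded (f ` {0..T})" using assms by (intro compact_imp_bounded compact_continuous_image) auto
  then obtain K where "\<forall>x\<in>f ` {0..T}. norm x \<le> K" unfolding bounded_iff by blast
  then have "\<bar>f t\<bar> \<le> K" if "t \<in> {0..T}" for t using that by auto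
  then show ?thesis by (rule that)
qed

definition pred_seq :: "nat \<Rightarrow> (nat \<Rightarrow> 'a \<Rightarrow> real) \<Rightarrow> bool" where
  "pred_seq l \<eta> \<longleftrightarrow> (\<forall>i<2^l. \<eta> i \<in> borel_measurable (Filt (grid l i))) \<and>
     (\<exists>C. \<forall>i<2^l. \<forall>\<omega>\<in>space M. \<bar>\<eta> i \<omega>\<bar> \<le> C)"

lemma pred_seq_meas: "pred_seq l \<eta> \<Longrightarrow> i < 2 ^ l \<Longrightarrow> \<eta> i \<in> borel_measurable M"
  unfolding pred_seq_def by (meson filtration_measurableD grid_le_T less_imp_le)

lemma dB_meas [measurable]: "i < 2 ^ l \<Longrightarrow> dB l i \<in> borel_measurable M"
  by (intro borel_measurable_diff B_measurable) (auto intro: grid_le_T)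

text \<open>
  Stated for a function \<open>g\<close> of the increments because it is used twice: with the increments
  themselves for the isometry, and with their compensated squares for the quadratic variation.
\<close>

lemma martingale_transform:
  assumes \<eta>: "pred_seq l \<eta>" and ac: "a \<le> c" "c \<le> 2 ^ l"
    and g[measurable]: "g \<in> borel_measurable borel"
    and gi: "\<And>i. i < 2 ^ l \<Longrightarrow> integrable M (\<lambda>\<omega>. g (dB l i \<omega>))" "\<And>i. i < 2 ^ l \<Longrightarrow> integrable M (\<lambda>\<omega>. (g (dB l i \<omega>))\<^sup>2)"
    and g0: "\<And>i. i < 2 ^ l \<Longrightarrow> expectation (\<lambda>\<omega>. g (dB l i \<omega>)) = 0"
    and gv: "\<And>i. i < 2 ^ l \<Longrightarrow> expectation (\<lambda>\<omega>. (g (dB l i \<omega>))\<^sup>2) = v"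
  shows "integrable M (\<lambda>\<omega>. (\<Sum>i\<in>{a..<c}. \<eta> i \<omega> * g (dB l i \<omega>)))"
    "integrable M (\<lambda>\<omega>. (\<Sum>i\<in>{a..<c}. \<eta> i \<omega> * g (dB l i \<omega>))\<^sup>2)"
    "expectation (\<lambda>\<omega>. \<Sum>i\<in>{a..<c}. \<eta> i \<omega> * g (dB l i \<omega>)) = 0"
    "expectation (\<lambda>\<omega>. (\<Sum>i\<in>{a..<c}. \<eta> i \<omega> * g (dB l i \<omega>))\<^sup>2) = (\<Sum>i\<in>{a..<c}. v * expectation (\<lambda>\<omega>. (\<eta> i \<omega>)\<^sup>2))"
proof -
  obtain C where C: "\<And>i \<omega>. i < 2 ^ l \<Longrightarrow> \<omega> \<in> space M \<Longrightarrow> \<bar>\<eta> i \<omega>\<bar> \<le> C" using \<eta> unfolding pred_seq_def by blast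
  have \<eta>m: "\<eta> i \<in> borel_measurable (Filt (grid l i))" if "i < 2 ^ l" for i using \<eta> that unfolding pred_seq_def by blast
  let ?S = "\<lambda>c \<omega>. \<Sum>i\<in>{a..<c}. \<eta> i \<omega> * g (dB l i \<omega>)"
  have "?S c \<in> borel_measurable (Filt (grid l c)) \<and> integrable M (?S c) \<and> integrable M (\<lambda>\<omega>. (?S c \<omega>)\<^sup>2) \<and>
    expectation (?S c) = 0 \<and> expectation (\<lambda>\<omega>. (?S c \<omega>)\<^sup>2) = (\<Sum>i\<in>{a..<c}. v * expectation (\<lambda>\<omega>. (\<eta> i \<omega>)\<^sup>2))"
    using ac
  proof (induction c rule: dec_induct)
    case base then show ?case by simp
  next
    case (step c)
    then have c: "c < 2 ^ l" and IH: "?S c \<in> borel_measurable (Filt (grid l c))" "integrable M (?S c)" "integrable M (\<lambda>\<omega>. (?S c \<omega>)\<^sup>2)"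
      "expectation (?S c) = 0" "expectation (\<lambda>\<omega>. (?S c \<omega>)\<^sup>2) = (\<Sum>i\<in>{a..<c}. v * expectation (\<lambda>\<omega>. (\<eta> i \<omega>)\<^sup>2))" by auto
    have st: "0 \<le> grid l c" "grid l c < grid l (Suc c)" "grid l (Suc c) \<le> T" using c by (auto intro!: grid_le_T)
    have Suc: "?S (Suc c) \<omega> = ?S c \<omega> + \<eta> c \<omega> * g (dB l c \<omega>)" for \<omega> using step(1) by simp
    note [measurable] = \<eta>m[OF c]
    have cM[measurable]: "\<eta> c \<in> borel_measurable M" by (rule pred_seq_meas[OF \<eta> c])
    have i1: "integrable M (\<eta> c)" by (rule integrable_const_bound[of _ C]) (use C c in auto)
    have i2: "integrable M (\<lambda>\<omega>. (\<eta> c \<omega>)\<^sup>2)"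
      by (rule integrable_const_bound[of _ "C\<^sup>2"]) (use C c in \<open>auto simp: abs_le_square_iff[symmetric] intro!: AE_I2 order_trans[OF _ abs_ge_self]\<close>)
    have i3: "integrable M (\<lambda>\<omega>. ?S c \<omega> * \<eta> c \<omega>)"
    proof (rule Bochner_Integration.integrable_bound[of _ "\<lambda>\<omega>. C * ?S c \<omega>"])
      show "AE \<omega> in M. norm (?S c \<omega> * \<eta> c \<omega>) \<le> norm (C * ?S c \<omega>)"
      proof (rule AE_I2)
        fix \<omega> assume "\<omega> \<in> space M"
        then have "\<bar>\<eta> c \<omega>\<bar> \<le> \<bar>C\<bar>" using C[OF c, of \<omega>] by linarith
        then have "\<bar>\<eta> c \<omega>\<bar> * \<bar>?S c \<omega>\<bar> \<le> \<bar>C\<bar> * \<bar>?S c \<omega>\<bar>" by (intro mult_right_mono) auto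
        then show "norm (?S c \<omega> * \<eta> c \<omega>) \<le> norm (C * ?S c \<omega>)" by (simp add: abs_mult mult.commute)
      qed
    qed (use IH(2) in auto)
    \<comment> \<open>After expanding \<open>(S + \<eta> * g)\<^sup>2\<close>, each new summand is the product of a variable known at the left end
       of the cell and a function of the increment over it.\<close>
    note e1 = expectation_mult_increment[OF st \<eta>m[OF c] i1 g gi(1)[OF c]]
    have th2: "(\<lambda>\<omega>. (\<eta> c \<omega>)\<^sup>2) \<in> borel_measurable (Filt (grid l c))" by measurable
    have "(\<lambda>x. (g x)\<^sup>2) \<in> borel_measurable borel" by measurable
    note e2 = expectation_mult_increment[OF st th2 i2 this gi(2)[OF c]]
    have th3: "(\<lambda>\<omega>. ?S c \<omega> * \<eta> c \<omega>) \<in> borel_measurable (Filt (grid l c))" using IH(1) by measurable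
    note e3 = expectation_mult_increment[OF st th3 i3 g gi(1)[OF c]]
    have sq: "(?S (Suc c) \<omega>)\<^sup>2 = (?S c \<omega>)\<^sup>2 + 2 * ((?S c \<omega> * \<eta> c \<omega>) * g (dB l c \<omega>)) + (\<eta> c \<omega>)\<^sup>2 * (g (dB l c \<omega>))\<^sup>2" for \<omega>
      unfolding Suc by (simp add: power2_eq_square algebra_simps)
    have m: "?S (Suc c) \<in> borel_measurable (Filt (grid l (Suc c)))"
    proof -
      have [measurable]: "B (grid l (Suc c)) \<in> borel_measurable (Filt (grid l (Suc c)))" "B (grid l c) \<in> borel_measurable (Filt (grid l (Suc c)))"
        by (auto intro!: B_adapted)
      have [measurable]: "?S c \<in> borel_measurable (Filt (grid l (Suc c)))" "\<eta> c \<in> borel_measurable (Filt (grid l (Suc c)))"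
        by (auto intro!: filtration_measurable_mono[OF IH(1)] filtration_measurable_mono[OF \<eta>m[OF c]])
      show ?thesis unfolding Suc by measurable
    qed
    show ?case
    proof (intro conjI)
      show "integrable M (?S (Suc c))" unfolding Suc by (intro Bochner_Integration.integrable_add IH(2) e1(1))
      show "expectation (?S (Suc c)) = 0" unfolding Suc
        by (subst Bochner_Integration.integral_add[OF IH(2) e1(1)]) (simp add: IH(4) e1(2) g0[OF c])
      show "integrable M (\<lambda>\<omega>. (?S (Suc c) \<omega>)\<^sup>2)" unfolding sq using IH(3) e2(1) e3(1) by simp
      have "expectation (\<lambda>\<omega>. (?S (Suc c) \<omega>)\<^sup>2) = expectation (\<lambda>\<omega>. (?S c \<omega>)\<^sup>2) + 2 * expectation (\<lambda>\<omega>. (?S c \<omega> * \<eta> c \<omega>) * g (dB l c \<omega>)) + expectation (\<lambda>\<omega>. (\<eta> c \<omega>)\<^sup>2 * (g (dB l c \<omega>))\<^sup>2)"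
        unfolding sq using IH(3) e2(1) e3(1) by simp
      also have "\<dots> = (\<Sum>i\<in>{a..<Suc c}. v * expectation (\<lambda>\<omega>. (\<eta> i \<omega>)\<^sup>2))"
        unfolding e3(2) e2(2) g0[OF c] gv[OF c] IH(5) using step(1) by simp
      finally show "expectation (\<lambda>\<omega>. (?S (Suc c) \<omega>)\<^sup>2) = (\<Sum>i\<in>{a..<Suc c}. v * expectation (\<lambda>\<omega>. (\<eta> i \<omega>)\<^sup>2))" .
    qed (rule m)
  qed
  then show "integrable M (\<lambda>\<omega>. (\<Sum>i\<in>{a..<c}. \<eta> i \<omega> * g (dB l i \<omega>)))"
    "integrable M (\<lambda>\<omega>. (\<Sum>i\<in>{a..<c}. \<eta> i \<omega> * g (dB l i \<omega>))\<^sup>2)"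
    "expectation (\<lambda>\<omega>. \<Sum>i\<in>{a..<c}. \<eta> i \<omega> * g (dB l i \<omega>)) = 0"
    "expectation (\<lambda>\<omega>. (\<Sum>i\<in>{a..<c}. \<eta> i \<omega> * g (dB l i \<omega>))\<^sup>2) = (\<Sum>i\<in>{a..<c}. v * expectation (\<lambda>\<omega>. (\<eta> i \<omega>)\<^sup>2))"
    by auto
qed

lemma dB_moments:
  assumes i: "i < 2 ^ l"
  shows "integrable M (\<lambda>\<omega>. (dB l i \<omega>) ^ k)" "expectation (dB l i) = 0"
    "expectation (\<lambda>\<omega>. (dB l i \<omega>)\<^sup>2) = T / 2 ^ l"
    "expectation (\<lambda>\<omega>. (dB l i \<omega>) ^ 4) = 3 * (T / 2 ^ l)\<^sup>2"
proof -
  have st: "0 \<le> grid l i" "grid l i < grid l (Suc i)" "grid l (Suc i) \<le> T" using i by (auto intro!: grid_le_T)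
  show "integrable M (\<lambda>\<omega>. (dB l i \<omega>) ^ k)" "expectation (dB l i) = 0"
    "expectation (\<lambda>\<omega>. (dB l i \<omega>)\<^sup>2) = T / 2 ^ l"
    "expectation (\<lambda>\<omega>. (dB l i \<omega>) ^ 4) = 3 * (T / 2 ^ l)\<^sup>2"
    using increment_moments[OF st] by (auto simp: grid_Suc)
qed

lemma transform_isometry:
  assumes "pred_seq l \<eta>" and "a \<le> c" "c \<le> 2 ^ l"
  shows "integrable M (\<lambda>\<omega>. (\<Sum>i\<in>{a..<c}. \<eta> i \<omega> * dB l i \<omega>))"
    "integrable M (\<lambda>\<omega>. (\<Sum>i\<in>{a..<c}. \<eta> i \<omega> * dB l i \<omega>)\<^sup>2)"
    "expectation (\<lambda>\<omega>. \<Sum>i\<in>{a..<c}. \<eta> i \<omega> * dB l i \<omega>) = 0"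
    "expectation (\<lambda>\<omega>. (\<Sum>i\<in>{a..<c}. \<eta> i \<omega> * dB l i \<omega>)\<^sup>2) = (\<Sum>i\<in>{a..<c}. T / 2 ^ l * expectation (\<lambda>\<omega>. (\<eta> i \<omega>)\<^sup>2))"
  using martingale_transform[OF assms, of "\<lambda>x. x" "T / 2 ^ l"] dB_moments(2,3)[of _ l] dB_moments(1)[of _ l 1] dB_moments(1)[of _ l 2]
  by simp_all

lemma transform_square_isometry:
  assumes \<eta>: "pred_seq l \<eta>" and "c \<le> 2 ^ l"
  shows "integrable M (\<lambda>\<omega>. (\<Sum>i<c. (\<eta> i \<omega>)\<^sup>2 * ((dB l i \<omega>)\<^sup>2 - T / 2 ^ l))\<^sup>2)"
    "expectation (\<lambda>\<omega>. (\<Sum>i<c. (\<eta> i \<omega>)\<^sup>2 * ((dB l i \<omega>)\<^sup>2 - T / 2 ^ l))\<^sup>2) =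
      (\<Sum>i<c. 2 * (T / 2 ^ l)\<^sup>2 * expectation (\<lambda>\<omega>. (\<eta> i \<omega>) ^ 4))"
proof -
  have p: "pred_seq l (\<lambda>i \<omega>. (\<eta> i \<omega>)\<^sup>2)"
  proof -
    obtain C where C: "\<And>i \<omega>. i < 2 ^ l \<Longrightarrow> \<omega> \<in> space M \<Longrightarrow> \<bar>\<eta> i \<omega>\<bar> \<le> C" using \<eta> unfolding pred_seq_def by blast
    have "\<forall>i<2^l. \<forall>\<omega>\<in>space M. \<bar>(\<eta> i \<omega>)\<^sup>2\<bar> \<le> C\<^sup>2" using C by (auto simp: abs_le_square_iff[symmetric] intro: order_trans[OF _ abs_ge_self])
    moreover have "(\<lambda>\<omega>. (\<eta> i \<omega>)\<^sup>2) \<in> borel_measurable (Filt (grid l i))" if "i < 2 ^ l" for i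
      using \<eta> that unfolding pred_seq_def by (intro borel_measurable_power) auto
    ultimately show ?thesis unfolding pred_seq_def by blast
  qed
  let ?h = "T / 2 ^ l"
  have q: "(x\<^sup>2 - ?h)\<^sup>2 = x ^ 4 - 2 * ?h * x\<^sup>2 + ?h\<^sup>2" for x :: real
    by (simp add: power2_eq_square power4_eq_xxxx algebra_simps)
  have gi: "integrable M (\<lambda>\<omega>. (dB l i \<omega>)\<^sup>2 - ?h)" "integrable M (\<lambda>\<omega>. ((dB l i \<omega>)\<^sup>2 - ?h)\<^sup>2)"
     "expectation (\<lambda>\<omega>. (dB l i \<omega>)\<^sup>2 - ?h) = 0" "expectation (\<lambda>\<omega>. ((dB l i \<omega>)\<^sup>2 - ?h)\<^sup>2) = 2 * ?h\<^sup>2" if "i < 2 ^ l" for i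
    unfolding q using dB_moments(1)[OF that, of 2] dB_moments(1)[OF that, of 4] dB_moments(3,4)[OF that]
    by (simp_all add: prob_space power2_eq_square)
  show "integrable M (\<lambda>\<omega>. (\<Sum>i<c. (\<eta> i \<omega>)\<^sup>2 * ((dB l i \<omega>)\<^sup>2 - ?h))\<^sup>2)"
    "expectation (\<lambda>\<omega>. (\<Sum>i<c. (\<eta> i \<omega>)\<^sup>2 * ((dB l i \<omega>)\<^sup>2 - ?h))\<^sup>2) =
      (\<Sum>i<c. 2 * ?h\<^sup>2 * expectation (\<lambda>\<omega>. (\<eta> i \<omega>) ^ 4))"
    using martingale_transform(2,4)[OF p _ assms(2), of 0 "\<lambda>x. x\<^sup>2 - ?h" "2 * ?h\<^sup>2"] gi
    by (simp_all add: lessThan_atLeast0 flip: power_mult)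
qed

text \<open>
  A discrete stopping argument: the coefficients are set to zero as soon as the running time
  integral of their squares would exceed \<open>\<delta>\<close>.
\<close>

lemma predictable_cut:
  assumes \<eta>: "pred_seq l \<eta>" and \<delta>: "0 \<le> \<delta>"
  obtains \<eta>' where "pred_seq l \<eta>'"
    "\<And>\<omega>. \<omega> \<in> space M \<Longrightarrow> T / 2 ^ l * (\<Sum>i<2^l. (\<eta>' i \<omega>)\<^sup>2) \<le> \<delta>"
    "\<And>\<omega> i. T / 2 ^ l * (\<Sum>i<2^l. (\<eta> i \<omega>)\<^sup>2) \<le> \<delta> \<Longrightarrow> i < 2 ^ l \<Longrightarrow> \<eta>' i \<omega> = \<eta> i \<omega>"
proof -
  let ?h = "T / 2 ^ l"
  \<comment> \<open>The sum includes the term \<open>i\<close> itself: the coefficient is known before its increment is seen, so the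
     cut is adapted although it never lets the running sum exceed the bound.\<close>
  define V where "V i \<omega> = ?h * (\<Sum>j\<le>i. (\<eta> j \<omega>)\<^sup>2)" for i \<omega>
  define \<eta>' where "\<eta>' i \<omega> = (if V i \<omega> \<le> \<delta> then \<eta> i \<omega> else 0)" for i \<omega>
  have h: "0 \<le> ?h" using T_pos by simp
  have \<eta>m: "\<eta> i \<in> borel_measurable (Filt (grid l i))" if "i < 2 ^ l" for i using \<eta> that unfolding pred_seq_def by blast
  have Vm: "V i \<in> borel_measurable (Filt (grid l i))" if "i < 2 ^ l" for i
    unfolding V_def using that
    by (intro borel_measurable_times borel_measurable_const borel_measurable_sum borel_measurable_power) (auto intro!: filtration_measurable_mono[OF \<eta>m])
  have mono: "V i \<omega> \<le> V j \<omega>" if "i \<le> j" for i j :: nat and \<omega>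
    unfolding V_def using that h by (intro mult_left_mono sum_mono2) auto
  show ?thesis
  proof (rule that)
    obtain C where C: "\<And>i \<omega>. i < 2 ^ l \<Longrightarrow> \<omega> \<in> space M \<Longrightarrow> \<bar>\<eta> i \<omega>\<bar> \<le> C" using \<eta> unfolding pred_seq_def by blast
    have "\<eta>' i \<in> borel_measurable (Filt (grid l i))" if "i < 2 ^ l" for i
      using \<eta>m[OF that] Vm[OF that] unfolding \<eta>'_def by measurable
    moreover have "\<forall>i<2^l. \<forall>\<omega>\<in>space M. \<bar>\<eta>' i \<omega>\<bar> \<le> max C 0" using C unfolding \<eta>'_def by fastforce
    ultimately show "pred_seq l \<eta>'" unfolding pred_seq_def by blast
  next
    fix \<omega>
    have "?h * (\<Sum>i<k. (\<eta>' i \<omega>)\<^sup>2) \<le> \<delta>" for k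
    proof (induction k)
      case 0 then show ?case using \<delta> by simp
    next
      case (Suc k)
      show ?case
      proof (cases "V k \<omega> \<le> \<delta>")
        case True
        have "?h * (\<Sum>i<Suc k. (\<eta>' i \<omega>)\<^sup>2) \<le> V k \<omega>"
          unfolding V_def lessThan_Suc_atMost using h by (intro mult_left_mono sum_mono) (auto simp: \<eta>'_def)
        then show ?thesis using True by simp
      next
        case False then show ?thesis using Suc by (simp add: \<eta>'_def)
      qed
    qed
    then show "?h * (\<Sum>i<2^l. (\<eta>' i \<omega>)\<^sup>2) \<le> \<delta>" .
  next
    fix \<omega> and i :: nat assume le: "?h * (\<Sum>i<2^l. (\<eta> i \<omega>)\<^sup>2) \<le> \<delta>" and i: "i < 2 ^ l"
    have "V i \<omega> \<le> V (2 ^ l - 1) \<omega>" by (rule mono) (use i in simp)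
    also have "\<dots> = ?h * (\<Sum>i<2^l. (\<eta> i \<omega>)\<^sup>2)"
      unfolding V_def by (simp add: lessThan_Suc_atMost[symmetric])
    finally show "\<eta>' i \<omega> = \<eta> i \<omega>" using le by (simp add: \<eta>'_def)
  qed
qed

text \<open>
  An inequality of Lenglart type. After the predictable cut the sum has second moment at most \<open>\<delta>\<^sup>2\<close>
  by the isometry, and the cut changes something only on the event that the quadratic variation
  exceeds \<open>\<delta>\<^sup>2\<close>. The second version has the Euclidean norm of the sums over \<open>k\<close> consecutive blocks of
  length \<open>2 ^ r\<close> in place of the total sum; the same cut serves for it, as the second moments of the
  blocks add up to the same total.
\<close>

lemma transform_prob_size:
  assumes \<eta>: "pred_seq l \<eta>" and c: "c \<le> 2 ^ l" and \<delta>: "0 < \<delta>" "\<delta> \<le> 1"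
  shows "prob_size (\<lambda>\<omega>. \<Sum>i<c. \<eta> i \<omega> * dB l i \<omega>) \<le> \<delta> + prob_size (\<lambda>\<omega>. sqrt (T / 2 ^ l * (\<Sum>i<2^l. (\<eta> i \<omega>)\<^sup>2))) / \<delta>"
    and block_transform_prob_size: "l = n + r \<Longrightarrow> k \<le> 2 ^ n \<Longrightarrow>
      prob_size (\<lambda>\<omega>. sqrt (\<Sum>b<k. (\<Sum>i\<in>{b * 2 ^ r..<Suc b * 2 ^ r}. \<eta> i \<omega> * dB l i \<omega>)\<^sup>2)) \<le>
        \<delta> + prob_size (\<lambda>\<omega>. sqrt (T / 2 ^ l * (\<Sum>i<2^l. (\<eta> i \<omega>)\<^sup>2))) / \<delta>"
proof -
  let ?h = "T / 2 ^ l"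
  have h: "0 \<le> ?h" using T_pos by simp
  obtain \<eta>' where \<eta>': "pred_seq l \<eta>'"
    "\<And>\<omega>. \<omega> \<in> space M \<Longrightarrow> ?h * (\<Sum>i<2^l. (\<eta>' i \<omega>)\<^sup>2) \<le> \<delta>\<^sup>2"
    "\<And>\<omega> i. ?h * (\<Sum>i<2^l. (\<eta> i \<omega>)\<^sup>2) \<le> \<delta>\<^sup>2 \<Longrightarrow> i < 2 ^ l \<Longrightarrow> \<eta>' i \<omega> = \<eta> i \<omega>"
    using predictable_cut[OF \<eta>, of "\<delta>\<^sup>2"] by (auto)
  note [measurable] = pred_seq_meas[OF \<eta>] pred_seq_meas[OF \<eta>'(1)]
  define Q where "Q \<omega> = sqrt (?h * (\<Sum>i<2^l. (\<eta> i \<omega>)\<^sup>2))" for \<omega>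
  have Qm[measurable]: "Q \<in> borel_measurable M" unfolding Q_def by measurable
  have Q0: "0 \<le> ?h * (\<Sum>i<2^l. (\<eta> i \<omega>)\<^sup>2)" for \<omega> using h by (intro mult_nonneg_nonneg sum_nonneg) auto
  \<comment> \<open>On the complement of \<open>A\<close> nothing is cut off, and the Markov inequality bounds the probability of \<open>A\<close>.\<close>
  define A where "A = {\<omega> \<in> space M. \<delta> < \<bar>Q \<omega>\<bar>}"
  have A[measurable]: "A \<in> sets M" unfolding A_def by measurable
  have pA: "prob A \<le> prob_size Q / \<delta>" unfolding A_def by (rule prob_le_prob_size[OF Qm \<delta>])
  have eq: "\<eta>' i \<omega> = \<eta> i \<omega>" if "\<omega> \<in> space M" "\<omega> \<notin> A" "i < 2 ^ l" for i \<omega>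
  proof (rule \<eta>'(3)[OF _ that(3)])
    have "\<bar>Q \<omega>\<bar> \<le> \<delta>" using that by (auto simp: A_def)
    then have "(Q \<omega>)\<^sup>2 \<le> \<delta>\<^sup>2" using \<delta> by (simp add: abs_le_square_iff[symmetric])
    then show "?h * (\<Sum>i<2^l. (\<eta> i \<omega>)\<^sup>2) \<le> \<delta>\<^sup>2" unfolding Q_def using Q0[of \<omega>] by simp
  qed
  have main: "prob_size Y \<le> \<delta> + prob_size Q / \<delta>" if [measurable]: "Y \<in> borel_measurable M" "Z \<in> borel_measurable M"
    and eqY: "\<And>\<omega>. \<omega> \<in> space M \<Longrightarrow> \<omega> \<notin> A \<Longrightarrow> Y \<omega> = Z \<omega>"
    and i: "integrable M (\<lambda>\<omega>. (Z \<omega>)\<^sup>2)" "expectation (\<lambda>\<omega>. (Z \<omega>)\<^sup>2) \<le> \<delta>\<^sup>2" for Y Z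
  proof -
    have "prob_size Y \<le> prob_size (\<lambda>\<omega>. Y \<omega> - Z \<omega>) + prob_size Z"
      using prob_size_add[of "\<lambda>\<omega>. Y \<omega> - Z \<omega>" Z] by simp
    moreover have "prob_size (\<lambda>\<omega>. Y \<omega> - Z \<omega>) \<le> 0 + prob A"
      by (rule prob_size_le_event) (use eqY in auto)
    moreover have "prob_size Z \<le> \<delta>" by (rule prob_size_le_second_moment) (use i \<delta> in auto)
    ultimately show ?thesis using pA by linarith
  qed
  have i4: "integrable M (\<lambda>\<omega>. (\<eta>' i \<omega>)\<^sup>2)" if "i < 2 ^ l" for i
  proof -
    have "(\<eta>' i \<omega>)\<^sup>2 \<le> \<delta>\<^sup>2 / ?h" if w: "\<omega> \<in> space M" for \<omega>
    proof -
      have "(\<eta>' i \<omega>)\<^sup>2 \<le> (\<Sum>i<2^l. (\<eta>' i \<omega>)\<^sup>2)" using \<open>i < 2 ^ l\<close> by (intro member_le_sum) auto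
      also have "\<dots> \<le> \<delta>\<^sup>2 / ?h" using \<eta>'(2)[OF w] T_pos by (simp add: field_simps)
      finally show ?thesis .
    qed
    then show ?thesis by (intro integrable_const_bound[of _ "\<delta>\<^sup>2 / ?h"]) (use that in auto)
  qed
  have tot: "(\<Sum>i<2^l. ?h * expectation (\<lambda>\<omega>. (\<eta>' i \<omega>)\<^sup>2)) \<le> \<delta>\<^sup>2"
  proof -
    have "(\<Sum>i<2^l. ?h * expectation (\<lambda>\<omega>. (\<eta>' i \<omega>)\<^sup>2)) = expectation (\<lambda>\<omega>. ?h * (\<Sum>i<2^l. (\<eta>' i \<omega>)\<^sup>2))"
      using i4 by (simp add: Bochner_Integration.integral_sum sum_distrib_left)
    also have "\<dots> \<le> \<delta>\<^sup>2"
      by (rule integral_le_const) (use \<eta>'(2) i4 in \<open>auto intro!: integrable_mult_right Bochner_Integration.integrable_sum\<close>)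
    finally show ?thesis .
  qed
  have part: "(\<Sum>i<k. ?h * expectation (\<lambda>\<omega>. (\<eta>' i \<omega>)\<^sup>2)) \<le> \<delta>\<^sup>2" if "k \<le> 2 ^ l" for k
    by (rule order_trans[OF sum_mono2 tot]) (use that T_pos in \<open>auto intro!: mult_nonneg_nonneg divide_nonneg_nonneg integral_nonneg_AE\<close>)
  have "prob_size (\<lambda>\<omega>. \<Sum>i<c. \<eta> i \<omega> * dB l i \<omega>) \<le> \<delta> + prob_size Q / \<delta>"
  proof (rule main[of _ "\<lambda>\<omega>. \<Sum>i<c. \<eta>' i \<omega> * dB l i \<omega>"])
    show "expectation (\<lambda>\<omega>. (\<Sum>i<c. \<eta>' i \<omega> * dB l i \<omega>)\<^sup>2) \<le> \<delta>\<^sup>2"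
      using transform_isometry(4)[OF \<eta>'(1) _ c, of 0] part[OF c] by (simp add: lessThan_atLeast0)
  qed (use eq c transform_isometry(2)[OF \<eta>'(1) _ c, of 0] in \<open>auto simp: lessThan_atLeast0 intro!: sum.cong\<close>)
  then show "prob_size (\<lambda>\<omega>. \<Sum>i<c. \<eta> i \<omega> * dB l i \<omega>) \<le> \<delta> + prob_size (\<lambda>\<omega>. sqrt (T / 2 ^ l * (\<Sum>i<2^l. (\<eta> i \<omega>)\<^sup>2))) / \<delta>"
    unfolding Q_def .
  {
    assume l: "l = n + r" and k: "k \<le> 2 ^ n"
    have bl: "Suc b * 2 ^ r \<le> 2 ^ l" if "b < k" for b
      unfolding l power_add using that k by (intro mult_right_mono) auto
    have bl2: "i < 2 ^ l" if "b < k" "i \<in> {b * 2 ^ r..<Suc b * 2 ^ r}" for b i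
      using bl[OF that(1)] that(2) by auto
    let ?S = "\<lambda>\<eta> b \<omega>. \<Sum>i\<in>{b * 2 ^ r..<Suc b * 2 ^ r}. \<eta> i \<omega> * dB l i \<omega>"
    have Sm: "?S \<eta> b \<in> borel_measurable M" "?S \<eta>' b \<in> borel_measurable M" if "b < k" for b
      using bl2[OF that] by (auto intro!: borel_measurable_sum borel_measurable_times dB_meas pred_seq_meas[OF \<eta>] pred_seq_meas[OF \<eta>'(1)])
    have iso: "integrable M (\<lambda>\<omega>. (?S \<eta>' b \<omega>)\<^sup>2)" "expectation (\<lambda>\<omega>. (?S \<eta>' b \<omega>)\<^sup>2) = (\<Sum>i\<in>{b * 2 ^ r..<Suc b * 2 ^ r}. ?h * expectation (\<lambda>\<omega>. (\<eta>' i \<omega>)\<^sup>2))"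
      if "b < k" for b
      using transform_isometry(2,4)[OF \<eta>'(1) _ bl[OF that], of "b * 2 ^ r"] by auto
    have s2: "(sqrt (\<Sum>b<k. (?S \<eta>' b \<omega>)\<^sup>2))\<^sup>2 = (\<Sum>b<k. (?S \<eta>' b \<omega>)\<^sup>2)" for \<omega>
      by (simp add: sum_nonneg)
    have "prob_size (\<lambda>\<omega>. sqrt (\<Sum>b<k. (?S \<eta> b \<omega>)\<^sup>2)) \<le> \<delta> + prob_size Q / \<delta>"
    proof (rule main[of _ "\<lambda>\<omega>. sqrt (\<Sum>b<k. (?S \<eta>' b \<omega>)\<^sup>2)"])
      show "(\<lambda>\<omega>. sqrt (\<Sum>b<k. (?S \<eta> b \<omega>)\<^sup>2)) \<in> borel_measurable M" "(\<lambda>\<omega>. sqrt (\<Sum>b<k. (?S \<eta>' b \<omega>)\<^sup>2)) \<in> borel_measurable M"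
        using Sm by (auto intro!: borel_measurable_sqrt borel_measurable_sum borel_measurable_power)
      fix \<omega> assume "\<omega> \<in> space M" "\<omega> \<notin> A"
      then show "sqrt (\<Sum>b<k. (?S \<eta> b \<omega>)\<^sup>2) = sqrt (\<Sum>b<k. (?S \<eta>' b \<omega>)\<^sup>2)"
        using bl2 by (intro arg_cong[where f=sqrt] sum.cong refl arg_cong[where f="\<lambda>x. x\<^sup>2"]) (auto simp: eq)
    next
      show "integrable M (\<lambda>\<omega>. (sqrt (\<Sum>b<k. (?S \<eta>' b \<omega>)\<^sup>2))\<^sup>2)" unfolding s2 using iso(1) by (auto intro!: Bochner_Integration.integrable_sum)
      have "expectation (\<lambda>\<omega>. (sqrt (\<Sum>b<k. (?S \<eta>' b \<omega>)\<^sup>2))\<^sup>2) = (\<Sum>b<k. \<Sum>i\<in>{b * 2 ^ r..<Suc b * 2 ^ r}. ?h * expectation (\<lambda>\<omega>. (\<eta>' i \<omega>)\<^sup>2))"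
        unfolding s2 using iso by (subst Bochner_Integration.integral_sum) (auto intro!: sum.cong)
      also have "\<dots> = (\<Sum>i<k * 2 ^ r. ?h * expectation (\<lambda>\<omega>. (\<eta>' i \<omega>)\<^sup>2))" by (rule block_sums)
      also have "\<dots> \<le> \<delta>\<^sup>2" by (rule part) (use k in \<open>auto simp: l power_add\<close>)
      finally show "expectation (\<lambda>\<omega>. (sqrt (\<Sum>b<k. (?S \<eta>' b \<omega>)\<^sup>2))\<^sup>2) \<le> \<delta>\<^sup>2" .
    qed
    then show "prob_size (\<lambda>\<omega>. sqrt (\<Sum>b<k. (\<Sum>i\<in>{b * 2 ^ r..<Suc b * 2 ^ r}. \<eta> i \<omega> * dB l i \<omega>)\<^sup>2)) \<le>
        \<delta> + prob_size (\<lambda>\<omega>. sqrt (T / 2 ^ l * (\<Sum>i<2^l. (\<eta> i \<omega>)\<^sup>2))) / \<delta>"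
      unfolding Q_def .
  }
qed

end

section \<open>Progressive processes and time integrals\<close>

lemma L2_triangle:
  fixes f g :: "'a \<Rightarrow> real"
  assumes [measurable]: "f \<in> borel_measurable M" "g \<in> borel_measurable M"
    and f: "integrable M (\<lambda>x. (f x)\<^sup>2)" and g: "integrable M (\<lambda>x. (g x)\<^sup>2)"
  shows "integrable M (\<lambda>x. f x * g x)" "integrable M (\<lambda>x. (f x + g x)\<^sup>2)"
    "sqrt (\<integral>x. (f x + g x)\<^sup>2 \<partial>M) \<le> sqrt (\<integral>x. (f x)\<^sup>2 \<partial>M) + sqrt (\<integral>x. (g x)\<^sup>2 \<partial>M)"
proof -
  show fg: "integrable M (\<lambda>x. f x * g x)"
  proof (rule Bochner_Integration.integrable_bound[OF Bochner_Integration.integrable_add[OF f g]])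
    have "\<bar>a * b\<bar> \<le> a\<^sup>2 + b\<^sup>2" for a b :: real
    proof -
      have "2 * (\<bar>a\<bar> * \<bar>b\<bar>) \<le> \<bar>a\<bar>\<^sup>2 + \<bar>b\<bar>\<^sup>2" using sum_squares_bound[of "\<bar>a\<bar>" "\<bar>b\<bar>"] by simp
      moreover have "0 \<le> \<bar>a\<bar> * \<bar>b\<bar>" by simp
      ultimately show ?thesis unfolding abs_mult power2_abs by linarith
    qed
    then show "AE x in M. norm (f x * g x) \<le> norm ((f x)\<^sup>2 + (g x)\<^sup>2)" by auto
  qed auto
  have sq: "(x * f w + g w)\<^sup>2 = x\<^sup>2 * (f w)\<^sup>2 + 2 * x * (f w * g w) + (g w)\<^sup>2" for x w
    by (simp add: power2_eq_square algebra_simps)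
  show int: "integrable M (\<lambda>x. (f x + g x)\<^sup>2)" using sq[of 1] f g fg by simp
  define A C D where "A = (\<integral>x. (f x)\<^sup>2 \<partial>M)" and "C = (\<integral>x. f x * g x \<partial>M)" and "D = (\<integral>x. (g x)\<^sup>2 \<partial>M)"
  have AD: "0 \<le> A" "0 \<le> D" by (auto simp: A_def D_def)
  \<comment> \<open>A nonnegative quadratic polynomial has nonpositive discriminant.\<close>
  have q: "0 \<le> x\<^sup>2 * A + 2 * x * C + D" for x
  proof -
    have "0 \<le> (\<integral>w. (x * f w + g w)\<^sup>2 \<partial>M)" by simp
    also have "\<dots> = x\<^sup>2 * A + 2 * x * C + D" unfolding sq A_def C_def D_def using f g fg by simp
    finally show ?thesis .
  qed
  have CS: "C\<^sup>2 \<le> A * D"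
  proof (cases "A = 0")
    case True
    have "C = 0"
    proof (rule ccontr)
      assume "C \<noteq> 0"
      then have "2 * (- (D + 1) / (2 * C)) * C = - (D + 1)" by simp
      then show False using q[of "- (D + 1) / (2 * C)"] unfolding True by linarith
    qed
    then show ?thesis using True by simp
  next
    case False
    then have "0 < A" using AD by simp
    then show ?thesis using q[of "- C / A"] by (simp add: power2_eq_square field_simps)
  qed
  have "C \<le> sqrt A * sqrt D"
    using real_le_rsqrt[OF CS] by (simp add: real_sqrt_mult)
  then have "A + 2 * C + D \<le> (sqrt A + sqrt D)\<^sup>2" using AD by (simp add: power2_sum)
  moreover have "(\<integral>x. (f x + g x)\<^sup>2 \<partial>M) = A + 2 * C + D"
    using sq[of 1] f g fg by (simp add: A_def C_def D_def)
  ultimately show "sqrt (\<integral>x. (f x + g x)\<^sup>2 \<partial>M) \<le> sqrt (\<integral>x. (f x)\<^sup>2 \<partial>M) + sqrt (\<integral>x. (g x)\<^sup>2 \<partial>M)"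
    using AD by (simp add: A_def D_def real_le_lsqrt)
qed

lemma L2_triangle_diff:
  fixes f g :: "'a \<Rightarrow> real"
  assumes "f \<in> borel_measurable M" "g \<in> borel_measurable M"
    and f: "integrable M (\<lambda>x. (f x)\<^sup>2)" and g: "integrable M (\<lambda>x. (g x)\<^sup>2)"
  shows "integrable M (\<lambda>x. (f x - g x)\<^sup>2)"
    "\<bar>sqrt (\<integral>x. (f x)\<^sup>2 \<partial>M) - sqrt (\<integral>x. (g x)\<^sup>2 \<partial>M)\<bar> \<le> sqrt (\<integral>x. (f x - g x)\<^sup>2 \<partial>M)"
proof -
  have ng: "integrable M (\<lambda>x. (- g x)\<^sup>2)" using g by simp
  show d: "integrable M (\<lambda>x. (f x - g x)\<^sup>2)" using L2_triangle(2)[OF assms(1) _ f ng] assms(2) by simp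
  have d': "integrable M (\<lambda>x. (g x - f x)\<^sup>2)" using d by (simp add: power2_commute)
  have "(\<lambda>x. f x - g x) \<in> borel_measurable M" "(\<lambda>x. g x - f x) \<in> borel_measurable M" using assms by auto
  from L2_triangle(3)[OF this(1) assms(2) d g] L2_triangle(3)[OF this(2) assms(1) d' f]
  show "\<bar>sqrt (\<integral>x. (f x)\<^sup>2 \<partial>M) - sqrt (\<integral>x. (g x)\<^sup>2 \<partial>M)\<bar> \<le> sqrt (\<integral>x. (f x - g x)\<^sup>2 \<partial>M)"
    by (simp add: power2_commute[of "g _" "f _"])
qed

context brownian_setting
begin

abbreviation Leb :: "real measure" where "Leb \<equiv> lebesgue_on {0..T}"

abbreviation jointly_measurable :: "(real \<Rightarrow> 'a \<Rightarrow> real) \<Rightarrow> bool" where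
  "jointly_measurable f \<equiv> (\<lambda>(s, \<omega>). f s \<omega>) \<in> borel_measurable (Leb \<Otimes>\<^sub>M M)"

lemma finite_Leb: "finite_measure Leb"
  by (rule finite_measure_lebesgue_on) auto

lemma sigma_finite_Leb: "sigma_finite_measure Leb"
  using finite_Leb finite_measure.sigma_finite_measure by blast

lemma sigma_finite_lebesgue_on: "sigma_finite_measure (lebesgue_on {0..t::real})"
  using finite_measure_lebesgue_on[of "{0..t}"] finite_measure.sigma_finite_measure by blast

lemma pair_sigma_finite_Leb: "pair_sigma_finite Leb M"
  by (intro pair_sigma_finite.intro sigma_finite_Leb sigma_finite_measure_axioms)

lemma borel_Leb: assumes "f \<in> borel_measurable borel" shows "f \<in> borel_measurable Leb"
proof -
  have "f \<in> borel_measurable lborel" using assms by simp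
  then show ?thesis by (intro measurable_restrict_space1 measurable_completion)
qed

lemma AE_Leb: "AE s in Leb. s \<noteq> t" "AE s in Leb. s \<in> {0..<T}"
proof -
  show *: "AE s in Leb. s \<noteq> t" for t
  proof -
    have "{t} \<in> null_sets lebesgue" by simp
    from AE_not_in[OF this] have "AE s in lebesgue. s \<in> {0..T} \<longrightarrow> s \<noteq> t" by eventually_elim auto
    then show ?thesis by (rule AE_restrict_space_iff[THEN iffD2, rotated]) simp
  qed
  have "AE s in Leb. s \<in> {0..T}" by (auto intro!: AE_I2)
  with *[of T] show "AE s in Leb. s \<in> {0..<T}" by eventually_elim auto
qed

lemma progressive_adapted:
  assumes X: "progressive M B T X" and t: "t \<in> {0..T}"
  shows "X t \<in> borel_measurable (Filt t)"
proof -
  have "(\<lambda>(s, \<omega>). X s \<omega>) \<in> borel_measurable (lebesgue_on {0..t} \<Otimes>\<^sub>M Filt t)"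
    using X t unfolding progressive_def by blast
  from measurable_compose[OF measurable_Pair1'[of t "lebesgue_on {0..t}"] this]
  show ?thesis using t by (simp)
qed

lemma progressive_meas: "progressive M B T X \<Longrightarrow> t \<in> {0..T} \<Longrightarrow> X t \<in> borel_measurable M"
  using progressive_adapted filtration_measurableD by auto

lemma progressive_joint:
  assumes X: "progressive M B T X"
  shows "jointly_measurable X"
proof -
  have X': "(\<lambda>(s, \<omega>). X s \<omega>) \<in> borel_measurable (Leb \<Otimes>\<^sub>M Filt T)"
    using X T_pos unfolding progressive_def by auto
  have id: "(\<lambda>x. x) \<in> measurable M (Filt T)"
    using filtration_sub[of T] by (auto simp: measurable_def dest: sets.sets_into_space)
  have "(\<lambda>p. (fst p, snd p)) \<in> measurable (Leb \<Otimes>\<^sub>M M) (Leb \<Otimes>\<^sub>M Filt T)"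
    by (rule measurable_Pair) (auto intro: measurable_compose[OF _ id])
  from measurable_compose[OF this X'] show ?thesis by (simp add: split_beta')
qed

lemma joint_swap:
  assumes "jointly_measurable f"
  shows "(\<lambda>(\<omega>, s). f s \<omega>) \<in> borel_measurable (M \<Otimes>\<^sub>M Leb)"
  using measurable_compose[OF measurable_pair_swap' assms] by (simp add: split_beta')

lemma joint_section:
  assumes "jointly_measurable f" "\<omega> \<in> space M"
  shows "(\<lambda>s. f s \<omega>) \<in> borel_measurable Leb"
  using measurable_compose[OF measurable_Pair2'[OF assms(2)] assms(1)] by simp

lemma joint_integral:
  fixes f :: "real \<Rightarrow> 'a \<Rightarrow> real"
  assumes "jointly_measurable f"
  shows "(\<lambda>\<omega>. \<integral>s. f s \<omega> \<partial>Leb) \<in> borel_measurable M"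
  by (rule sigma_finite_measure.borel_measurable_lebesgue_integral[OF sigma_finite_Leb joint_swap[OF assms]])

lemma joint_diff_mult:
  assumes "jointly_measurable f" "jointly_measurable g"
  shows "jointly_measurable (\<lambda>s \<omega>. f s \<omega> - g s \<omega> :: real)"
    "jointly_measurable (\<lambda>s \<omega>. f s \<omega> * g s \<omega> :: real)"
  using assms by (simp_all add: split_beta' borel_measurable_diff borel_measurable_times)

lemma progressive_compose2:
  assumes f: "(\<lambda>(x, y). f x y) \<in> borel_measurable borel" and "progressive M B T X" "progressive M B T Y"
  shows "progressive M B T (\<lambda>t \<omega>. f (X t \<omega> :: real) (Y t \<omega> :: real) :: real)"
  unfolding progressive_def
proof
  fix t assume t: "t \<in> {0..T}"
  then have [measurable]: "(\<lambda>(s, \<omega>). X s \<omega>) \<in> borel_measurable (lebesgue_on {0..t} \<Otimes>\<^sub>M Filt t)"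
    "(\<lambda>(s, \<omega>). Y s \<omega>) \<in> borel_measurable (lebesgue_on {0..t} \<Otimes>\<^sub>M Filt t)"
    using assms unfolding progressive_def by auto
  have "(\<lambda>p. ((\<lambda>(s, \<omega>). X s \<omega>) p, (\<lambda>(s, \<omega>). Y s \<omega>) p)) \<in> measurable (lebesgue_on {0..t} \<Otimes>\<^sub>M Filt t) borel"
    by (rule borel_measurable_Pair) measurable
  from measurable_compose[OF this f]
  show "(\<lambda>(s, \<omega>). f (X s \<omega>) (Y s \<omega>)) \<in> borel_measurable (lebesgue_on {0..t} \<Otimes>\<^sub>M Filt t)"
    by (simp add: split_beta')
qed

lemma progressive_add: "progressive M B T X \<Longrightarrow> progressive M B T Y \<Longrightarrow> progressive M B T (\<lambda>t \<omega>. X t \<omega> + Y t \<omega> :: real)"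
  by (rule progressive_compose2[of "\<lambda>x y. x + y"]) (auto simp: split_beta' intro!: borel_measurable_continuous_onI continuous_intros)

lemma progressive_mult: "progressive M B T X \<Longrightarrow> progressive M B T Y \<Longrightarrow> progressive M B T (\<lambda>t \<omega>. X t \<omega> * Y t \<omega> :: real)"
  by (rule progressive_compose2[of "\<lambda>x y. x * y"]) (auto simp: split_beta' intro!: borel_measurable_continuous_onI continuous_intros)

lemma progressive_const: "progressive M B T (\<lambda>t \<omega>. c :: real)"
  unfolding progressive_def by simp

lemma progressive_cmult: "progressive M B T X \<Longrightarrow> progressive M B T (\<lambda>t \<omega>. c * X t \<omega> :: real)"
  by (rule progressive_mult[OF progressive_const])

lemma progressive_minus: "progressive M B T X \<Longrightarrow> progressive M B T (\<lambda>t \<omega>. - X t \<omega> :: real)"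
  using progressive_cmult[of X "-1"] by simp

lemma progressive_diff: "progressive M B T X \<Longrightarrow> progressive M B T Y \<Longrightarrow> progressive M B T (\<lambda>t \<omega>. X t \<omega> - Y t \<omega> :: real)"
  using progressive_add[OF _ progressive_minus] by simp

lemma progressive_power: "progressive M B T X \<Longrightarrow> progressive M B T (\<lambda>t \<omega>. (X t \<omega> :: real) ^ n)"
  by (induction n) (auto intro: progressive_const progressive_mult)

lemma progressive_exp: "progressive M B T X \<Longrightarrow> progressive M B T (\<lambda>t \<omega>. exp (X t \<omega> :: real))"
  by (rule progressive_compose2[of "\<lambda>x y. exp x" X X]) (auto simp: split_beta' intro!: borel_measurable_continuous_onI continuous_intros)

lemmas progressive_intros = progressive_add progressive_diff progressive_mult progressive_minus
  progressive_const progressive_cmult progressive_power progressive_exp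

text \<open>
  The exceptional set is enclosed in a measurable null set of the product; Fubini then swaps the
  order of the two quantifiers for this set.
\<close>

lemma AE_time_prob:
  assumes "AE (t, \<omega>) in time_prob M T. P t \<omega>"
  shows "AE \<omega> in M. AE t in Leb. P t \<omega>"
proof -
  interpret L: pair_sigma_finite Leb M by (rule pair_sigma_finite_Leb)
  obtain N where N: "N \<in> null_sets (Leb \<Otimes>\<^sub>M M)" "{p \<in> space (Leb \<Otimes>\<^sub>M M). \<not> (case p of (t, \<omega>) \<Rightarrow> P t \<omega>)} \<subseteq> N"
    using assms by (auto elim!: AE_E simp: null_sets_def)
  have Ns: "N \<in> sets (Leb \<Otimes>\<^sub>M M)" using N(1) by auto
  have m: "{x \<in> space (Leb \<Otimes>\<^sub>M M). (fst x, snd x) \<notin> N} \<in> sets (Leb \<Otimes>\<^sub>M M)"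
  proof -
    have "{x \<in> space (Leb \<Otimes>\<^sub>M M). (fst x, snd x) \<notin> N} = space (Leb \<Otimes>\<^sub>M M) - N" by auto
    then show ?thesis using Ns by auto
  qed
  have "AE z in Leb \<Otimes>\<^sub>M M. z \<notin> N" by (rule AE_not_in[OF N(1)])
  then have "AE t in Leb. AE \<omega> in M. (t, \<omega>) \<notin> N" using L.AE_pair by blast
  then have "AE \<omega> in M. AE t in Leb. (t, \<omega>) \<notin> N" using L.AE_commute[OF m] by simp
  then show ?thesis
    using AE_space
  proof eventually_elim
    case (elim \<omega>)
    from elim(1) AE_space[of Leb] show ?case
    proof eventually_elim
      case (elim t)
      then have "(t, \<omega>) \<notin> {p \<in> space (Leb \<Otimes>\<^sub>M M). \<not> (case p of (t, \<omega>) \<Rightarrow> P t \<omega>)}" using N(2) by blast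
      then show ?case using elim(2) \<open>\<omega> \<in> space M\<close> by (simp add: space_pair_measure)
    qed
  qed
qed

text \<open>
  In this direction measurability of the condition has to be assumed: exceptional sets of single
  paths need not form a measurable set of the product.
\<close>

lemma time_prob_AE_I:
  assumes m: "jointly_measurable f" and A: "A \<in> sets borel"
    and ae: "AE \<omega> in M. AE t in Leb. f t \<omega> \<in> A"
  shows "AE (t, \<omega>) in time_prob M T. f t \<omega> \<in> A"
proof -
  interpret L: pair_sigma_finite Leb M by (rule pair_sigma_finite_Leb)
  have s: "{x \<in> space (Leb \<Otimes>\<^sub>M M). f (fst x) (snd x) \<in> A} \<in> sets (Leb \<Otimes>\<^sub>M M)"
    using measurable_sets[OF m A] by (auto simp: vimage_def Int_def split_beta' conj_commute)
  have "AE t in Leb. AE \<omega> in M. f t \<omega> \<in> A" using ae L.AE_commute[OF s] by simp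
  then have "AE z in Leb \<Otimes>\<^sub>M M. f (fst z) (snd z) \<in> A"
    using L.AE_pair_iff[OF s] by simp
  then show ?thesis by (simp add: split_beta')
qed

text \<open>
  The reference measure is the same for all \<open>t\<close>, so that dominated convergence applies to moving
  upper limits. The interval is half open so that the intervals belonging to the cells of a grid are
  disjoint.
\<close>

definition time_integral :: "real \<Rightarrow> (real \<Rightarrow> real) \<Rightarrow> real" where
  "time_integral t f = (\<integral>s. indicator {0..<t} s * f s \<partial>Leb)"

lemma time_integral_integrable: "integrable Leb f \<Longrightarrow> integrable Leb (\<lambda>s. indicator {a..<t} s * f s :: real)"
proof -
  assume f: "integrable Leb f"
  then have [measurable]: "f \<in> borel_measurable Leb" by auto
  have [measurable]: "(indicator {a..<t} :: real \<Rightarrow> real) \<in> borel_measurable Leb" by (rule borel_Leb) measurable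
  show ?thesis
  proof (rule Bochner_Integration.integrable_bound[OF f])
    show "(\<lambda>s. indicator {a..<t} s * f s) \<in> borel_measurable Leb" by measurable
  qed (auto simp: indicator_def)
qed

lemma time_integral_0 [simp]: "time_integral 0 f = 0" by (simp add: time_integral_def)

lemma time_integral_cong: "(\<And>s. 0 \<le> s \<Longrightarrow> s < t \<Longrightarrow> s \<le> T \<Longrightarrow> f s = g s) \<Longrightarrow> time_integral t f = time_integral t g"
  unfolding time_integral_def by (rule Bochner_Integration.integral_cong) (auto simp: indicator_def)

lemma time_integral_add: "integrable Leb f \<Longrightarrow> integrable Leb g \<Longrightarrow> time_integral t (\<lambda>s. f s + g s) = time_integral t f + time_integral t g"
  unfolding time_integral_def distrib_left by (intro Bochner_Integration.integral_add time_integral_integrable)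

lemma time_integral_cmult: "time_integral t (\<lambda>s. c * f s) = c * time_integral t f"
  unfolding time_integral_def mult.left_commute[of _ c] by simp

lemma time_integral_T: assumes [measurable]: "f \<in> borel_measurable Leb" shows "time_integral T f = (\<integral>s. f s \<partial>Leb)"
  unfolding time_integral_def
proof (rule integral_cong_AE)
  have [measurable]: "(indicator {0..<T} :: real \<Rightarrow> real) \<in> borel_measurable Leb" by (rule borel_Leb) measurable
  show "(\<lambda>s. indicator {0..<T} s * f s) \<in> borel_measurable Leb" by measurable
  show "AE s in Leb. indicator {0..<T} s * f s = f s"
    using AE_Leb(2) by eventually_elim auto
qed measurable

lemma time_integral_lebesgue_on:
  assumes t: "t \<in> {0..T}" and f: "f \<in> borel_measurable Leb"
  shows "(\<integral>s. f s \<partial>lebesgue_on {0..t}) = time_integral t f"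
proof -
  have [measurable]: "(\<lambda>s. indicator {0..T} s * f s) \<in> borel_measurable lebesgue"
    using f by (simp add: borel_measurable_restrict_space_iff)
  have [measurable]: "(indicator {0..<t} :: real \<Rightarrow> real) \<in> borel_measurable lebesgue" "(indicator {0..t} :: real \<Rightarrow> real) \<in> borel_measurable lebesgue"
    by (auto intro!: borel_measurable_indicator)
  have "(\<integral>s. f s \<partial>lebesgue_on {0..t}) = (\<integral>s. indicator {0..t} s * f s \<partial>lebesgue)"
    by (subst integral_restrict_space) auto
  also have "\<dots> = (\<integral>s. indicator {0..t} s * (indicator {0..T} s * f s) \<partial>lebesgue)"
    by (rule Bochner_Integration.integral_cong) (use t in \<open>auto simp: indicator_def\<close>)
  also have "\<dots> = (\<integral>s. indicator {0..<t} s * (indicator {0..T} s * f s) \<partial>lebesgue)"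
  proof (rule integral_cong_AE)
    have "{t} \<in> null_sets lebesgue" by simp
    then have "AE s in lebesgue. s \<notin> {t}" by (rule AE_not_in)
    then show "AE s in lebesgue. indicator {0..t} s * (indicator {0..T} s * f s) = indicator {0..<t} s * (indicator {0..T} s * f s)"
      by eventually_elim (auto simp: indicator_def)
  qed measurable
  also have "\<dots> = (\<integral>s. indicator {0..T} s * (indicator {0..<t} s * f s) \<partial>lebesgue)"
    by (simp add: mult.left_commute)
  also have "\<dots> = time_integral t f" unfolding time_integral_def by (subst integral_restrict_space) auto
  finally show ?thesis .
qed

lemma time_integral_diff: assumes f: "integrable Leb f" and "0 \<le> t" "t \<le> u"
  shows "time_integral u f - time_integral t f = (\<integral>s. indicator {t..<u} s * f s \<partial>Leb)"
proof -
  have "time_integral u f - time_integral t f = (\<integral>s. indicator {0..<u} s * f s - indicator {0..<t} s * f s \<partial>Leb)"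
    unfolding time_integral_def by (rule Bochner_Integration.integral_diff[symmetric]) (auto intro!: time_integral_integrable f)
  also have "\<dots> = (\<integral>s. indicator {t..<u} s * f s \<partial>Leb)"
    by (rule Bochner_Integration.integral_cong) (use assms in \<open>auto simp: indicator_def\<close>)
  finally show ?thesis .
qed

lemma integrable_time_integral_mono:
  assumes k: "integrable Leb k" and nn: "\<And>s. 0 \<le> k s" and tu: "0 \<le> t" "t \<le> u"
  shows "time_integral t k \<le> time_integral u k"
  unfolding time_integral_def
  by (intro integral_mono time_integral_integrable k) (use nn tu in \<open>auto simp: indicator_def\<close>)

lemma time_integral_meas:
  assumes f: "jointly_measurable f"
  shows "(\<lambda>\<omega>. time_integral t (\<lambda>s. f s \<omega>)) \<in> borel_measurable M"
proof -
  have ind: "jointly_measurable (\<lambda>s \<omega>. indicator {0..<t} s :: real)"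
    unfolding split_beta' by (rule measurable_compose[OF measurable_fst borel_Leb]) measurable
  show ?thesis unfolding time_integral_def by (rule joint_integral[OF joint_diff_mult(2)[OF ind f]])
qed

lemma time_integral_tendsto:
  assumes f: "integrable Leb f" and lim: "u \<longlonglongrightarrow> t"
    and ut: "\<And>s. s \<in> {0..<T} \<Longrightarrow> s \<noteq> t \<Longrightarrow> (\<lambda>n. g n s) \<longlonglongrightarrow> h s"
    and bd: "\<And>n s. s \<in> {0..<T} \<Longrightarrow> \<bar>g n s\<bar> \<le> K"
    and gm: "\<And>n. g n \<in> borel_measurable Leb" "h \<in> borel_measurable Leb"
  shows "(\<lambda>n. time_integral (u n) (\<lambda>s. g n s * f s)) \<longlonglongrightarrow> time_integral t (\<lambda>s. h s * f s)"
  unfolding time_integral_def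
proof (rule integral_dominated_convergence[where w = "\<lambda>s. \<bar>K\<bar> * \<bar>f s\<bar>"])
  have [measurable]: "f \<in> borel_measurable Leb" using f by auto
  have ind: "(indicator {0..<t} :: real \<Rightarrow> real) \<in> borel_measurable Leb" for t
    by (rule borel_Leb) measurable
  note [measurable] = gm
  show "(\<lambda>s. indicator {0..<t} s * (h s * f s)) \<in> borel_measurable Leb"
    "(\<lambda>s. indicator {0..<u n} s * (g n s * f s)) \<in> borel_measurable Leb" for n
    using ind[of t] ind[of "u n"] by measurable
  show "integrable Leb (\<lambda>s. \<bar>K\<bar> * \<bar>f s\<bar>)" using f by auto
  have nT: "AE s in Leb. s \<in> {0..<T}" by (rule AE_Leb)
  show "AE s in Leb. norm (indicator {0..<u n} s * (g n s * f s)) \<le> \<bar>K\<bar> * \<bar>f s\<bar>" for n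
    using nT
  proof eventually_elim
    case (elim s)
    then have "\<bar>g n s\<bar> \<le> \<bar>K\<bar>" using bd[of s n] by linarith
    then show ?case by (auto simp: abs_mult indicator_def intro!: mult_right_mono)
  qed
  have nt: "AE s in Leb. s \<noteq> t" by (rule AE_Leb)
  show "AE s in Leb. (\<lambda>n. indicator {0..<u n} s * (g n s * f s)) \<longlonglongrightarrow> indicator {0..<t} s * (h s * f s)"
    using nT nt
  proof eventually_elim
    case (elim s)
    then have s: "s \<in> {0..<T}" by auto
    have "(\<lambda>n. indicator {0..<u n} s :: real) \<longlonglongrightarrow> indicator {0..<t} s"
    proof (cases "s < t")
      case True
      then have "\<forall>\<^sub>F n in sequentially. s < u n" using order_tendstoD(1)[OF lim] by auto
      then have "\<forall>\<^sub>F n in sequentially. indicator {0..<u n} s = (indicator {0..<t} s :: real)"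
        by eventually_elim (use True in \<open>auto simp: indicator_def\<close>)
      then show ?thesis by (rule tendsto_eventually)
    next
      case False
      then have "t < s" using elim by simp
      then have "\<forall>\<^sub>F n in sequentially. u n < s" using order_tendstoD(2)[OF lim] by auto
      then have "\<forall>\<^sub>F n in sequentially. indicator {0..<u n} s = (indicator {0..<t} s :: real)"
        by eventually_elim (use False in \<open>auto simp: indicator_def\<close>)
      then show ?thesis by (rule tendsto_eventually)
    qed
    then show ?case using elim by (intro tendsto_mult ut[OF s] tendsto_const) auto
  qed
qed

lemma time_integral_continuous: assumes f: "integrable Leb f" shows "continuous_on A (\<lambda>t. time_integral t f)"
proof -
  have "(\<lambda>n. time_integral (u n) f) \<longlonglongrightarrow> time_integral t f" if "u \<longlonglongrightarrow> t" for u t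
    using time_integral_tendsto[OF f that, of "\<lambda>n s. 1" "\<lambda>s. 1" 1] by auto
  then show ?thesis by (auto simp: continuous_on_sequentially comp_def)
qed

text \<open>
  Up to time \<open>t\<close> the process is jointly measurable with respect to the past at time \<open>t\<close>; integrating
  out the inner time variable preserves this.
\<close>

lemma progressive_time_integral:
  assumes k: "progressive M B T k"
  shows "progressive M B T (\<lambda>t \<omega>. time_integral t (\<lambda>s. k s \<omega>))"
  unfolding progressive_def
proof
  fix t assume t: "t \<in> {0..T}"
  let ?L = "lebesgue_on {0..t}"
  have k': "(\<lambda>(s, \<omega>). k s \<omega>) \<in> borel_measurable (?L \<Otimes>\<^sub>M Filt t)" using k t unfolding progressive_def by auto
  have id: "(\<lambda>s. s) \<in> borel_measurable ?L"
    by (intro measurable_restrict_space1 measurable_completion) simp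
  have [measurable]: "(\<lambda>p. fst (fst p)) \<in> borel_measurable ((?L \<Otimes>\<^sub>M Filt t) \<Otimes>\<^sub>M ?L)" "(\<lambda>p. snd p) \<in> borel_measurable ((?L \<Otimes>\<^sub>M Filt t) \<Otimes>\<^sub>M ?L)"
    by (intro measurable_compose[OF _ id] measurable_compose[OF measurable_fst measurable_fst] measurable_snd)+
  have "(\<lambda>p. (snd p, snd (fst p))) \<in> measurable ((?L \<Otimes>\<^sub>M Filt t) \<Otimes>\<^sub>M ?L) (?L \<Otimes>\<^sub>M Filt t)"
    by (intro measurable_Pair measurable_snd measurable_compose[OF measurable_fst measurable_snd])
  from measurable_compose[OF this k'] have [measurable]: "(\<lambda>p. k (snd p) (snd (fst p))) \<in> borel_measurable ((?L \<Otimes>\<^sub>M Filt t) \<Otimes>\<^sub>M ?L)"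
    by simp
  have "(\<lambda>p. if 0 \<le> snd p \<and> snd p < fst (fst p) then k (snd p) (snd (fst p)) else 0) \<in> borel_measurable ((?L \<Otimes>\<^sub>M Filt t) \<Otimes>\<^sub>M ?L)"
    by measurable
  then have "(\<lambda>(q, r). if 0 \<le> r \<and> r < fst q then k r (snd q) else 0) \<in> borel_measurable ((?L \<Otimes>\<^sub>M Filt t) \<Otimes>\<^sub>M ?L)"
    by (simp add: split_beta')
  from sigma_finite_measure.borel_measurable_lebesgue_integral[OF sigma_finite_lebesgue_on this]
  have m: "(\<lambda>q. \<integral>r. (if 0 \<le> r \<and> r < fst q then k r (snd q) else 0) \<partial>?L) \<in> borel_measurable (?L \<Otimes>\<^sub>M Filt t)" .
  show "(\<lambda>(s, \<omega>). time_integral s (\<lambda>r. k r \<omega>)) \<in> borel_measurable (?L \<Otimes>\<^sub>M Filt t)"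
  proof (rule measurable_cong[THEN iffD1, OF _ m])
    fix q assume "q \<in> space (?L \<Otimes>\<^sub>M Filt t)"
    then obtain s \<omega> where q: "q = (s, \<omega>)" "0 \<le> s" "s \<le> t" by (auto simp: space_pair_measure)
    have "(\<integral>r. (if 0 \<le> r \<and> r < fst q then k r (snd q) else 0) \<partial>?L) = (\<integral>r. indicator {0..t} r * (if 0 \<le> r \<and> r < s then k r \<omega> else 0) \<partial>lebesgue)"
      unfolding q fst_conv snd_conv by (subst integral_restrict_space) auto
    also have "\<dots> = (\<integral>r. indicator {0..T} r * (indicator {0..<s} r * k r \<omega>) \<partial>lebesgue)"
      by (rule Bochner_Integration.integral_cong) (use q t in \<open>auto simp: indicator_def\<close>)
    also have "\<dots> = time_integral s (\<lambda>r. k r \<omega>)" unfolding time_integral_def by (subst integral_restrict_space) auto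
    finally show "(\<integral>r. (if 0 \<le> r \<and> r < fst q then k r (snd q) else 0) \<partial>?L) = (case q of (s, \<omega>) \<Rightarrow> time_integral s (\<lambda>r. k r \<omega>))" by (simp add: q)
  qed
qed

lemma grid_index_measurable: "(\<lambda>s. h (grid_index m s) :: real) \<in> borel_measurable Leb"
proof -
  have "(\<lambda>s. h (nat \<lfloor>s * 2 ^ m / T\<rfloor>)) \<in> borel_measurable borel" by measurable
  then show ?thesis unfolding grid_index_def by (rule borel_Leb)
qed

lemma grid_index_indicator: "0 \<le> s \<Longrightarrow> indicator {0..<grid m j} s * h (grid_index m s) = (\<Sum>i<j. h i * indicator {grid m i..<grid m (Suc i)} s :: real)"
proof -
  assume s: "0 \<le> s"
  have eq: "s \<in> {grid m i..<grid m (Suc i)} \<longleftrightarrow> i = grid_index m s" for i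
    using grid_index_bounds[OF s, of m] grid_index_eqI[of m i s] by auto
  have "s < grid m j \<longleftrightarrow> grid_index m s < j"
    using grid_index_bounds[OF s, of m] grid_le_iff[of m "Suc (grid_index m s)" j] grid_le_iff[of m j "grid_index m s"] by (meson Suc_leI leD leI order_less_le_trans order_trans)
  then show ?thesis unfolding indicator_def eq using s by (auto simp: sum.delta if_distrib cong: if_cong)
qed

text \<open>
  A Riemann sum over a grid is itself the time integral of a function that is constant on the cells.
  Limits of Riemann sums thereby become instances of dominated convergence.
\<close>

lemma riemann_sum:
  assumes f: "integrable Leb f"
  shows "(\<Sum>i<j. h i * (time_integral (grid m (Suc i)) f - time_integral (grid m i) f)) = time_integral (grid m j) (\<lambda>s. h (grid_index m s) * f s)"
proof -
  have "(\<Sum>i<j. h i * (time_integral (grid m (Suc i)) f - time_integral (grid m i) f)) = (\<Sum>i<j. \<integral>s. h i * (indicator {grid m i..<grid m (Suc i)} s * f s) \<partial>Leb)"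
    by (subst time_integral_diff[OF f]) auto
  also have "\<dots> = (\<integral>s. (\<Sum>i<j. h i * (indicator {grid m i..<grid m (Suc i)} s * f s)) \<partial>Leb)"
    by (intro Bochner_Integration.integral_sum[symmetric] integrable_mult_right time_integral_integrable f)
  also have "\<dots> = time_integral (grid m j) (\<lambda>s. h (grid_index m s) * f s)"
    unfolding time_integral_def
  proof (rule Bochner_Integration.integral_cong[OF refl])
    fix s assume "s \<in> space Leb"
    then have "0 \<le> s" by simp
    from grid_index_indicator[OF this, of m j h]
    have "indicator {0..<grid m j} s * h (grid_index m s) * f s = (\<Sum>i<j. h i * indicator {grid m i..<grid m (Suc i)} s) * f s" by simp
    then show "(\<Sum>i<j. h i * (indicator {grid m i..<grid m (Suc i)} s * f s)) = indicator {0..<grid m j} s * (h (grid_index m s) * f s)"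
      by (simp only: sum_distrib_right mult.assoc)
  qed
  finally show ?thesis .
qed

lemma riemann_limit:
  assumes f: "integrable Leb f" and t: "t \<in> {0..T}"
    and lim: "\<And>s. s \<in> {0..<T} \<Longrightarrow> (\<lambda>m. h m (grid_index m s)) \<longlonglongrightarrow> g s"
    and bd: "\<And>m s. s \<in> {0..<T} \<Longrightarrow> \<bar>h m (grid_index m s)\<bar> \<le> K" and g: "g \<in> borel_measurable Leb"
  shows "(\<lambda>m. \<Sum>i<grid_index m t. h m i * (time_integral (grid m (Suc i)) f - time_integral (grid m i) f)) \<longlonglongrightarrow> time_integral t (\<lambda>s. g s * f s)"
  unfolding riemann_sum[OF f] grid_floor_def[symmetric]
  by (rule time_integral_tendsto[OF f grid_floor_tendsto]) (use t lim bd g in \<open>auto intro: grid_index_measurable\<close>)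

lemma integrable_Leb_1: "integrable Leb (\<lambda>s. c :: real)"
  using finite_measure.integrable_const[OF finite_Leb] .

lemma time_integral_1: assumes "t \<in> {0..T}" shows "time_integral t (\<lambda>s. 1) = t"
proof -
  have "(\<integral>s. 1 \<partial>lebesgue_on {0..t}) = t" using assms by (simp add: measure_restrict_space)
  then show ?thesis using time_integral_lebesgue_on[OF assms, of "\<lambda>s. 1"] by simp
qed

lemma sqrt_time_integral_diff:
  assumes [measurable]: "f \<in> borel_measurable Leb" "g \<in> borel_measurable Leb"
    and f: "integrable Leb (\<lambda>s. (f s)\<^sup>2)" and g: "integrable Leb (\<lambda>s. (g s)\<^sup>2)"
  shows "\<bar>sqrt (time_integral t (\<lambda>s. (f s)\<^sup>2)) - sqrt (time_integral t (\<lambda>s. (g s)\<^sup>2))\<bar> \<le> sqrt (\<integral>s. (f s - g s)\<^sup>2 \<partial>Leb)"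
proof -
  let ?i = "indicator {0..<t} :: real \<Rightarrow> real"
  have [measurable]: "?i \<in> borel_measurable Leb" by (rule borel_Leb) measurable
  have i2: "(?i s * x)\<^sup>2 = ?i s * x\<^sup>2" for s x by (auto simp: indicator_def)
  have if2: "integrable Leb (\<lambda>s. (?i s * f s)\<^sup>2)" "integrable Leb (\<lambda>s. (?i s * g s)\<^sup>2)"
    unfolding i2 by (auto intro!: time_integral_integrable f g)
  have "\<bar>sqrt (time_integral t (\<lambda>s. (f s)\<^sup>2)) - sqrt (time_integral t (\<lambda>s. (g s)\<^sup>2))\<bar> \<le> sqrt (\<integral>s. (?i s * f s - ?i s * g s)\<^sup>2 \<partial>Leb)"
    using L2_triangle_diff(2)[OF _ _ if2] unfolding time_integral_def i2 by simp
  also have "\<dots> \<le> sqrt (\<integral>s. (f s - g s)\<^sup>2 \<partial>Leb)"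
  proof (intro real_sqrt_le_mono integral_mono)
    show "integrable Leb (\<lambda>s. (?i s * f s - ?i s * g s)\<^sup>2)" by (rule L2_triangle_diff(1)[OF _ _ if2]) auto
    show "integrable Leb (\<lambda>s. (f s - g s)\<^sup>2)" by (rule L2_triangle_diff(1)[OF _ _ f g]) auto
  qed (auto simp: indicator_def)
  finally show ?thesis .
qed

lemma L2_bounded_mult:
  assumes [measurable]: "Q \<in> borel_measurable Leb" "f \<in> borel_measurable Leb"
    and f: "integrable Leb (\<lambda>s. (f s)\<^sup>2)" and Q: "\<And>s. s \<in> {0..<T} \<Longrightarrow> \<bar>Q s\<bar> \<le> K"
  shows "integrable Leb (\<lambda>s. (Q s * f s)\<^sup>2)" "sqrt (\<integral>s. (Q s * f s)\<^sup>2 \<partial>Leb) \<le> \<bar>K\<bar> * sqrt (\<integral>s. (f s)\<^sup>2 \<partial>Leb)"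
proof -
  have ae: "AE s in Leb. (Q s * f s)\<^sup>2 \<le> K\<^sup>2 * (f s)\<^sup>2"
    using AE_Leb(2)
  proof eventually_elim
    case (elim s)
    then have "(Q s)\<^sup>2 \<le> K\<^sup>2" using Q[OF elim] by (simp add: abs_le_square_iff[symmetric] order_trans[OF _ abs_ge_self])
    then show ?case by (simp add: power_mult_distrib mult_right_mono)
  qed
  have i: "integrable Leb (\<lambda>s. K\<^sup>2 * (f s)\<^sup>2)" using f by simp
  show i2: "integrable Leb (\<lambda>s. (Q s * f s)\<^sup>2)"
    by (rule Bochner_Integration.integrable_bound[OF i]) (use ae in auto)
  have "sqrt (\<integral>s. (Q s * f s)\<^sup>2 \<partial>Leb) \<le> sqrt (K\<^sup>2 * (\<integral>s. (f s)\<^sup>2 \<partial>Leb))"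
    using integral_mono_AE[OF i2 i ae] by simp
  then show "sqrt (\<integral>s. (Q s * f s)\<^sup>2 \<partial>Leb) \<le> \<bar>K\<bar> * sqrt (\<integral>s. (f s)\<^sup>2 \<partial>Leb)"
    by (simp add: real_sqrt_mult)
qed

lemma L1_bounded_mult:
  assumes [measurable]: "Q \<in> borel_measurable Leb"
    and f: "integrable Leb f" and Q: "\<And>s. s \<in> {0..<T} \<Longrightarrow> \<bar>Q s\<bar> \<le> K"
  shows "integrable Leb (\<lambda>s. Q s * f s :: real)"
proof (rule Bochner_Integration.integrable_bound)
  show "integrable Leb (\<lambda>s. K * f s)" using f by simp
  have [measurable]: "f \<in> borel_measurable Leb" using f by auto
  show "(\<lambda>s. Q s * f s) \<in> borel_measurable Leb" by measurable
  show "AE s in Leb. norm (Q s * f s) \<le> norm (K * f s)"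
    using AE_Leb(2)
  proof eventually_elim
    case (elim s)
    then have "\<bar>Q s\<bar> \<le> \<bar>K\<bar>" using Q[OF elim] by linarith
    then show ?case by (simp add: abs_mult mult_right_mono)
  qed
qed

text \<open>
  The norm of a path in \<open>L\<^sup>2(0,T)\<close>. A path that is not square integrable gets the value \<open>0\<close>;
  estimates with \<open>time_norm\<close> are therefore accompanied by square integrability.
\<close>

definition time_norm :: "(real \<Rightarrow> 'a \<Rightarrow> real) \<Rightarrow> 'a \<Rightarrow> real" where
  "time_norm c \<omega> = sqrt (\<integral>s. (c s \<omega>)\<^sup>2 \<partial>Leb)"

abbreviation time_dist :: "(real \<Rightarrow> 'a \<Rightarrow> real) \<Rightarrow> (real \<Rightarrow> 'a \<Rightarrow> real) \<Rightarrow> 'a \<Rightarrow> real" where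
  "time_dist H c \<equiv> time_norm (\<lambda>s \<omega>. H s \<omega> - c s \<omega>)"

lemma time_norm_nonneg [simp]: "0 \<le> time_norm c \<omega>" by (simp add: time_norm_def)

lemma time_norm_meas:
  assumes [measurable]: "jointly_measurable c"
  shows "time_norm c \<in> borel_measurable M"
proof -
  have "jointly_measurable (\<lambda>s \<omega>. (c s \<omega>)\<^sup>2)" by measurable
  from joint_integral[OF this] show ?thesis unfolding time_norm_def by measurable
qed

lemma time_norm_sum:
  assumes "\<And>s. s \<in> {0..<T} \<Longrightarrow> c s \<omega> = h (grid_index m s)" and [measurable]: "(\<lambda>s. c s \<omega>) \<in> borel_measurable Leb"
  shows "time_norm c \<omega> = sqrt (T / 2 ^ m * (\<Sum>i<2^m. (h i)\<^sup>2))"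
proof -
  have [measurable]: "(\<lambda>s. h (grid_index m s)) \<in> borel_measurable Leb" by (rule grid_index_measurable)
  have "(\<integral>s. (c s \<omega>)\<^sup>2 \<partial>Leb) = (\<integral>s. (h (grid_index m s))\<^sup>2 * 1 \<partial>Leb)"
  proof (rule integral_cong_AE)
    show "AE s in Leb. (c s \<omega>)\<^sup>2 = (h (grid_index m s))\<^sup>2 * 1"
      using AE_Leb(2) by eventually_elim (use assms in auto)
  qed measurable
  also have "\<dots> = time_integral (grid m (2 ^ m)) (\<lambda>s. (h (grid_index m s))\<^sup>2 * 1)"
    unfolding grid_top by (rule time_integral_T[symmetric]) measurable
  also have "\<dots> = (\<Sum>i<2^m. (h i)\<^sup>2 * (time_integral (grid m (Suc i)) (\<lambda>s. 1) - time_integral (grid m i) (\<lambda>s. 1)))"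
    by (rule riemann_sum[OF integrable_Leb_1, symmetric])
  also have "\<dots> = (\<Sum>i<2^m. (h i)\<^sup>2 * (T / 2 ^ m))"
  proof (intro sum.cong refl)
    fix i :: nat assume "i \<in> {..<2 ^ m}"
    then have "grid m i \<in> {0..T}" "grid m (Suc i) \<in> {0..T}" by (auto intro!: grid_le_T)
    then show "(h i)\<^sup>2 * (time_integral (grid m (Suc i)) (\<lambda>s. 1) - time_integral (grid m i) (\<lambda>s. 1)) = (h i)\<^sup>2 * (T / 2 ^ m)"
      by (simp only: time_integral_1) (simp add: grid_Suc)
  qed
  finally show ?thesis by (simp only: time_norm_def sum_distrib_left mult.commute)
qed

lemma time_norm_le:
  assumes "ennreal (d\<^sup>2) \<ge> (\<integral>\<^sup>+ s. ennreal ((f s \<omega>)\<^sup>2) \<partial>Leb)" "0 \<le> d"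
  shows "time_norm f \<omega> \<le> d"
proof (cases "integrable Leb (\<lambda>s. (f s \<omega>)\<^sup>2)")
  case True
  have "(\<integral>\<^sup>+ s. ennreal ((f s \<omega>)\<^sup>2) \<partial>Leb) = ennreal (\<integral>s. (f s \<omega>)\<^sup>2 \<partial>Leb)" by (rule nn_integral_eq_integral[OF True]) simp
  then have "(\<integral>s. (f s \<omega>)\<^sup>2 \<partial>Leb) \<le> d\<^sup>2" using assms by (simp add: ennreal_le_iff)
  then show ?thesis unfolding time_norm_def using assms(2) real_le_lsqrt by blast
next
  case False
  then show ?thesis using assms(2) by (simp add: time_norm_def not_integrable_integral_eq)
qed

section \<open>Continuous processes\<close>

text \<open>
  The supremum of a process over an uncountable set of times need not be measurable. \<open>Z\<close> is a
  measurable version of it, below the supremum everywhere so that finite integrals of the supremum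
  are inherited.
\<close>

lemma continuous_process_sup:
  assumes X: "continuous_process M B T X"
  obtains Z where "Z \<in> borel_measurable M" "\<And>\<omega>. Z \<omega> \<le> (SUP t\<in>{0..T}. ennreal ((X t \<omega>)\<^sup>2))"
    "AE \<omega> in M. Z \<omega> < \<infinity> \<and> (\<forall>t\<in>{0..T}. ennreal ((X t \<omega>)\<^sup>2) \<le> Z \<omega>)"
proof -
  have Xp: "progressive M B T X" and Xc: "AE \<omega> in M. continuous_on {0..T} (\<lambda>t. X t \<omega>)" using X unfolding continuous_process_def by auto
  \<comment> \<open>By continuity the supremum may be taken over the countably many grid points, which makes it measurable.\<close>
  define I where "I = {(m, i) | m i. i \<le> (2::nat) ^ m}"
  define Z where "Z \<omega> = (SUP p\<in>I. ennreal ((X (grid (fst p) (snd p)) \<omega>)\<^sup>2))" for \<omega>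
  have I: "grid (fst p) (snd p) \<in> {0..T}" if "p \<in> I" for p using that by (auto simp: I_def intro!: grid_le_T)
  show ?thesis
  proof (rule that)
    show "Z \<in> borel_measurable M" unfolding Z_def
    proof (rule borel_measurable_SUP)
      fix p assume "p \<in> I"
      then have "X (grid (fst p) (snd p)) \<in> borel_measurable M" using I by (intro progressive_meas[OF Xp])
      then show "(\<lambda>\<omega>. ennreal ((X (grid (fst p) (snd p)) \<omega>)\<^sup>2)) \<in> borel_measurable M" by measurable
    qed simp
    show "Z \<omega> \<le> (SUP t\<in>{0..T}. ennreal ((X t \<omega>)\<^sup>2))" for \<omega>
      unfolding Z_def using I by (intro SUP_mono) blast
    show "AE \<omega> in M. Z \<omega> < \<infinity> \<and> (\<forall>t\<in>{0..T}. ennreal ((X t \<omega>)\<^sup>2) \<le> Z \<omega>)"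
      using Xc
    proof eventually_elim
      case (elim \<omega>)
      have "continuous_on {0..T} (\<lambda>t. (X t \<omega>)\<^sup>2)" using elim by (intro continuous_intros)
      then have "bounded ((\<lambda>t. (X t \<omega>)\<^sup>2) ` {0..T})" by (intro compact_imp_bounded compact_continuous_image) auto
      then obtain K where K: "\<And>t. t \<in> {0..T} \<Longrightarrow> (X t \<omega>)\<^sup>2 \<le> K" unfolding bounded_iff by fastforce
      have "Z \<omega> \<le> ennreal K" unfolding Z_def using I K by (intro SUP_least ennreal_leI) blast
      then have fin: "Z \<omega> < \<infinity>" using le_less_trans ennreal_less_top infinity_ennreal_def by metis
      have "ennreal ((X t \<omega>)\<^sup>2) \<le> Z \<omega>" if t: "t \<in> {0..T}" for t
      proof (rule LIMSEQ_le_const2)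
        have fT: "grid_floor m t \<in> {0..T}" for m using grid_floor_bounds[of t m] t by auto
        have "(\<lambda>m. X (grid_floor m t) \<omega>) \<longlonglongrightarrow> X t \<omega>"
          using continuous_on_tendsto_compose[OF elim grid_floor_tendsto[of t] t] t fT by auto
        then show "(\<lambda>m. ennreal ((X (grid_floor m t) \<omega>)\<^sup>2)) \<longlonglongrightarrow> ennreal ((X t \<omega>)\<^sup>2)" by (intro tendsto_ennrealI tendsto_power)
        have "(m, grid_index m t) \<in> I" for m using grid_index_le[of t m] t by (auto simp: I_def)
        then have "ennreal ((X (grid_floor m t) \<omega>)\<^sup>2) \<le> Z \<omega>" for m
          unfolding Z_def grid_floor_def using SUP_upper[of "(m, grid_index m t)" I "\<lambda>p. ennreal ((X (grid (fst p) (snd p)) \<omega>)\<^sup>2)"] by simp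
        then show "\<exists>N. \<forall>n\<ge>N. ennreal ((X (grid_floor n t) \<omega>)\<^sup>2) \<le> Z \<omega>" by blast
      qed
      with fin show ?case by blast
    qed
  qed
qed

lemma continuous_process_bound:
  assumes X: "continuous_process M B T X"
  obtains Z where "Z \<in> borel_measurable M" "\<And>\<omega>. 0 \<le> Z \<omega>" "AE \<omega> in M. \<forall>t\<in>{0..T}. \<bar>X t \<omega>\<bar> \<le> Z \<omega>"
proof -
  obtain Z where Z: "Z \<in> borel_measurable M" "AE \<omega> in M. Z \<omega> < \<infinity> \<and> (\<forall>t\<in>{0..T}. ennreal ((X t \<omega>)\<^sup>2) \<le> Z \<omega>)"
    by (rule continuous_process_sup[OF X])
  show ?thesis
  proof (rule that[of "\<lambda>\<omega>. sqrt (enn2real (Z \<omega>))"])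
    show "(\<lambda>\<omega>. sqrt (enn2real (Z \<omega>))) \<in> borel_measurable M" using Z(1) by measurable
    show "AE \<omega> in M. \<forall>t\<in>{0..T}. \<bar>X t \<omega>\<bar> \<le> sqrt (enn2real (Z \<omega>))"
      using Z(2)
    proof eventually_elim
      case (elim \<omega>)
      then obtain z where z: "Z \<omega> = ennreal z" "0 \<le> z" by (cases "Z \<omega>") auto
      show ?case
      proof
        fix t assume "t \<in> {0..T}"
        then have "(X t \<omega>)\<^sup>2 \<le> z" using elim z by (auto simp: ennreal_le_iff)
        then have "sqrt ((X t \<omega>)\<^sup>2) \<le> sqrt z" by (rule real_sqrt_le_mono)
        then show "\<bar>X t \<omega>\<bar> \<le> sqrt (enn2real (Z \<omega>))" using z by simp
      qed
    qed
  qed simp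
qed

lemma continuous_process_intros:
  assumes "continuous_process M B T X" "continuous_process M B T Y"
  shows "continuous_process M B T (\<lambda>t \<omega>. X t \<omega> + Y t \<omega>)" "continuous_process M B T (\<lambda>t \<omega>. k * X t \<omega>)" "continuous_process M B T (\<lambda>t \<omega>. (X t \<omega>)\<^sup>2)"
proof -
  have c: "AE \<omega> in M. continuous_on {0..T} (\<lambda>t. X t \<omega>)" "AE \<omega> in M. continuous_on {0..T} (\<lambda>t. Y t \<omega>)" and p: "progressive M B T X" "progressive M B T Y"
    using assms unfolding continuous_process_def by auto
  have "AE \<omega> in M. continuous_on {0..T} (\<lambda>t. X t \<omega> + Y t \<omega>)" using c by eventually_elim (intro continuous_intros)
  moreover have "AE \<omega> in M. continuous_on {0..T} (\<lambda>t. k * X t \<omega>)" using c(1) by eventually_elim (intro continuous_intros)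
  moreover have "AE \<omega> in M. continuous_on {0..T} (\<lambda>t. (X t \<omega>)\<^sup>2)" using c(1) by eventually_elim (intro continuous_intros)
  ultimately show "continuous_process M B T (\<lambda>t \<omega>. X t \<omega> + Y t \<omega>)" "continuous_process M B T (\<lambda>t \<omega>. k * X t \<omega>)" "continuous_process M B T (\<lambda>t \<omega>. (X t \<omega>)\<^sup>2)"
    using p unfolding continuous_process_def by (auto intro: progressive_intros)
qed

lemma square_sup_integrable_combine:
  assumes X: "continuous_process M B T X" "square_sup_integrable M T X"
    and Y: "continuous_process M B T Y" "square_sup_integrable M T Y"
    and W: "AE \<omega> in M. \<forall>t\<in>{0..T}. \<bar>W t \<omega>\<bar> \<le> \<bar>Y t \<omega>\<bar> + K * \<bar>X t \<omega>\<bar>" and K: "0 \<le> K"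
  shows "square_sup_integrable M T W"
proof -
  obtain Z where Z: "Z \<in> borel_measurable M" "\<And>\<omega>. Z \<omega> \<le> (SUP t\<in>{0..T}. ennreal ((X t \<omega>)\<^sup>2))"
    "AE \<omega> in M. Z \<omega> < \<infinity> \<and> (\<forall>t\<in>{0..T}. ennreal ((X t \<omega>)\<^sup>2) \<le> Z \<omega>)"
    by (rule continuous_process_sup[OF X(1)]) (rule that)
  obtain Z' where Z': "Z' \<in> borel_measurable M" "\<And>\<omega>. Z' \<omega> \<le> (SUP t\<in>{0..T}. ennreal ((Y t \<omega>)\<^sup>2))"
    "AE \<omega> in M. Z' \<omega> < \<infinity> \<and> (\<forall>t\<in>{0..T}. ennreal ((Y t \<omega>)\<^sup>2) \<le> Z' \<omega>)"
    by (rule continuous_process_sup[OF Y(1)]) (rule that)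
  have fin: "(\<integral>\<^sup>+ \<omega>. Z \<omega> \<partial>M) < \<infinity>" "(\<integral>\<^sup>+ \<omega>. Z' \<omega> \<partial>M) < \<infinity>"
    using X(2) Y(2) nn_integral_mono[of M Z, OF Z(2)] nn_integral_mono[of M Z', OF Z'(2)] unfolding square_sup_integrable_def
    by (auto intro: le_less_trans)
  have "(\<integral>\<^sup>+ \<omega>. (SUP t\<in>{0..T}. ennreal ((W t \<omega>)\<^sup>2)) \<partial>M) \<le> (\<integral>\<^sup>+ \<omega>. 2 * Z' \<omega> + ennreal (2 * K\<^sup>2) * Z \<omega> \<partial>M)"
  proof (rule nn_integral_mono_AE)
    show "AE \<omega> in M. (SUP t\<in>{0..T}. ennreal ((W t \<omega>)\<^sup>2)) \<le> 2 * Z' \<omega> + ennreal (2 * K\<^sup>2) * Z \<omega>"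
      using W Z(3) Z'(3)
    proof eventually_elim
      case (elim \<omega>)
      show ?case
      proof (rule SUP_least)
        fix t assume t: "t \<in> {0..T}"
        have "\<bar>W t \<omega>\<bar>\<^sup>2 \<le> (\<bar>Y t \<omega>\<bar> + K * \<bar>X t \<omega>\<bar>)\<^sup>2" using elim(1) t by (intro power_mono) auto
        also have "\<dots> \<le> 2 * \<bar>Y t \<omega>\<bar>\<^sup>2 + 2 * (K * \<bar>X t \<omega>\<bar>)\<^sup>2"
          using sum_squares_bound[of "\<bar>Y t \<omega>\<bar>" "K * \<bar>X t \<omega>\<bar>"] by (simp add: power2_sum)
        finally have le: "(W t \<omega>)\<^sup>2 \<le> 2 * (Y t \<omega>)\<^sup>2 + (2 * K\<^sup>2) * (X t \<omega>)\<^sup>2" by (simp add: power_mult_distrib)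
        have "ennreal ((W t \<omega>)\<^sup>2) \<le> ennreal (2 * (Y t \<omega>)\<^sup>2 + (2 * K\<^sup>2) * (X t \<omega>)\<^sup>2)" by (rule ennreal_leI[OF le])
        also have "\<dots> = 2 * ennreal ((Y t \<omega>)\<^sup>2) + ennreal (2 * K\<^sup>2) * ennreal ((X t \<omega>)\<^sup>2)"
          by (simp add: ennreal_plus ennreal_mult)
        also have "\<dots> \<le> 2 * Z' \<omega> + ennreal (2 * K\<^sup>2) * Z \<omega>"
          using elim t by (intro add_mono mult_left_mono) auto
        finally show "ennreal ((W t \<omega>)\<^sup>2) \<le> 2 * Z' \<omega> + ennreal (2 * K\<^sup>2) * Z \<omega>" .
      qed
    qed
  qed
  also have "\<dots> = 2 * (\<integral>\<^sup>+ \<omega>. Z' \<omega> \<partial>M) + ennreal (2 * K\<^sup>2) * (\<integral>\<^sup>+ \<omega>. Z \<omega> \<partial>M)"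
    using Z(1) Z'(1) by (simp add: nn_integral_add nn_integral_cmult)
  also have "\<dots> < \<infinity>" using fin by (simp add: ennreal_mult_less_top less_top)
  finally show ?thesis unfolding square_sup_integrable_def .
qed

section \<open>Step processes and stochastic integrals\<close>

text \<open>
  Step processes are functions of continuous time, not sequences of coefficients, so that one and
  the same \<open>H\<close> is a step process at all finer levels (\<open>grid_step_refine\<close>). The end point \<open>T\<close> is not
  the left end of a cell; the value there is fixed to obtain joint measurability on all of \<open>{0..T}\<close>.
\<close>

definition grid_step :: "nat \<Rightarrow> (real \<Rightarrow> 'a \<Rightarrow> real) \<Rightarrow> bool" where
  "grid_step m H \<longleftrightarrow> pred_seq m (\<lambda>i. H (grid m i)) \<and> (\<forall>s\<in>{0..<T}. \<forall>\<omega>. H (grid_floor m s) \<omega> = H s \<omega>) \<and> H T = (\<lambda>_. 0)"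

text \<open>
  The incomplete cell before \<open>t\<close> is left out. This makes the integral a plain martingale transform,
  and the omitted part disappears in the limit.
\<close>

definition step_integral :: "nat \<Rightarrow> (real \<Rightarrow> 'a \<Rightarrow> real) \<Rightarrow> real \<Rightarrow> 'a \<Rightarrow> real" where
  "step_integral m H t \<omega> = (\<Sum>i<grid_index m t. H (grid m i) \<omega> * dB m i \<omega>)"

lemma step_integral_meas:
  assumes H: "grid_step m H" and t: "t \<in> {0..T}" shows "step_integral m H t \<in> borel_measurable M"
  unfolding step_integral_def
proof (intro borel_measurable_sum borel_measurable_times)
  fix i assume "i \<in> {..<grid_index m t}"
  then have i: "i < 2 ^ m" using grid_index_le[of t m] t by auto
  show "H (grid m i) \<in> borel_measurable M" using H i unfolding grid_step_def by (auto intro: pred_seq_meas)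
  show "dB m i \<in> borel_measurable M" by (rule dB_meas[OF i])
qed

lemma step_integral_add: "step_integral m (\<lambda>s \<omega>. H s \<omega> + G s \<omega>) t \<omega> = step_integral m H t \<omega> + step_integral m G t \<omega>"
  unfolding step_integral_def distrib_right sum.distrib ..

lemma step_integral_cmult: "step_integral m (\<lambda>s \<omega>. k * H s \<omega>) t \<omega> = k * step_integral m H t \<omega>"
  unfolding step_integral_def by (simp add: sum_distrib_left mult.assoc)

lemma grid_step_joint:
  assumes H: "grid_step m H"
  shows "jointly_measurable H"
proof -
  let ?f = "\<lambda>(s, \<omega>). \<Sum>i<2^m. indicator {i} (grid_index m s) * H (grid m i) \<omega> :: real"
  have "?f \<in> borel_measurable (Leb \<Otimes>\<^sub>M M)"
    unfolding split_beta'
  proof (intro borel_measurable_sum borel_measurable_times)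
    fix i :: nat assume "i \<in> {..<2^m}"
    then have i: "i < 2 ^ m" by simp
    show "(\<lambda>p. indicator {i} (grid_index m (fst p)) :: real) \<in> borel_measurable (Leb \<Otimes>\<^sub>M M)"
      by (rule measurable_compose[OF measurable_fst grid_index_measurable])
    show "(\<lambda>p. H (grid m i) (snd p)) \<in> borel_measurable (Leb \<Otimes>\<^sub>M M)"
      by (rule measurable_compose[OF measurable_snd pred_seq_meas[of m "\<lambda>i. H (grid m i)"]]) (use H i in \<open>auto simp: grid_step_def\<close>)
  qed
  moreover have "?f p = (\<lambda>(s, \<omega>). H s \<omega>) p" if p: "p \<in> space (Leb \<Otimes>\<^sub>M M)" for p
  proof -
    obtain s \<omega> where s: "p = (s, \<omega>)" "s \<in> {0..T}" using p by (auto simp: space_pair_measure)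
    show ?thesis
    proof (cases "s = T")
      case True
      have "grid_index m T = 2 ^ m" using grid_index_grid[of m "2 ^ m"] by simp
      then show ?thesis using H True s by (auto simp: grid_step_def indicator_def intro!: sum.neutral)
    next
      case False
      then have "grid_index m s < 2 ^ m" "H s \<omega> = H (grid m (grid_index m s)) \<omega>" using s H grid_index_less[of s m] by (auto simp: grid_step_def grid_floor_def)
      then show ?thesis using s by (simp add: indicator_def)
    qed
  qed
  ultimately show ?thesis using measurable_cong[of "Leb \<Otimes>\<^sub>M M" ?f] by blast
qed

lemma grid_step_eq: "grid_step m H \<Longrightarrow> s \<in> {0..<T} \<Longrightarrow> H s \<omega> = H (grid m (grid_index m s)) \<omega>"
  by (simp add: grid_step_def grid_floor_def)

lemma grid_step_refine: assumes H: "grid_step n H" shows "grid_step (n + r) H"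
proof -
  obtain C where C: "\<And>i \<omega>. i < 2 ^ n \<Longrightarrow> \<omega> \<in> space M \<Longrightarrow> \<bar>H (grid n i) \<omega>\<bar> \<le> C"
    using H unfolding grid_step_def pred_seq_def by blast
  have H1: "H (grid (n + r) i) = H (grid n (grid_index n (grid (n + r) i)))" "grid_index n (grid (n + r) i) < 2 ^ n" if "i < 2 ^ (n + r)" for i
    using grid_step_eq[OF H] grid_less_T[OF that] grid_index_less[of "grid (n + r) i" n] by auto
  have "H (grid (n + r) i) \<in> borel_measurable (Filt (grid (n + r) i))" if "i < 2 ^ (n + r)" for i
  proof -
    have "H (grid n (grid_index n (grid (n + r) i))) \<in> borel_measurable (Filt (grid n (grid_index n (grid (n + r) i))))"
      using H H1(2)[OF that] unfolding grid_step_def pred_seq_def by blast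
    then show ?thesis unfolding H1(1)[OF that] by (rule filtration_measurable_mono) (rule grid_index_bounds, simp)
  qed
  moreover have "\<forall>i<2^(n + r). \<forall>\<omega>\<in>space M. \<bar>H (grid (n + r) i) \<omega>\<bar> \<le> C" using H1 C by auto
  moreover have "H (grid_floor (n + r) s) \<omega> = H s \<omega>" if "s \<in> {0..<T}" for s \<omega>
  proof -
    have s0: "0 \<le> s" using that by simp
    have "grid_floor (n + r) s \<in> {0..<T}" using grid_floor_bounds[OF s0, of "n + r"] that by auto
    then have "H (grid_floor (n + r) s) \<omega> = H (grid_floor n (grid_floor (n + r) s)) \<omega>" using H unfolding grid_step_def by metis
    also have "\<dots> = H s \<omega>" unfolding grid_floor_grid_floor_refine[OF s0] using H that unfolding grid_step_def by auto
    finally show ?thesis by simp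
  qed
  ultimately show ?thesis using H unfolding grid_step_def pred_seq_def by blast
qed

lemma grid_step_compose2:
  assumes G: "grid_step m G" and H: "grid_step m H" and f: "(\<lambda>(x, y). f x y) \<in> borel_measurable borel" "f 0 0 = 0"
    and bd: "\<And>C. \<exists>C'. \<forall>x y. \<bar>x\<bar> \<le> C \<longrightarrow> \<bar>y\<bar> \<le> C \<longrightarrow> \<bar>f x y\<bar> \<le> C'"
  shows "grid_step m (\<lambda>s \<omega>. f (G s \<omega>) (H s \<omega>) :: real)"
proof -
  obtain C where C: "\<And>i \<omega>. i < 2 ^ m \<Longrightarrow> \<omega> \<in> space M \<Longrightarrow> \<bar>G (grid m i) \<omega>\<bar> \<le> C"
    using G unfolding grid_step_def pred_seq_def by blast
  obtain C' where C': "\<And>i \<omega>. i < 2 ^ m \<Longrightarrow> \<omega> \<in> space M \<Longrightarrow> \<bar>H (grid m i) \<omega>\<bar> \<le> C'"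
    using H unfolding grid_step_def pred_seq_def by blast
  obtain K where K: "\<forall>x y. \<bar>x\<bar> \<le> max C C' \<longrightarrow> \<bar>y\<bar> \<le> max C C' \<longrightarrow> \<bar>f x y\<bar> \<le> K" using bd[of "max C C'"] by blast
  have "\<forall>i<2^m. \<forall>\<omega>\<in>space M. \<bar>f (G (grid m i) \<omega>) (H (grid m i) \<omega>)\<bar> \<le> K"
    using K C C' by (simp add: le_max_iff_disj)
  moreover have "(\<lambda>\<omega>. f (G (grid m i) \<omega>) (H (grid m i) \<omega>)) \<in> borel_measurable (Filt (grid m i))" if "i < 2 ^ m" for i
  proof -
    have "G (grid m i) \<in> borel_measurable (Filt (grid m i))" "H (grid m i) \<in> borel_measurable (Filt (grid m i))"
      using G H that unfolding grid_step_def pred_seq_def by blast+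
    from measurable_compose[OF borel_measurable_Pair[OF this] f(1)] show ?thesis by simp
  qed
  moreover have "\<forall>s\<in>{0..<T}. \<forall>\<omega>. f (G (grid_floor m s) \<omega>) (H (grid_floor m s) \<omega>) = f (G s \<omega>) (H s \<omega>)"
    using G H unfolding grid_step_def by simp
  ultimately show ?thesis using G H f(2) unfolding grid_step_def pred_seq_def by auto
qed

lemma grid_step_add: "grid_step m G \<Longrightarrow> grid_step m H \<Longrightarrow> grid_step m (\<lambda>s \<omega>. G s \<omega> + H s \<omega>)"
proof (rule grid_step_compose2[of _ _ _ "\<lambda>x y. x + y"])
  fix C :: real
  show "\<exists>C'. \<forall>x y :: real. \<bar>x\<bar> \<le> C \<longrightarrow> \<bar>y\<bar> \<le> C \<longrightarrow> \<bar>x + y\<bar> \<le> C'" by (rule exI[of _ "2 * C"]) auto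
qed (auto simp: split_beta' intro!: borel_measurable_continuous_onI continuous_intros)

lemma grid_step_diff: "grid_step m G \<Longrightarrow> grid_step m H \<Longrightarrow> grid_step m (\<lambda>s \<omega>. G s \<omega> - H s \<omega>)"
proof (rule grid_step_compose2[of _ _ _ "\<lambda>x y. x - y"])
  fix C :: real
  show "\<exists>C'. \<forall>x y :: real. \<bar>x\<bar> \<le> C \<longrightarrow> \<bar>y\<bar> \<le> C \<longrightarrow> \<bar>x - y\<bar> \<le> C'" by (rule exI[of _ "2 * C"]) auto
qed (auto simp: split_beta' intro!: borel_measurable_continuous_onI continuous_intros)

lemma grid_step_mult: "grid_step m G \<Longrightarrow> grid_step m H \<Longrightarrow> grid_step m (\<lambda>s \<omega>. G s \<omega> * H s \<omega>)"
proof (rule grid_step_compose2[of _ _ _ "\<lambda>x y. x * y"])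
  fix C :: real
  have "\<bar>x * y\<bar> \<le> C * C" if "\<bar>x\<bar> \<le> C" "\<bar>y\<bar> \<le> C" for x y :: real
    unfolding abs_mult using that by (intro mult_mono) auto
  then show "\<exists>C'. \<forall>x y. \<bar>x\<bar> \<le> C \<longrightarrow> \<bar>y\<bar> \<le> C \<longrightarrow> \<bar>x * y\<bar> \<le> C'" by blast
qed (auto simp: split_beta' intro!: borel_measurable_continuous_onI continuous_intros)

lemma grid_step_cmult: "grid_step m G \<Longrightarrow> grid_step m (\<lambda>s \<omega>. c * G s \<omega>)"
proof (rule grid_step_compose2[of _ _ _ "\<lambda>x y. c * x"])
  fix C :: real
  have "\<bar>c * x\<bar> \<le> \<bar>c\<bar> * C" if "\<bar>x\<bar> \<le> C" for x :: real
    unfolding abs_mult using that by (intro mult_mono) auto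
  then show "\<exists>C'. \<forall>x y :: real. \<bar>x\<bar> \<le> C \<longrightarrow> \<bar>y\<bar> \<le> C \<longrightarrow> \<bar>c * x\<bar> \<le> C'" by blast
qed (auto simp: split_beta' intro!: borel_measurable_continuous_onI continuous_intros)

lemma grid_step_zero: "grid_step m (\<lambda>s \<omega>. 0)"
  by (auto simp: grid_step_def pred_seq_def)

lemma grid_step_square_integrable:
  assumes H: "grid_step m H" and \<omega>: "\<omega> \<in> space M"
  shows "integrable Leb (\<lambda>s. (H s \<omega>)\<^sup>2)" "(\<lambda>s. H s \<omega>) \<in> borel_measurable Leb"
proof -
  show m: "(\<lambda>s. H s \<omega>) \<in> borel_measurable Leb" by (rule joint_section[OF grid_step_joint[OF H] \<omega>])
  obtain C where C: "\<And>i \<omega>. i < 2 ^ m \<Longrightarrow> \<omega> \<in> space M \<Longrightarrow> \<bar>H (grid m i) \<omega>\<bar> \<le> C"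
    using H unfolding grid_step_def pred_seq_def by blast
  show "integrable Leb (\<lambda>s. (H s \<omega>)\<^sup>2)"
  proof (rule finite_measure.integrable_const_bound[OF finite_Leb, of _ "C\<^sup>2"])
    show "AE s in Leb. norm ((H s \<omega>)\<^sup>2) \<le> C\<^sup>2"
      using AE_Leb(2)
    proof eventually_elim
      case (elim s)
      then have "\<bar>H s \<omega>\<bar> \<le> C" using C[OF grid_index_less[of s m] \<omega>] grid_step_eq[OF H elim] by auto
      then show ?case by (simp add: abs_le_square_iff[symmetric] order_trans[OF _ abs_ge_self])
    qed
  qed (use m in measurable)
qed

text \<open>
  \<open>N\<close> is a version of \<open>\<integral> c dB\<close> in a weak sense. Step processes approximate \<open>c\<close> in \<open>L\<^sup>2(0,T)\<close> and
  their integrals approximate \<open>N\<close> at finitely many prescribed times, both in probability. The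
  quantifiers are arranged so that approximations exist at every sufficiently high dyadic level: the
  approximations of two integrands can then be added at a common level, and no sequence of processes
  has to be chosen for uncountably many times at once.
\<close>

definition stoch_int :: "(real \<Rightarrow> 'a \<Rightarrow> real) \<Rightarrow> (real \<Rightarrow> 'a \<Rightarrow> real) \<Rightarrow> bool" where
  "stoch_int N c \<longleftrightarrow> progressive M B T c \<and> (AE \<omega> in M. integrable Leb (\<lambda>s. (c s \<omega>)\<^sup>2)) \<and>
     (\<forall>t\<in>{0..T}. N t \<in> borel_measurable M) \<and>
     (\<forall>e>0. \<forall>S. finite S \<longrightarrow> S \<subseteq> {0..T} \<longrightarrow> (\<forall>\<^sub>F m in sequentially. \<exists>H. grid_step m H \<and>
        prob_size (time_dist H c) < e \<and> (\<forall>t\<in>S. prob_size (\<lambda>\<omega>. step_integral m H t \<omega> - N t \<omega>) < e)))"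

lemma stoch_int_eventually:
  assumes "stoch_int N c" "0 < e" "finite S" "S \<subseteq> {0..T}"
  shows "\<forall>\<^sub>F m in sequentially. \<exists>H. grid_step m H \<and> prob_size (time_dist H c) < e \<and>
    (\<forall>t\<in>S. prob_size (\<lambda>\<omega>. step_integral m H t \<omega> - N t \<omega>) < e)"
  using assms unfolding stoch_int_def by blast

lemma stoch_int_joint: "stoch_int N c \<Longrightarrow> jointly_measurable c"
  unfolding stoch_int_def by (auto intro: progressive_joint)

lemma stoch_int_meas: "stoch_int N c \<Longrightarrow> t \<in> {0..T} \<Longrightarrow> N t \<in> borel_measurable M"
  unfolding stoch_int_def by auto

text \<open>
  For a fixed finite set of times, approximations with errors tending to zero have an almost surely
  convergent subsequence.
\<close>

lemma stoch_int_approx: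
  assumes N: "stoch_int N c" and S: "finite S" "S \<subseteq> {0..T}"
  obtains m :: "nat \<Rightarrow> nat" and H where "\<And>l. n0 \<le> m l" "\<And>l. grid_step (m l) (H l)"
    "AE \<omega> in M. (\<lambda>l. time_dist (H l) c \<omega>) \<longlonglongrightarrow> 0"
    "AE \<omega> in M. \<forall>t\<in>S. (\<lambda>l. step_integral (m l) (H l) t \<omega>) \<longlonglongrightarrow> N t \<omega>"
proof -
  have c: "jointly_measurable c" using N unfolding stoch_int_def by (auto intro: progressive_joint)
  have Nm: "N t \<in> borel_measurable M" if "t \<in> S" for t using N S that unfolding stoch_int_def by auto
  have "\<forall>l. \<exists>p. n0 \<le> fst p \<and> grid_step (fst p) (snd p) \<and> prob_size (time_dist (snd p) c) < 1 / Suc l \<and>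
      (\<forall>t\<in>S. prob_size (\<lambda>\<omega>. step_integral (fst p) (snd p) t \<omega> - N t \<omega>) < 1 / Suc l)"
  proof
    fix l
    have "\<forall>\<^sub>F m in sequentially. \<exists>H. grid_step m H \<and> prob_size (time_dist H c) < 1 / Suc l \<and> (\<forall>t\<in>S. prob_size (\<lambda>\<omega>. step_integral m H t \<omega> - N t \<omega>) < 1 / Suc l)"
      using stoch_int_eventually[OF N _ S] by simp
    from eventually_happens[OF eventually_conj[OF this eventually_ge_at_top[of n0]]] show "\<exists>p. n0 \<le> fst p \<and> grid_step (fst p) (snd p) \<and> prob_size (time_dist (snd p) c) < 1 / Suc l \<and>
      (\<forall>t\<in>S. prob_size (\<lambda>\<omega>. step_integral (fst p) (snd p) t \<omega> - N t \<omega>) < 1 / Suc l)" by auto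
  qed
  from choice[OF this] obtain p where p: "\<And>l. n0 \<le> fst (p l) \<and> grid_step (fst (p l)) (snd (p l)) \<and> prob_size (time_norm (\<lambda>s \<omega>. snd (p l) s \<omega> - c s \<omega>)) < 1 / Suc l \<and>
      (\<forall>t\<in>S. prob_size (\<lambda>\<omega>. step_integral (fst (p l)) (snd (p l)) t \<omega> - N t \<omega>) < 1 / Suc l)" by blast
  define m H where "m l = fst (p l)" and "H l = snd (p l)" for l
  have mH: "\<And>l. n0 \<le> m l" "\<And>l. grid_step (m l) (H l)" "\<And>l. prob_size (time_dist (H l) c) < 1 / Suc l"
    "\<And>l t. t \<in> S \<Longrightarrow> prob_size (\<lambda>\<omega>. step_integral (m l) (H l) t \<omega> - N t \<omega>) < 1 / Suc l"
    using p unfolding m_def H_def by blast+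
  define X where "X l \<omega> = time_dist (H l) c \<omega> + (\<Sum>t\<in>S. \<bar>step_integral (m l) (H l) t \<omega> - N t \<omega>\<bar>)" for l \<omega>
  have tz: "(\<lambda>l. 1 / real (Suc l)) \<longlonglongrightarrow> 0" using LIMSEQ_inverse_real_of_nat by (simp add: inverse_eq_divide)
  have Jm: "step_integral (m l) (H l) t \<in> borel_measurable M" if "t \<in> S" for l t using step_integral_meas[OF mH(2)] that S by auto
  have nm: "time_dist (H l) c \<in> borel_measurable M" for l
    by (rule time_norm_meas[OF joint_diff_mult(1)[OF grid_step_joint[OF mH(2)] c]])
  have c1: "prob_null (\<lambda>l. time_dist (H l) c)"
    unfolding prob_null_def using nm mH(3)
    by (intro conjI allI Lim_null_comparison[OF always_eventually tz]) (auto simp: prob_size_nonneg less_imp_le simp del: of_nat_Suc)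
  have c2: "prob_null (\<lambda>l \<omega>. \<Sum>t\<in>S'. \<bar>step_integral (m l) (H l) t \<omega> - N t \<omega>\<bar>)" if "S' \<subseteq> S" for S'
    using finite_subset[OF that S(1)] that
  proof (induction S' rule: finite_induct)
    case empty then show ?case by (intro prob_null_AE) auto
  next
    case (insert t S')
    have "prob_null (\<lambda>l \<omega>. step_integral (m l) (H l) t \<omega> - N t \<omega>)"
      unfolding prob_null_def using Jm Nm mH(4) insert(4)
      by (intro conjI allI Lim_null_comparison[OF always_eventually tz]) (auto simp: prob_size_nonneg less_imp_le simp del: of_nat_Suc)
    then have "prob_null (\<lambda>l \<omega>. \<bar>step_integral (m l) (H l) t \<omega> - N t \<omega>\<bar>)" by (rule prob_null_le) (use Jm Nm insert(4) in auto)
    from prob_null_add[OF this insert(3)] show ?case using insert by simp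
  qed
  have "prob_null X" unfolding X_def by (rule prob_null_add[OF c1 c2]) simp
  then obtain r :: "nat \<Rightarrow> nat" where r: "AE \<omega> in M. (\<lambda>l. X (r l) \<omega>) \<longlonglongrightarrow> 0" by (rule prob_null_subseq)
  show ?thesis
  proof (rule that[of "\<lambda>l. m (r l)" "\<lambda>l. H (r l)"])
    show "AE \<omega> in M. (\<lambda>l. time_norm (\<lambda>s \<omega>. H (r l) s \<omega> - c s \<omega>) \<omega>) \<longlonglongrightarrow> 0"
      using r
    proof eventually_elim
      case (elim \<omega>)
      have le: "time_norm (\<lambda>s \<omega>. H (r l) s \<omega> - c s \<omega>) \<omega> \<le> X (r l) \<omega>" for l unfolding X_def by (simp add: sum_nonneg)
      show ?case by (rule Lim_null_comparison[OF always_eventually elim]) (simp add: le)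
    qed
    show "AE \<omega> in M. \<forall>t\<in>S. (\<lambda>l. step_integral (m (r l)) (H (r l)) t \<omega>) \<longlonglongrightarrow> N t \<omega>"
      using r
    proof eventually_elim
      case (elim \<omega>)
      show ?case
      proof
        fix t assume t: "t \<in> S"
        have le: "\<bar>step_integral (m (r l)) (H (r l)) t \<omega> - N t \<omega>\<bar> \<le> X (r l) \<omega>" for l
          unfolding X_def using member_le_sum[OF t, of "\<lambda>t. \<bar>step_integral (m (r l)) (H (r l)) t \<omega> - N t \<omega>\<bar>"] S(1)
          by (simp add: add_increasing)
        have "(\<lambda>l. step_integral (m (r l)) (H (r l)) t \<omega> - N t \<omega>) \<longlonglongrightarrow> 0"
          by (rule Lim_null_comparison[OF always_eventually elim]) (use le in auto)
        then show "(\<lambda>l. step_integral (m (r l)) (H (r l)) t \<omega>) \<longlonglongrightarrow> N t \<omega>" by (simp add: LIM_zero_iff)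
      qed
    qed
  qed (use mH in auto)
qed

text \<open>
  A criterion for integrands and integrals that are limits of one sequence of step processes at
  consecutive levels.
\<close>

lemma stoch_intI:
  assumes "progressive M B T c" "AE \<omega> in M. integrable Leb (\<lambda>s. (c s \<omega>)\<^sup>2)" "\<And>t. t \<in> {0..T} \<Longrightarrow> N t \<in> borel_measurable M"
    and H: "\<And>m. grid_step m (H m)" and nrm0: "prob_null (\<lambda>m. time_dist (H m) c)"
    and J0: "\<And>t. t \<in> {0..T} \<Longrightarrow> prob_null (\<lambda>m \<omega>. step_integral m (H m) t \<omega> - N t \<omega>)"
  shows "stoch_int N c"
  unfolding stoch_int_def
proof (intro conjI allI impI ballI assms(1-3))
  fix e :: real and S :: "real set" assume e: "0 < e" and S: "finite S" "S \<subseteq> {0..T}"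
  have 1: "\<forall>\<^sub>F m in sequentially. prob_size (time_dist (H m) c) < e"
    using nrm0 e unfolding prob_null_def by (intro order_tendstoD(2)) auto
  have "\<forall>\<^sub>F m in sequentially. \<forall>t\<in>S. prob_size (\<lambda>\<omega>. step_integral m (H m) t \<omega> - N t \<omega>) < e"
  proof (rule eventually_ball_finite[OF S(1)], rule ballI)
    fix t assume "t \<in> S"
    then have "prob_null (\<lambda>m \<omega>. step_integral m (H m) t \<omega> - N t \<omega>)" using J0 S(2) by blast
    then have "(\<lambda>m. prob_size (\<lambda>\<omega>. step_integral m (H m) t \<omega> - N t \<omega>)) \<longlonglongrightarrow> 0" by (simp add: prob_null_def)
    from order_tendstoD(2)[OF this e] show "\<forall>\<^sub>F m in sequentially. prob_size (\<lambda>\<omega>. step_integral m (H m) t \<omega> - N t \<omega>) < e" .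
  qed
  with 1 show "\<forall>\<^sub>F m in sequentially. \<exists>H. grid_step m H \<and> prob_size (time_dist H c) < e \<and> (\<forall>t\<in>S. prob_size (\<lambda>\<omega>. step_integral m H t \<omega> - N t \<omega>) < e)"
  proof eventually_elim
    case (elim m)
    show ?case by (intro exI[of _ "H m"] conjI H elim)
  qed
qed

text \<open>
  Conversely to \<open>stoch_intI\<close>, the integrand alone is a limit of a sequence of step processes with
  one process for each level.
\<close>

lemma stoch_int_integrands:
  assumes N: "stoch_int N c"
  obtains H where "\<And>m. grid_step m (H m)" "prob_null (\<lambda>m. time_dist (H m) c)"
proof -
  note c = stoch_int_joint[OF N]
  \<comment> \<open>At each level a step process is chosen whose error is within \<open>1 / Suc m\<close> of the best possible one
     at that level; the best possible errors tend to zero.\<close>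
  define E where "E m = {prob_size (time_dist H c) | H. grid_step m H}" for m
  have Ene: "E m \<noteq> {}" for m unfolding E_def using grid_step_zero[of m] by blast
  have Ebd: "bdd_below (E m)" for m unfolding E_def by (rule bdd_belowI[of _ 0]) (auto intro: prob_size_nonneg)
  have "\<exists>H. grid_step m H \<and> prob_size (time_dist H c) < Inf (E m) + 1 / Suc m" for m
    using cInf_lessD[OF Ene[of m], of "Inf (E m) + 1 / Suc m"] unfolding E_def by auto
  then have "\<forall>m. \<exists>H. grid_step m H \<and> prob_size (time_dist H c) < Inf (E m) + 1 / Suc m" by blast
  from choice[OF this] obtain H where H: "\<forall>m. grid_step m (H m) \<and> prob_size (time_dist (H m) c) < Inf (E m) + 1 / Suc m" ..
  have Hs: "grid_step m (H m)" for m by (rule H[THEN spec, THEN conjunct1])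
  have Hr: "prob_size (time_dist (H m) c) < Inf (E m) + 1 / Suc m" for m by (rule H[THEN spec, THEN conjunct2])
  have tz: "(\<lambda>l. 1 / real (Suc l)) \<longlonglongrightarrow> 0" using LIMSEQ_inverse_real_of_nat by (simp add: inverse_eq_divide)
  have "(\<lambda>m. prob_size (time_dist (H m) c)) \<longlonglongrightarrow> 0"
  proof (rule prob_size_LIMSEQ_I)
    fix e :: real assume e: "0 < e"
    then have "\<forall>\<^sub>F m in sequentially. \<exists>H. grid_step m H \<and> prob_size (time_dist H c) < e / 2 \<and> (\<forall>t\<in>{}. prob_size (\<lambda>\<omega>. step_integral m H t \<omega> - N t \<omega>) < e / 2)"
      using stoch_int_eventually[OF N, of "e / 2" "{}"] by simp
    moreover have "\<forall>\<^sub>F m in sequentially. 1 / real (Suc m) < e / 2" using order_tendstoD(2)[OF tz, of "e / 2"] e by simp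
    ultimately show "\<forall>\<^sub>F m in sequentially. prob_size (time_dist (H m) c) < e"
    proof eventually_elim
      case (elim m)
      then obtain H' where H': "grid_step m H'" "prob_size (time_dist H' c) < e / 2" by blast
      have "Inf (E m) \<le> prob_size (time_dist H' c)" by (rule cInf_lower[OF _ Ebd]) (use H' in \<open>auto simp: E_def\<close>)
      then show ?case using Hr[of m] H'(2) elim(2) by linarith
    qed
  qed
  then have "prob_null (\<lambda>m. time_dist (H m) c)"
    unfolding prob_null_def by (auto intro!: time_norm_meas joint_diff_mult(1) grid_step_joint[OF Hs] c)
  with Hs show ?thesis by (rule that)
qed

lemma stoch_int_add:
  assumes N: "stoch_int N c" and N': "stoch_int N' c'"
  shows "stoch_int (\<lambda>t \<omega>. N t \<omega> + N' t \<omega>) (\<lambda>t \<omega>. c t \<omega> + c' t \<omega>)"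
  unfolding stoch_int_def
proof (intro conjI ballI allI impI)
  note cj = stoch_int_joint[OF N] stoch_int_joint[OF N']
  have c2: "AE \<omega> in M. integrable Leb (\<lambda>s. (c s \<omega>)\<^sup>2)" "AE \<omega> in M. integrable Leb (\<lambda>s. (c' s \<omega>)\<^sup>2)"
    using N N' unfolding stoch_int_def by auto
  show "progressive M B T (\<lambda>t \<omega>. c t \<omega> + c' t \<omega>)" using N N' unfolding stoch_int_def by (auto intro: progressive_intros)
  show "AE \<omega> in M. integrable Leb (\<lambda>s. (c s \<omega> + c' s \<omega>)\<^sup>2)"
    using c2 AE_space by eventually_elim (rule L2_triangle(2), auto intro: joint_section cj)
  show "(\<lambda>\<omega>. N t \<omega> + N' t \<omega>) \<in> borel_measurable M" if "t \<in> {0..T}" for t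
    using stoch_int_meas[OF N that] stoch_int_meas[OF N' that] by measurable
  fix e :: real and S :: "real set" assume e: "0 < e" and S: "finite S" "S \<subseteq> {0..T}"
  have e2: "0 < e / 2" using e by simp
  note ev = stoch_int_eventually[OF N e2 S]
    stoch_int_eventually[OF N' e2 S]
  show "\<forall>\<^sub>F m in sequentially. \<exists>H. grid_step m H \<and> prob_size (time_norm (\<lambda>s \<omega>. H s \<omega> - (c s \<omega> + c' s \<omega>))) < e \<and>
      (\<forall>t\<in>S. prob_size (\<lambda>\<omega>. step_integral m H t \<omega> - (N t \<omega> + N' t \<omega>)) < e)"
    using ev
  proof eventually_elim
    case (elim m)
    then obtain H H' where H: "grid_step m H" "prob_size (time_dist H c) < e / 2" "\<forall>t\<in>S. prob_size (\<lambda>\<omega>. step_integral m H t \<omega> - N t \<omega>) < e / 2"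
      and H': "grid_step m H'" "prob_size (time_dist H' c') < e / 2" "\<forall>t\<in>S. prob_size (\<lambda>\<omega>. step_integral m H' t \<omega> - N' t \<omega>) < e / 2" by blast
    have nm: "time_dist H c \<in> borel_measurable M" "time_dist H' c' \<in> borel_measurable M"
      by (intro time_norm_meas joint_diff_mult(1) grid_step_joint[OF H(1)] grid_step_joint[OF H'(1)] cj)+
    have sj: "grid_step m (\<lambda>s \<omega>. H s \<omega> + H' s \<omega>)" by (rule grid_step_add[OF H(1) H'(1)])
    have nm2: "time_norm (\<lambda>s \<omega>. H s \<omega> + H' s \<omega> - (c s \<omega> + c' s \<omega>)) \<in> borel_measurable M"
      using progressive_joint[OF \<open>progressive M B T (\<lambda>t \<omega>. c t \<omega> + c' t \<omega>)\<close>]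
      by (intro time_norm_meas joint_diff_mult(1) grid_step_joint[OF sj])
    have "prob_size (time_norm (\<lambda>s \<omega>. H s \<omega> + H' s \<omega> - (c s \<omega> + c' s \<omega>))) \<le> prob_size (\<lambda>\<omega>. time_dist H c \<omega> + time_dist H' c' \<omega>)"
    proof (rule prob_size_mono[OF nm2])
      show "AE \<omega> in M. \<bar>time_norm (\<lambda>s \<omega>. H s \<omega> + H' s \<omega> - (c s \<omega> + c' s \<omega>)) \<omega>\<bar> \<le> \<bar>time_dist H c \<omega> + time_dist H' c' \<omega>\<bar>"
        using c2 AE_space
      proof eventually_elim
        case (elim \<omega>)
        note sec = joint_section[OF cj(1) elim(3)] joint_section[OF cj(2) elim(3)] grid_step_square_integrable[OF H(1) elim(3)] grid_step_square_integrable[OF H'(1) elim(3)]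
        have d: "integrable Leb (\<lambda>s. (H s \<omega> - c s \<omega>)\<^sup>2)" "integrable Leb (\<lambda>s. (H' s \<omega> - c' s \<omega>)\<^sup>2)"
          using sec elim by (auto intro!: L2_triangle_diff(1))
        have "time_norm (\<lambda>s \<omega>. (H s \<omega> - c s \<omega>) + (H' s \<omega> - c' s \<omega>)) \<omega> \<le> time_dist H c \<omega> + time_dist H' c' \<omega>"
          unfolding time_norm_def by (rule L2_triangle(3)[OF _ _ d]) (use sec in auto)
        then show ?case by (simp add: algebra_simps)
      qed
    qed (use nm in measurable)
    also have "\<dots> \<le> prob_size (time_dist H c) + prob_size (time_dist H' c')" by (rule prob_size_add[OF nm])
    also have "\<dots> < e" using H(2) H'(2) by simp
    finally have 1: "prob_size (time_norm (\<lambda>s \<omega>. H s \<omega> + H' s \<omega> - (c s \<omega> + c' s \<omega>))) < e" .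
    have 2: "prob_size (\<lambda>\<omega>. step_integral m (\<lambda>s \<omega>. H s \<omega> + H' s \<omega>) t \<omega> - (N t \<omega> + N' t \<omega>)) < e" if t: "t \<in> S" for t
    proof -
      have tT: "t \<in> {0..T}" using t S by auto
      have m: "(\<lambda>\<omega>. step_integral m H t \<omega> - N t \<omega>) \<in> borel_measurable M" "(\<lambda>\<omega>. step_integral m H' t \<omega> - N' t \<omega>) \<in> borel_measurable M"
        by (intro borel_measurable_diff step_integral_meas[OF H(1) tT] step_integral_meas[OF H'(1) tT] stoch_int_meas[OF N tT] stoch_int_meas[OF N' tT])+
      have "prob_size (\<lambda>\<omega>. step_integral m (\<lambda>s \<omega>. H s \<omega> + H' s \<omega>) t \<omega> - (N t \<omega> + N' t \<omega>)) = prob_size (\<lambda>\<omega>. (step_integral m H t \<omega> - N t \<omega>) + (step_integral m H' t \<omega> - N' t \<omega>))"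
        unfolding step_integral_add by (simp add: algebra_simps)
      also have "\<dots> \<le> prob_size (\<lambda>\<omega>. step_integral m H t \<omega> - N t \<omega>) + prob_size (\<lambda>\<omega>. step_integral m H' t \<omega> - N' t \<omega>)" by (rule prob_size_add[OF m])
      also have "\<dots> < e" using H(3) H'(3) t by fastforce
      finally show ?thesis .
    qed
    show ?case using sj 1 2 by blast
  qed
qed

lemma stoch_int_cmult:
  assumes N: "stoch_int N c"
  shows "stoch_int (\<lambda>t \<omega>. k * N t \<omega>) (\<lambda>t \<omega>. k * c t \<omega>)"
  unfolding stoch_int_def
proof (intro conjI ballI allI impI)
  note cj = stoch_int_joint[OF N]
  have c2: "AE \<omega> in M. integrable Leb (\<lambda>s. (c s \<omega>)\<^sup>2)" using N unfolding stoch_int_def by auto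
  show "progressive M B T (\<lambda>t \<omega>. k * c t \<omega>)" using N unfolding stoch_int_def by (auto intro: progressive_intros)
  show "AE \<omega> in M. integrable Leb (\<lambda>s. (k * c s \<omega>)\<^sup>2)"
    using c2 by eventually_elim (simp add: power_mult_distrib)
  show "(\<lambda>\<omega>. k * N t \<omega>) \<in> borel_measurable M" if "t \<in> {0..T}" for t
    using stoch_int_meas[OF N that] by measurable
  fix e :: real and S :: "real set" assume e: "0 < e" and S: "finite S" "S \<subseteq> {0..T}"
  have e2: "0 < e / (1 + \<bar>k\<bar>)" using e by (simp add: add_pos_nonneg)
  have mul: "(1 + \<bar>k\<bar>) * x < e" if "x < e / (1 + \<bar>k\<bar>)" for x
    using that by (simp add: pos_less_divide_eq add_pos_nonneg mult.commute)
  note ev = stoch_int_eventually[OF N e2 S]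
  show "\<forall>\<^sub>F m in sequentially. \<exists>H. grid_step m H \<and> prob_size (time_norm (\<lambda>s \<omega>. H s \<omega> - k * c s \<omega>)) < e \<and>
      (\<forall>t\<in>S. prob_size (\<lambda>\<omega>. step_integral m H t \<omega> - k * N t \<omega>) < e)"
    using ev
  proof eventually_elim
    case (elim m)
    then obtain H where H: "grid_step m H" "prob_size (time_dist H c) < e / (1 + \<bar>k\<bar>)" "\<forall>t\<in>S. prob_size (\<lambda>\<omega>. step_integral m H t \<omega> - N t \<omega>) < e / (1 + \<bar>k\<bar>)" by blast
    have nm: "time_dist H c \<in> borel_measurable M"
      by (intro time_norm_meas joint_diff_mult(1) grid_step_joint[OF H(1)] cj)
    have "time_norm (\<lambda>s \<omega>. k * H s \<omega> - k * c s \<omega>) \<omega> = \<bar>k\<bar> * time_dist H c \<omega>" for \<omega>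
      unfolding time_norm_def right_diff_distrib[symmetric] power_mult_distrib by (simp add: real_sqrt_mult)
    then have "prob_size (time_norm (\<lambda>s \<omega>. k * H s \<omega> - k * c s \<omega>)) = prob_size (\<lambda>\<omega>. \<bar>k\<bar> * time_dist H c \<omega>)"
      by (intro prob_size_cong)
    also have "\<dots> \<le> (1 + \<bar>k\<bar>) * prob_size (time_dist H c)" using prob_size_cmult[OF nm, of "\<bar>k\<bar>"] by simp
    also have "\<dots> < e" by (rule mul[OF H(2)])
    finally have 1: "prob_size (time_norm (\<lambda>s \<omega>. k * H s \<omega> - k * c s \<omega>)) < e" .
    have 2: "prob_size (\<lambda>\<omega>. step_integral m (\<lambda>s \<omega>. k * H s \<omega>) t \<omega> - k * N t \<omega>) < e" if t: "t \<in> S" for t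
    proof -
      have tT: "t \<in> {0..T}" using t S by auto
      have m: "(\<lambda>\<omega>. step_integral m H t \<omega> - N t \<omega>) \<in> borel_measurable M"
        by (intro borel_measurable_diff step_integral_meas[OF H(1) tT] stoch_int_meas[OF N tT])
      have "prob_size (\<lambda>\<omega>. step_integral m (\<lambda>s \<omega>. k * H s \<omega>) t \<omega> - k * N t \<omega>) = prob_size (\<lambda>\<omega>. k * (step_integral m H t \<omega> - N t \<omega>))"
        unfolding step_integral_cmult by (simp add: algebra_simps)
      also have "\<dots> \<le> (1 + \<bar>k\<bar>) * prob_size (\<lambda>\<omega>. step_integral m H t \<omega> - N t \<omega>)" by (rule prob_size_cmult[OF m])
      also have "\<dots> < e" using mul H(3) t by blast
      finally show ?thesis .
    qed
    show ?case using grid_step_cmult[OF H(1), of k] 1 2 by blast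
  qed
qed

lemma stoch_int_cong:
  assumes N: "stoch_int N c" and eq: "\<And>t. t \<in> {0..T} \<Longrightarrow> AE \<omega> in M. N t \<omega> = N' t \<omega>" and m: "\<And>t. t \<in> {0..T} \<Longrightarrow> N' t \<in> borel_measurable M"
  shows "stoch_int N' c"
  unfolding stoch_int_def
proof (intro conjI ballI allI impI)
  show "progressive M B T c" "AE \<omega> in M. integrable Leb (\<lambda>s. (c s \<omega>)\<^sup>2)" using N unfolding stoch_int_def by auto
  show "N' t \<in> borel_measurable M" if "t \<in> {0..T}" for t by (rule m[OF that])
  fix e :: real and S :: "real set" assume e: "0 < e" and S: "finite S" "S \<subseteq> {0..T}"
  show "\<forall>\<^sub>F m in sequentially. \<exists>H. grid_step m H \<and> prob_size (time_dist H c) < e \<and> (\<forall>t\<in>S. prob_size (\<lambda>\<omega>. step_integral m H t \<omega> - N' t \<omega>) < e)"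
    using stoch_int_eventually[OF N e S]
  proof eventually_elim
    case (elim k)
    then obtain H where H: "grid_step k H" "prob_size (time_dist H c) < e" "\<forall>t\<in>S. prob_size (\<lambda>\<omega>. step_integral k H t \<omega> - N t \<omega>) < e" by blast
    have "prob_size (\<lambda>\<omega>. step_integral k H t \<omega> - N' t \<omega>) < e" if t: "t \<in> S" for t
    proof -
      have tT: "t \<in> {0..T}" using t S by auto
      have "prob_size (\<lambda>\<omega>. step_integral k H t \<omega> - N' t \<omega>) \<le> prob_size (\<lambda>\<omega>. step_integral k H t \<omega> - N t \<omega>)"
      proof (rule prob_size_mono)
        show "AE \<omega> in M. \<bar>step_integral k H t \<omega> - N' t \<omega>\<bar> \<le> \<bar>step_integral k H t \<omega> - N t \<omega>\<bar>" using eq[OF tT] by eventually_elim simp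
      qed (intro borel_measurable_diff step_integral_meas[OF H(1) tT] stoch_int_meas[OF N tT] m[OF tT])+
      then show ?thesis using H(3) t by fastforce
    qed
    then show ?case using H(1,2) by blast
  qed
qed

lemma step_integral_block: "step_integral (n + r) H (grid n (Suc b)) \<omega> - step_integral (n + r) H (grid n b) \<omega> = (\<Sum>i\<in>{b * 2 ^ r..<Suc b * 2 ^ r}. H (grid (n + r) i) \<omega> * dB (n + r) i \<omega>)"
proof -
  have "(\<Sum>i<Suc b * 2 ^ r. H (grid (n + r) i) \<omega> * dB (n + r) i \<omega>) =
    (\<Sum>i<b * 2 ^ r. H (grid (n + r) i) \<omega> * dB (n + r) i \<omega>) + (\<Sum>i\<in>{b * 2 ^ r..<Suc b * 2 ^ r}. H (grid (n + r) i) \<omega> * dB (n + r) i \<omega>)"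
    unfolding lessThan_atLeast0 by (rule sum.atLeastLessThan_concat[symmetric]) auto
  then show ?thesis unfolding step_integral_def grid_index_refine by linarith
qed

lemma grid_step_block:
  assumes H: "grid_step n H" and b: "b < 2 ^ n" and i: "i \<in> {b * 2 ^ r..<Suc b * 2 ^ r}"
  shows "H (grid (n + r) i) \<omega> = H (grid n b) \<omega>" "i < 2 ^ (n + r)"
proof -
  have i': "i - b * 2 ^ r < 2 ^ r" "i = b * 2 ^ r + (i - b * 2 ^ r)" using i by auto
  have "Suc b * 2 ^ r \<le> 2 ^ n * 2 ^ r" using b by (intro mult_right_mono) auto
  then show lt: "i < 2 ^ (n + r)" using i by (auto simp: power_add)
  have "H (grid (n + r) i) \<omega> = H (grid_floor n (grid (n + r) i)) \<omega>" using H grid_less_T[OF lt] unfolding grid_step_def by simp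
  also have "grid_floor n (grid (n + r) i) = grid n b" using grid_floor_refine[OF i'(1), of n b] unfolding i'(2)[symmetric] .
  finally show "H (grid (n + r) i) \<omega> = H (grid n b) \<omega>" .
qed

lemma block_increment:
  assumes H: "grid_step n H" and b: "b < 2 ^ n"
  shows "(\<Sum>i\<in>{b * 2 ^ r..<Suc b * 2 ^ r}. H (grid (n + r) i) \<omega> * dB (n + r) i \<omega>) = H (grid n b) \<omega> * dB n b \<omega>"
proof -
  have "(\<Sum>i\<in>{b * 2 ^ r..<Suc b * 2 ^ r}. H (grid (n + r) i) \<omega> * dB (n + r) i \<omega>) = (\<Sum>i\<in>{b * 2 ^ r..<Suc b * 2 ^ r}. H (grid n b) \<omega> * dB (n + r) i \<omega>)"
    by (intro sum.cong refl) (simp only: grid_step_block(1)[OF H b])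
  also have "\<dots> = H (grid n b) \<omega> * (\<Sum>i\<in>{b * 2 ^ r..<Suc b * 2 ^ r}. dB (n + r) i \<omega>)"
    by (rule sum_distrib_left[symmetric])
  also have "(\<Sum>i\<in>{b * 2 ^ r..<Suc b * 2 ^ r}. dB (n + r) i \<omega>) = B (grid (n + r) (Suc b * 2 ^ r)) \<omega> - B (grid (n + r) (b * 2 ^ r)) \<omega>"
    by (rule sum_Suc_diff') simp
  also have "\<dots> = dB n b \<omega>" by (simp only: grid_refine)
  finally show ?thesis .
qed

text \<open>
  The inequality of Lenglart type for limits: the increments of \<open>N\<close> over the cells of a grid are
  compared with those of the step process \<open>H\<close>, summed with weights \<open>G\<close> in the first version, in
  Euclidean norm in the second. It holds for step integrals of finer levels \<open>m l\<close> in place of \<open>N\<close> by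
  \<open>transform_prob_size\<close>, and both sides converge.
\<close>

lemma stoch_int_increments:
  assumes N: "stoch_int N c" and H: "grid_step n H" and G: "grid_step n G" and k: "k \<le> 2 ^ n" and \<delta>: "0 < \<delta>" "\<delta> \<le> 1"
  shows "prob_size (\<lambda>\<omega>. \<Sum>b<k. G (grid n b) \<omega> * (N (grid n (Suc b)) \<omega> - N (grid n b) \<omega> - H (grid n b) \<omega> * dB n b \<omega>)) \<le>
      \<delta> + prob_size (time_norm (\<lambda>s \<omega>. G s \<omega> * (c s \<omega> - H s \<omega>))) / \<delta>" (is ?A)
    and "prob_size (\<lambda>\<omega>. sqrt (\<Sum>b<k. (N (grid n (Suc b)) \<omega> - N (grid n b) \<omega> - H (grid n b) \<omega> * dB n b \<omega>)\<^sup>2)) \<le>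
      \<delta> + prob_size (time_dist c H) / \<delta>" (is ?B)
proof -
  have c: "jointly_measurable c" using N unfolding stoch_int_def by (auto intro: progressive_joint)
  have c2: "AE \<omega> in M. integrable Leb (\<lambda>s. (c s \<omega>)\<^sup>2)" using N unfolding stoch_int_def by auto
  define S where "S = grid n ` {..2^n}"
  have S: "finite S" "S \<subseteq> {0..T}" by (auto simp: S_def intro!: grid_le_T)
  have Nm: "N t \<in> borel_measurable M" if "t \<in> S" for t using N S that unfolding stoch_int_def by auto
  obtain m L where mL: "\<And>l. n \<le> m l" "\<And>l. grid_step (m l) (L l)"
    "AE \<omega> in M. (\<lambda>l. time_dist (L l) c \<omega>) \<longlonglongrightarrow> 0"
    "AE \<omega> in M. \<forall>t\<in>S. (\<lambda>l. step_integral (m l) (L l) t \<omega>) \<longlonglongrightarrow> N t \<omega>"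
    using stoch_int_approx[OF N S, of n] by blast
  define r where "r l = m l - n" for l
  have mr: "m l = n + r l" for l using mL(1)[of l] by (simp add: r_def)
  have Hr: "grid_step (m l) H" and Gr: "grid_step (m l) G" for l unfolding mr using grid_step_refine H G by auto
  let ?I = "\<lambda>l b \<omega>. step_integral (m l) (L l) (grid n (Suc b)) \<omega> - step_integral (m l) (L l) (grid n b) \<omega> - H (grid n b) \<omega> * dB n b \<omega>"
  let ?N = "\<lambda>b \<omega>. N (grid n (Suc b)) \<omega> - N (grid n b) \<omega> - H (grid n b) \<omega> * dB n b \<omega>"
  have bS: "grid n (Suc b) \<in> S" "grid n b \<in> S" if "b < k" for b using that k by (auto simp: S_def)
  have Hm: "H (grid n b) \<in> borel_measurable M" "G (grid n b) \<in> borel_measurable M" if "b < k" for b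
    using pred_seq_meas[of n "\<lambda>i. H (grid n i)" b] pred_seq_meas[of n "\<lambda>i. G (grid n i)" b] H G that k unfolding grid_step_def by auto
  have Im: "?I l b \<in> borel_measurable M" if "b < k" for l b
    using step_integral_meas[OF mL(2)] bS[OF that] S(2) Hm[OF that] dB_meas[of b n] that k
    by (intro borel_measurable_diff borel_measurable_times) auto
  have Nm': "?N b \<in> borel_measurable M" if "b < k" for b
    using Nm bS[OF that] S(2) Hm[OF that] dB_meas[of b n] that k
    by (intro borel_measurable_diff borel_measurable_times) auto
  have Ilim: "AE \<omega> in M. \<forall>b<k. (\<lambda>l. ?I l b \<omega>) \<longlonglongrightarrow> ?N b \<omega>"
    using mL(4) by eventually_elim (use bS in \<open>auto intro!: tendsto_intros\<close>)
  have blk: "?I l b \<omega> = (\<Sum>i\<in>{b * 2 ^ r l..<Suc b * 2 ^ r l}. (L l (grid (m l) i) \<omega> - H (grid (m l) i) \<omega>) * dB (m l) i \<omega>)" if "b < k" for l b \<omega>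
    using step_integral_block[of n "r l" "L l" b \<omega>] block_increment[OF H, of b "r l" \<omega>] that k
    unfolding mr left_diff_distrib sum_subtractf by linarith
  have nrmJ: "sqrt (T / 2 ^ m l * (\<Sum>i<2^m l. (Q (grid (m l) i) \<omega>)\<^sup>2)) = time_norm Q \<omega>" if "grid_step (m l) Q" "\<omega> \<in> space M" for Q l \<omega>
    by (rule time_norm_sum[symmetric]) (use that grid_step_eq grid_step_square_integrable in auto)
  have lim_time_norm: "AE \<omega> in M. (\<lambda>l. time_norm (\<lambda>s \<omega>. Q s \<omega> * (L l s \<omega> - H s \<omega>)) \<omega>) \<longlonglongrightarrow> time_norm (\<lambda>s \<omega>. Q s \<omega> * (c s \<omega> - H s \<omega>)) \<omega>"
    if Q: "jointly_measurable Q" and QK: "\<And>s \<omega>. s \<in> {0..<T} \<Longrightarrow> \<omega> \<in> space M \<Longrightarrow> \<bar>Q s \<omega>\<bar> \<le> K" for Q K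
    using mL(3) c2 AE_space
  proof eventually_elim
    case (elim \<omega>)
    have [measurable]: "(\<lambda>s. Q s \<omega>) \<in> borel_measurable Leb" "(\<lambda>s. c s \<omega>) \<in> borel_measurable Leb" "(\<lambda>s. H s \<omega>) \<in> borel_measurable Leb"
      "\<And>l. (\<lambda>s. L l s \<omega>) \<in> borel_measurable Leb"
      using joint_section[OF Q] joint_section[OF c] grid_step_square_integrable(2)[OF H] grid_step_square_integrable(2)[OF mL(2)] elim(3) by auto
    have dom: "integrable Leb (\<lambda>s. (Q s \<omega> * f s)\<^sup>2)" "sqrt (\<integral>s. (Q s \<omega> * f s)\<^sup>2 \<partial>Leb) \<le> \<bar>K\<bar> * sqrt (\<integral>s. (f s)\<^sup>2 \<partial>Leb)"
      if f: "integrable Leb (\<lambda>s. (f s)\<^sup>2)" and fm: "f \<in> borel_measurable Leb" for f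
      by (rule L2_bounded_mult[OF _ fm f], use QK elim(3) in auto)+
    have cH: "integrable Leb (\<lambda>s. (c s \<omega> - H s \<omega>)\<^sup>2)" and LH: "integrable Leb (\<lambda>s. (L l s \<omega> - H s \<omega>)\<^sup>2)" and Lc: "integrable Leb (\<lambda>s. (L l s \<omega> - c s \<omega>)\<^sup>2)" for l
      using elim grid_step_square_integrable[OF H elim(3)] grid_step_square_integrable[OF mL(2) elim(3), of l] by (auto intro!: L2_triangle_diff)
    have le: "\<bar>time_norm (\<lambda>s \<omega>. Q s \<omega> * (L l s \<omega> - H s \<omega>)) \<omega> - time_norm (\<lambda>s \<omega>. Q s \<omega> * (c s \<omega> - H s \<omega>)) \<omega>\<bar> \<le> \<bar>K\<bar> * time_dist (L l) c \<omega>" for l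
    proof -
      have "\<bar>time_norm (\<lambda>s \<omega>. Q s \<omega> * (L l s \<omega> - H s \<omega>)) \<omega> - time_norm (\<lambda>s \<omega>. Q s \<omega> * (c s \<omega> - H s \<omega>)) \<omega>\<bar> \<le>
        sqrt (\<integral>s. (Q s \<omega> * (L l s \<omega> - H s \<omega>) - Q s \<omega> * (c s \<omega> - H s \<omega>))\<^sup>2 \<partial>Leb)"
        unfolding time_norm_def by (rule L2_triangle_diff(2)) (use dom(1)[OF LH] dom(1)[OF cH] in auto)
      also have "\<dots> = sqrt (\<integral>s. (Q s \<omega> * (L l s \<omega> - c s \<omega>))\<^sup>2 \<partial>Leb)" by (simp add: algebra_simps)
      also have "\<dots> \<le> \<bar>K\<bar> * sqrt (\<integral>s. (L l s \<omega> - c s \<omega>)\<^sup>2 \<partial>Leb)" using dom(2)[OF Lc] by auto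
      finally show ?thesis by (simp add: time_norm_def)
    qed
    have z: "(\<lambda>l. \<bar>K\<bar> * time_dist (L l) c \<omega>) \<longlonglongrightarrow> 0" using elim(1) by (rule tendsto_mult_right_zero)
    have "(\<lambda>l. time_norm (\<lambda>s \<omega>. Q s \<omega> * (L l s \<omega> - H s \<omega>)) \<omega> - time_norm (\<lambda>s \<omega>. Q s \<omega> * (c s \<omega> - H s \<omega>)) \<omega>) \<longlonglongrightarrow> 0"
      by (rule Lim_null_comparison[OF always_eventually z]) (use le in \<open>simp add: real_norm_def\<close>)
    then show ?case by (simp add: LIM_zero_iff)
  qed
  have Ljm: "jointly_measurable (\<lambda>s \<omega>. L l s \<omega> - H s \<omega>)" for l
    by (rule joint_diff_mult(1)[OF grid_step_joint[OF mL(2)] grid_step_joint[OF H]])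
  have cjm: "jointly_measurable (\<lambda>s \<omega>. c s \<omega> - H s \<omega>)"
    by (rule joint_diff_mult(1)[OF c grid_step_joint[OF H]])
  show ?A
  proof (rule LIMSEQ_le)
    show "(\<lambda>l. prob_size (\<lambda>\<omega>. \<Sum>b<k. G (grid n b) \<omega> * ?I l b \<omega>)) \<longlonglongrightarrow> prob_size (\<lambda>\<omega>. \<Sum>b<k. G (grid n b) \<omega> * ?N b \<omega>)"
    proof (rule prob_size_tendsto)
      show "(\<lambda>\<omega>. \<Sum>b<k. G (grid n b) \<omega> * ?I l b \<omega>) \<in> borel_measurable M" for l
        by (intro borel_measurable_sum borel_measurable_times Hm Im) auto
      show "(\<lambda>\<omega>. \<Sum>b<k. G (grid n b) \<omega> * ?N b \<omega>) \<in> borel_measurable M"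
        by (intro borel_measurable_sum borel_measurable_times Hm Nm') auto
      show "AE \<omega> in M. (\<lambda>l. \<Sum>b<k. G (grid n b) \<omega> * ?I l b \<omega>) \<longlonglongrightarrow> (\<Sum>b<k. G (grid n b) \<omega> * ?N b \<omega>)"
        using Ilim by eventually_elim (intro tendsto_sum tendsto_mult tendsto_const, auto)
    qed
    obtain K where K: "\<And>i \<omega>. i < 2 ^ n \<Longrightarrow> \<omega> \<in> space M \<Longrightarrow> \<bar>G (grid n i) \<omega>\<bar> \<le> K"
      using G unfolding grid_step_def pred_seq_def by blast
    have QK: "\<bar>G s \<omega>\<bar> \<le> K" if "s \<in> {0..<T}" "\<omega> \<in> space M" for s \<omega>
      using K[OF grid_index_less[of s n] that(2)] grid_step_eq[OF G that(1)] that by auto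
    have "(\<lambda>l. prob_size (time_norm (\<lambda>s \<omega>. G s \<omega> * (L l s \<omega> - H s \<omega>)))) \<longlonglongrightarrow> prob_size (time_norm (\<lambda>s \<omega>. G s \<omega> * (c s \<omega> - H s \<omega>)))"
      by (rule prob_size_tendsto[OF _ _ lim_time_norm[OF grid_step_joint[OF G] QK]]) (auto intro!: time_norm_meas joint_diff_mult(2) grid_step_joint[OF G] Ljm cjm)
    then show "(\<lambda>l. \<delta> + prob_size (time_norm (\<lambda>s \<omega>. G s \<omega> * (L l s \<omega> - H s \<omega>))) / \<delta>) \<longlonglongrightarrow> \<delta> + prob_size (time_norm (\<lambda>s \<omega>. G s \<omega> * (c s \<omega> - H s \<omega>))) / \<delta>"
      using \<delta> by (intro tendsto_intros) auto
    show "\<exists>N. \<forall>l\<ge>N. prob_size (\<lambda>\<omega>. \<Sum>b<k. G (grid n b) \<omega> * ?I l b \<omega>) \<le> \<delta> + prob_size (time_norm (\<lambda>s \<omega>. G s \<omega> * (L l s \<omega> - H s \<omega>))) / \<delta>"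
    proof (intro exI allI impI)
      fix l
      let ?\<eta> = "\<lambda>s \<omega>. G s \<omega> * (L l s \<omega> - H s \<omega>)"
      have \<eta>: "grid_step (m l) ?\<eta>" by (intro grid_step_mult grid_step_diff Gr Hr mL(2))
      have "(\<Sum>b<k. G (grid n b) \<omega> * ?I l b \<omega>) = (\<Sum>i<k * 2 ^ r l. ?\<eta> (grid (m l) i) \<omega> * dB (m l) i \<omega>)" for \<omega>
      proof -
        have "G (grid n b) \<omega> * ?I l b \<omega> = (\<Sum>i\<in>{b * 2 ^ r l..<Suc b * 2 ^ r l}. ?\<eta> (grid (m l) i) \<omega> * dB (m l) i \<omega>)" if b: "b < k" for b
        proof -
          have bn: "b < 2 ^ n" using b k by simp
          show ?thesis unfolding blk[OF b] sum_distrib_left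
            by (intro sum.cong refl) (simp only: mr grid_step_block(1)[OF G bn] mult.assoc)
        qed
        then have "(\<Sum>b<k. G (grid n b) \<omega> * ?I l b \<omega>) = (\<Sum>b<k. \<Sum>i\<in>{b * 2 ^ r l..<Suc b * 2 ^ r l}. ?\<eta> (grid (m l) i) \<omega> * dB (m l) i \<omega>)" by simp
        then show ?thesis unfolding block_sums .
      qed
      then have "prob_size (\<lambda>\<omega>. \<Sum>b<k. G (grid n b) \<omega> * ?I l b \<omega>) = prob_size (\<lambda>\<omega>. \<Sum>i<k * 2 ^ r l. ?\<eta> (grid (m l) i) \<omega> * dB (m l) i \<omega>)" by simp
      also have "\<dots> \<le> \<delta> + prob_size (\<lambda>\<omega>. sqrt (T / 2 ^ m l * (\<Sum>i<2^m l. (?\<eta> (grid (m l) i) \<omega>)\<^sup>2))) / \<delta>"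
        by (rule transform_prob_size[OF _ _ \<delta>]) (use \<eta> k in \<open>auto simp: grid_step_def mr power_add\<close>)
      also have "prob_size (\<lambda>\<omega>. sqrt (T / 2 ^ m l * (\<Sum>i<2^m l. (?\<eta> (grid (m l) i) \<omega>)\<^sup>2))) = prob_size (time_norm ?\<eta>)"
        by (rule prob_size_cong) (rule nrmJ[OF \<eta>])
      finally show "prob_size (\<lambda>\<omega>. \<Sum>b<k. G (grid n b) \<omega> * ?I l b \<omega>) \<le> \<delta> + prob_size (time_norm ?\<eta>) / \<delta>" .
    qed
  qed
  show ?B
  proof (rule LIMSEQ_le)
    show "(\<lambda>l. prob_size (\<lambda>\<omega>. sqrt (\<Sum>b<k. (?I l b \<omega>)\<^sup>2))) \<longlonglongrightarrow> prob_size (\<lambda>\<omega>. sqrt (\<Sum>b<k. (?N b \<omega>)\<^sup>2))"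
    proof (rule prob_size_tendsto)
      show "(\<lambda>\<omega>. sqrt (\<Sum>b<k. (?I l b \<omega>)\<^sup>2)) \<in> borel_measurable M" for l
        by (rule measurable_compose[OF _ borel_measurable_sqrt]) (intro borel_measurable_sum borel_measurable_power Im, auto)
      show "(\<lambda>\<omega>. sqrt (\<Sum>b<k. (?N b \<omega>)\<^sup>2)) \<in> borel_measurable M"
        by (rule measurable_compose[OF _ borel_measurable_sqrt]) (intro borel_measurable_sum borel_measurable_power Nm', auto)
      show "AE \<omega> in M. (\<lambda>l. sqrt (\<Sum>b<k. (?I l b \<omega>)\<^sup>2)) \<longlonglongrightarrow> sqrt (\<Sum>b<k. (?N b \<omega>)\<^sup>2)"
        using Ilim by eventually_elim (intro tendsto_real_sqrt tendsto_sum tendsto_power, auto)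
    qed
    have "(\<lambda>l. prob_size (time_norm (\<lambda>s \<omega>. 1 * (L l s \<omega> - H s \<omega>)))) \<longlonglongrightarrow> prob_size (time_norm (\<lambda>s \<omega>. 1 * (c s \<omega> - H s \<omega>)))"
      by (rule prob_size_tendsto[OF _ _ lim_time_norm[of "\<lambda>s \<omega>. 1" 1]]) (auto intro!: time_norm_meas Ljm cjm)
    then show "(\<lambda>l. \<delta> + prob_size (time_dist (L l) H) / \<delta>) \<longlonglongrightarrow> \<delta> + prob_size (time_dist c H) / \<delta>"
      using \<delta> by (intro tendsto_intros) auto
    show "\<exists>N. \<forall>l\<ge>N. prob_size (\<lambda>\<omega>. sqrt (\<Sum>b<k. (?I l b \<omega>)\<^sup>2)) \<le> \<delta> + prob_size (time_dist (L l) H) / \<delta>"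
    proof (intro exI allI impI)
      fix l
      let ?\<eta> = "\<lambda>s \<omega>. L l s \<omega> - H s \<omega>"
      have \<eta>: "grid_step (m l) ?\<eta>" by (intro grid_step_diff Hr mL(2))
      have "prob_size (\<lambda>\<omega>. sqrt (\<Sum>b<k. (?I l b \<omega>)\<^sup>2)) = prob_size (\<lambda>\<omega>. sqrt (\<Sum>b<k. (\<Sum>i\<in>{b * 2 ^ r l..<Suc b * 2 ^ r l}. ?\<eta> (grid (m l) i) \<omega> * dB (m l) i \<omega>)\<^sup>2))"
        using blk by simp
      also have "\<dots> \<le> \<delta> + prob_size (\<lambda>\<omega>. sqrt (T / 2 ^ m l * (\<Sum>i<2^m l. (?\<eta> (grid (m l) i) \<omega>)\<^sup>2))) / \<delta>"
        by (rule block_transform_prob_size[where c = 0, OF _ _ \<delta> mr k]) (use \<eta> in \<open>auto simp: grid_step_def\<close>)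
      also have "prob_size (\<lambda>\<omega>. sqrt (T / 2 ^ m l * (\<Sum>i<2^m l. (?\<eta> (grid (m l) i) \<omega>)\<^sup>2))) = prob_size (time_norm ?\<eta>)"
        by (rule prob_size_cong) (rule nrmJ[OF \<eta>])
      finally show "prob_size (\<lambda>\<omega>. sqrt (\<Sum>b<k. (?I l b \<omega>)\<^sup>2)) \<le> \<delta> + prob_size (time_norm ?\<eta>) / \<delta>" .
    qed
  qed
qed

end

section \<open>Quadratic variation and expectation\<close>

lemma L2_set_diff: "\<bar>L2_set f A - L2_set g A\<bar> \<le> L2_set (\<lambda>i. f i - g i) A"
proof -
  have "L2_set f A \<le> L2_set (\<lambda>i. f i - g i) A + L2_set g A"
    using L2_set_triangle_ineq[of "\<lambda>i. f i - g i" g A] by simp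
  moreover have "L2_set g A \<le> L2_set (\<lambda>i. g i - f i) A + L2_set f A"
    using L2_set_triangle_ineq[of "\<lambda>i. g i - f i" f A] by simp
  moreover have "L2_set (\<lambda>i. g i - f i) A = L2_set (\<lambda>i. f i - g i) A"
    by (simp add: L2_set_def power2_commute)
  ultimately show ?thesis by linarith
qed

context brownian_setting
begin

text \<open>
  Replacing \<open>(dB)\<^sup>2\<close> by its mean, the length of the cell, costs a martingale transform whose variance
  is of the order of the mesh, by the fourth moments.
\<close>

lemma grid_step_quadratic_variation:
  assumes H: "grid_step k H" and t: "t \<in> {0..T}"
  shows "prob_null (\<lambda>r \<omega>. (\<Sum>b<grid_index (k + r) t. (H (grid (k + r) b) \<omega> * dB (k + r) b \<omega>)\<^sup>2) - time_integral t (\<lambda>s. (H s \<omega>)\<^sup>2))"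
proof -
  have Hr: "grid_step (k + r) H" for r by (rule grid_step_refine[OF H])
  have ile: "grid_index n t \<le> 2 ^ n" for n using grid_index_le t by auto
  obtain C where C: "\<And>i \<omega>. i < 2 ^ k \<Longrightarrow> \<omega> \<in> space M \<Longrightarrow> \<bar>H (grid k i) \<omega>\<bar> \<le> C"
    using H unfolding grid_step_def pred_seq_def by blast
  have CH: "\<bar>H (grid (k + r) i) \<omega>\<bar> \<le> C" if "i < 2 ^ (k + r)" "\<omega> \<in> space M" for r i \<omega>
    using grid_step_eq[OF H, of "grid (k + r) i" \<omega>] grid_less_T[OF that(1)] C[OF grid_index_less[of "grid (k + r) i" k] that(2)] by simp
  have Hm: "H (grid (k + r) b) \<in> borel_measurable M" if "b < 2 ^ (k + r)" for r b
    using pred_seq_meas[of "k + r" "\<lambda>i. H (grid (k + r) i)" b] Hr[of r] that by (auto simp: grid_step_def)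
  have term_meas: "(\<lambda>\<omega>. (H (grid (k + r) b) \<omega>)\<^sup>2) \<in> borel_measurable M" "(\<lambda>\<omega>. (dB (k + r) b \<omega>)\<^sup>2) \<in> borel_measurable M" if "b < grid_index (k + r) t" for r b
    using Hm[of b r] dB_meas[of b "k + r"] ile[of "k + r"] that by (auto intro!: borel_measurable_power)
  \<comment> \<open>\<open>?W\<close> is a martingale transform of the compensated squares of Brownian increments; \<open>?V\<close> is the error
     of stopping at the last grid point before \<open>t\<close>.\<close>
  let ?W = "\<lambda>r \<omega>. \<Sum>b<grid_index (k + r) t. (H (grid (k + r) b) \<omega>)\<^sup>2 * ((dB (k + r) b \<omega>)\<^sup>2 - T / 2 ^ (k + r))"
  let ?V = "\<lambda>r \<omega>. time_integral (grid_floor (k + r) t) (\<lambda>s. (H s \<omega>)\<^sup>2) - time_integral t (\<lambda>s. (H s \<omega>)\<^sup>2)"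
  have Wm: "?W r \<in> borel_measurable M" for r
    using term_meas by (intro borel_measurable_sum borel_measurable_times borel_measurable_diff) auto
  have W: "prob_null ?W"
    unfolding prob_null_def
  proof (intro conjI allI Wm)
    let ?d = "\<lambda>r. sqrt (2 * T\<^sup>2 * C ^ 4) * sqrt (1 / 2 ^ (k + r))"
    have W1: "prob_size (?W r) \<le> ?d r" for r
    proof (rule prob_size_le_second_moment[OF Wm])
      have p: "pred_seq (k + r) (\<lambda>i. H (grid (k + r) i))" using Hr by (simp add: grid_step_def)
      note iso = transform_square_isometry[OF p ile]
      show "integrable M (\<lambda>\<omega>. (?W r \<omega>)\<^sup>2)" by (rule iso(1))
      have "expectation (\<lambda>\<omega>. (?W r \<omega>)\<^sup>2) = (\<Sum>i<grid_index (k + r) t. 2 * (T / 2 ^ (k + r))\<^sup>2 * expectation (\<lambda>\<omega>. (H (grid (k + r) i) \<omega>) ^ 4))" by (rule iso(2))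
      also have "\<dots> \<le> (\<Sum>i<grid_index (k + r) t. 2 * (T / 2 ^ (k + r))\<^sup>2 * C ^ 4)"
      proof (intro sum_mono mult_left_mono)
        fix i assume "i \<in> {..<grid_index (k + r) t}"
        then have i: "i < 2 ^ (k + r)" using ile[of "k + r"] by simp
        have le: "(H (grid (k + r) i) \<omega>) ^ 4 \<le> C ^ 4" if "\<omega> \<in> space M" for \<omega>
          using power_mono[OF CH[OF i that], of 4] by (simp add: power_even_abs_numeral)
        show "expectation (\<lambda>\<omega>. (H (grid (k + r) i) \<omega>) ^ 4) \<le> C ^ 4"
        proof (rule integral_le_const)
          show "integrable M (\<lambda>\<omega>. (H (grid (k + r) i) \<omega>) ^ 4)"
            by (rule integrable_const_bound[of _ "C ^ 4"]) (use le Hm[OF i] in auto)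
        qed (use le in auto)
      qed auto
      also have "\<dots> \<le> 2 ^ (k + r) * (2 * (T / 2 ^ (k + r))\<^sup>2 * C ^ 4)"
        using ile[of "k + r"] by (simp only: sum_constant card_lessThan) (intro mult_right_mono, auto simp flip: of_nat_le_iff)
      also have "\<dots> = (?d r)\<^sup>2"
        using T_pos by (simp add: power_mult_distrib power2_eq_square field_simps)
      finally show "expectation (\<lambda>\<omega>. (?W r \<omega>)\<^sup>2) \<le> (?d r)\<^sup>2" .
    qed auto
    have W2: "?d \<longlonglongrightarrow> 0"
    proof -
      have "(\<lambda>r. 1 / 2 ^ (k + r) :: real) \<longlonglongrightarrow> 0"
        using LIMSEQ_ignore_initial_segment[OF LIMSEQ_divide_realpow_zero[of 2 1], of k] by (simp add: add.commute)
      from tendsto_mult_right_zero[OF tendsto_real_sqrt[OF this, simplified]] show ?thesis .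
    qed
    show "(\<lambda>r. prob_size (?W r)) \<longlonglongrightarrow> 0"
    proof (rule Lim_null_comparison[OF always_eventually W2], rule allI)
      fix r
      have "norm (prob_size (?W r)) = prob_size (?W r)" unfolding real_norm_def by (rule abs_of_nonneg[OF prob_size_nonneg])
      then show "norm (prob_size (?W r)) \<le> ?d r" using W1[of r] by (rule ord_eq_le_trans)
    qed
  qed
  have Hsq: "integrable Leb (\<lambda>s. (H s \<omega>)\<^sup>2)" if "\<omega> \<in> space M" for \<omega> using grid_step_square_integrable(1)[OF H that] .
  have Hj: "jointly_measurable (\<lambda>s \<omega>. (H s \<omega>)\<^sup>2)"
    using joint_diff_mult(2)[OF grid_step_joint[OF H] grid_step_joint[OF H]] by (simp add: power2_eq_square)
  have V: "prob_null ?V"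
  proof (rule prob_null_AE)
    show "?V r \<in> borel_measurable M" for r by (intro borel_measurable_diff time_integral_meas Hj)
    have "(\<lambda>r. ?V r \<omega>) \<longlonglongrightarrow> 0" if \<omega>: "\<omega> \<in> space M" for \<omega>
    proof -
      have "(\<lambda>r. grid_floor (k + r) t) \<longlonglongrightarrow> t"
        using LIMSEQ_ignore_initial_segment[OF grid_floor_tendsto[of t], of k] t by (simp add: add.commute)
      from time_integral_tendsto[OF Hsq[OF \<omega>] this, of "\<lambda>_ _. 1" "\<lambda>_. 1" 1]
      show ?thesis by (simp add: LIM_zero)
    qed
    then show "AE \<omega> in M. (\<lambda>r. ?V r \<omega>) \<longlonglongrightarrow> 0" by auto
  qed
  have eq: "(\<Sum>b<grid_index (k + r) t. (H (grid (k + r) b) \<omega> * dB (k + r) b \<omega>)\<^sup>2) - time_integral t (\<lambda>s. (H s \<omega>)\<^sup>2) = ?W r \<omega> + ?V r \<omega>" for r \<omega>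
  proof -
    let ?n = "k + r"
    have "time_integral (grid_floor ?n t) (\<lambda>s. (H s \<omega>)\<^sup>2) = time_integral (grid ?n (grid_index ?n t)) (\<lambda>s. (H (grid ?n (grid_index ?n s)) \<omega>)\<^sup>2 * 1)"
      unfolding grid_floor_def
    proof (rule time_integral_cong)
      fix s assume "0 \<le> s" "s < grid ?n (grid_index ?n t)"
      then have "s \<in> {0..<T}" using grid_floor_bounds(1)[of t ?n] t by (auto simp: grid_floor_def)
      then show "(H s \<omega>)\<^sup>2 = (H (grid ?n (grid_index ?n s)) \<omega>)\<^sup>2 * 1" using grid_step_eq[OF Hr[of r]] by simp
    qed
    also have "\<dots> = (\<Sum>b<grid_index ?n t. (H (grid ?n b) \<omega>)\<^sup>2 * (time_integral (grid ?n (Suc b)) (\<lambda>s. 1) - time_integral (grid ?n b) (\<lambda>s. 1)))"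
      by (rule riemann_sum[OF integrable_Leb_1, symmetric])
    also have "\<dots> = (\<Sum>b<grid_index ?n t. (H (grid ?n b) \<omega>)\<^sup>2 * (T / 2 ^ ?n))"
    proof (intro sum.cong refl)
      fix b assume "b \<in> {..<grid_index ?n t}"
      then have "grid ?n b \<in> {0..T}" "grid ?n (Suc b) \<in> {0..T}" using ile[of ?n] by (auto intro!: grid_le_T)
      then show "(H (grid ?n b) \<omega>)\<^sup>2 * (time_integral (grid ?n (Suc b)) (\<lambda>s. 1) - time_integral (grid ?n b) (\<lambda>s. 1)) = (H (grid ?n b) \<omega>)\<^sup>2 * (T / 2 ^ ?n)"
        by (simp only: time_integral_1) (simp add: grid_Suc)
    qed
    finally have V: "time_integral (grid_floor ?n t) (\<lambda>s. (H s \<omega>)\<^sup>2) = (\<Sum>b<grid_index ?n t. (H (grid ?n b) \<omega>)\<^sup>2 * (T / 2 ^ ?n))" .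
    have alg: "(x * y)\<^sup>2 = x\<^sup>2 * (y\<^sup>2 - z) + x\<^sup>2 * z" for x y z :: real by (simp add: power2_eq_square algebra_simps)
    have "(\<Sum>b<grid_index ?n t. (H (grid ?n b) \<omega> * dB ?n b \<omega>)\<^sup>2) = ?W r \<omega> + (\<Sum>b<grid_index ?n t. (H (grid ?n b) \<omega>)\<^sup>2 * (T / 2 ^ ?n))"
      unfolding sum.distrib[symmetric] by (intro sum.cong refl alg)
    then show ?thesis unfolding V by linarith
  qed
  show ?thesis unfolding eq by (rule prob_null_add[OF W V])
qed

text \<open>
  The error of replacing \<open>c\<close> by a step process is bounded uniformly in the level by
  \<open>stoch_int_increments\<close>, so the result for step processes carries over.
\<close>

lemma quadratic_variation:
  assumes N: "stoch_int N c" and t: "t \<in> {0..T}"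
  shows "prob_null (\<lambda>n \<omega>. (\<Sum>b<grid_index n t. (N (grid n (Suc b)) \<omega> - N (grid n b) \<omega>)\<^sup>2) - time_integral t (\<lambda>s. (c s \<omega>)\<^sup>2))"
proof -
  note c = stoch_int_joint[OF N]
  have c2: "AE \<omega> in M. integrable Leb (\<lambda>s. (c s \<omega>)\<^sup>2)" using N unfolding stoch_int_def by auto
  have ile: "grid_index n t \<le> 2 ^ n" for n using grid_index_le t by auto
  let ?Q = "\<lambda>n \<omega>. \<Sum>b<grid_index n t. (N (grid n (Suc b)) \<omega> - N (grid n b) \<omega>)\<^sup>2"
  let ?Y = "\<lambda>\<omega>. time_integral t (\<lambda>s. (c s \<omega>)\<^sup>2)"
  have cj: "jointly_measurable (\<lambda>s \<omega>. (c s \<omega>)\<^sup>2)"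
    using joint_diff_mult(2)[OF c c] by (simp add: power2_eq_square)
  have Ym[measurable]: "?Y \<in> borel_measurable M" by (rule time_integral_meas[OF cj])
  have Nm: "N (grid n (Suc b)) \<in> borel_measurable M" "N (grid n b) \<in> borel_measurable M" if "b < grid_index n t" for n b
    using ile[of n] that by (auto intro!: stoch_int_meas[OF N] grid_le_T)
  have Qm[measurable]: "?Q n \<in> borel_measurable M" for n
    by (intro borel_measurable_sum borel_measurable_power borel_measurable_diff Nm) auto
  have "prob_null (\<lambda>n \<omega>. sqrt (?Q n \<omega>) - sqrt (?Y \<omega>))"
    unfolding prob_null_def
  proof (intro conjI allI)
    show "(\<lambda>\<omega>. sqrt (?Q n \<omega>) - sqrt (?Y \<omega>)) \<in> borel_measurable M" for n by measurable
    show "(\<lambda>n. prob_size (\<lambda>\<omega>. sqrt (?Q n \<omega>) - sqrt (?Y \<omega>))) \<longlonglongrightarrow> 0"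
    proof (rule LIMSEQ_I)
      fix e :: real assume e: "0 < e"
      \<comment> \<open>The estimate below has four terms, each at most \<open>d\<close>.\<close>
      define d where "d = min (e / 5) 1"
      have d: "0 < d" "d \<le> 1" "5 * d \<le> e" using e by (auto simp: d_def)
      have "\<exists>k H. grid_step k H \<and> prob_size (time_dist H c) < d\<^sup>2"
      proof -
        have "\<forall>\<^sub>F m in sequentially. \<exists>H. grid_step m H \<and> prob_size (time_dist H c) < d\<^sup>2 \<and> (\<forall>t\<in>{}. prob_size (\<lambda>\<omega>. step_integral m H t \<omega> - N t \<omega>) < d\<^sup>2)"
          using stoch_int_eventually[OF N, of "d\<^sup>2" "{}"] d(1) by simp
        from eventually_happens[OF this] show ?thesis by auto
      qed
      then obtain k H where H: "grid_step k H" and rH: "prob_size (time_dist H c) < d\<^sup>2" by blast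
      have Hr: "grid_step (k + r) H" for r by (rule grid_step_refine[OF H])
      let ?A = "\<lambda>r \<omega>. sqrt (\<Sum>b<grid_index (k + r) t. (N (grid (k + r) (Suc b)) \<omega> - N (grid (k + r) b) \<omega> - H (grid (k + r) b) \<omega> * dB (k + r) b \<omega>)\<^sup>2)"
      let ?U = "\<lambda>r \<omega>. \<Sum>b<grid_index (k + r) t. (H (grid (k + r) b) \<omega> * dB (k + r) b \<omega>)\<^sup>2"
      let ?V = "\<lambda>\<omega>. time_integral t (\<lambda>s. (H s \<omega>)\<^sup>2)"
      let ?C = "\<lambda>r \<omega>. sqrt (?U r \<omega>) - sqrt (?V \<omega>)"
      let ?D = "time_dist H c"
      have Hm: "H (grid (k + r) b) \<in> borel_measurable M" "dB (k + r) b \<in> borel_measurable M" if "b < grid_index (k + r) t" for r b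
        using pred_seq_meas[of "k + r" "\<lambda>i. H (grid (k + r) i)" b] Hr[of r] that ile[of "k + r"] dB_meas[of b "k + r"] by (auto simp: grid_step_def)
      have Um[measurable]: "?U r \<in> borel_measurable M" for r
        by (intro borel_measurable_sum borel_measurable_power borel_measurable_times Hm) auto
      have Hj: "jointly_measurable (\<lambda>s \<omega>. (H s \<omega>)\<^sup>2)"
        using joint_diff_mult(2)[OF grid_step_joint[OF H] grid_step_joint[OF H]] by (simp add: power2_eq_square)
      have Vm[measurable]: "?V \<in> borel_measurable M" by (rule time_integral_meas[OF Hj])
      have Am[measurable]: "?A r \<in> borel_measurable M" for r
        by (rule measurable_compose[OF _ borel_measurable_sqrt])
           (intro borel_measurable_sum borel_measurable_power borel_measurable_times borel_measurable_diff Hm Nm, auto)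
      have Dm[measurable]: "?D \<in> borel_measurable M" by (rule time_norm_meas[OF joint_diff_mult(1)[OF grid_step_joint[OF H] c]])
      have "prob_null ?C" by (rule prob_null_sqrt[OF grid_step_quadratic_variation[OF H t]]) auto
      then have "(\<lambda>r. prob_size (?C r)) \<longlonglongrightarrow> 0" by (simp add: prob_null_def)
      from LIMSEQ_D[OF this d(1)] obtain r0 where r0: "\<And>r. r \<ge> r0 \<Longrightarrow> prob_size (?C r) < d" using prob_size_nonneg by fastforce
      have bound: "prob_size (\<lambda>\<omega>. sqrt (?Q (k + r) \<omega>) - sqrt (?Y \<omega>)) < e" if r: "r \<ge> r0" for r
      proof -
        \<comment> \<open>Square roots of sums of squares are Euclidean norms, so the triangle inequality passes through
           \<open>?U\<close> and \<open>?V\<close>, the discrete and the limiting variation of the step process.\<close>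
        have ae: "AE \<omega> in M. \<bar>sqrt (?Q (k + r) \<omega>) - sqrt (?Y \<omega>)\<bar> \<le> \<bar>?A r \<omega> + (\<bar>?C r \<omega>\<bar> + ?D \<omega>)\<bar>"
          using c2 AE_space
        proof eventually_elim
          case (elim \<omega>)
          have "\<bar>sqrt (?Q (k + r) \<omega>) - sqrt (?U r \<omega>)\<bar> \<le> ?A r \<omega>"
            using L2_set_diff[of "\<lambda>b. N (grid (k + r) (Suc b)) \<omega> - N (grid (k + r) b) \<omega>" "{..<grid_index (k + r) t}" "\<lambda>b. H (grid (k + r) b) \<omega> * dB (k + r) b \<omega>"]
            by (simp add: L2_set_def)
          moreover have "\<bar>sqrt (?V \<omega>) - sqrt (?Y \<omega>)\<bar> \<le> ?D \<omega>"
            unfolding time_norm_def by (rule sqrt_time_integral_diff) (use elim grid_step_square_integrable[OF H elim(2)] joint_section[OF c] in auto)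
          moreover have "0 \<le> ?A r \<omega>" by (simp add: sum_nonneg)
          ultimately show ?case using time_norm_nonneg[of "\<lambda>s \<omega>. H s \<omega> - c s \<omega>" \<omega>] by linarith
        qed
        have "prob_size (\<lambda>\<omega>. sqrt (?Q (k + r) \<omega>) - sqrt (?Y \<omega>)) \<le> prob_size (\<lambda>\<omega>. ?A r \<omega> + (\<bar>?C r \<omega>\<bar> + ?D \<omega>))"
          by (rule prob_size_mono[OF _ _ ae]) measurable
        also have "\<dots> \<le> prob_size (?A r) + prob_size (\<lambda>\<omega>. \<bar>?C r \<omega>\<bar> + ?D \<omega>)" by (rule prob_size_add) measurable
        also have "prob_size (\<lambda>\<omega>. \<bar>?C r \<omega>\<bar> + ?D \<omega>) \<le> prob_size (\<lambda>\<omega>. \<bar>?C r \<omega>\<bar>) + prob_size ?D" by (rule prob_size_add) measurable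
        also have "prob_size (\<lambda>\<omega>. \<bar>?C r \<omega>\<bar>) = prob_size (?C r)" by (simp add: prob_size_def)
        also have "prob_size (?A r) \<le> d + prob_size (time_dist c H) / d"
          by (rule stoch_int_increments(2)[OF N Hr Hr ile d(1,2)])
        also have "time_dist c H = ?D" by (simp add: time_norm_def power2_commute fun_eq_iff)
        finally have "prob_size (\<lambda>\<omega>. sqrt (?Q (k + r) \<omega>) - sqrt (?Y \<omega>)) \<le> d + prob_size ?D / d + (prob_size (?C r) + prob_size ?D)" by simp
        moreover have "prob_size ?D / d \<le> d" using rH d by (simp add: power2_eq_square field_simps)
        moreover have "d\<^sup>2 \<le> d" using d by (simp add: power2_eq_square mult_left_le)
        ultimately show ?thesis using r0[OF r] rH d by linarith
      qed
      show "\<exists>no. \<forall>n\<ge>no. norm (prob_size (\<lambda>\<omega>. sqrt (?Q n \<omega>) - sqrt (?Y \<omega>)) - 0) < e"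
      proof (intro exI allI impI)
        fix n assume n: "n \<ge> k + r0"
        then have "n = k + (n - k)" "n - k \<ge> r0" by auto
        then show "norm (prob_size (\<lambda>\<omega>. sqrt (?Q n \<omega>) - sqrt (?Y \<omega>)) - 0) < e"
          using bound[of "n - k"] prob_size_nonneg[of "\<lambda>\<omega>. sqrt (?Q n \<omega>) - sqrt (?Y \<omega>)"] by simp
      qed
    qed
  qed
  then show ?thesis
  proof (rule prob_null_of_sqrt[OF _ Qm Ym])
    show "0 \<le> ?Y \<omega>" for \<omega> unfolding time_integral_def by (rule integral_nonneg_AE) auto
  qed (rule sum_nonneg, simp)
qed

text \<open>
  Approximating step processes are cut so that their integrals are bounded in \<open>L\<^sup>2\<close>; the cut
  integrals are martingale transforms with mean zero, and their means converge.
\<close>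

lemma stoch_int_expectation:
  assumes N: "stoch_int N c" and t: "t \<in> {0..T}" and K: "AE \<omega> in M. (\<integral>s. (c s \<omega>)\<^sup>2 \<partial>Leb) \<le> K"
  shows "integrable M (N t)" "expectation (N t) = 0"
proof -
  note c = stoch_int_joint[OF N]
  have c2: "AE \<omega> in M. integrable Leb (\<lambda>s. (c s \<omega>)\<^sup>2)" using N unfolding stoch_int_def by auto
  have K0: "0 \<le> K"
  proof (rule ccontr)
    assume neg: "\<not> 0 \<le> K"
    have "AE \<omega> in M. False"
      using K
    proof eventually_elim
      case (elim \<omega>)
      have "0 \<le> (\<integral>s. (c s \<omega>)\<^sup>2 \<partial>Leb)" by simp
      then show ?case using elim neg by linarith
    qed
    then show False by simp
  qed
  have ile: "grid_index n t \<le> 2 ^ n" for n using grid_index_le t by auto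
  obtain m H where mH: "\<And>l. 0 \<le> m l" "\<And>l. grid_step (m l) (H l)"
    "AE \<omega> in M. (\<lambda>l. time_dist (H l) c \<omega>) \<longlonglongrightarrow> 0"
    "AE \<omega> in M. \<forall>t\<in>{t}. (\<lambda>l. step_integral (m l) (H l) t \<omega>) \<longlonglongrightarrow> N t \<omega>"
    using stoch_int_approx[OF N, of "{t}" 0] t by auto
  have p: "pred_seq (m l) (\<lambda>i. H l (grid (m l) i))" for l using mH(2) by (simp add: grid_step_def)
  \<comment> \<open>The cut is made at \<open>K + 1\<close> rather than \<open>K\<close>: the norms of the approximations converge to a limit
     below \<open>sqrt (K + 1)\<close>, so on almost every path the cut is eventually inactive.\<close>
  have "\<forall>l. \<exists>\<eta>'. pred_seq (m l) \<eta>' \<and> (\<forall>\<omega>\<in>space M. T / 2 ^ m l * (\<Sum>i<2^m l. (\<eta>' i \<omega>)\<^sup>2) \<le> K + 1) \<and>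
    (\<forall>\<omega> i. T / 2 ^ m l * (\<Sum>i<2^m l. (H l (grid (m l) i) \<omega>)\<^sup>2) \<le> K + 1 \<longrightarrow> i < 2 ^ m l \<longrightarrow> \<eta>' i \<omega> = H l (grid (m l) i) \<omega>)"
  proof
    fix l
    have "0 \<le> K + 1" using K0 by simp
    then obtain \<eta>' where \<eta>': "pred_seq (m l) \<eta>'" "\<And>\<omega>. \<omega> \<in> space M \<Longrightarrow> T / 2 ^ m l * (\<Sum>i<2^m l. (\<eta>' i \<omega>)\<^sup>2) \<le> K + 1"
      "\<And>\<omega> i. T / 2 ^ m l * (\<Sum>i<2^m l. (H l (grid (m l) i) \<omega>)\<^sup>2) \<le> K + 1 \<Longrightarrow> i < 2 ^ m l \<Longrightarrow> \<eta>' i \<omega> = H l (grid (m l) i) \<omega>"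
      by (rule predictable_cut[OF p[of l]]) (rule that)
    show "\<exists>\<eta>'. pred_seq (m l) \<eta>' \<and> (\<forall>\<omega>\<in>space M. T / 2 ^ m l * (\<Sum>i<2^m l. (\<eta>' i \<omega>)\<^sup>2) \<le> K + 1) \<and>
      (\<forall>\<omega> i. T / 2 ^ m l * (\<Sum>i<2^m l. (H l (grid (m l) i) \<omega>)\<^sup>2) \<le> K + 1 \<longrightarrow> i < 2 ^ m l \<longrightarrow> \<eta>' i \<omega> = H l (grid (m l) i) \<omega>)"
      by (intro exI[of _ \<eta>'] conjI ballI allI impI \<eta>')
  qed
  from choice[OF this] obtain \<eta> where \<eta>0: "\<forall>l. pred_seq (m l) (\<eta> l) \<and> (\<forall>\<omega>\<in>space M. T / 2 ^ m l * (\<Sum>i<2^m l. (\<eta> l i \<omega>)\<^sup>2) \<le> K + 1) \<and>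
    (\<forall>\<omega> i. T / 2 ^ m l * (\<Sum>i<2^m l. (H l (grid (m l) i) \<omega>)\<^sup>2) \<le> K + 1 \<longrightarrow> i < 2 ^ m l \<longrightarrow> \<eta> l i \<omega> = H l (grid (m l) i) \<omega>)" ..
  have \<eta>: "\<And>l. pred_seq (m l) (\<eta> l)"
    "\<And>l \<omega>. \<omega> \<in> space M \<Longrightarrow> T / 2 ^ m l * (\<Sum>i<2^m l. (\<eta> l i \<omega>)\<^sup>2) \<le> K + 1"
    "\<And>l \<omega> i. T / 2 ^ m l * (\<Sum>i<2^m l. (H l (grid (m l) i) \<omega>)\<^sup>2) \<le> K + 1 \<Longrightarrow> i < 2 ^ m l \<Longrightarrow> \<eta> l i \<omega> = H l (grid (m l) i) \<omega>"
    by (rule \<eta>0[THEN spec, THEN conjunct1])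
      (rule \<eta>0[THEN spec, THEN conjunct2, THEN conjunct1, THEN bspec], assumption,
       rule \<eta>0[THEN spec, THEN conjunct2, THEN conjunct2, THEN spec, THEN spec, THEN mp, THEN mp], assumption+)
  define X where "X l \<omega> = (\<Sum>i\<in>{0..<grid_index (m l) t}. \<eta> l i \<omega> * dB (m l) i \<omega>)" for l \<omega>
  note iso = transform_isometry[OF \<eta>(1) le0 ile, folded X_def]
  have Nm: "N t \<in> borel_measurable M" by (rule stoch_int_meas[OF N t])
  have Xm: "X l \<in> borel_measurable M" for l using iso(1)[of l] unfolding X_def by auto
  have lim: "AE \<omega> in M. (\<lambda>l. X l \<omega>) \<longlonglongrightarrow> N t \<omega>"
    using mH(3,4) c2 K AE_space
  proof eventually_elim
    case (elim \<omega>)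
    have nH: "time_norm (H l) \<omega> = sqrt (T / 2 ^ m l * (\<Sum>i<2^m l. (H l (grid (m l) i) \<omega>)\<^sup>2))" for l
      by (rule time_norm_sum) (use grid_step_eq[OF mH(2)] grid_step_square_integrable(2)[OF mH(2) elim(5)] in auto)
    have "time_norm c \<omega> < sqrt (K + 1)" unfolding time_norm_def using elim(4) by simp
    then have "\<forall>\<^sub>F l in sequentially. time_dist (H l) c \<omega> < sqrt (K + 1) - time_norm c \<omega>"
      using order_tendstoD(2)[OF elim(1)] by simp
    then have "\<forall>\<^sub>F l in sequentially. X l \<omega> = step_integral (m l) (H l) t \<omega>"
    proof eventually_elim
      case (elim l)
      have "\<bar>time_norm (H l) \<omega> - time_norm c \<omega>\<bar> \<le> time_dist (H l) c \<omega>"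
        unfolding time_norm_def by (rule L2_triangle_diff(2))
          (use grid_step_square_integrable[OF mH(2) \<open>\<omega> \<in> space M\<close>] joint_section[OF c \<open>\<omega> \<in> space M\<close>] \<open>integrable Leb (\<lambda>s. (c s \<omega>)\<^sup>2)\<close> in auto)
      then have "time_norm (H l) \<omega> \<le> sqrt (K + 1)" using elim by linarith
      then have "T / 2 ^ m l * (\<Sum>i<2^m l. (H l (grid (m l) i) \<omega>)\<^sup>2) \<le> K + 1" unfolding nH real_sqrt_le_iff .
      then have le: "\<eta> l i \<omega> = H l (grid (m l) i) \<omega>" if "i < 2 ^ m l" for i using \<eta>(3) that by blast
      show ?case unfolding X_def step_integral_def lessThan_atLeast0
      proof (intro sum.cong refl)
        fix i assume "i \<in> {0..<grid_index (m l) t}"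
        then have "i < 2 ^ m l" using ile[of "m l"] by simp
        from le[OF this] show "\<eta> l i \<omega> * dB (m l) i \<omega> = H l (grid (m l) i) \<omega> * dB (m l) i \<omega>" by simp
      qed
    qed
    with elim(2) show ?case by (simp add: tendsto_cong)
  qed
  have EX2: "expectation (\<lambda>\<omega>. (X l \<omega>)\<^sup>2) \<le> K + 1" for l
  proof -
    let ?h = "T / 2 ^ m l"
    have h: "0 \<le> ?h" using T_pos by simp
    have i2: "integrable M (\<lambda>\<omega>. (\<eta> l i \<omega>)\<^sup>2)" if i: "i < 2 ^ m l" for i
    proof -
      obtain C where C: "\<And>\<omega>. \<omega> \<in> space M \<Longrightarrow> \<bar>\<eta> l i \<omega>\<bar> \<le> C" using \<eta>(1)[of l] i unfolding pred_seq_def by blast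
      have "(\<eta> l i \<omega>)\<^sup>2 \<le> C\<^sup>2" if "\<omega> \<in> space M" for \<omega> using C[OF that] by (simp add: abs_le_square_iff[symmetric] order_trans[OF _ abs_ge_self])
      then show ?thesis using pred_seq_meas[OF \<eta>(1) i] by (intro integrable_const_bound[of _ "C\<^sup>2"]) auto
    qed
    have "expectation (\<lambda>\<omega>. (X l \<omega>)\<^sup>2) = (\<Sum>i\<in>{0..<grid_index (m l) t}. ?h * expectation (\<lambda>\<omega>. (\<eta> l i \<omega>)\<^sup>2))" by (rule iso(4))
    also have "\<dots> \<le> (\<Sum>i\<in>{0..<2^m l}. ?h * expectation (\<lambda>\<omega>. (\<eta> l i \<omega>)\<^sup>2))"
      by (rule sum_mono2) (use ile[of "m l"] T_pos in \<open>auto intro!: mult_nonneg_nonneg divide_nonneg_nonneg integral_nonneg_AE\<close>)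
    also have "\<dots> = expectation (\<lambda>\<omega>. ?h * (\<Sum>i<2^m l. (\<eta> l i \<omega>)\<^sup>2))"
      using i2 by (simp add: Bochner_Integration.integral_sum sum_distrib_left lessThan_atLeast0)
    also have "\<dots> \<le> K + 1"
      by (rule integral_le_const) (use \<eta>(2) i2 in \<open>auto intro!: integrable_mult_right Bochner_Integration.integrable_sum\<close>)
    finally show ?thesis .
  qed
  note L2 = L2_bounded_expectation_tendsto[OF Xm Nm lim iso(2) EX2]
  show "integrable M (N t)" by (rule L2(1))
  have "(\<lambda>l. expectation (X l)) = (\<lambda>l. 0)" using iso(3) unfolding X_def[abs_def] by simp
  with L2(2) show "expectation (N t) = 0" by (simp add: LIMSEQ_const_iff)
qed

end

section \<open>Weak Ito processes and the product rule\<close>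

text \<open>
  The discrete product rule for a square: \<open>n\<close> and \<open>d\<close> stand for the increments of the martingale
  part and of the drift part.
\<close>

lemma square_increment_identity:
  fixes n d f0 f1 :: real
  assumes "f1 - f0 = n + d"
  shows "2 * f0 * n = (f1\<^sup>2 - f0\<^sup>2) - n\<^sup>2 - ((f1 - f0) + n) * d - 2 * f0 * d"
proof -
  have "f1 = f0 + (n + d)" using assms by simp
  then show ?thesis by (simp add: power2_eq_square algebra_simps)
qed

text \<open>
  Clipping to \<open>[-m, m]\<close>, a bound that is harmless in the limit but makes values admissible in step
  processes.
\<close>

definition trunc :: "nat \<Rightarrow> real \<Rightarrow> real" where "trunc m x = max (- real m) (min (real m) x)"

lemma trunc_bounds: "\<bar>trunc m x\<bar> \<le> real m" "\<bar>trunc m x\<bar> \<le> \<bar>x\<bar>" "\<bar>x\<bar> \<le> real m \<Longrightarrow> trunc m x = x"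
  by (auto simp: trunc_def)

context brownian_setting
begin

lemma left_point_grid_step:
  assumes F: "progressive M B T F"
  shows "grid_step m (\<lambda>s \<omega>. if s < T then 2 * trunc m (F (grid_floor m s) \<omega>) else 0)"
proof -
  have "(\<lambda>\<omega>. 2 * trunc m (F (grid m i) \<omega>)) \<in> borel_measurable (Filt (grid m i))" if i: "i < 2 ^ m" for i
  proof -
    have [measurable]: "F (grid m i) \<in> borel_measurable (Filt (grid m i))" using grid_less_T[OF i] by (intro progressive_adapted[OF F]) auto
    show ?thesis unfolding trunc_def by measurable
  qed
  moreover have "\<bar>2 * trunc m x\<bar> \<le> 2 * real m" for x using trunc_bounds(1)[of m x] by simp
  moreover have "grid_floor m s < T" if "0 \<le> s" "s < T" for s using grid_floor_bounds(1)[OF that(1), of m] that by simp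
  moreover have "grid_floor m (grid m i) = grid m i" for i by (simp add: grid_floor_def)
  ultimately show ?thesis unfolding grid_step_def pred_seq_def using grid_less_T by auto
qed

definition weak_ito :: "(real \<Rightarrow> 'a \<Rightarrow> real) \<Rightarrow> (real \<Rightarrow> 'a \<Rightarrow> real) \<Rightarrow> (real \<Rightarrow> 'a \<Rightarrow> real) \<Rightarrow> bool" where
  "weak_ito F a c \<longleftrightarrow> continuous_process M B T F \<and> progressive M B T a \<and>
     (AE \<omega> in M. integrable Leb (\<lambda>s. a s \<omega>)) \<and>
     stoch_int (\<lambda>t \<omega>. F t \<omega> - F 0 \<omega> - time_integral t (\<lambda>s. a s \<omega>)) c"

lemma weak_itoD:
  assumes "weak_ito F a c"
  shows "continuous_process M B T F" "progressive M B T F" "AE \<omega> in M. continuous_on {0..T} (\<lambda>t. F t \<omega>)"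
    "progressive M B T a" "progressive M B T c"
    "AE \<omega> in M. integrable Leb (\<lambda>s. a s \<omega>)" "AE \<omega> in M. integrable Leb (\<lambda>s. (c s \<omega>)\<^sup>2)"
    "stoch_int (\<lambda>t \<omega>. F t \<omega> - F 0 \<omega> - time_integral t (\<lambda>s. a s \<omega>)) c"
  using assms unfolding weak_ito_def stoch_int_def continuous_process_def by auto

lemma weak_ito_martingale_meas:
  assumes "progressive M B T F" "progressive M B T a" "t \<in> {0..T}"
  shows "(\<lambda>\<omega>. F t \<omega> - F 0 \<omega> - time_integral t (\<lambda>s. a s \<omega>)) \<in> borel_measurable M"
  using assms T_pos by (intro borel_measurable_diff progressive_meas time_integral_meas progressive_joint) auto

lemma weak_ito_add:
  assumes F: "weak_ito F a c" and G: "weak_ito G a' c'"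
  shows "weak_ito (\<lambda>t \<omega>. F t \<omega> + G t \<omega>) (\<lambda>t \<omega>. a t \<omega> + a' t \<omega>) (\<lambda>t \<omega>. c t \<omega> + c' t \<omega>)"
  unfolding weak_ito_def
proof (intro conjI)
  note f = weak_itoD[OF F] and g = weak_itoD[OF G]
  show cp: "continuous_process M B T (\<lambda>t \<omega>. F t \<omega> + G t \<omega>)" by (rule continuous_process_intros(1)[OF f(1) g(1)])
  show pa: "progressive M B T (\<lambda>t \<omega>. a t \<omega> + a' t \<omega>)" by (intro progressive_intros f g)
  show "AE \<omega> in M. integrable Leb (\<lambda>s. a s \<omega> + a' s \<omega>)" using f(6) g(6) by eventually_elim simp
  show "stoch_int (\<lambda>t \<omega>. F t \<omega> + G t \<omega> - (F 0 \<omega> + G 0 \<omega>) - time_integral t (\<lambda>s. a s \<omega> + a' s \<omega>)) (\<lambda>t \<omega>. c t \<omega> + c' t \<omega>)"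
  proof (rule stoch_int_cong[OF stoch_int_add[OF f(8) g(8)]])
    fix t assume t: "t \<in> {0..T}"
    show "AE \<omega> in M. F t \<omega> - F 0 \<omega> - time_integral t (\<lambda>s. a s \<omega>) + (G t \<omega> - G 0 \<omega> - time_integral t (\<lambda>s. a' s \<omega>)) = F t \<omega> + G t \<omega> - (F 0 \<omega> + G 0 \<omega>) - time_integral t (\<lambda>s. a s \<omega> + a' s \<omega>)"
      using f(6) g(6) by eventually_elim (simp add: time_integral_add)
    show "(\<lambda>\<omega>. F t \<omega> + G t \<omega> - (F 0 \<omega> + G 0 \<omega>) - time_integral t (\<lambda>s. a s \<omega> + a' s \<omega>)) \<in> borel_measurable M"
      using weak_ito_martingale_meas[OF _ pa t] cp unfolding continuous_process_def by auto
  qed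
qed

lemma weak_ito_cmult:
  assumes F: "weak_ito F a c"
  shows "weak_ito (\<lambda>t \<omega>. k * F t \<omega>) (\<lambda>t \<omega>. k * a t \<omega>) (\<lambda>t \<omega>. k * c t \<omega>)"
  unfolding weak_ito_def
proof (intro conjI)
  note f = weak_itoD[OF F]
  show "continuous_process M B T (\<lambda>t \<omega>. k * F t \<omega>)" by (rule continuous_process_intros(2)[OF f(1) f(1)])
  show "progressive M B T (\<lambda>t \<omega>. k * a t \<omega>)" by (intro progressive_intros f)
  show "AE \<omega> in M. integrable Leb (\<lambda>s. k * a s \<omega>)" using f(6) by eventually_elim simp
  have "(\<lambda>t \<omega>. k * F t \<omega> - k * F 0 \<omega> - time_integral t (\<lambda>s. k * a s \<omega>)) = (\<lambda>t \<omega>. k * (F t \<omega> - F 0 \<omega> - time_integral t (\<lambda>s. a s \<omega>)))"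
    by (simp add: fun_eq_iff time_integral_cmult algebra_simps)
  then show "stoch_int (\<lambda>t \<omega>. k * F t \<omega> - k * F 0 \<omega> - time_integral t (\<lambda>s. k * a s \<omega>)) (\<lambda>t \<omega>. k * c t \<omega>)"
    using stoch_int_cmult[OF f(8), of k] by simp
qed

lemma weak_ito_diff:
  assumes F: "weak_ito F a c" and G: "weak_ito G a' c'"
  shows "weak_ito (\<lambda>t \<omega>. F t \<omega> - G t \<omega>) (\<lambda>t \<omega>. a t \<omega> - a' t \<omega>) (\<lambda>t \<omega>. c t \<omega> - c' t \<omega>)"
  using weak_ito_add[OF F weak_ito_cmult[OF G, of "-1"]] by simp

text \<open>
  The identity \<open>square_increment_identity\<close> is summed over the cells of a grid. The squares of the
  martingale increments converge to \<open>\<integral> c\<^sup>2 dt\<close> by \<open>quadratic_variation\<close>, the sums against the drift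
  are Riemann sums, and the remaining sum of \<open>2 F dN\<close> is close to the step integral of \<open>2 F c\<close> by
  \<open>stoch_int_increments\<close>.
\<close>

lemma weak_ito_square:
  assumes F: "weak_ito F a c"
  shows "weak_ito (\<lambda>t \<omega>. (F t \<omega>)\<^sup>2) (\<lambda>t \<omega>. 2 * F t \<omega> * a t \<omega> + (c t \<omega>)\<^sup>2) (\<lambda>t \<omega>. 2 * F t \<omega> * c t \<omega>)"
proof -
  note f = weak_itoD[OF F]
  define N where "N t \<omega> = F t \<omega> - F 0 \<omega> - time_integral t (\<lambda>s. a s \<omega>)" for t \<omega>
  have N: "stoch_int N c" using f(8) unfolding N_def[abs_def] .
  note Fj = progressive_joint[OF f(2)] and aj = progressive_joint[OF f(4)] and cj = progressive_joint[OF f(5)]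
  obtain H where H: "\<And>m. grid_step m (H m)" and Hc: "prob_null (\<lambda>m. time_dist (H m) c)" by (rule stoch_int_integrands[OF N]) (rule that)
  obtain Z where Z: "Z \<in> borel_measurable M" "\<And>\<omega>. 0 \<le> Z \<omega>" "AE \<omega> in M. \<forall>t\<in>{0..T}. \<bar>F t \<omega>\<bar> \<le> Z \<omega>"
    by (rule continuous_process_bound[OF f(1)]) (rule that)
  \<comment> \<open>Left-point values of \<open>2 * F\<close>, truncated at \<open>m\<close> to be bounded; on each path the truncation is
     eventually inactive.\<close>
  define G where "G m s \<omega> = (if s < T then 2 * trunc m (F (grid_floor m s) \<omega>) else 0)" for m s \<omega>
  have G: "grid_step m (G m)" for m unfolding G_def[abs_def] by (rule left_point_grid_step[OF f(2)])
  have Ggr: "G m (grid m b) \<omega> = 2 * trunc m (F (grid m b) \<omega>)" if "b < 2 ^ m" for m b \<omega>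
    using grid_less_T[OF that] by (simp add: G_def grid_floor_def)
  have pa: "progressive M B T (\<lambda>t \<omega>. 2 * F t \<omega> * a t \<omega> + (c t \<omega>)\<^sup>2)" and pc: "progressive M B T (\<lambda>t \<omega>. 2 * F t \<omega> * c t \<omega>)"
    and pF2: "progressive M B T (\<lambda>t \<omega>. (F t \<omega>)\<^sup>2)" and pFa: "progressive M B T (\<lambda>t \<omega>. 2 * F t \<omega> * a t \<omega>)" and pc2: "progressive M B T (\<lambda>t \<omega>. (c t \<omega>)\<^sup>2)"
    by (intro progressive_intros f)+
  have GZ: "AE \<omega> in M. \<forall>m. \<forall>s\<in>{0..<T}. \<bar>G m s \<omega>\<bar> \<le> 2 * Z \<omega>"
    using Z(3)
  proof eventually_elim
    case (elim \<omega>)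
    show ?case
    proof (intro allI ballI)
      fix m s assume s: "s \<in> {0..<T}"
      then have "grid_floor m s \<in> {0..T}" using grid_floor_bounds[of s m] by auto
      then have "\<bar>F (grid_floor m s) \<omega>\<bar> \<le> Z \<omega>" using elim by blast
      then show "\<bar>G m s \<omega>\<bar> \<le> 2 * Z \<omega>" using trunc_bounds(2)[of m "F (grid_floor m s) \<omega>"] s by (simp add: G_def)
    qed
  qed
  have int_Fa: "AE \<omega> in M. integrable Leb (\<lambda>s. 2 * F s \<omega> * a s \<omega>)"
    using Z(3) f(6) AE_space
  proof eventually_elim
    case (elim \<omega>)
    have "integrable Leb (\<lambda>s. (2 * F s \<omega>) * a s \<omega>)"
      by (rule L1_bounded_mult[where K = "2 * Z \<omega>"]) (use elim joint_section[OF Fj elim(3)] in \<open>auto simp: abs_mult\<close>)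
    then show ?case by simp
  qed
  have int_a: "AE \<omega> in M. integrable Leb (\<lambda>s. 2 * F s \<omega> * a s \<omega> + (c s \<omega>)\<^sup>2)"
    using int_Fa f(7) by eventually_elim simp
  have int_c: "AE \<omega> in M. integrable Leb (\<lambda>s. (2 * F s \<omega> * c s \<omega>)\<^sup>2)"
    using Z(3) f(7) AE_space
  proof eventually_elim
    case (elim \<omega>)
    show ?case by (rule L2_bounded_mult(1)[where K = "2 * Z \<omega>"]) (use elim joint_section[OF Fj elim(3)] joint_section[OF cj elim(3)] in \<open>auto simp: abs_mult\<close>)
  qed
  have nHc: "time_dist (H m) c \<in> borel_measurable M" for m by (intro time_norm_meas joint_diff_mult(1) grid_step_joint[OF H] cj)
  \<comment> \<open>\<open>G * H\<close> approximates \<open>2 * F * c\<close>: the difference is \<open>G * (H - c) + (G - 2 * F) * c\<close>.\<close>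
  have GHc: "prob_null (\<lambda>m. time_norm (\<lambda>s \<omega>. G m s \<omega> * (H m s \<omega> - c s \<omega>)))"
  proof (rule prob_null_le[OF prob_null_mult[OF Hc, of "\<lambda>\<omega>. 2 * Z \<omega>"]])
    show "(\<lambda>\<omega>. 2 * Z \<omega>) \<in> borel_measurable M" using Z(1) by measurable
    show "time_norm (\<lambda>s \<omega>. G m s \<omega> * (H m s \<omega> - c s \<omega>)) \<in> borel_measurable M" for m
      by (intro time_norm_meas joint_diff_mult grid_step_joint[OF H] grid_step_joint[OF G] cj)
    show "AE \<omega> in M. \<bar>time_norm (\<lambda>s \<omega>. G m s \<omega> * (H m s \<omega> - c s \<omega>)) \<omega>\<bar> \<le> \<bar>2 * Z \<omega> * time_dist (H m) c \<omega>\<bar>" for m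
      using GZ f(7) AE_space
    proof eventually_elim
      case (elim \<omega>)
      note sec = joint_section[OF cj elim(3)] grid_step_square_integrable[OF H elim(3), of m] grid_step_square_integrable[OF G elim(3), of m]
      have "integrable Leb (\<lambda>s. (H m s \<omega> - c s \<omega>)\<^sup>2)" using sec elim by (auto intro!: L2_triangle_diff(1))
      from L2_bounded_mult(2)[OF sec(5) _ this, of "2 * Z \<omega>"] elim sec Z(2)[of \<omega>] show ?case unfolding time_norm_def by (auto simp: abs_mult)
    qed
  qed
  have V: "prob_null (\<lambda>m. time_norm (\<lambda>s \<omega>. (G m s \<omega> - 2 * F s \<omega>) * c s \<omega>))"
  proof (rule prob_null_AE)
    show "time_norm (\<lambda>s \<omega>. (G m s \<omega> - 2 * F s \<omega>) * c s \<omega>) \<in> borel_measurable M" for m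
      by (intro time_norm_meas joint_diff_mult grid_step_joint[OF G] progressive_joint[OF progressive_cmult[OF f(2)]] cj)
    show "AE \<omega> in M. (\<lambda>m. time_norm (\<lambda>s \<omega>. (G m s \<omega> - 2 * F s \<omega>) * c s \<omega>) \<omega>) \<longlonglongrightarrow> 0"
      using GZ Z(3) f(3) f(7) AE_space
    proof eventually_elim
      case (elim \<omega>)
      note [measurable] = joint_section[OF cj elim(5)] joint_section[OF Fj elim(5)] grid_step_square_integrable(2)[OF G elim(5)]
      have "(\<lambda>m. \<integral>s. ((G m s \<omega> - 2 * F s \<omega>) * c s \<omega>)\<^sup>2 \<partial>Leb) \<longlonglongrightarrow> (\<integral>s. 0 \<partial>Leb)"
      proof (rule integral_dominated_convergence[where w = "\<lambda>s. (4 * Z \<omega>)\<^sup>2 * (c s \<omega>)\<^sup>2"])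
        show "integrable Leb (\<lambda>s. (4 * Z \<omega>)\<^sup>2 * (c s \<omega>)\<^sup>2)" using elim(4) by simp
        show "AE s in Leb. (\<lambda>m. ((G m s \<omega> - 2 * F s \<omega>) * c s \<omega>)\<^sup>2) \<longlonglongrightarrow> 0"
          using AE_Leb(2)
        proof (eventually_elim)
          case (elim s)
          have sT: "s \<in> {0..T}" using elim by auto
          obtain k :: nat where k: "Z \<omega> \<le> real k" using real_arch_simple by blast
          have "\<forall>\<^sub>F m in sequentially. G m s \<omega> = 2 * F (grid_floor m s) \<omega>"
            using eventually_ge_at_top[of k]
          proof eventually_elim
            case (elim m)
            have "grid_floor m s \<in> {0..T}" using grid_floor_bounds[of s m] sT by auto
            then have "\<bar>F (grid_floor m s) \<omega>\<bar> \<le> real m" using \<open>\<forall>t\<in>{0..T}. \<bar>F t \<omega>\<bar> \<le> Z \<omega>\<close> k elim by (meson of_nat_mono order_trans)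
            then show ?case using \<open>s \<in> {0..<T}\<close> by (simp add: G_def trunc_bounds(3))
          qed
          moreover have "(\<lambda>m. 2 * F (grid_floor m s) \<omega>) \<longlonglongrightarrow> 2 * F s \<omega>"
            by (intro tendsto_intros grid_floor_path_tendsto[OF \<open>continuous_on {0..T} (\<lambda>t. F t \<omega>)\<close> sT])
          ultimately have "(\<lambda>m. G m s \<omega>) \<longlonglongrightarrow> 2 * F s \<omega>" by (simp add: tendsto_cong)
          then have "(\<lambda>m. ((G m s \<omega> - 2 * F s \<omega>) * c s \<omega>)\<^sup>2) \<longlonglongrightarrow> ((2 * F s \<omega> - 2 * F s \<omega>) * c s \<omega>)\<^sup>2" by (intro tendsto_intros)
          then show ?case by simp
        qed
        show "AE s in Leb. norm (((G m s \<omega> - 2 * F s \<omega>) * c s \<omega>)\<^sup>2) \<le> (4 * Z \<omega>)\<^sup>2 * (c s \<omega>)\<^sup>2" for m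
          using AE_Leb(2)
        proof (eventually_elim)
          case (elim s)
          have "\<bar>G m s \<omega>\<bar> \<le> 2 * Z \<omega>" "\<bar>F s \<omega>\<bar> \<le> Z \<omega>" using elim \<open>\<forall>m. \<forall>s\<in>{0..<T}. \<bar>G m s \<omega>\<bar> \<le> 2 * Z \<omega>\<close> \<open>\<forall>t\<in>{0..T}. \<bar>F t \<omega>\<bar> \<le> Z \<omega>\<close> by auto
          then have "\<bar>G m s \<omega> - 2 * F s \<omega>\<bar> \<le> \<bar>4 * Z \<omega>\<bar>" using Z(2)[of \<omega>] by linarith
          then have "(G m s \<omega> - 2 * F s \<omega>)\<^sup>2 \<le> (4 * Z \<omega>)\<^sup>2" by (simp only: abs_le_square_iff)
          then show ?case by (simp add: power_mult_distrib mult_right_mono)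
        qed
      qed measurable
      then have "(\<lambda>m. sqrt (\<integral>s. ((G m s \<omega> - 2 * F s \<omega>) * c s \<omega>)\<^sup>2 \<partial>Leb)) \<longlonglongrightarrow> sqrt 0" by (intro tendsto_real_sqrt) simp
      then show ?case by (simp add: time_norm_def)
    qed
  qed
  have int_conv: "prob_null (\<lambda>m. time_norm (\<lambda>s \<omega>. G m s \<omega> * H m s \<omega> - 2 * F s \<omega> * c s \<omega>))"
  proof (rule prob_null_le[OF prob_null_add[OF GHc V]])
    show "time_norm (\<lambda>s \<omega>. G m s \<omega> * H m s \<omega> - 2 * F s \<omega> * c s \<omega>) \<in> borel_measurable M" for m
      by (intro time_norm_meas joint_diff_mult grid_step_joint[OF G] grid_step_joint[OF H] progressive_joint[OF pc])
    show "AE \<omega> in M. \<bar>time_norm (\<lambda>s \<omega>. G m s \<omega> * H m s \<omega> - 2 * F s \<omega> * c s \<omega>) \<omega>\<bar> \<le>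
      \<bar>time_norm (\<lambda>s \<omega>. G m s \<omega> * (H m s \<omega> - c s \<omega>)) \<omega> + time_norm (\<lambda>s \<omega>. (G m s \<omega> - 2 * F s \<omega>) * c s \<omega>) \<omega>\<bar>" for m
      using GZ Z(3) f(7) AE_space
    proof eventually_elim
      case (elim \<omega>)
      note sec = joint_section[OF cj elim(4)] joint_section[OF Fj elim(4)] grid_step_square_integrable[OF H elim(4), of m] grid_step_square_integrable[OF G elim(4), of m]
      have Hc2: "integrable Leb (\<lambda>s. (H m s \<omega> - c s \<omega>)\<^sup>2)" using sec elim by (auto intro!: L2_triangle_diff(1))
      have 1: "integrable Leb (\<lambda>s. (G m s \<omega> * (H m s \<omega> - c s \<omega>))\<^sup>2)"
        by (rule L2_bounded_mult(1)[OF _ _ Hc2, of _ "2 * Z \<omega>"]) (use elim sec in auto)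
      have 2: "integrable Leb (\<lambda>s. ((G m s \<omega> - 2 * F s \<omega>) * c s \<omega>)\<^sup>2)"
      proof (rule L2_bounded_mult(1)[OF _ _ elim(3), of _ "4 * Z \<omega>"])
        fix s assume "s \<in> {0..<T}"
        then have "\<bar>G m s \<omega>\<bar> \<le> 2 * Z \<omega>" "\<bar>F s \<omega>\<bar> \<le> Z \<omega>" using elim by auto
        then show "\<bar>G m s \<omega> - 2 * F s \<omega>\<bar> \<le> 4 * Z \<omega>" by linarith
      qed (use sec in auto)
      have "time_norm (\<lambda>s \<omega>. G m s \<omega> * (H m s \<omega> - c s \<omega>) + (G m s \<omega> - 2 * F s \<omega>) * c s \<omega>) \<omega> \<le>
        time_norm (\<lambda>s \<omega>. G m s \<omega> * (H m s \<omega> - c s \<omega>)) \<omega> + time_norm (\<lambda>s \<omega>. (G m s \<omega> - 2 * F s \<omega>) * c s \<omega>) \<omega>"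
        unfolding time_norm_def by (rule L2_triangle(3)[OF _ _ 1 2]) (use sec in auto)
      then show ?case by (simp add: algebra_simps)
    qed
  qed
  have step_integral_conv: "prob_null (\<lambda>m \<omega>. step_integral m (\<lambda>s \<omega>. G m s \<omega> * H m s \<omega>) t \<omega> - ((F t \<omega>)\<^sup>2 - (F 0 \<omega>)\<^sup>2 - time_integral t (\<lambda>s. 2 * F s \<omega> * a s \<omega> + (c s \<omega>)\<^sup>2)))"
    if t: "t \<in> {0..T}" for t
  proof -
    have ile: "grid_index m t \<le> 2 ^ m" for m using grid_index_le t by auto
    have grT: "grid m b \<in> {0..T}" "grid m (Suc b) \<in> {0..T}" "b < 2 ^ m" if "b < grid_index m t" for m b using that ile[of m] by (auto intro!: grid_le_T)
    let ?dN = "\<lambda>m b \<omega>. N (grid m (Suc b)) \<omega> - N (grid m b) \<omega>"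
    let ?dD = "\<lambda>m b \<omega>. time_integral (grid m (Suc b)) (\<lambda>s. a s \<omega>) - time_integral (grid m b) (\<lambda>s. a s \<omega>)"
    let ?dF = "\<lambda>m b \<omega>. F (grid m (Suc b)) \<omega> - F (grid m b) \<omega>"
    \<comment> \<open>\<open>?P\<close> replaces the increments of \<open>N\<close> by those of the step process, \<open>?E1\<close> undoes the truncation,
       \<open>?E2\<close> comes from the incomplete cell before \<open>t\<close>, \<open>?E3\<close> is the error of a Riemann sum against the drift, \<open>?E4\<close> is
       the error of the quadratic variation and \<open>?E5\<close> the mixed variation of a continuous path and a
       path of bounded variation.\<close>
    let ?P = "\<lambda>m \<omega>. \<Sum>b<grid_index m t. G m (grid m b) \<omega> * (?dN m b \<omega> - H m (grid m b) \<omega> * dB m b \<omega>)"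
    let ?E1 = "\<lambda>m \<omega>. \<Sum>b<grid_index m t. (G m (grid m b) \<omega> - 2 * F (grid m b) \<omega>) * ?dN m b \<omega>"
    let ?E2 = "\<lambda>m \<omega>. (F (grid_floor m t) \<omega>)\<^sup>2 - (F t \<omega>)\<^sup>2"
    let ?E3 = "\<lambda>m \<omega>. (\<Sum>b<grid_index m t. 2 * F (grid m b) \<omega> * ?dD m b \<omega>) - time_integral t (\<lambda>s. 2 * F s \<omega> * a s \<omega>)"
    let ?E4 = "\<lambda>m \<omega>. (\<Sum>b<grid_index m t. (?dN m b \<omega>)\<^sup>2) - time_integral t (\<lambda>s. (c s \<omega>)\<^sup>2)"
    let ?E5 = "\<lambda>m \<omega>. \<Sum>b<grid_index m t. (?dF m b \<omega> + ?dN m b \<omega>) * ?dD m b \<omega>"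
    have dNm: "?dN m b \<in> borel_measurable M" if "b < grid_index m t" for m b
      by (intro borel_measurable_diff stoch_int_meas[OF N] grT[OF that])
    have dDm: "?dD m b \<in> borel_measurable M" for m b by (intro borel_measurable_diff time_integral_meas aj)
    have Fm: "F u \<in> borel_measurable M" if "u \<in> {0..T}" for u by (rule progressive_meas[OF f(2) that])
    have GHm: "G m (grid m b) \<in> borel_measurable M" "H m (grid m b) \<in> borel_measurable M" "dB m b \<in> borel_measurable M" if "b < grid_index m t" for m b
      using pred_seq_meas[of m "\<lambda>i. H m (grid m i)" b] pred_seq_meas[of m "\<lambda>i. G m (grid m i)" b] H G grT(3)[OF that] dB_meas[OF grT(3)[OF that]] unfolding grid_step_def by auto
    have Pm: "?P m \<in> borel_measurable M" for m
      by (intro borel_measurable_sum borel_measurable_times borel_measurable_diff dNm GHm) auto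
    have P: "prob_null ?P"
    proof (rule prob_null_from_bound[OF Pm GHc])
      fix m and \<delta> :: real assume d: "0 < \<delta>" "\<delta> \<le> 1"
      have "prob_size (?P m) \<le> \<delta> + prob_size (time_norm (\<lambda>s \<omega>. G m s \<omega> * (c s \<omega> - H m s \<omega>))) / \<delta>"
        by (rule stoch_int_increments(1)[OF N H G ile d])
      also have "time_norm (\<lambda>s \<omega>. G m s \<omega> * (c s \<omega> - H m s \<omega>)) = time_norm (\<lambda>s \<omega>. G m s \<omega> * (H m s \<omega> - c s \<omega>))"
        unfolding time_norm_def power_mult_distrib by (simp add: power2_commute fun_eq_iff)
      finally show "prob_size (?P m) \<le> \<delta> + prob_size (time_norm (\<lambda>s \<omega>. G m s \<omega> * (H m s \<omega> - c s \<omega>))) / \<delta>" .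
    qed
    have E1: "prob_null ?E1"
    proof (rule prob_null_AE)
      show "?E1 m \<in> borel_measurable M" for m
        by (intro borel_measurable_sum borel_measurable_times borel_measurable_diff borel_measurable_const dNm GHm Fm grT) auto
      show "AE \<omega> in M. (\<lambda>m. ?E1 m \<omega>) \<longlonglongrightarrow> 0"
        using Z(3)
      proof eventually_elim
        case (elim \<omega>)
        obtain k :: nat where k: "Z \<omega> \<le> real k" using real_arch_simple by blast
        have "\<forall>\<^sub>F m in sequentially. ?E1 m \<omega> = 0"
          using eventually_ge_at_top[of k]
        proof eventually_elim
          case (elim m)
          show ?case
          proof (rule sum.neutral, rule ballI)
            fix b assume "b \<in> {..<grid_index m t}"
            then have b: "b < grid_index m t" by simp
            have "\<bar>F (grid m b) \<omega>\<bar> \<le> real m" using \<open>\<forall>t\<in>{0..T}. \<bar>F t \<omega>\<bar> \<le> Z \<omega>\<close> grT(1)[OF b] k elim by (meson of_nat_mono order_trans)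
            then show "(G m (grid m b) \<omega> - 2 * F (grid m b) \<omega>) * ?dN m b \<omega> = 0"
              using Ggr[OF grT(3)[OF b]] by (simp add: trunc_bounds(3))
          qed
        qed
        then show ?case by (rule tendsto_eventually)
      qed
    qed
    have E2: "prob_null ?E2"
    proof (rule prob_null_AE)
      have "grid_floor m t \<in> {0..T}" for m using grid_floor_bounds[of t m] t by auto
      then show "?E2 m \<in> borel_measurable M" for m
        by (intro borel_measurable_diff borel_measurable_power Fm t)
      show "AE \<omega> in M. (\<lambda>m. ?E2 m \<omega>) \<longlonglongrightarrow> 0"
        using f(3)
      proof eventually_elim
        case (elim \<omega>)
        show ?case by (intro LIM_zero tendsto_power grid_floor_path_tendsto[OF elim t])
      qed
    qed
    have E3: "prob_null ?E3"
    proof (rule prob_null_AE)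
      show "?E3 m \<in> borel_measurable M" for m
        by (intro borel_measurable_sum borel_measurable_times borel_measurable_diff[of "\<lambda>\<omega>. \<Sum>b<grid_index m t. 2 * F (grid m b) \<omega> * ?dD m b \<omega>"] borel_measurable_const dDm Fm grT time_integral_meas progressive_joint[OF pFa]) auto
      show "AE \<omega> in M. (\<lambda>m. ?E3 m \<omega>) \<longlonglongrightarrow> 0"
        using Z(3) f(3) f(6) AE_space
      proof eventually_elim
        case (elim \<omega>)
        note [measurable] = joint_section[OF Fj elim(4)]
        show ?case
        proof (rule LIM_zero, rule riemann_limit[OF elim(3) t, where K = "2 * Z \<omega>"])
          fix s assume s: "s \<in> {0..<T}"
          then show "(\<lambda>m. 2 * F (grid m (grid_index m s)) \<omega>) \<longlonglongrightarrow> 2 * F s \<omega>"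
            using grid_floor_path_tendsto[OF elim(2), of s] unfolding grid_floor_def by (intro tendsto_intros) auto
          fix m
          have "grid m (grid_index m s) \<in> {0..T}" using grid_floor_bounds[of s m] s by (auto simp: grid_floor_def)
          then show "\<bar>2 * F (grid m (grid_index m s)) \<omega>\<bar> \<le> 2 * Z \<omega>" using elim(1) by (auto simp: abs_mult)
        qed measurable
      qed
    qed
    have E4: "prob_null ?E4" by (rule quadratic_variation[OF N t])
    have E5: "prob_null ?E5"
    proof (rule prob_null_AE)
      show "?E5 m \<in> borel_measurable M" for m
        by (intro borel_measurable_sum borel_measurable_times borel_measurable_add dNm dDm borel_measurable_diff[of "F _"] Fm grT) auto
      show "AE \<omega> in M. (\<lambda>m. ?E5 m \<omega>) \<longlonglongrightarrow> 0"
        using f(3) f(6)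
      proof eventually_elim
        case (elim \<omega>)
        have cN: "continuous_on {0..T} (\<lambda>t. N t \<omega>)" unfolding N_def by (intro continuous_intros time_integral_continuous elim)
        have c: "continuous_on {0..T} (\<lambda>t. F t \<omega> + N t \<omega>)" by (intro continuous_intros cN elim)
        obtain K where K: "\<And>t. t \<in> {0..T} \<Longrightarrow> \<bar>F t \<omega> + N t \<omega>\<bar> \<le> K" by (rule continuous_path_bound[OF c]) (rule that)
        have "(\<lambda>m. \<Sum>b<grid_index m t. (?dF m b \<omega> + ?dN m b \<omega>) * ?dD m b \<omega>) \<longlonglongrightarrow> time_integral t (\<lambda>s. 0 * a s \<omega>)"
        proof (rule riemann_limit[OF elim(2) t, where K = "2 * K"])
          fix s assume s: "s \<in> {0..<T}"
          have "(\<lambda>m. (F (grid m (Suc (grid_index m s))) \<omega> + N (grid m (Suc (grid_index m s))) \<omega>) - (F (grid m (grid_index m s)) \<omega> + N (grid m (grid_index m s)) \<omega>)) \<longlonglongrightarrow>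
            (F s \<omega> + N s \<omega>) - (F s \<omega> + N s \<omega>)"
            using grid_floor_path_tendsto[OF c, of s] grid_next_path_tendsto[OF c s] s unfolding grid_floor_def by (intro tendsto_diff) auto
          then show "(\<lambda>m. ?dF m (grid_index m s) \<omega> + ?dN m (grid_index m s) \<omega>) \<longlonglongrightarrow> 0" by (simp add: algebra_simps)
          fix m
          have "grid m (grid_index m s) \<in> {0..T}" "grid m (Suc (grid_index m s)) \<in> {0..T}" using grid_floor_bounds[of s m] grid_index_less[of s m] s by (auto simp: grid_floor_def intro!: grid_le_T)
          from K[OF this(1)] K[OF this(2)] show "\<bar>?dF m (grid_index m s) \<omega> + ?dN m (grid_index m s) \<omega>\<bar> \<le> 2 * K" by linarith
        qed simp
        then show ?case by (simp add: time_integral_def)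
      qed
    qed
    have tot: "prob_null (\<lambda>m \<omega>. ?E1 m \<omega> + ?E2 m \<omega> - (?P m \<omega> + ?E3 m \<omega> + ?E4 m \<omega> + ?E5 m \<omega>))"
      by (intro prob_null_diff prob_null_add E1 E2 E3 E4 E5 P)
    show ?thesis
    proof (rule prob_null_le[OF tot])
      show "(\<lambda>\<omega>. step_integral m (\<lambda>s \<omega>. G m s \<omega> * H m s \<omega>) t \<omega> - ((F t \<omega>)\<^sup>2 - (F 0 \<omega>)\<^sup>2 - time_integral t (\<lambda>s. 2 * F s \<omega> * a s \<omega> + (c s \<omega>)\<^sup>2))) \<in> borel_measurable M" for m
        by (intro borel_measurable_diff[of "step_integral m _ t"] step_integral_meas[OF grid_step_mult[OF G H] t] weak_ito_martingale_meas[OF pF2 pa t])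
      show "AE \<omega> in M. \<bar>step_integral m (\<lambda>s \<omega>. G m s \<omega> * H m s \<omega>) t \<omega> - ((F t \<omega>)\<^sup>2 - (F 0 \<omega>)\<^sup>2 - time_integral t (\<lambda>s. 2 * F s \<omega> * a s \<omega> + (c s \<omega>)\<^sup>2))\<bar> \<le>
         \<bar>?E1 m \<omega> + ?E2 m \<omega> - (?P m \<omega> + ?E3 m \<omega> + ?E4 m \<omega> + ?E5 m \<omega>)\<bar>" for m
        using int_Fa f(7)
      proof eventually_elim
        case (elim \<omega>)
        have inc: "?dF m b \<omega> = ?dN m b \<omega> + ?dD m b \<omega>" for b unfolding N_def by simp
        have "(\<Sum>b<grid_index m t. 2 * F (grid m b) \<omega> * ?dN m b \<omega>) =
          (\<Sum>b<grid_index m t. ((F (grid m (Suc b)) \<omega>)\<^sup>2 - (F (grid m b) \<omega>)\<^sup>2) - (?dN m b \<omega>)\<^sup>2 - (?dF m b \<omega> + ?dN m b \<omega>) * ?dD m b \<omega> - 2 * F (grid m b) \<omega> * ?dD m b \<omega>)"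
          by (intro sum.cong refl square_increment_identity inc)
        also have "\<dots> = (\<Sum>b<grid_index m t. (F (grid m (Suc b)) \<omega>)\<^sup>2 - (F (grid m b) \<omega>)\<^sup>2) - (\<Sum>b<grid_index m t. (?dN m b \<omega>)\<^sup>2) - ?E5 m \<omega> - (\<Sum>b<grid_index m t. 2 * F (grid m b) \<omega> * ?dD m b \<omega>)"
          by (simp only: sum_subtractf)
        also have "(\<Sum>b<grid_index m t. (F (grid m (Suc b)) \<omega>)\<^sup>2 - (F (grid m b) \<omega>)\<^sup>2) = (F (grid_floor m t) \<omega>)\<^sup>2 - (F 0 \<omega>)\<^sup>2"
          using sum_lessThan_telescope[of "\<lambda>b. (F (grid m b) \<omega>)\<^sup>2" "grid_index m t"] by (simp add: grid_floor_def)
        finally have 1: "(\<Sum>b<grid_index m t. 2 * F (grid m b) \<omega> * ?dN m b \<omega>) = (F (grid_floor m t) \<omega>)\<^sup>2 - (F 0 \<omega>)\<^sup>2 - (\<Sum>b<grid_index m t. (?dN m b \<omega>)\<^sup>2) - ?E5 m \<omega> - (\<Sum>b<grid_index m t. 2 * F (grid m b) \<omega> * ?dD m b \<omega>)" .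
        have alg: "g * h * d = (g - f2) * n + f2 * n - g * (n - h * d)" for g h d f2 n :: real by (simp add: algebra_simps)
        have 2: "step_integral m (\<lambda>s \<omega>. G m s \<omega> * H m s \<omega>) t \<omega> = ?E1 m \<omega> + (\<Sum>b<grid_index m t. 2 * F (grid m b) \<omega> * ?dN m b \<omega>) - ?P m \<omega>"
          unfolding step_integral_def sum.distrib[symmetric] sum_subtractf[symmetric] by (intro sum.cong refl alg)
        have 3: "time_integral t (\<lambda>s. 2 * F s \<omega> * a s \<omega> + (c s \<omega>)\<^sup>2) = time_integral t (\<lambda>s. 2 * F s \<omega> * a s \<omega>) + time_integral t (\<lambda>s. (c s \<omega>)\<^sup>2)"
          by (rule time_integral_add[OF elim])
        show ?case unfolding 2 1 3 by (intro eq_refl arg_cong[where f = abs]) linarith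
      qed
    qed
  qed
  show ?thesis
    unfolding weak_ito_def
  proof (intro conjI pa int_a)
    show "continuous_process M B T (\<lambda>t \<omega>. (F t \<omega>)\<^sup>2)" by (rule continuous_process_intros(3)[OF f(1) f(1)])
    show "stoch_int (\<lambda>t \<omega>. (F t \<omega>)\<^sup>2 - (F 0 \<omega>)\<^sup>2 - time_integral t (\<lambda>s. 2 * F s \<omega> * a s \<omega> + (c s \<omega>)\<^sup>2)) (\<lambda>t \<omega>. 2 * F t \<omega> * c t \<omega>)"
      by (rule stoch_intI[OF pc int_c weak_ito_martingale_meas[OF pF2 pa] grid_step_mult[OF G H] int_conv step_integral_conv])
  qed
qed

text \<open>
  By polarization from squares.
\<close>

lemma weak_ito_mult:
  assumes F: "weak_ito F a c" and G: "weak_ito G a' c'"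
  shows "weak_ito (\<lambda>t \<omega>. F t \<omega> * G t \<omega>) (\<lambda>t \<omega>. F t \<omega> * a' t \<omega> + G t \<omega> * a t \<omega> + c t \<omega> * c' t \<omega>) (\<lambda>t \<omega>. F t \<omega> * c' t \<omega> + G t \<omega> * c t \<omega>)"
proof -
  note w = weak_ito_cmult[OF weak_ito_diff[OF weak_ito_square[OF weak_ito_add[OF F G]] weak_ito_square[OF weak_ito_diff[OF F G]]], of "1 / 4"]
  have eq: "(\<lambda>t \<omega>. 1 / 4 * ((F t \<omega> + G t \<omega>)\<^sup>2 - (F t \<omega> - G t \<omega>)\<^sup>2)) = (\<lambda>t \<omega>. F t \<omega> * G t \<omega>)"
    "(\<lambda>t \<omega>. 1 / 4 * (2 * (F t \<omega> + G t \<omega>) * (a t \<omega> + a' t \<omega>) + (c t \<omega> + c' t \<omega>)\<^sup>2 - (2 * (F t \<omega> - G t \<omega>) * (a t \<omega> - a' t \<omega>) + (c t \<omega> - c' t \<omega>)\<^sup>2))) =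
     (\<lambda>t \<omega>. F t \<omega> * a' t \<omega> + G t \<omega> * a t \<omega> + c t \<omega> * c' t \<omega>)"
    "(\<lambda>t \<omega>. 1 / 4 * (2 * (F t \<omega> + G t \<omega>) * (c t \<omega> + c' t \<omega>) - 2 * (F t \<omega> - G t \<omega>) * (c t \<omega> - c' t \<omega>))) = (\<lambda>t \<omega>. F t \<omega> * c' t \<omega> + G t \<omega> * c t \<omega>)"
    by (auto simp: fun_eq_iff power2_eq_square algebra_simps)
  show ?thesis using w unfolding eq .
qed

end

section \<open>Exponential weights\<close>

text \<open>
  The mean value theorem for \<open>exp (- x)\<close>, in a form in which the intermediate value is squeezed when
  \<open>x\<close> and \<open>y\<close> approach a common limit.
\<close>

lemma exp_difference_quotient:
  fixes x y :: real
  shows "\<exists>h. exp (- y) - exp (- x) = - h * (y - x) \<and> min (exp (- x)) (exp (- y)) \<le> h \<and> h \<le> max (exp (- x)) (exp (- y))"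
proof -
  have ub: "exp (- x) - exp (- y) \<le> exp (- x) * (y - x)" for x y :: real
  proof -
    have "exp (- x) * (1 + (x - y)) \<le> exp (- x) * exp (x - y)" by (intro mult_left_mono exp_ge_add_one_self) auto
    also have "\<dots> = exp (- y)" by (simp flip: exp_add)
    finally show ?thesis by (simp add: algebra_simps)
  qed
  show ?thesis
  proof (cases "x = y")
    case True then show ?thesis by (intro exI[of _ "exp (- x)"]) auto
  next
    case False
    have *: "\<exists>h. exp (- y) - exp (- x) = - h * (y - x) \<and> exp (- y) \<le> h \<and> h \<le> exp (- x)" if "x < y" for x y :: real
    proof (intro exI conjI)
      let ?h = "(exp (- x) - exp (- y)) / (y - x)"
      show "exp (- y) - exp (- x) = - ?h * (y - x)" using that by (simp add: field_simps)
      show "?h \<le> exp (- x)" using ub[of x y] that by (simp add: pos_divide_le_eq)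
      show "exp (- y) \<le> ?h" using ub[of y x] that by (simp add: pos_le_divide_eq algebra_simps)
    qed
    show ?thesis
    proof (cases "x < y")
      case True
      from *[OF this] obtain h where "exp (- y) - exp (- x) = - h * (y - x)" "exp (- y) \<le> h" "h \<le> exp (- x)" by blast
      then show ?thesis by (intro exI[of _ h]) auto
    next
      case False
      then have "y < x" using \<open>x \<noteq> y\<close> by simp
      from *[OF this] obtain h where "exp (- x) - exp (- y) = - h * (x - y)" "exp (- x) \<le> h" "h \<le> exp (- y)" by blast
      then show ?thesis by (intro exI[of _ h]) (auto simp: algebra_simps)
    qed
  qed
qed

context brownian_setting
begin

text \<open>
  The fundamental theorem of calculus for the exponential of an indefinite Lebesgue integral. As the
  latter is differentiable only almost everywhere, the increments are summed over a grid and passed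
  to the limit by \<open>riemann_limit\<close>.
\<close>

lemma exp_time_integral:
  assumes k: "integrable Leb k" and t: "t \<in> {0..T}"
  shows "exp (- time_integral t k) - 1 = - time_integral t (\<lambda>s. exp (- time_integral s k) * k s)"
proof -
  let ?e = "\<lambda>u. exp (- time_integral u k)"
  have c: "continuous_on {0..T} ?e" by (intro continuous_intros time_integral_continuous k)
  obtain K where K: "\<And>u. u \<in> {0..T} \<Longrightarrow> \<bar>?e u\<bar> \<le> K" by (rule continuous_path_bound[OF c]) (rule that)
  have "\<forall>p. \<exists>h. ?e (grid (fst p) (Suc (snd p))) - ?e (grid (fst p) (snd p)) = - h * (time_integral (grid (fst p) (Suc (snd p))) k - time_integral (grid (fst p) (snd p)) k) \<and>
    min (?e (grid (fst p) (snd p))) (?e (grid (fst p) (Suc (snd p)))) \<le> h \<and> h \<le> max (?e (grid (fst p) (snd p))) (?e (grid (fst p) (Suc (snd p))))"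
    by (rule allI, rule exp_difference_quotient)
  from choice[OF this] obtain h' where h': "\<forall>p. ?e (grid (fst p) (Suc (snd p))) - ?e (grid (fst p) (snd p)) = - h' p * (time_integral (grid (fst p) (Suc (snd p))) k - time_integral (grid (fst p) (snd p)) k) \<and>
    min (?e (grid (fst p) (snd p))) (?e (grid (fst p) (Suc (snd p)))) \<le> h' p \<and> h' p \<le> max (?e (grid (fst p) (snd p))) (?e (grid (fst p) (Suc (snd p))))" ..
  define h where "h m b = h' (m, b)" for m b
  have h1: "?e (grid m (Suc b)) - ?e (grid m b) = - h m b * (time_integral (grid m (Suc b)) k - time_integral (grid m b) k)" for m b
    using h'[THEN spec, of "(m, b)"] unfolding h_def by simp
  have h2: "min (?e (grid m b)) (?e (grid m (Suc b))) \<le> h m b" and h3: "h m b \<le> max (?e (grid m b)) (?e (grid m (Suc b)))" for m b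
    using h'[THEN spec, of "(m, b)"] unfolding h_def by simp_all
  have cm: "?e \<in> borel_measurable Leb"
  proof -
    have "continuous_on UNIV ?e" by (intro continuous_intros time_integral_continuous k)
    then show ?thesis by (intro borel_Leb borel_measurable_continuous_onI)
  qed
  \<comment> \<open>An intermediate value between the exponentials at the two ends of a cell takes the place of the
     derivative.\<close>
  have "(\<lambda>m. \<Sum>b<grid_index m t. h m b * (time_integral (grid m (Suc b)) k - time_integral (grid m b) k)) \<longlonglongrightarrow> time_integral t (\<lambda>s. ?e s * k s)"
  proof (rule riemann_limit[OF k t _ _ cm, where K = K])
    fix s assume s: "s \<in> {0..<T}"
    have l: "(\<lambda>m. ?e (grid m (grid_index m s))) \<longlonglongrightarrow> ?e s" "(\<lambda>m. ?e (grid m (Suc (grid_index m s)))) \<longlonglongrightarrow> ?e s"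
      using grid_floor_path_tendsto[OF c, of s] grid_next_path_tendsto[OF c s] s unfolding grid_floor_def by auto
    show "(\<lambda>m. h m (grid_index m s)) \<longlonglongrightarrow> ?e s"
    proof (rule real_tendsto_sandwich)
      show "(\<lambda>m. min (?e (grid m (grid_index m s))) (?e (grid m (Suc (grid_index m s))))) \<longlonglongrightarrow> ?e s" using tendsto_min[OF l] by simp
      show "(\<lambda>m. max (?e (grid m (grid_index m s))) (?e (grid m (Suc (grid_index m s))))) \<longlonglongrightarrow> ?e s" using tendsto_max[OF l] by simp
    qed (intro always_eventually allI h2 h3)+
    fix m
    have "grid m (grid_index m s) \<in> {0..T}" "grid m (Suc (grid_index m s)) \<in> {0..T}" using grid_floor_bounds[of s m] grid_index_less[of s m] s by (auto simp: grid_floor_def intro!: grid_le_T)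
    then have "?e (grid m (grid_index m s)) \<le> K" "?e (grid m (Suc (grid_index m s))) \<le> K" using K by force+
    moreover have "0 \<le> h m (grid_index m s)" by (rule order_trans[OF _ h2]) simp
    ultimately show "\<bar>h m (grid_index m s)\<bar> \<le> K" using h3[of m "grid_index m s"] by simp
  qed
  moreover have "(\<lambda>m. \<Sum>b<grid_index m t. h m b * (time_integral (grid m (Suc b)) k - time_integral (grid m b) k)) = (\<lambda>m. - (?e (grid_floor m t) - 1))"
  proof
    fix m
    have "(\<Sum>b<grid_index m t. ?e (grid m (Suc b)) - ?e (grid m b)) = ?e (grid_floor m t) - ?e (grid m 0)"
      unfolding grid_floor_def by (rule sum_lessThan_telescope)
    also have "\<dots> = ?e (grid_floor m t) - 1" by simp
    finally show "(\<Sum>b<grid_index m t. h m b * (time_integral (grid m (Suc b)) k - time_integral (grid m b) k)) = - (?e (grid_floor m t) - 1)"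
      unfolding h1 by (simp add: sum_negf)
  qed
  ultimately have "(\<lambda>m. - (?e (grid_floor m t) - 1)) \<longlonglongrightarrow> time_integral t (\<lambda>s. ?e s * k s)" by simp
  moreover have "(\<lambda>m. - (?e (grid_floor m t) - 1)) \<longlonglongrightarrow> - (?e t - 1)" by (intro tendsto_intros grid_floor_path_tendsto[OF c t])
  ultimately show ?thesis using LIMSEQ_unique by fastforce
qed

lemma weak_ito_exp:
  assumes k: "progressive M B T k" and ki: "AE \<omega> in M. integrable Leb (\<lambda>s. k s \<omega>)"
  shows "weak_ito (\<lambda>t \<omega>. exp (- time_integral t (\<lambda>s. k s \<omega>))) (\<lambda>t \<omega>. - (exp (- time_integral t (\<lambda>s. k s \<omega>)) * k t \<omega>)) (\<lambda>t \<omega>. 0)"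
  unfolding weak_ito_def
proof (intro conjI)
  let ?w = "\<lambda>t \<omega>. exp (- time_integral t (\<lambda>s. k s \<omega>))"
  have pw: "progressive M B T ?w" by (intro progressive_intros progressive_time_integral k)
  show pa: "progressive M B T (\<lambda>t \<omega>. - (?w t \<omega> * k t \<omega>))" by (intro progressive_mult progressive_minus pw k)
  have cont: "AE \<omega> in M. continuous_on {0..T} (\<lambda>t. ?w t \<omega>)"
    using ki by eventually_elim (intro continuous_intros time_integral_continuous)
  then show cp: "continuous_process M B T ?w" unfolding continuous_process_def using pw by blast
  show "AE \<omega> in M. integrable Leb (\<lambda>s. - (?w s \<omega> * k s \<omega>))"
    using ki cont AE_space
  proof eventually_elim
    case (elim \<omega>)
    obtain K where K: "\<And>u. u \<in> {0..T} \<Longrightarrow> \<bar>?w u \<omega>\<bar> \<le> K" by (rule continuous_path_bound[OF elim(2)]) (rule that)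
    have "integrable Leb (\<lambda>s. ?w s \<omega> * k s \<omega>)"
      by (rule L1_bounded_mult[OF joint_section[OF progressive_joint[OF pw] elim(3)] elim(1), of K]) (use K in auto)
    then show ?case by simp
  qed
  show "stoch_int (\<lambda>t \<omega>. ?w t \<omega> - ?w 0 \<omega> - time_integral t (\<lambda>s. - (?w s \<omega> * k s \<omega>))) (\<lambda>t \<omega>. 0)"
  proof (rule stoch_intI[OF progressive_const _ weak_ito_martingale_meas[OF pw pa] grid_step_zero])
    have "time_norm (\<lambda>s \<omega>. 0 - 0) = (\<lambda>\<omega>. 0)" by (simp add: time_norm_def fun_eq_iff)
    then show "prob_null (\<lambda>m. time_norm (\<lambda>s \<omega>. 0 - 0))" by (intro prob_null_AE) auto
    fix t assume t: "t \<in> {0..T}"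
    show "prob_null (\<lambda>m \<omega>. step_integral m (\<lambda>s \<omega>. 0) t \<omega> - (?w t \<omega> - ?w 0 \<omega> - time_integral t (\<lambda>s. - (?w s \<omega> * k s \<omega>))))"
    proof (rule prob_null_AE)
      show "(\<lambda>\<omega>. step_integral m (\<lambda>s \<omega>. 0) t \<omega> - (?w t \<omega> - ?w 0 \<omega> - time_integral t (\<lambda>s. - (?w s \<omega> * k s \<omega>)))) \<in> borel_measurable M" for m
        by (intro borel_measurable_diff[of "step_integral m _ t"] step_integral_meas[OF grid_step_zero t] weak_ito_martingale_meas[OF pw pa t])
      show "AE \<omega> in M. (\<lambda>m. step_integral m (\<lambda>s \<omega>. 0) t \<omega> - (?w t \<omega> - ?w 0 \<omega> - time_integral t (\<lambda>s. - (?w s \<omega> * k s \<omega>)))) \<longlonglongrightarrow> 0"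
        using ki
      proof eventually_elim
        case (elim \<omega>)
        have "time_integral t (\<lambda>s. - (?w s \<omega> * k s \<omega>)) = - time_integral t (\<lambda>s. ?w s \<omega> * k s \<omega>)" using time_integral_cmult[of t "-1"] by simp
        then show ?case using exp_time_integral[OF elim t] by (simp add: step_integral_def)
      qed
    qed
  qed simp
qed

end

section \<open>Uniqueness for backward equations of linear growth\<close>

text \<open>
  Young's inequality: half of the square of the diffusion coefficient survives after the drift has
  been absorbed.
\<close>

lemma bsde_drift_bound:
  fixes y z a K :: real
  assumes "\<bar>a\<bar> \<le> K * (\<bar>y\<bar> + \<bar>z\<bar>)" "0 \<le> K"
  shows "z\<^sup>2 / 2 \<le> 2 * y * a + z\<^sup>2 + (2 * K + 2 * K\<^sup>2) * y\<^sup>2"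
proof -
  have "\<bar>2 * y * a\<bar> \<le> 2 * \<bar>y\<bar> * (K * (\<bar>y\<bar> + \<bar>z\<bar>))"
    using mult_left_mono[OF assms(1), of "2 * \<bar>y\<bar>"] by (simp add: abs_mult)
  also have "\<dots> = 2 * K * y\<^sup>2 + 2 * (K * \<bar>y\<bar>) * \<bar>z\<bar>" by (simp add: algebra_simps power2_eq_square flip: abs_mult)
  also have "2 * (K * \<bar>y\<bar>) * \<bar>z\<bar> \<le> 2 * K\<^sup>2 * y\<^sup>2 + z\<^sup>2 / 2"
  proof -
    have "0 \<le> (2 * (K * \<bar>y\<bar>) - \<bar>z\<bar>)\<^sup>2" by simp
    then have "4 * (K * \<bar>y\<bar>) * \<bar>z\<bar> \<le> 4 * (K * \<bar>y\<bar>)\<^sup>2 + \<bar>z\<bar>\<^sup>2" by (simp add: power2_diff power_mult_distrib)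
    then show ?thesis by (simp add: power_mult_distrib)
  qed
  finally show ?thesis by (simp add: algebra_simps)
qed

context brownian_setting
begin

text \<open>
  The product rule is applied to \<open>Y\<^sup>2 w\<close> with \<open>w = exp (L t - (1/(n+1)) \<integral> Y\<^sup>2 c\<^sup>2 ds)\<close>. The first
  summand of the exponent absorbs the drift of \<open>Y\<^sup>2\<close>. The second one makes the time integral of the
  squared diffusion coefficient bounded, so that the stochastic integral has mean zero although
  nothing is assumed about the integrability of \<open>c\<close> over \<open>\<Omega>\<close>. The mean of the remaining terms tends
  to zero as \<open>n\<close> grows, and the lemma of Fatou yields the claim.
\<close>

lemma bsde_uniqueness_at:
  assumes Y: "weak_ito Y a c" and YT: "AE \<omega> in M. Y T \<omega> = 0" and S2: "square_sup_integrable M T Y"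
    and K: "0 \<le> K" and bound: "AE \<omega> in M. AE s in Leb. \<bar>a s \<omega>\<bar> \<le> K * (\<bar>Y s \<omega>\<bar> + \<bar>c s \<omega>\<bar>)"
    and t: "t \<in> {0..T}"
  shows "AE \<omega> in M. (Y t \<omega>)\<^sup>2 + (time_integral T (\<lambda>s. (c s \<omega>)\<^sup>2) - time_integral t (\<lambda>s. (c s \<omega>)\<^sup>2)) / 2 = 0"
proof -
  note y = weak_itoD[OF Y]
  note Yj = progressive_joint[OF y(2)] and aj = progressive_joint[OF y(4)] and cj = progressive_joint[OF y(5)]
  have TT: "T \<in> {0..T}" using T_pos by simp
  obtain Zs where Zs: "Zs \<in> borel_measurable M" "\<And>\<omega>. Zs \<omega> \<le> (SUP t\<in>{0..T}. ennreal ((Y t \<omega>)\<^sup>2))"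
    "AE \<omega> in M. Zs \<omega> < \<infinity> \<and> (\<forall>t\<in>{0..T}. ennreal ((Y t \<omega>)\<^sup>2) \<le> Zs \<omega>)"
    by (rule continuous_process_sup[OF y(1)]) (rule that)
  define S where "S \<omega> = enn2real (Zs \<omega>)" for \<omega>
  have Sm[measurable]: "S \<in> borel_measurable M" unfolding S_def using Zs(1) by measurable
  have S0: "0 \<le> S \<omega>" for \<omega> by (simp add: S_def)
  have SY: "AE \<omega> in M. \<forall>t\<in>{0..T}. (Y t \<omega>)\<^sup>2 \<le> S \<omega>"
    using Zs(3)
  proof eventually_elim
    case (elim \<omega>)
    then obtain z where z: "Zs \<omega> = ennreal z" "0 \<le> z" by (cases "Zs \<omega>") auto
    then show ?case using elim by (auto simp: S_def ennreal_le_iff)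
  qed
  have Si: "integrable M S"
  proof (rule integrableI_nonneg)
    have "(\<integral>\<^sup>+ \<omega>. ennreal (S \<omega>) \<partial>M) \<le> (\<integral>\<^sup>+ \<omega>. (SUP t\<in>{0..T}. ennreal ((Y t \<omega>)\<^sup>2)) \<partial>M)"
    proof (rule nn_integral_mono)
      fix \<omega>
      have "ennreal (S \<omega>) \<le> Zs \<omega>" unfolding S_def by (cases "Zs \<omega>") auto
      then show "ennreal (S \<omega>) \<le> (SUP t\<in>{0..T}. ennreal ((Y t \<omega>)\<^sup>2))" using Zs(2)[of \<omega>] by (rule order_trans)
    qed
    also have "\<dots> < \<infinity>" using S2 unfolding square_sup_integrable_def .
    finally show "(\<integral>\<^sup>+ \<omega>. ennreal (S \<omega>) \<partial>M) < \<infinity>" .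
  qed (use S0 in auto)
  \<comment> \<open>\<open>L\<close> absorbs the part of the drift of \<open>Y\<^sup>2\<close> that is proportional to \<open>Y\<^sup>2\<close> (see \<open>bsde_drift_bound\<close>).\<close>
  define L where "L = 2 * K + 2 * K\<^sup>2"
  have L: "0 \<le> L" using K by (simp add: L_def)
  \<comment> \<open>\<open>4 * q\<close> is the square of the diffusion coefficient of \<open>Y\<^sup>2\<close>.  Nothing is known about its
     integrability over \<open>\<Omega>\<close>, so its time integral has to be controlled by the weight.\<close>
  define q where "q s \<omega> = (Y s \<omega>)\<^sup>2 * (c s \<omega>)\<^sup>2" for s \<omega>
  have q0: "0 \<le> q s \<omega>" for s \<omega> unfolding q_def by (intro mult_nonneg_nonneg) auto
  have pq: "progressive M B T q" unfolding q_def[abs_def] by (intro progressive_mult progressive_power y)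
  have qi: "AE \<omega> in M. integrable Leb (\<lambda>s. q s \<omega>)"
    using SY y(7) AE_space
  proof eventually_elim
    case (elim \<omega>)
    have [measurable]: "(\<lambda>s. Y s \<omega>) \<in> borel_measurable Leb" by (rule joint_section[OF Yj elim(3)])
    show ?case unfolding q_def
      by (rule L1_bounded_mult[OF _ elim(2), of _ "S \<omega>"]) (use elim in auto)
  qed
  define k0 where "k0 n s \<omega> = inverse (real (Suc n)) * q s \<omega>" for n s \<omega>
  \<comment> \<open>\<open>v\<close> is the weight that tends to \<open>1\<close> with \<open>n\<close>; the weight \<open>w\<close> of the product rule differs from it
     by the deterministic factor \<open>exp (L * t)\<close>.\<close>
  define v where "v n t \<omega> = exp (- time_integral t (\<lambda>s. k0 n s \<omega>))" for n t \<omega>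
  define w where "w n t \<omega> = exp (- time_integral t (\<lambda>s. k0 n s \<omega> - L))" for n t \<omega>
  have k00: "0 \<le> k0 n s \<omega>" for n s \<omega> unfolding k0_def using q0 by simp
  have pk0: "progressive M B T (k0 n)" for n unfolding k0_def[abs_def] by (intro progressive_cmult pq)
  have k0i: "AE \<omega> in M. integrable Leb (\<lambda>s. k0 n s \<omega>)" for n using qi unfolding k0_def by eventually_elim simp
  have v_meas: "v n t \<in> borel_measurable M" if "t \<in> {0..T}" for n t
    unfolding v_def by (rule progressive_meas[OF progressive_exp[OF progressive_minus[OF progressive_time_integral[OF pk0]]] that])
  have vT_lim: "(\<lambda>n. v n T \<omega>) \<longlonglongrightarrow> 1" for \<omega>
  proof -
    have "(\<lambda>n. exp (- (inverse (real (Suc n)) * time_integral T (\<lambda>s. q s \<omega>)))) \<longlonglongrightarrow> exp (- (0 * time_integral T (\<lambda>s. q s \<omega>)))"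
      by (intro tendsto_intros LIMSEQ_inverse_real_of_nat)
    then show ?thesis unfolding v_def k0_def time_integral_cmult by simp
  qed
  define \<Phi> where "\<Phi> \<omega> = (Y t \<omega>)\<^sup>2 + (time_integral T (\<lambda>s. (c s \<omega>)\<^sup>2) - time_integral t (\<lambda>s. (c s \<omega>)\<^sup>2)) / 2" for \<omega>
  have c2j: "jointly_measurable (\<lambda>s \<omega>. (c s \<omega>)\<^sup>2)" by (rule progressive_joint[OF progressive_power[OF y(5)]])
  have Phm[measurable]: "\<Phi> \<in> borel_measurable M"
  proof -
    have [measurable]: "Y t \<in> borel_measurable M" by (rule progressive_meas[OF y(2) t])
    note [measurable] = time_integral_meas[OF c2j]
    show ?thesis unfolding \<Phi>_def by measurable
  qed
  have Ph0: "AE \<omega> in M. 0 \<le> \<Phi> \<omega>"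
    using y(7)
  proof eventually_elim
    case (elim \<omega>)
    have "time_integral t (\<lambda>s. (c s \<omega>)\<^sup>2) \<le> time_integral T (\<lambda>s. (c s \<omega>)\<^sup>2)" by (rule integrable_time_integral_mono[OF elim]) (use t in auto)
    then show ?case by (simp add: \<Phi>_def)
  qed
  have est: "(\<integral>\<^sup>+ \<omega>. ennreal (v n T \<omega> * \<Phi> \<omega>) \<partial>M) \<le> ennreal (exp (L * T) * expectation (\<lambda>\<omega>. S \<omega> * (1 - v n T \<omega>)))" for n
  proof -
    have kLi: "AE \<omega> in M. integrable Leb (\<lambda>s. k0 n s \<omega> - L)"
      using k0i[of n] by eventually_elim (auto intro!: Bochner_Integration.integrable_diff integrable_Leb_1)
    have pkL: "progressive M B T (\<lambda>s \<omega>. k0 n s \<omega> - L)" by (intro progressive_diff pk0 progressive_const)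
    define d where "d s \<omega> = (Y s \<omega>)\<^sup>2 * - (w n s \<omega> * (k0 n s \<omega> - L)) + w n s \<omega> * (2 * Y s \<omega> * a s \<omega> + (c s \<omega>)\<^sup>2) + 2 * Y s \<omega> * c s \<omega> * 0" for s \<omega>
    define e where "e s \<omega> = (Y s \<omega>)\<^sup>2 * 0 + w n s \<omega> * (2 * Y s \<omega> * c s \<omega>)" for s \<omega>
    have F: "weak_ito (\<lambda>t \<omega>. (Y t \<omega>)\<^sup>2 * w n t \<omega>) d e"
      using weak_ito_mult[OF weak_ito_square[OF Y] weak_ito_exp[OF pkL kLi]] unfolding d_def[abs_def] e_def[abs_def] w_def[abs_def] .
    note f = weak_itoD[OF F]
    define N where "N t \<omega> = (Y t \<omega>)\<^sup>2 * w n t \<omega> - (Y 0 \<omega>)\<^sup>2 * w n 0 \<omega> - time_integral t (\<lambda>s. d s \<omega>)" for t \<omega>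
    have N: "stoch_int N e" using f(8) unfolding N_def[abs_def] .
    have wv: "AE \<omega> in M. \<forall>t\<in>{0..T}. w n t \<omega> = exp (L * t) * v n t \<omega>"
      using k0i[of n]
    proof eventually_elim
      case (elim \<omega>)
      show ?case
      proof
        fix t assume t: "t \<in> {0..T}"
        have "time_integral t (\<lambda>s. k0 n s \<omega> - L) = time_integral t (\<lambda>s. k0 n s \<omega> + (- L) * 1)" by simp
        also have "\<dots> = time_integral t (\<lambda>s. k0 n s \<omega>) + (- L) * time_integral t (\<lambda>s. 1)"
          by (subst time_integral_add) (auto intro!: elim integrable_Leb_1 simp: time_integral_cmult[symmetric])
        also have "\<dots> = time_integral t (\<lambda>s. k0 n s \<omega>) - L * t" by (simp add: time_integral_1[OF t])
        finally have eq: "time_integral t (\<lambda>s. k0 n s \<omega> - L) = time_integral t (\<lambda>s. k0 n s \<omega>) - L * t" .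
        have "w n t \<omega> = exp (L * t + - time_integral t (\<lambda>s. k0 n s \<omega>))" unfolding w_def eq by simp
        then show "w n t \<omega> = exp (L * t) * v n t \<omega>" unfolding exp_add v_def .
      qed
    qed
    have vb: "AE \<omega> in M. \<forall>t\<in>{0..T}. 0 < v n t \<omega> \<and> v n t \<omega> \<le> 1 \<and> v n T \<omega> \<le> v n t \<omega>"
      using k0i[of n]
    proof eventually_elim
      case (elim \<omega>)
      show ?case
      proof
        fix t assume t: "t \<in> {0..T}"
        have "0 \<le> time_integral t (\<lambda>s. k0 n s \<omega>)" unfolding time_integral_def by (rule integral_nonneg_AE) (auto simp: k00)
        moreover have "time_integral t (\<lambda>s. k0 n s \<omega>) \<le> time_integral T (\<lambda>s. k0 n s \<omega>)" by (rule integrable_time_integral_mono[OF elim k00]) (use t in auto)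
        ultimately show "0 < v n t \<omega> \<and> v n t \<omega> \<le> 1 \<and> v n T \<omega> \<le> v n t \<omega>" by (simp add: v_def)
      qed
    qed
    \<comment> \<open>\<open>v * k0\<close> is minus the derivative of \<open>v\<close>.  Its integral is therefore at most \<open>1\<close>, however large the
       integral of \<open>q\<close> is; this bounds the squared diffusion coefficient \<open>e\<^sup>2\<close> in \<open>e2\<close>.\<close>
    have vk: "AE \<omega> in M. integrable Leb (\<lambda>s. v n s \<omega> * k0 n s \<omega>) \<and> (\<integral>s. v n s \<omega> * k0 n s \<omega> \<partial>Leb) = 1 - v n T \<omega>"
      using k0i[of n] vb AE_space
    proof eventually_elim
      case (elim \<omega>)
      have m: "(\<lambda>s. v n s \<omega>) \<in> borel_measurable Leb"
        unfolding v_def by (rule joint_section[OF progressive_joint[OF progressive_exp[OF progressive_minus[OF progressive_time_integral[OF pk0]]]] elim(3)])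
      have i: "integrable Leb (\<lambda>s. v n s \<omega> * k0 n s \<omega>)" by (rule L1_bounded_mult[OF m elim(1), of 1]) (use elim(2) in \<open>force simp: abs_if\<close>)
      have "(\<integral>s. v n s \<omega> * k0 n s \<omega> \<partial>Leb) = time_integral T (\<lambda>s. v n s \<omega> * k0 n s \<omega>)" by (rule time_integral_T[symmetric]) (use i in auto)
      also have "\<dots> = 1 - v n T \<omega>" using exp_time_integral[OF elim(1) TT] unfolding v_def by simp
      finally show ?case using i by blast
    qed
    have e2: "AE \<omega> in M. (\<integral>s. (e s \<omega>)\<^sup>2 \<partial>Leb) \<le> 4 * real (Suc n) * exp (2 * L * T)"
      using f(7) vk vb wv
    proof eventually_elim
      case (elim \<omega>)
      let ?C = "4 * real (Suc n) * exp (2 * L * T)"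
      have "(\<integral>s. (e s \<omega>)\<^sup>2 \<partial>Leb) \<le> (\<integral>s. ?C * (v n s \<omega> * k0 n s \<omega>) \<partial>Leb)"
      proof (rule integral_mono_AE[OF elim(1)])
        show "integrable Leb (\<lambda>s. ?C * (v n s \<omega> * k0 n s \<omega>))" using elim(2) by simp
        show "AE s in Leb. (e s \<omega>)\<^sup>2 \<le> ?C * (v n s \<omega> * k0 n s \<omega>)"
          using AE_Leb(2)
        proof (eventually_elim)
          case (elim s)
          then have s: "s \<in> {0..T}" by auto
          have v: "0 < v n s \<omega>" "v n s \<omega> \<le> 1" and ws: "w n s \<omega> = exp (L * s) * v n s \<omega>"
            using \<open>\<forall>t\<in>{0..T}. 0 < v n t \<omega> \<and> v n t \<omega> \<le> 1 \<and> v n T \<omega> \<le> v n t \<omega>\<close> \<open>\<forall>t\<in>{0..T}. w n t \<omega> = exp (L * t) * v n t \<omega>\<close> s by auto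
          have "(w n s \<omega>)\<^sup>2 = exp (2 * L * s) * (v n s \<omega>)\<^sup>2" unfolding ws power_mult_distrib by (simp add: exp_double[symmetric] mult.assoc)
          also have "\<dots> \<le> exp (2 * L * T) * v n s \<omega>"
            using v s L by (intro mult_mono) (auto simp: power2_eq_square mult_left_le_one_le intro!: mult_left_mono)
          finally have w2: "(w n s \<omega>)\<^sup>2 \<le> exp (2 * L * T) * v n s \<omega>" .
          have yc: "(Y s \<omega>)\<^sup>2 * (c s \<omega>)\<^sup>2 \<le> real (Suc n) * k0 n s \<omega>"
          proof -
            have "real (Suc n) * k0 n s \<omega> = q s \<omega>" unfolding k0_def by (simp del: of_nat_Suc)
            then show ?thesis unfolding q_def by simp
          qed
          have "(e s \<omega>)\<^sup>2 = 4 * ((w n s \<omega>)\<^sup>2 * ((Y s \<omega>)\<^sup>2 * (c s \<omega>)\<^sup>2))" unfolding e_def by (simp add: power_mult_distrib)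
          also have "\<dots> \<le> 4 * ((exp (2 * L * T) * v n s \<omega>) * (real (Suc n) * k0 n s \<omega>))"
            using v by (intro mult_left_mono mult_mono w2 yc) auto
          also have "\<dots> = ?C * (v n s \<omega> * k0 n s \<omega>)" by (simp only: mult_ac)
          finally show ?case .
        qed
      qed
      also have "\<dots> = ?C * (1 - v n T \<omega>)" using elim(2) by simp
      also have "\<dots> \<le> ?C * 1" using elim(3) TT by (intro mult_left_mono) (auto simp: less_imp_le)
      finally show ?case by simp
    qed
    note EN = stoch_int_expectation[OF N _ e2]
    \<comment> \<open>The stochastic integral \<open>N\<close> has mean zero, hence the mean of \<open>r\<close> is that of its second summand, the
       price of the weight.\<close>
    define r where "r \<omega> = - (N T \<omega> - N t \<omega>) + exp (L * T) * (S \<omega> * (1 - v n T \<omega>))" for \<omega>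
    have Sv: "integrable M (\<lambda>\<omega>. S \<omega> * (1 - v n T \<omega>))"
    proof (rule Bochner_Integration.integrable_bound[OF Si])
      show "(\<lambda>\<omega>. S \<omega> * (1 - v n T \<omega>)) \<in> borel_measurable M" using v_meas[OF TT] by measurable
      show "AE \<omega> in M. norm (S \<omega> * (1 - v n T \<omega>)) \<le> norm (S \<omega>)"
        using vb
      proof eventually_elim
        case (elim \<omega>)
        then have "0 < v n T \<omega> \<and> v n T \<omega> \<le> 1" using TT by blast
        then have "\<bar>1 - v n T \<omega>\<bar> \<le> 1" by simp
        then show ?case using S0[of \<omega>] by (simp add: abs_mult mult_left_le)
      qed
    qed
    have ri: "integrable M r" unfolding r_def using EN(1)[OF TT] EN(1)[OF t] Sv by auto
    have rE: "expectation r = exp (L * T) * expectation (\<lambda>\<omega>. S \<omega> * (1 - v n T \<omega>))"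
      unfolding r_def using EN[OF TT] EN[OF t] Sv by simp
    have path: "AE \<omega> in M. v n T \<omega> * \<Phi> \<omega> \<le> r \<omega>"
      using wv vb vk YT SY f(6) y(7) bound
    proof eventually_elim
      case (elim \<omega>)
      have vT: "0 < v n T \<omega>" using elim(2) TT by blast
      let ?i = "indicator {t..<T} :: real \<Rightarrow> real"
      have NTt: "- (N T \<omega> - N t \<omega>) = (Y t \<omega>)\<^sup>2 * w n t \<omega> + (\<integral>s. ?i s * d s \<omega> \<partial>Leb)"
        using time_integral_diff[OF elim(6), of t T] t elim(4) unfolding N_def by simp
      have Yw: "v n T \<omega> * (Y t \<omega>)\<^sup>2 \<le> (Y t \<omega>)\<^sup>2 * w n t \<omega>"
      proof -
        have "1 * v n t \<omega> \<le> exp (L * t) * v n t \<omega>" using L t elim(2) by (intro mult_right_mono) (auto simp: less_imp_le)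
        moreover have "v n T \<omega> \<le> v n t \<omega>" "w n t \<omega> = exp (L * t) * v n t \<omega>" using elim(1,2) t by blast+
        ultimately have "v n T \<omega> \<le> w n t \<omega>" by simp
        then show ?thesis by (simp add: mult.commute[of "(Y t \<omega>)\<^sup>2"] mult_right_mono)
      qed
      have "(\<integral>s. v n T \<omega> / 2 * (?i s * (c s \<omega>)\<^sup>2) - exp (L * T) * S \<omega> * (v n s \<omega> * k0 n s \<omega>) \<partial>Leb) \<le> (\<integral>s. ?i s * d s \<omega> \<partial>Leb)"
      proof (rule integral_mono_AE)
        show "integrable Leb (\<lambda>s. v n T \<omega> / 2 * (?i s * (c s \<omega>)\<^sup>2) - exp (L * T) * S \<omega> * (v n s \<omega> * k0 n s \<omega>))"
          using elim(3) time_integral_integrable[OF elim(7)] by auto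
        show "integrable Leb (\<lambda>s. ?i s * d s \<omega>)" by (rule time_integral_integrable[OF elim(6)])
        show "AE s in Leb. v n T \<omega> / 2 * (?i s * (c s \<omega>)\<^sup>2) - exp (L * T) * S \<omega> * (v n s \<omega> * k0 n s \<omega>) \<le> ?i s * d s \<omega>"
          using AE_Leb(2) elim(8)
        proof (eventually_elim)
          case (elim s)
          then have s: "s \<in> {0..T}" by auto
          have v: "0 < v n s \<omega>" "v n s \<omega> \<le> 1" "v n T \<omega> \<le> v n s \<omega>" and ws: "w n s \<omega> = exp (L * s) * v n s \<omega>" and ys: "(Y s \<omega>)\<^sup>2 \<le> S \<omega>"
            using \<open>\<forall>t\<in>{0..T}. 0 < v n t \<omega> \<and> v n t \<omega> \<le> 1 \<and> v n T \<omega> \<le> v n t \<omega>\<close> \<open>\<forall>t\<in>{0..T}. w n t \<omega> = exp (L * t) * v n t \<omega>\<close>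
              \<open>\<forall>t\<in>{0..T}. (Y t \<omega>)\<^sup>2 \<le> S \<omega>\<close> s by auto
          have w1: "v n s \<omega> \<le> w n s \<omega>" unfolding ws using L s v(1) by (simp add: mult_le_cancel_right1)
          have w2: "w n s \<omega> \<le> exp (L * T) * v n s \<omega>" unfolding ws using L s v(1) by (auto intro!: mult_right_mono mult_left_mono)
          have w0: "0 \<le> w n s \<omega>" using w1 v(1) by linarith
          have d_eq: "d s \<omega> = w n s \<omega> * (2 * Y s \<omega> * a s \<omega> + (c s \<omega>)\<^sup>2 + L * (Y s \<omega>)\<^sup>2) - w n s \<omega> * (k0 n s \<omega> * (Y s \<omega>)\<^sup>2)"
            unfolding d_def by (simp add: algebra_simps)
          have "w n s \<omega> * ((c s \<omega>)\<^sup>2 / 2) \<le> w n s \<omega> * (2 * Y s \<omega> * a s \<omega> + (c s \<omega>)\<^sup>2 + L * (Y s \<omega>)\<^sup>2)"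
            using bsde_drift_bound[OF elim(2) K] w0 unfolding L_def by (intro mult_left_mono) auto
          moreover have "v n T \<omega> * ((c s \<omega>)\<^sup>2 / 2) \<le> w n s \<omega> * ((c s \<omega>)\<^sup>2 / 2)"
            using v w1 by (intro mult_right_mono) auto
          moreover have "w n s \<omega> * (k0 n s \<omega> * (Y s \<omega>)\<^sup>2) \<le> (exp (L * T) * v n s \<omega>) * (k0 n s \<omega> * S \<omega>)"
            using w2 w0 ys k00 v by (intro mult_mono mult_left_mono mult_nonneg_nonneg) auto
          ultimately have d1: "v n T \<omega> * ((c s \<omega>)\<^sup>2 / 2) - exp (L * T) * S \<omega> * (v n s \<omega> * k0 n s \<omega>) \<le> d s \<omega>"
            unfolding d_eq by (simp add: mult_ac)
          have nn: "0 \<le> exp (L * T) * S \<omega> * (v n s \<omega> * k0 n s \<omega>)" using S0 v k00 by (intro mult_nonneg_nonneg) (auto simp: less_imp_le)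
          show ?case using d1 nn by (cases "s \<in> {t..<T}") auto
        qed
      qed
      moreover have "(\<integral>s. v n T \<omega> / 2 * (?i s * (c s \<omega>)\<^sup>2) - exp (L * T) * S \<omega> * (v n s \<omega> * k0 n s \<omega>) \<partial>Leb) =
        v n T \<omega> / 2 * (\<integral>s. ?i s * (c s \<omega>)\<^sup>2 \<partial>Leb) - exp (L * T) * S \<omega> * (1 - v n T \<omega>)"
        using elim(3) time_integral_integrable[OF elim(7)] by simp
      moreover have "(\<integral>s. ?i s * (c s \<omega>)\<^sup>2 \<partial>Leb) = time_integral T (\<lambda>s. (c s \<omega>)\<^sup>2) - time_integral t (\<lambda>s. (c s \<omega>)\<^sup>2)"
        by (rule time_integral_diff[symmetric, OF elim(7)]) (use t in auto)
      ultimately have fin: "v n T \<omega> / 2 * (time_integral T (\<lambda>s. (c s \<omega>)\<^sup>2) - time_integral t (\<lambda>s. (c s \<omega>)\<^sup>2)) - exp (L * T) * S \<omega> * (1 - v n T \<omega>) \<le> (\<integral>s. ?i s * d s \<omega> \<partial>Leb)" by simp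
      have "v n T \<omega> * \<Phi> \<omega> = v n T \<omega> * (Y t \<omega>)\<^sup>2 + v n T \<omega> / 2 * (time_integral T (\<lambda>s. (c s \<omega>)\<^sup>2) - time_integral t (\<lambda>s. (c s \<omega>)\<^sup>2))"
        unfolding \<Phi>_def by (simp add: distrib_left)
      moreover have "exp (L * T) * S \<omega> * (1 - v n T \<omega>) = exp (L * T) * (S \<omega> * (1 - v n T \<omega>))" by (rule mult.assoc)
      ultimately show ?case unfolding r_def NTt using Yw fin by linarith
    qed
    have r0: "AE \<omega> in M. 0 \<le> r \<omega>"
      using path Ph0 vb
    proof eventually_elim
      case (elim \<omega>)
      have "0 \<le> v n T \<omega> * \<Phi> \<omega>" using elim TT by (intro mult_nonneg_nonneg) (auto simp: less_imp_le)
      then show ?case using elim(1) by linarith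
    qed
    have "(\<integral>\<^sup>+ \<omega>. ennreal (v n T \<omega> * \<Phi> \<omega>) \<partial>M) \<le> (\<integral>\<^sup>+ \<omega>. ennreal (r \<omega>) \<partial>M)"
      by (rule nn_integral_mono_AE) (use path in \<open>auto elim!: eventually_mono intro!: ennreal_leI\<close>)
    also have "\<dots> = ennreal (expectation r)" by (rule nn_integral_eq_integral[OF ri r0])
    finally show ?thesis unfolding rE .
  qed
  \<comment> \<open>As \<open>n\<close> grows the weights tend to one and the bound in \<open>est\<close> tends to zero, by dominated convergence.\<close>
  have lim: "(\<lambda>n. exp (L * T) * expectation (\<lambda>\<omega>. S \<omega> * (1 - v n T \<omega>))) \<longlonglongrightarrow> exp (L * T) * expectation (\<lambda>\<omega>. 0)"
  proof (intro tendsto_mult tendsto_const integral_dominated_convergence[where w = S])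
    show "(\<lambda>\<omega>. S \<omega> * (1 - v n T \<omega>)) \<in> borel_measurable M" for n using v_meas[OF TT] by measurable
    show "AE \<omega> in M. (\<lambda>n. S \<omega> * (1 - v n T \<omega>)) \<longlonglongrightarrow> 0"
    proof (rule AE_I2)
      fix \<omega>
      have "(\<lambda>n. S \<omega> * (1 - v n T \<omega>)) \<longlonglongrightarrow> S \<omega> * (1 - 1)" by (intro tendsto_intros vT_lim)
      then show "(\<lambda>n. S \<omega> * (1 - v n T \<omega>)) \<longlonglongrightarrow> 0" by simp
    qed
    show "AE \<omega> in M. norm (S \<omega> * (1 - v n T \<omega>)) \<le> S \<omega>" for n
      using k0i[of n]
    proof eventually_elim
      case (elim \<omega>)
      have "0 \<le> time_integral T (\<lambda>s. k0 n s \<omega>)" unfolding time_integral_def by (rule integral_nonneg_AE) (auto simp: k00)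
      then have "\<bar>1 - v n T \<omega>\<bar> \<le> 1" by (simp add: v_def)
      then show ?case using S0[of \<omega>] by (simp add: abs_mult mult_left_le)
    qed
  qed (use Si in auto)
  have "(\<integral>\<^sup>+ \<omega>. ennreal (\<Phi> \<omega>) \<partial>M) = (\<integral>\<^sup>+ \<omega>. liminf (\<lambda>n. ennreal (v n T \<omega> * \<Phi> \<omega>)) \<partial>M)"
  proof (rule nn_integral_cong)
    fix \<omega>
    have "(\<lambda>n. ennreal (v n T \<omega> * \<Phi> \<omega>)) \<longlonglongrightarrow> ennreal (1 * \<Phi> \<omega>)" by (intro tendsto_ennrealI tendsto_intros vT_lim)
    from lim_imp_Liminf[OF _ this] show "ennreal (\<Phi> \<omega>) = liminf (\<lambda>n. ennreal (v n T \<omega> * \<Phi> \<omega>))" by simp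
  qed
  also have "\<dots> \<le> liminf (\<lambda>n. \<integral>\<^sup>+ \<omega>. ennreal (v n T \<omega> * \<Phi> \<omega>) \<partial>M)"
    by (rule nn_integral_liminf) (use v_meas[OF TT] in measurable)
  also have "\<dots> \<le> liminf (\<lambda>n. ennreal (exp (L * T) * expectation (\<lambda>\<omega>. S \<omega> * (1 - v n T \<omega>))))"
    by (rule Liminf_mono) (simp add: est always_eventually)
  also have "\<dots> = ennreal (exp (L * T) * expectation (\<lambda>\<omega>. 0))"
    by (rule lim_imp_Liminf[OF _ tendsto_ennrealI[OF lim]]) simp
  finally have "(\<integral>\<^sup>+ \<omega>. ennreal (\<Phi> \<omega>) \<partial>M) = 0" by simp
  then have "AE \<omega> in M. ennreal (\<Phi> \<omega>) = 0" by (subst (asm) nn_integral_0_iff_AE) auto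
  with Ph0 show ?thesis unfolding \<Phi>_def by eventually_elim (simp add: ennreal_eq_0_iff)
qed

text \<open>
  By continuity it suffices to consider \<open>Y\<close> at countably many times; the time \<open>0\<close> gives \<open>c = 0\<close>.
\<close>

lemma bsde_uniqueness:
  assumes Y: "weak_ito Y a c" and YT: "AE \<omega> in M. Y T \<omega> = 0" and S2: "square_sup_integrable M T Y"
    and K: "0 \<le> K" and bound: "AE \<omega> in M. AE s in Leb. \<bar>a s \<omega>\<bar> \<le> K * (\<bar>Y s \<omega>\<bar> + \<bar>c s \<omega>\<bar>)"
  shows "AE \<omega> in M. \<forall>t\<in>{0..T}. Y t \<omega> = 0" "AE \<omega> in M. AE s in Leb. c s \<omega> = 0"
proof -
  note y = weak_itoD[OF Y]
  note at = bsde_uniqueness_at[OF Y YT S2 K bound]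
  have pos: "AE \<omega> in M. \<forall>t\<in>{0..T}. time_integral t (\<lambda>s. (c s \<omega>)\<^sup>2) \<le> time_integral T (\<lambda>s. (c s \<omega>)\<^sup>2)"
    using y(7) by eventually_elim (auto intro!: integrable_time_integral_mono)
  have Yt: "AE \<omega> in M. Y t \<omega> = 0" if t: "t \<in> {0..T}" for t
    using at[OF t] pos
  proof eventually_elim
    case (elim \<omega>)
    have "time_integral t (\<lambda>s. (c s \<omega>)\<^sup>2) \<le> time_integral T (\<lambda>s. (c s \<omega>)\<^sup>2)" using elim(2) t by blast
    then have "0 \<le> (time_integral T (\<lambda>s. (c s \<omega>)\<^sup>2) - time_integral t (\<lambda>s. (c s \<omega>)\<^sup>2)) / 2" by simp
    from add_nonneg_eq_0_iff[OF zero_le_power2 this, THEN iffD1, OF elim(1)] show ?case by simp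
  qed
  have "AE \<omega> in M. \<forall>m. \<forall>i. i \<le> 2 ^ m \<longrightarrow> Y (grid m i) \<omega> = 0"
    unfolding AE_all_countable using Yt grid_le_T by (auto simp: AE_all_countable intro!: AE_impI)
  with y(3) show "AE \<omega> in M. \<forall>t\<in>{0..T}. Y t \<omega> = 0"
  proof eventually_elim
    case (elim \<omega>)
    show ?case
    proof
      fix t assume t: "t \<in> {0..T}"
      have "Y (grid_floor m t) \<omega> = 0" for m using elim(2) grid_index_le[of t m] t by (auto simp: grid_floor_def)
      with grid_floor_path_tendsto[OF elim(1) t] show "Y t \<omega> = 0" by (simp add: LIMSEQ_const_iff)
    qed
  qed
  have "0 \<in> {0..T}" using T_pos by simp
  from at[OF this] y(7) AE_space show "AE \<omega> in M. AE s in Leb. c s \<omega> = 0"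
  proof eventually_elim
    case (elim \<omega>)
    have m: "(\<lambda>s. c s \<omega>) \<in> borel_measurable Leb" by (rule joint_section[OF progressive_joint[OF y(5)] elim(3)])
    have "(\<lambda>s. (c s \<omega>)\<^sup>2) \<in> borel_measurable Leb" using m by measurable
    from time_integral_T[OF this] have T: "time_integral T (\<lambda>s. (c s \<omega>)\<^sup>2) = (\<integral>s. (c s \<omega>)\<^sup>2 \<partial>Leb)" .
    have "0 \<le> ((\<integral>s. (c s \<omega>)\<^sup>2 \<partial>Leb) - 0) / 2" by simp
    from add_nonneg_eq_0_iff[OF zero_le_power2 this, THEN iffD1, OF elim(1)[unfolded T time_integral_0]]
    have "(\<integral>s. (c s \<omega>)\<^sup>2 \<partial>Leb) = 0" by simp
    then have "AE s in Leb. (c s \<omega>)\<^sup>2 = 0" using integral_nonneg_eq_0_iff_AE[OF elim(2)] by simp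
    then show ?case by eventually_elim simp
  qed
qed

section \<open>Ito processes are weak Ito processes\<close>

lemma B_continuous: "AE \<omega> in M. continuous_on {0..T} (\<lambda>t. B t \<omega>)"
  using brownian unfolding brownian_motion_def by auto

text \<open>
  The number of grid points in \<open>[0, x)\<close>.
\<close>

definition grid_ceil :: "nat \<Rightarrow> real \<Rightarrow> nat" where "grid_ceil m x = nat \<lceil>x * 2 ^ m / T\<rceil>"

lemma grid_less_iff_grid_ceil: "grid m j < x \<longleftrightarrow> j < grid_ceil m x"
proof -
  have "grid m j < x \<longleftrightarrow> real j < x * 2 ^ m / T" using T_pos by (simp add: grid_def field_simps)
  also have "\<dots> \<longleftrightarrow> int j < \<lceil>x * 2 ^ m / T\<rceil>" by (simp add: less_ceiling_iff)
  also have "\<dots> \<longleftrightarrow> j < grid_ceil m x" unfolding grid_ceil_def by linarith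
  finally show ?thesis .
qed

lemma grid_grid_ceil_tendsto: assumes x: "0 \<le> x" shows "(\<lambda>m. grid m (grid_ceil m x)) \<longlonglongrightarrow> x"
proof (rule real_tendsto_sandwich)
  show "\<forall>\<^sub>F m in sequentially. x \<le> grid m (grid_ceil m x)"
    using grid_less_iff_grid_ceil[of _ "grid_ceil _ x" x] by (intro always_eventually allI) (simp add: not_less[symmetric])
  show "\<forall>\<^sub>F m in sequentially. grid m (grid_ceil m x) \<le> x + T / 2 ^ m"
  proof (intro always_eventually allI)
    fix m
    show "grid m (grid_ceil m x) \<le> x + T / 2 ^ m"
    proof (cases "grid_ceil m x")
      case 0
      then show ?thesis using x T_pos by simp
    next
      case (Suc j)
      then have "grid m j < x" using grid_less_iff_grid_ceil by simp
      then show ?thesis unfolding Suc grid_Suc by simp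
    qed
  qed
  show "(\<lambda>m. x + T / 2 ^ m) \<longlonglongrightarrow> x" using tendsto_add[OF tendsto_const mesh_tendsto, of x] by simp
qed (rule tendsto_const)

lemma initial_segment_increment:
  "(\<Sum>j<grid_index m t. indicator {..<x} (grid m j) * dB m j \<omega>) = B (grid m (min (grid_ceil m x) (grid_index m t))) \<omega> - B 0 \<omega>"
proof -
  have "(\<Sum>j<grid_index m t. indicator {..<x} (grid m j) * dB m j \<omega>) = (\<Sum>j\<in>{..<grid_index m t} \<inter> {..<grid_ceil m x}. dB m j \<omega>)"
    by (rule sum.mono_neutral_cong_right) (auto simp: grid_less_iff_grid_ceil)
  also have "{..<grid_index m t} \<inter> {..<grid_ceil m x} = {..<min (grid_ceil m x) (grid_index m t)}" by auto
  also have "(\<Sum>j<min (grid_ceil m x) (grid_index m t). dB m j \<omega>) = B (grid m (min (grid_ceil m x) (grid_index m t))) \<omega> - B (grid m 0) \<omega>"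
    using sum_lessThan_telescope[of "\<lambda>j. B (grid m j) \<omega>"] by blast
  finally show ?thesis by simp
qed

lemma initial_segment_tendsto:
  assumes c: "continuous_on {0..T} (\<lambda>t. B t \<omega>)" and t: "t \<in> {0..T}" and x: "0 \<le> x" "x \<le> T"
  shows "(\<lambda>m. B (grid m (min (grid_ceil m x) (grid_index m t))) \<omega>) \<longlonglongrightarrow> B (min x t) \<omega>"
proof -
  have "grid m (min (grid_ceil m x) (grid_index m t)) = min (grid m (grid_ceil m x)) (grid_floor m t)" for m
    unfolding grid_floor_def by (simp add: min_def)
  then have "(\<lambda>m. grid m (min (grid_ceil m x) (grid_index m t))) \<longlonglongrightarrow> min x t"
    using tendsto_min[OF grid_grid_ceil_tendsto[OF x(1)] grid_floor_tendsto[of t]] t by simp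
  moreover have "grid m (min (grid_ceil m x) (grid_index m t)) \<in> {0..T}" for m
    using grid_index_le[of t m] t by (auto intro!: grid_le_T)
  ultimately show ?thesis using continuous_on_tendsto_compose[OF c, of "\<lambda>m. grid m (min (grid_ceil m x) (grid_index m t))" "min x t"] t x by auto
qed

lemma simple_data_partition:
  assumes "simple_data M B T n \<tau> \<xi>"
  shows "i \<le> j \<Longrightarrow> j \<le> n \<Longrightarrow> \<tau> i \<le> \<tau> j" "i \<le> n \<Longrightarrow> \<tau> i \<in> {0..T}"
proof -
  have st: "\<tau> i \<le> \<tau> (Suc i)" if "i < n" for i using assms that unfolding simple_data_def by auto
  have mono: "\<tau> i \<le> \<tau> j" if "i \<le> j" "j \<le> n" for i j
    using that
  proof (induction j rule: dec_induct)
    case (step j)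
    then have "\<tau> i \<le> \<tau> j" "\<tau> j \<le> \<tau> (Suc j)" using st by auto
    then show ?case by simp
  qed simp
  show "i \<le> j \<Longrightarrow> j \<le> n \<Longrightarrow> \<tau> i \<le> \<tau> j" by (rule mono)
  show "i \<le> n \<Longrightarrow> \<tau> i \<in> {0..T}"
    using mono[of 0 i] mono[of i n] assms unfolding simple_data_def by auto
qed

lemma simple_process_joint:
  assumes s: "simple_data M B T n \<tau> \<xi>"
  shows "jointly_measurable (simple_process n \<tau> \<xi>)"
  unfolding simple_process_def split_beta'
proof (intro borel_measurable_sum borel_measurable_times)
  fix i assume "i \<in> {..<n}"
  then have i: "i < n" by simp
  have "\<xi> i \<in> borel_measurable M" using s i simple_data_partition(2)[OF s, of i] unfolding simple_data_def by (auto intro: filtration_measurableD)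
  then show "(\<lambda>p. \<xi> i (snd p)) \<in> borel_measurable (Leb \<Otimes>\<^sub>M M)" by (rule measurable_compose[OF measurable_snd])
  show "(\<lambda>p. indicator {\<tau> i<..\<tau> (Suc i)} (fst p) :: real) \<in> borel_measurable (Leb \<Otimes>\<^sub>M M)"
    by (rule measurable_compose[OF measurable_fst borel_Leb]) measurable
qed

lemma simple_process_bound:
  "\<bar>simple_process n \<tau> \<xi> t \<omega>\<bar> \<le> (\<Sum>i<n. \<bar>\<xi> i \<omega>\<bar>)"
  unfolding simple_process_def by (rule order_trans[OF sum_abs sum_mono]) (auto simp: indicator_def)

text \<open>
  Simple processes may jump at arbitrary times. Rounding the jump times up to the grid gives step
  processes, and by continuity of Brownian paths the integrals converge.
\<close>

lemma simple_approximation: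
  assumes s: "simple_data M B T n \<tau> \<xi>"
  obtains H where "\<And>m. grid_step m (H m)" "prob_null (\<lambda>m. time_norm (\<lambda>t \<omega>. H m t \<omega> - simple_process n \<tau> \<xi> t \<omega>))"
    "\<And>t. t \<in> {0..T} \<Longrightarrow> prob_null (\<lambda>m \<omega>. step_integral m (H m) t \<omega> - simple_integral B n \<tau> \<xi> t \<omega>)"
proof -
  \<comment> \<open>The simple process is sampled at the last grid point.  Its intervals are open on the left and closed
     on the right, those of a step process the other way round; this matters only at the points \<open>\<tau> i\<close>.\<close>
  define H where "H m t \<omega> = (if t < T then \<Sum>i<n. \<xi> i \<omega> * indicator {\<tau> i..<\<tau> (Suc i)} (grid_floor m t) else 0)" for m t \<omega>
  let ?P = "simple_process n \<tau> \<xi>"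
  have tau: "\<tau> i \<in> {0..T}" "\<tau> (Suc i) \<in> {0..T}" "\<tau> i \<le> \<tau> (Suc i)" if "i < n" for i
    using simple_data_partition[OF s] that by auto
  have \<xi>: "\<xi> i \<in> borel_measurable (Filt (\<tau> i))" "\<exists>C. \<forall>\<omega>\<in>space M. \<bar>\<xi> i \<omega>\<bar> \<le> C" if "i < n" for i
    using s that unfolding simple_data_def by auto
  have "\<forall>i. \<exists>C. i < n \<longrightarrow> (\<forall>\<omega>\<in>space M. \<bar>\<xi> i \<omega>\<bar> \<le> C)" using \<xi>(2) by blast
  from choice[OF this] obtain C where C: "\<forall>i. i < n \<longrightarrow> (\<forall>\<omega>\<in>space M. \<bar>\<xi> i \<omega>\<bar> \<le> C i)" ..
  have fT: "grid_floor m t < T" if "0 \<le> t" "t < T" for m t using grid_floor_bounds(1)[OF that(1), of m] that by simp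
  have H: "grid_step m (H m)" for m
  proof -
    have "H m (grid m j) \<in> borel_measurable (Filt (grid m j))" if j: "j < 2 ^ m" for j
    proof -
      have "(\<lambda>\<omega>. \<xi> i \<omega> * indicator {\<tau> i..<\<tau> (Suc i)} (grid m j)) \<in> borel_measurable (Filt (grid m j))" if i: "i < n" for i
      proof (cases "grid m j \<in> {\<tau> i..<\<tau> (Suc i)}")
        case True
        then show ?thesis using filtration_measurable_mono[OF \<xi>(1)[OF i], of "grid m j"] by simp
      qed simp
      then have "(\<lambda>\<omega>. \<Sum>i<n. \<xi> i \<omega> * indicator {\<tau> i..<\<tau> (Suc i)} (grid m j)) \<in> borel_measurable (Filt (grid m j))"
        by (intro borel_measurable_sum) auto
      then show ?thesis using grid_less_T[OF j] unfolding H_def grid_floor_def grid_index_grid by simp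
    qed
    moreover have "\<bar>H m t \<omega>\<bar> \<le> (\<Sum>i<n. \<bar>C i\<bar>)" if "\<omega> \<in> space M" for t \<omega>
    proof (cases "t < T")
      case True
      have "\<bar>\<Sum>i<n. \<xi> i \<omega> * indicator {\<tau> i..<\<tau> (Suc i)} (grid_floor m t)\<bar> \<le> (\<Sum>i<n. \<bar>C i\<bar>)"
      proof (rule order_trans[OF sum_abs sum_mono])
        fix i assume "i \<in> {..<n}"
        then have "\<bar>\<xi> i \<omega>\<bar> \<le> C i" using C that by auto
        then show "\<bar>\<xi> i \<omega> * indicator {\<tau> i..<\<tau> (Suc i)} (grid_floor m t)\<bar> \<le> \<bar>C i\<bar>" by (auto simp: indicator_def)
      qed
      then show ?thesis using True by (simp add: H_def)
    qed (simp add: H_def sum_nonneg)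
    moreover have "\<forall>s\<in>{0..<T}. \<forall>\<omega>. H m (grid_floor m s) \<omega> = H m s \<omega>" by (auto simp: H_def fT)
    moreover have "H m T = (\<lambda>_. 0)" by (simp add: H_def fun_eq_iff)
    ultimately show ?thesis unfolding grid_step_def pred_seq_def by blast
  qed
  have Pj: "jointly_measurable ?P" by (rule simple_process_joint[OF s])
  have nH: "prob_null (\<lambda>m. time_dist (H m) ?P)"
  proof (rule prob_null_AE)
    show "time_dist (H m) ?P \<in> borel_measurable M" for m by (intro time_norm_meas joint_diff_mult(1) grid_step_joint[OF H] Pj)
    show "AE \<omega> in M. (\<lambda>m. time_dist (H m) ?P \<omega>) \<longlonglongrightarrow> 0"
      using AE_space
    proof eventually_elim
      case (elim \<omega>)
      note [measurable] = joint_section[OF Pj elim] grid_step_square_integrable(2)[OF H elim]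
      let ?D = "\<Sum>i<n. \<bar>\<xi> i \<omega>\<bar>"
      have "(\<lambda>m. \<integral>t. (H m t \<omega> - ?P t \<omega>)\<^sup>2 \<partial>Leb) \<longlonglongrightarrow> (\<integral>t. 0 \<partial>Leb)"
      proof (rule integral_dominated_convergence[where w = "\<lambda>_. (2 * ?D)\<^sup>2"])
        show "integrable Leb (\<lambda>_. (2 * ?D)\<^sup>2)" by (rule integrable_Leb_1)
        have Hb: "\<bar>H m t \<omega>\<bar> \<le> ?D" for m t
        proof (cases "t < T")
          case True
          have "\<bar>\<Sum>i<n. \<xi> i \<omega> * indicator {\<tau> i..<\<tau> (Suc i)} (grid_floor m t)\<bar> \<le> ?D"
            by (rule order_trans[OF sum_abs sum_mono]) (simp add: indicator_def)
          then show ?thesis using True by (simp add: H_def)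
        qed (simp add: H_def sum_nonneg)
        show "AE t in Leb. norm ((H m t \<omega> - ?P t \<omega>)\<^sup>2) \<le> (2 * ?D)\<^sup>2" for m
        proof (rule AE_I2)
          fix t
          have "\<bar>H m t \<omega> - ?P t \<omega>\<bar> \<le> 2 * ?D" using Hb[of m t] simple_process_bound[of n \<tau> \<xi> t \<omega>] by linarith
          then have "\<bar>H m t \<omega> - ?P t \<omega>\<bar>\<^sup>2 \<le> (2 * ?D)\<^sup>2" by (intro power_mono) auto
          then show "norm ((H m t \<omega> - ?P t \<omega>)\<^sup>2) \<le> (2 * ?D)\<^sup>2" by simp
        qed
        have "AE t in Leb. \<forall>i\<in>{..n}. t \<noteq> \<tau> i" by (rule AE_finite_allI) (auto intro: AE_Leb)
        then show "AE t in Leb. (\<lambda>m. (H m t \<omega> - ?P t \<omega>)\<^sup>2) \<longlonglongrightarrow> 0"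
          using AE_Leb(2)
        proof (eventually_elim)
          case (elim t)
          have t0: "0 \<le> t" "t < T" using elim(2) by auto
          have ev: "\<forall>\<^sub>F m in sequentially. indicator {\<tau> i..<\<tau> (Suc i)} (grid_floor m t) = (indicator {\<tau> i<..\<tau> (Suc i)} t :: real)" if i: "i < n" for i
          proof -
            have ne: "t \<noteq> \<tau> i" "t \<noteq> \<tau> (Suc i)" using elim(1) i by auto
            have e: "\<forall>\<^sub>F m in sequentially. x < t \<longrightarrow> x < grid_floor m t" for x
              using order_tendstoD(1)[OF grid_floor_tendsto[OF t0(1)], of x] by (cases "x < t") auto
            show ?thesis using e[of "\<tau> i"] e[of "\<tau> (Suc i)"]
            proof eventually_elim
              case (elim m)
              then show ?case using grid_floor_bounds(1)[OF t0(1), of m] ne by (auto simp: indicator_def)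
            qed
          qed
          have "\<forall>\<^sub>F m in sequentially. \<forall>i\<in>{..<n}. indicator {\<tau> i..<\<tau> (Suc i)} (grid_floor m t) = (indicator {\<tau> i<..\<tau> (Suc i)} t :: real)"
            by (rule eventually_ball_finite) (use ev in auto)
          then have "\<forall>\<^sub>F m in sequentially. (H m t \<omega> - ?P t \<omega>)\<^sup>2 = 0"
          proof eventually_elim
            case (elim m)
            have "H m t \<omega> = ?P t \<omega>" unfolding H_def simple_process_def using t0 elim by (auto intro!: sum.cong)
            then show ?case by simp
          qed
          then show ?case by (rule tendsto_eventually)
        qed
      qed measurable
      then have "(\<lambda>m. sqrt (\<integral>t. (H m t \<omega> - ?P t \<omega>)\<^sup>2 \<partial>Leb)) \<longlonglongrightarrow> sqrt 0" by (intro tendsto_real_sqrt) simp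
      then show ?case by (simp add: time_norm_def)
    qed
  qed
  have JH: "prob_null (\<lambda>m \<omega>. step_integral m (H m) t \<omega> - simple_integral B n \<tau> \<xi> t \<omega>)" if t: "t \<in> {0..T}" for t
  proof (rule prob_null_AE)
    have "simple_integral B n \<tau> \<xi> t \<in> borel_measurable M"
      unfolding simple_integral_def
    proof (intro borel_measurable_sum borel_measurable_times borel_measurable_diff B_measurable)
      fix i assume "i \<in> {..<n}"
      then show "\<xi> i \<in> borel_measurable M" using \<xi>(1)[of i] tau[of i] by (auto intro: filtration_measurableD)
    qed (use t tau in auto)
    then show "(\<lambda>\<omega>. step_integral m (H m) t \<omega> - simple_integral B n \<tau> \<xi> t \<omega>) \<in> borel_measurable M" for m
      by (intro borel_measurable_diff step_integral_meas[OF H t])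
    show "AE \<omega> in M. (\<lambda>m. step_integral m (H m) t \<omega> - simple_integral B n \<tau> \<xi> t \<omega>) \<longlonglongrightarrow> 0"
      using B_continuous
    proof eventually_elim
      case (elim \<omega>)
      \<comment> \<open>Writing an interval as the difference of two initial segments turns the sum over the cells of the
         grid into a telescoping one.\<close>
      have eq: "step_integral m (H m) t \<omega> = (\<Sum>i<n. \<xi> i \<omega> * (B (grid m (min (grid_ceil m (\<tau> (Suc i))) (grid_index m t))) \<omega> - B (grid m (min (grid_ceil m (\<tau> i)) (grid_index m t))) \<omega>))" for m
      proof -
        have "step_integral m (H m) t \<omega> = (\<Sum>j<grid_index m t. \<Sum>i<n. \<xi> i \<omega> * (indicator {..<\<tau> (Suc i)} (grid m j) * dB m j \<omega> - indicator {..<\<tau> i} (grid m j) * dB m j \<omega>))"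
          unfolding step_integral_def
        proof (intro sum.cong refl)
          fix j assume "j \<in> {..<grid_index m t}"
          then have "grid m j < T" using grid_index_le[of t m] t by (intro grid_less_T) auto
          then have "H m (grid m j) \<omega> = (\<Sum>i<n. \<xi> i \<omega> * indicator {\<tau> i..<\<tau> (Suc i)} (grid m j))" unfolding H_def grid_floor_def grid_index_grid by simp
          also have "\<dots> = (\<Sum>i<n. \<xi> i \<omega> * (indicator {..<\<tau> (Suc i)} (grid m j) - indicator {..<\<tau> i} (grid m j)))"
            using tau(3) by (intro sum.cong refl) (force simp: indicator_def)
          finally show "H m (grid m j) \<omega> * dB m j \<omega> = (\<Sum>i<n. \<xi> i \<omega> * (indicator {..<\<tau> (Suc i)} (grid m j) * dB m j \<omega> - indicator {..<\<tau> i} (grid m j) * dB m j \<omega>))"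
            by (simp only: sum_distrib_right mult.assoc left_diff_distrib)
        qed
        also have "\<dots> = (\<Sum>i<n. \<xi> i \<omega> * ((\<Sum>j<grid_index m t. indicator {..<\<tau> (Suc i)} (grid m j) * dB m j \<omega>) - (\<Sum>j<grid_index m t. indicator {..<\<tau> i} (grid m j) * dB m j \<omega>)))"
          unfolding sum_subtractf[symmetric] sum_distrib_left by (rule sum.swap)
        finally show ?thesis unfolding initial_segment_increment by simp
      qed
      have "(\<lambda>m. step_integral m (H m) t \<omega>) \<longlonglongrightarrow> simple_integral B n \<tau> \<xi> t \<omega>"
        unfolding eq simple_integral_def
      proof (intro tendsto_sum tendsto_mult tendsto_const tendsto_diff initial_segment_tendsto[OF elim t])
      qed (use tau in auto)
      then show ?case by (rule LIM_zero)
    qed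
  qed
  show ?thesis by (rule that[OF H nH JH])
qed

lemma ito_integral_stoch_int:
  assumes "has_ito_integral M B T c I"
  shows "stoch_int I c"
proof -
  have pc: "progressive M B T c" and cf: "AE \<omega> in M. (\<integral>\<^sup>+ s. ennreal ((c s \<omega>)\<^sup>2) \<partial>Leb) < \<infinity>" and I: "continuous_process M B T I"
    using assms unfolding has_ito_integral_def by auto
  have Ip: "progressive M B T I" and Ic: "AE \<omega> in M. continuous_on {0..T} (\<lambda>t. I t \<omega>)" using I unfolding continuous_process_def by auto
  obtain n \<tau> \<xi> where sd: "\<And>k :: nat. simple_data M B T (n k) (\<tau> k) (\<xi> k)"
    and L2: "\<And>e. e > 0 \<Longrightarrow> (\<lambda>k. prob {\<omega> \<in> space M. (\<integral>\<^sup>+ s. ennreal ((simple_process (n k) (\<tau> k) (\<xi> k) s \<omega> - c s \<omega>)\<^sup>2) \<partial>Leb) > ennreal e}) \<longlonglongrightarrow> 0"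
    and ucp: "\<And>e. e > 0 \<Longrightarrow> (\<lambda>k. prob {\<omega> \<in> space M. \<exists>t\<in>{0..T}. \<bar>simple_integral B (n k) (\<tau> k) (\<xi> k) t \<omega> - I t \<omega>\<bar> > e}) \<longlonglongrightarrow> 0"
    using assms unfolding has_ito_integral_def by blast
  let ?P = "\<lambda>k. simple_process (n k) (\<tau> k) (\<xi> k)" and ?I = "\<lambda>k. simple_integral B (n k) (\<tau> k) (\<xi> k)"
  note cj = progressive_joint[OF pc]
  have c2: "AE \<omega> in M. integrable Leb (\<lambda>s. (c s \<omega>)\<^sup>2)"
    using cf AE_space
  proof eventually_elim
    case (elim \<omega>)
    note [measurable] = joint_section[OF cj elim(2)]
    show ?case by (rule integrableI_nonneg) (use elim in auto)
  qed
  have Im: "I t \<in> borel_measurable M" if "t \<in> {0..T}" for t by (rule progressive_meas[OF Ip that])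
  have Pj: "jointly_measurable (?P k)" for k by (rule simple_process_joint[OF sd])
  have nm: "time_dist (?P k) c \<in> borel_measurable M" for k by (intro time_norm_meas joint_diff_mult(1) Pj cj)
  have tau: "\<tau> k i \<in> {0..T}" if "i \<le> n k" for k i using simple_data_partition(2)[OF sd that] .
  have SIm: "?I k t \<in> borel_measurable M" if t: "t \<in> {0..T}" for k t
    unfolding simple_integral_def
  proof (intro borel_measurable_sum borel_measurable_times borel_measurable_diff B_measurable)
    fix i assume "i \<in> {..<n k}"
    then show "\<xi> k i \<in> borel_measurable M" using sd[of k] tau[of i k] unfolding simple_data_def by (auto intro: filtration_measurableD)
  qed (use t tau in force)+
  have r1: "(\<lambda>k. prob_size (time_dist (?P k) c)) \<longlonglongrightarrow> 0"
  proof (rule prob_size_LIMSEQ_I)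
    fix e :: real assume e: "0 < e"
    let ?A = "\<lambda>k. {\<omega> \<in> space M. (\<integral>\<^sup>+ s. ennreal ((?P k s \<omega> - c s \<omega>)\<^sup>2) \<partial>Leb) > ennreal ((e / 2)\<^sup>2)}"
    have A: "?A k \<in> sets M" for k
    proof -
      have "(\<lambda>(\<omega>, s). ?P k s \<omega> - c s \<omega>) \<in> borel_measurable (M \<Otimes>\<^sub>M Leb)" by (rule joint_swap[OF joint_diff_mult(1)[OF Pj cj]])
      then have "(\<lambda>(\<omega>, s). ennreal ((?P k s \<omega> - c s \<omega>)\<^sup>2)) \<in> borel_measurable (M \<Otimes>\<^sub>M Leb)" by measurable
      from sigma_finite_measure.borel_measurable_nn_integral[OF sigma_finite_Leb this]
      have [measurable]: "(\<lambda>\<omega>. \<integral>\<^sup>+ s. ennreal ((?P k s \<omega> - c s \<omega>)\<^sup>2) \<partial>Leb) \<in> borel_measurable M" .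
      show ?thesis by measurable
    qed
    have "\<forall>\<^sub>F k in sequentially. prob (?A k) < e / 2" by (rule order_tendstoD(2)[OF L2]) (use e in auto)
    then show "\<forall>\<^sub>F k in sequentially. prob_size (time_dist (?P k) c) < e"
    proof eventually_elim
      case (elim k)
      have "prob_size (time_dist (?P k) c) \<le> e / 2 + prob (?A k)"
      proof (rule prob_size_le_event[OF nm A])
        fix \<omega> assume "\<omega> \<in> space M" "\<omega> \<notin> ?A k"
        then have "(\<integral>\<^sup>+ s. ennreal ((?P k s \<omega> - c s \<omega>)\<^sup>2) \<partial>Leb) \<le> ennreal ((e / 2)\<^sup>2)" by auto
        from time_norm_le[of "\<lambda>s \<omega>. ?P k s \<omega> - c s \<omega>", OF this] e show "\<bar>time_dist (?P k) c \<omega>\<bar> \<le> e / 2" by simp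
      qed (use e in auto)
      then show ?case using elim by linarith
    qed
  qed
  have r2: "(\<lambda>k. prob_size (\<lambda>\<omega>. ?I k t \<omega> - I t \<omega>)) \<longlonglongrightarrow> 0" if t: "t \<in> {0..T}" for t
  proof (rule prob_size_LIMSEQ_I)
    fix e :: real assume e: "0 < e"
    let ?A = "\<lambda>k. {\<omega> \<in> space M. \<exists>t\<in>{0..T}. \<bar>?I k t \<omega> - I t \<omega>\<bar> > e / 2}"
    have A: "?A k \<in> sets M" for k
    proof (rule complete_measure.in_sets_AE[OF complete])
      \<comment> \<open>Uncountably many times enter \<open>?A\<close>.  Continuity of the paths reduces them to grid points outside a
         null set, and completeness of the measure does the rest.\<close>
      let ?A' = "\<Union>m. \<Union>i\<in>{..2^m}. {\<omega> \<in> space M. \<bar>?I k (grid m i) \<omega> - I (grid m i) \<omega>\<bar> > e / 2}"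
      have one: "{\<omega> \<in> space M. \<bar>?I k (grid m i) \<omega> - I (grid m i) \<omega>\<bar> > e / 2} \<in> sets M" if "i \<in> {..2^m}" for m i
      proof -
        have "grid m i \<in> {0..T}" using that by (auto intro!: grid_le_T)
        note [measurable] = SIm[OF this, of k] Im[OF this]
        show ?thesis by measurable
      qed
      show "?A' \<in> sets M"
        by (rule sets.countable_nat_UN, rule image_subsetI, rule sets.finite_UN[OF finite_atMost one])
      show "AE \<omega> in M. (\<omega> \<in> ?A') = (\<omega> \<in> ?A k)"
        using B_continuous Ic AE_space
      proof eventually_elim
        case (elim \<omega>)
        have "continuous_on {0..T} (\<lambda>t. ?I k t \<omega>)"
          unfolding simple_integral_def
        proof (intro continuous_intros)
          fix i assume "i \<in> {..<n k}"
          then have i: "\<tau> k i \<in> {0..T}" "\<tau> k (Suc i) \<in> {0..T}" using tau by auto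
          have "continuous_on {0..T} (\<lambda>t. B (min x t) \<omega>)" if "x \<in> {0..T}" for x
            by (rule continuous_on_compose2[OF elim(1)]) (use that in \<open>auto intro!: continuous_intros\<close>)
          then show "continuous_on {0..T} (\<lambda>t. B (min (\<tau> k (Suc i)) t) \<omega>)" "continuous_on {0..T} (\<lambda>t. B (min (\<tau> k i) t) \<omega>)" using i by auto
        qed
        then have ct: "continuous_on {0..T} (\<lambda>t. \<bar>?I k t \<omega> - I t \<omega>\<bar>)" using elim(2) by (intro continuous_intros)
        show ?case
        proof
          assume "\<omega> \<in> ?A'"
          then obtain m i where "i \<le> 2 ^ m" "\<bar>?I k (grid m i) \<omega> - I (grid m i) \<omega>\<bar> > e / 2" by auto
          moreover have "grid m i \<in> {0..T}" using \<open>i \<le> 2 ^ m\<close> by (auto intro!: grid_le_T)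
          ultimately show "\<omega> \<in> ?A k" using elim(3) by blast
        next
          assume "\<omega> \<in> ?A k"
          then obtain u where u: "u \<in> {0..T}" "\<bar>?I k u \<omega> - I u \<omega>\<bar> > e / 2" by blast
          from order_tendstoD(1)[OF grid_floor_path_tendsto[OF ct u(1)] u(2)]
          obtain m where "\<bar>?I k (grid_floor m u) \<omega> - I (grid_floor m u) \<omega>\<bar> > e / 2" using eventually_happens by force
          moreover have "grid_index m u \<le> 2 ^ m" using grid_index_le u(1) by auto
          ultimately show "\<omega> \<in> ?A'" using elim(3) unfolding grid_floor_def by blast
        qed
      qed
    qed auto
    have "\<forall>\<^sub>F k in sequentially. prob (?A k) < e / 2" by (rule order_tendstoD(2)[OF ucp]) (use e in auto)
    then show "\<forall>\<^sub>F k in sequentially. prob_size (\<lambda>\<omega>. ?I k t \<omega> - I t \<omega>) < e"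
    proof eventually_elim
      case (elim k)
      have "prob_size (\<lambda>\<omega>. ?I k t \<omega> - I t \<omega>) \<le> e / 2 + prob (?A k)"
        by (rule prob_size_le_event[OF borel_measurable_diff[OF SIm[OF t] Im[OF t]] A]) (use e t in \<open>auto simp: not_less\<close>)
      then show ?case using elim by linarith
    qed
  qed
  show ?thesis
    unfolding stoch_int_def
  proof (intro conjI ballI allI impI pc c2 Im)
    fix e :: real and S :: "real set" assume e: "0 < e" and S: "finite S" "S \<subseteq> {0..T}"
    have e2: "0 < e / 2" using e by simp
    have "\<forall>\<^sub>F k in sequentially. \<forall>t\<in>S. prob_size (\<lambda>\<omega>. ?I k t \<omega> - I t \<omega>) < e / 2"
      by (rule eventually_ball_finite[OF S(1)]) (use order_tendstoD(2)[OF r2 e2] S(2) in blast)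
    with order_tendstoD(2)[OF r1 e2]
    have "\<forall>\<^sub>F k in sequentially. prob_size (time_dist (?P k) c) < e / 2 \<and> (\<forall>t\<in>S. prob_size (\<lambda>\<omega>. ?I k t \<omega> - I t \<omega>) < e / 2)"
      by (rule eventually_conj)
    \<comment> \<open>A single simple process that is \<open>e / 2\<close>-close is fixed; its grid approximations are \<open>e / 2\<close>-close
       to it from some level on.\<close>
    then obtain k where k: "prob_size (time_dist (?P k) c) < e / 2" "\<forall>t\<in>S. prob_size (\<lambda>\<omega>. ?I k t \<omega> - I t \<omega>) < e / 2"
      using eventually_happens by force
    obtain H where H: "\<And>m. grid_step m (H m)" and nH: "prob_null (\<lambda>m. time_dist (H m) (?P k))"
      and JH: "\<And>t. t \<in> {0..T} \<Longrightarrow> prob_null (\<lambda>m \<omega>. step_integral m (H m) t \<omega> - ?I k t \<omega>)"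
      by (rule simple_approximation[OF sd[of k]]) (rule that)
    have "\<forall>\<^sub>F m in sequentially. \<forall>t\<in>S. prob_size (\<lambda>\<omega>. step_integral m (H m) t \<omega> - ?I k t \<omega>) < e / 2"
    proof (rule eventually_ball_finite[OF S(1)], rule ballI)
      fix t assume "t \<in> S"
      then have "(\<lambda>m. prob_size (\<lambda>\<omega>. step_integral m (H m) t \<omega> - ?I k t \<omega>)) \<longlonglongrightarrow> 0" using JH[of t] S(2) unfolding prob_null_def by blast
      from order_tendstoD(2)[OF this e2] show "\<forall>\<^sub>F m in sequentially. prob_size (\<lambda>\<omega>. step_integral m (H m) t \<omega> - ?I k t \<omega>) < e / 2" .
    qed
    moreover have "\<forall>\<^sub>F m in sequentially. prob_size (time_dist (H m) (?P k)) < e / 2"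
      by (rule order_tendstoD(2)[OF _ e2]) (rule nH[unfolded prob_null_def, THEN conjunct2])
    ultimately show "\<forall>\<^sub>F m in sequentially. \<exists>H. grid_step m H \<and> prob_size (time_dist H c) < e \<and> (\<forall>t\<in>S. prob_size (\<lambda>\<omega>. step_integral m H t \<omega> - I t \<omega>) < e)"
    proof eventually_elim
      case (elim m)
      have m1: "time_dist (H m) (?P k) \<in> borel_measurable M" by (intro time_norm_meas joint_diff_mult(1) grid_step_joint[OF H] Pj)
      have m2: "time_dist (H m) c \<in> borel_measurable M" by (intro time_norm_meas joint_diff_mult(1) grid_step_joint[OF H] cj)
      have "prob_size (time_dist (H m) c) \<le> prob_size (\<lambda>\<omega>. time_dist (H m) (?P k) \<omega> + time_dist (?P k) c \<omega>)"
      proof (rule prob_size_mono[OF m2])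
        show "AE \<omega> in M. \<bar>time_dist (H m) c \<omega>\<bar> \<le> \<bar>time_dist (H m) (?P k) \<omega> + time_dist (?P k) c \<omega>\<bar>"
          using c2 AE_space
        proof eventually_elim
          case (elim \<omega>)
          note sec = joint_section[OF cj elim(2)] joint_section[OF Pj[of k] elim(2)] grid_step_square_integrable[OF H[of m] elim(2)]
          have P2: "integrable Leb (\<lambda>s. (?P k s \<omega>)\<^sup>2)"
          proof (rule finite_measure.integrable_const_bound[OF finite_Leb, of _ "(\<Sum>i<n k. \<bar>\<xi> k i \<omega>\<bar>)\<^sup>2"])
            show "AE s in Leb. norm ((?P k s \<omega>)\<^sup>2) \<le> (\<Sum>i<n k. \<bar>\<xi> k i \<omega>\<bar>)\<^sup>2"
            proof (rule AE_I2)
              fix s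
              have "\<bar>?P k s \<omega>\<bar>\<^sup>2 \<le> (\<Sum>i<n k. \<bar>\<xi> k i \<omega>\<bar>)\<^sup>2" by (intro power_mono simple_process_bound) auto
              then show "norm ((?P k s \<omega>)\<^sup>2) \<le> (\<Sum>i<n k. \<bar>\<xi> k i \<omega>\<bar>)\<^sup>2" by simp
            qed
          qed (use sec in measurable)
          have d: "integrable Leb (\<lambda>s. (H m s \<omega> - ?P k s \<omega>)\<^sup>2)" "integrable Leb (\<lambda>s. (?P k s \<omega> - c s \<omega>)\<^sup>2)"
            using sec elim P2 by (auto intro!: L2_triangle_diff(1))
          have "time_norm (\<lambda>s \<omega>. (H m s \<omega> - ?P k s \<omega>) + (?P k s \<omega> - c s \<omega>)) \<omega> \<le> time_dist (H m) (?P k) \<omega> + time_dist (?P k) c \<omega>"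
            unfolding time_norm_def by (rule L2_triangle(3)[OF _ _ d]) (use sec in auto)
          then show ?case by simp
        qed
      qed (use m1 nm in measurable)
      also have "\<dots> \<le> prob_size (time_dist (H m) (?P k)) + prob_size (time_dist (?P k) c)" by (rule prob_size_add[OF m1 nm])
      also have "\<dots> < e" using elim(2) k(1) by simp
      finally have 1: "prob_size (time_dist (H m) c) < e" .
      have 2: "prob_size (\<lambda>\<omega>. step_integral m (H m) t \<omega> - I t \<omega>) < e" if t: "t \<in> S" for t
      proof -
        have tT: "t \<in> {0..T}" using t S by auto
        have "prob_size (\<lambda>\<omega>. step_integral m (H m) t \<omega> - I t \<omega>) = prob_size (\<lambda>\<omega>. (step_integral m (H m) t \<omega> - ?I k t \<omega>) + (?I k t \<omega> - I t \<omega>))" by simp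
        also have "\<dots> \<le> prob_size (\<lambda>\<omega>. step_integral m (H m) t \<omega> - ?I k t \<omega>) + prob_size (\<lambda>\<omega>. ?I k t \<omega> - I t \<omega>)"
          by (rule prob_size_add) (intro borel_measurable_diff step_integral_meas[OF H tT] SIm[OF tT] Im[OF tT])+
        also have "\<dots> < e" using elim(1) k(2) t by fastforce
        finally show ?thesis .
      qed
      show ?case using H 1 2 by blast
    qed
  qed
qed

lemma ito_process_weak_ito:
  assumes "ito_process M B T X a c"
  shows "weak_ito X a c"
proof -
  have X: "continuous_process M B T X" and pa: "progressive M B T a" and ai: "AE \<omega> in M. integrable Leb (\<lambda>s. a s \<omega>)"
    using assms unfolding ito_process_def by auto
  obtain I where I: "has_ito_integral M B T c I" and eq: "AE \<omega> in M. \<forall>t\<in>{0..T}. X t \<omega> = X 0 \<omega> + (\<integral>s. a s \<omega> \<partial>lebesgue_on {0..t}) + I t \<omega>"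
    using assms unfolding ito_process_def by blast
  have pX: "progressive M B T X" using X unfolding continuous_process_def by auto
  have "stoch_int (\<lambda>t \<omega>. X t \<omega> - X 0 \<omega> - time_integral t (\<lambda>s. a s \<omega>)) c"
  proof (rule stoch_int_cong[OF ito_integral_stoch_int[OF I]])
    fix t assume t: "t \<in> {0..T}"
    show "AE \<omega> in M. I t \<omega> = X t \<omega> - X 0 \<omega> - time_integral t (\<lambda>s. a s \<omega>)"
      using eq ai
    proof eventually_elim
      case (elim \<omega>)
      have "(\<integral>s. a s \<omega> \<partial>lebesgue_on {0..t}) = time_integral t (\<lambda>s. a s \<omega>)" by (rule time_integral_lebesgue_on[OF t]) (use elim(2) in auto)
      moreover have "X t \<omega> = X 0 \<omega> + (\<integral>s. a s \<omega> \<partial>lebesgue_on {0..t}) + I t \<omega>" using elim(1) t by blast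
      ultimately show ?case by simp
    qed
  qed (rule weak_ito_martingale_meas[OF pX pa])
  then show ?thesis unfolding weak_ito_def using X pa ai by blast
qed

end

section \<open>Decoupling the variational equation\<close>

text \<open>
  The diffusion coefficient of \<open>Y1 - p X1\<close>. The hypothesis on \<open>K\<close> is the definition of \<open>K\<^sub>1\<close> without
  the division, that on \<open>D\<close> the equation for \<open>\<Delta>\<close>; they remove \<open>x\<close> and \<open>S\<close> from the right-hand side.
\<close>

lemma decoupling_diffusion:
  fixes K :: real
  assumes K: "K * (1 - p * sz) = sx * p + sy * p\<^sup>2 + q" and D: "D = p * S"
  shows "z - (p * (sx * x + sy * y + sz * (z - D) + S) + x * q) =
    (1 - p * sz) * (z - D - K * x) - p * sy * (y - p * x)"
proof -
  have q: "q = K * (1 - p * sz) - sx * p - sy * p\<^sup>2" using K by simp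
  show ?thesis unfolding q D by (simp add: power2_eq_square algebra_simps)
qed

text \<open>
  The drift of \<open>Y1 - p X1\<close>: this cancellation is the reason for the form of the adjoint equation.
\<close>

lemma decoupling_drift:
  fixes K :: real
  shows "- (gx * x + gy * y + gz * (z - D) - q * S) -
      (p * (bx * x + by' * y + bz * (z - D)) +
       x * - (gx + gy * p + gz * K + bx * p + by' * p\<^sup>2 + bz * K * p + sx * q + sy * p * q + sz * K * q) +
       q * (sx * x + sy * y + sz * (z - D) + S)) =
    - ((gy + p * by' + q * sy) * (y - p * x) + (gz + p * bz + q * sz) * (z - D - K * x))"
  by (simp add: power2_eq_square algebra_simps)

text \<open>
  \<open>\<zeta>\<close> is recovered from the diffusion coefficient \<open>c\<close> and \<open>y\<close> by dividing by \<open>1 - p * sz\<close>.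
\<close>

lemma decoupling_drift_bound:
  fixes c y C \<beta> :: real
  assumes bd: "\<bar>gy\<bar> \<le> C" "\<bar>gz\<bar> \<le> C" "\<bar>by'\<bar> \<le> C" "\<bar>bz\<bar> \<le> C" "\<bar>sy\<bar> \<le> C" "\<bar>sz\<bar> \<le> C" "\<bar>p\<bar> \<le> C" "\<bar>q\<bar> \<le> C"
    and \<beta>: "0 < \<beta>" "\<beta> \<le> 1 - p * sz" and c: "c = (1 - p * sz) * \<zeta> - p * sy * y"
  shows "\<bar>- ((gy + p * by' + q * sy) * y + (gz + p * bz + q * sz) * \<zeta>)\<bar> \<le> (C + 2 * C\<^sup>2) * (1 + (1 + C\<^sup>2) / \<beta>) * (\<bar>y\<bar> + \<bar>c\<bar>)"
proof -
  have C: "0 \<le> C" using bd(1) by linarith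
  have prod: "\<bar>u * v\<bar> \<le> C\<^sup>2" if "\<bar>u\<bar> \<le> C" "\<bar>v\<bar> \<le> C" for u v :: real
    unfolding abs_mult power2_eq_square using that C by (intro mult_mono) auto
  have y: "\<bar>gy + p * by' + q * sy\<bar> \<le> C + 2 * C\<^sup>2" using bd(1) prod[OF bd(7,3)] prod[OF bd(8,5)] by linarith
  have z: "\<bar>gz + p * bz + q * sz\<bar> \<le> C + 2 * C\<^sup>2" using bd(2) prod[OF bd(7,4)] prod[OF bd(8,6)] by linarith
  have C2: "0 \<le> C + 2 * C\<^sup>2" using C by simp
  have zb: "\<bar>\<zeta>\<bar> \<le> (1 + C\<^sup>2) / \<beta> * (\<bar>y\<bar> + \<bar>c\<bar>)"
  proof -
    have "\<beta> * \<bar>\<zeta>\<bar> \<le> \<bar>(1 - p * sz) * \<zeta>\<bar>" unfolding abs_mult using \<beta> by (intro mult_right_mono) auto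
    also have "\<dots> = \<bar>c + (p * sy) * y\<bar>" using c by simp
    also have "\<dots> \<le> \<bar>c\<bar> + \<bar>p * sy\<bar> * \<bar>y\<bar>" by (metis abs_mult abs_triangle_ineq)
    also have "\<dots> \<le> \<bar>c\<bar> + C\<^sup>2 * \<bar>y\<bar>" using prod[OF bd(7,5)] by (intro add_left_mono mult_right_mono) auto
    also have "\<dots> \<le> (1 + C\<^sup>2) * (\<bar>y\<bar> + \<bar>c\<bar>)" by (simp add: algebra_simps)
    finally show ?thesis using \<beta>(1) by (simp add: field_simps)
  qed
  have "\<bar>- ((gy + p * by' + q * sy) * y + (gz + p * bz + q * sz) * \<zeta>)\<bar> \<le> \<bar>gy + p * by' + q * sy\<bar> * \<bar>y\<bar> + \<bar>gz + p * bz + q * sz\<bar> * \<bar>\<zeta>\<bar>"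
    unfolding abs_minus_cancel by (rule order_trans[OF abs_triangle_ineq]) (simp add: abs_mult)
  also have "\<dots> \<le> (C + 2 * C\<^sup>2) * \<bar>y\<bar> + (C + 2 * C\<^sup>2) * ((1 + C\<^sup>2) / \<beta> * (\<bar>y\<bar> + \<bar>c\<bar>))"
    using y z zb C2 by (intro add_mono mult_mono mult_right_mono) auto
  also have "\<dots> \<le> (C + 2 * C\<^sup>2) * (\<bar>y\<bar> + \<bar>c\<bar>) + (C + 2 * C\<^sup>2) * ((1 + C\<^sup>2) / \<beta> * (\<bar>y\<bar> + \<bar>c\<bar>))"
    using C2 by (intro add_right_mono mult_left_mono) auto
  also have "\<dots> = (C + 2 * C\<^sup>2) * (1 + (1 + C\<^sup>2) / \<beta>) * (\<bar>y\<bar> + \<bar>c\<bar>)" by (simp only: distrib_left distrib_right mult_1_right mult.assoc)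
  finally show ?thesis .
qed

context brownian_setting
begin

text \<open>
  The decoupling formula for a linear system with general coefficient processes; \<open>D\<close> and \<open>S\<close> stand
  for \<open>\<Delta> I\<^sub>E\<close> and \<open>\<delta>\<sigma> I\<^sub>E\<close>. The difference \<open>Y1 - p X1\<close> solves a backward equation of linear growth
  with terminal value zero.
\<close>

lemma variational_decoupling:
  fixes bx by' bz \<sigma>x \<sigma>y \<sigma>z gx gy gz p q D S X1 Y1 Z1 :: "real \<Rightarrow> 'a \<Rightarrow> real"
  defines "K \<equiv> K\<^sub>1 \<sigma>x \<sigma>y \<sigma>z p q"
  assumes X1: "weak_ito X1 (\<lambda>t \<omega>. bx t \<omega> * X1 t \<omega> + by' t \<omega> * Y1 t \<omega> + bz t \<omega> * (Z1 t \<omega> - D t \<omega>))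
      (\<lambda>t \<omega>. \<sigma>x t \<omega> * X1 t \<omega> + \<sigma>y t \<omega> * Y1 t \<omega> + \<sigma>z t \<omega> * (Z1 t \<omega> - D t \<omega>) + S t \<omega>)"
    and Y1: "weak_ito Y1 (\<lambda>t \<omega>. - (gx t \<omega> * X1 t \<omega> + gy t \<omega> * Y1 t \<omega> + gz t \<omega> * (Z1 t \<omega> - D t \<omega>) - q t \<omega> * S t \<omega>)) Z1"
    and p: "weak_ito p (\<lambda>t \<omega>. - (gx t \<omega> + gy t \<omega> * p t \<omega> + gz t \<omega> * K t \<omega>
                    + bx t \<omega> * p t \<omega> + by' t \<omega> * (p t \<omega>)\<^sup>2 + bz t \<omega> * K t \<omega> * p t \<omega>
                    + \<sigma>x t \<omega> * q t \<omega> + \<sigma>y t \<omega> * p t \<omega> * q t \<omega> + \<sigma>z t \<omega> * K t \<omega> * q t \<omega>)) q"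
    and terminal: "AE \<omega> in M. Y1 T \<omega> = p T \<omega> * X1 T \<omega>"
    and S2: "square_sup_integrable M T X1" "square_sup_integrable M T Y1"
    and pC: "AE \<omega> in M. \<forall>t\<in>{0..T}. \<bar>p t \<omega>\<bar> \<le> C" and \<beta>: "0 < \<beta>"
    and coef: "AE (t, \<omega>) in time_prob M T. \<bar>by' t \<omega>\<bar> \<le> C \<and> \<bar>bz t \<omega>\<bar> \<le> C \<and> \<bar>\<sigma>y t \<omega>\<bar> \<le> C \<and> \<bar>\<sigma>z t \<omega>\<bar> \<le> C \<and>
      \<bar>gy t \<omega>\<bar> \<le> C \<and> \<bar>gz t \<omega>\<bar> \<le> C \<and> \<bar>q t \<omega>\<bar> \<le> C \<and> \<beta> \<le> 1 - p t \<omega> * \<sigma>z t \<omega> \<and> D t \<omega> = p t \<omega> * S t \<omega>"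
  shows "AE \<omega> in M. \<forall>t\<in>{0..T}. Y1 t \<omega> = p t \<omega> * X1 t \<omega>"
    and "AE (t, \<omega>) in time_prob M T. Z1 t \<omega> = K t \<omega> * X1 t \<omega> + D t \<omega>"
proof -
  \<comment> \<open>Drift and diffusion coefficient of \<open>Y1 - p * X1\<close>, as the product rule produces them.\<close>
  define a where "a t \<omega> = - (gx t \<omega> * X1 t \<omega> + gy t \<omega> * Y1 t \<omega> + gz t \<omega> * (Z1 t \<omega> - D t \<omega>) - q t \<omega> * S t \<omega>) -
      (p t \<omega> * (bx t \<omega> * X1 t \<omega> + by' t \<omega> * Y1 t \<omega> + bz t \<omega> * (Z1 t \<omega> - D t \<omega>)) +
       X1 t \<omega> * - (gx t \<omega> + gy t \<omega> * p t \<omega> + gz t \<omega> * K t \<omega>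
                    + bx t \<omega> * p t \<omega> + by' t \<omega> * (p t \<omega>)\<^sup>2 + bz t \<omega> * K t \<omega> * p t \<omega>
                    + \<sigma>x t \<omega> * q t \<omega> + \<sigma>y t \<omega> * p t \<omega> * q t \<omega> + \<sigma>z t \<omega> * K t \<omega> * q t \<omega>) +
       q t \<omega> * (\<sigma>x t \<omega> * X1 t \<omega> + \<sigma>y t \<omega> * Y1 t \<omega> + \<sigma>z t \<omega> * (Z1 t \<omega> - D t \<omega>) + S t \<omega>))" for t \<omega>
  define c where "c t \<omega> = Z1 t \<omega> - (p t \<omega> * (\<sigma>x t \<omega> * X1 t \<omega> + \<sigma>y t \<omega> * Y1 t \<omega> + \<sigma>z t \<omega> * (Z1 t \<omega> - D t \<omega>) + S t \<omega>) + X1 t \<omega> * q t \<omega>)" for t \<omega>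
  define W where "W t \<omega> = Y1 t \<omega> - p t \<omega> * X1 t \<omega>" for t \<omega>
  have W: "weak_ito W a c"
    using weak_ito_diff[OF Y1 weak_ito_mult[OF p X1]] unfolding W_def[abs_def] a_def[abs_def] c_def[abs_def] .
  have C0: "0 \<le> C"
  proof -
    have "AE \<omega> in M. 0 \<le> C" using pC by eventually_elim (use T_pos in force)
    then show ?thesis by simp
  qed
  have diffusion: "c t \<omega> = (1 - p t \<omega> * \<sigma>z t \<omega>) * (Z1 t \<omega> - D t \<omega> - K t \<omega> * X1 t \<omega>) - p t \<omega> * \<sigma>y t \<omega> * W t \<omega>"
    if "1 - p t \<omega> * \<sigma>z t \<omega> \<noteq> 0" "D t \<omega> = p t \<omega> * S t \<omega>" for t \<omega>
  proof -
    have "K t \<omega> * (1 - p t \<omega> * \<sigma>z t \<omega>) = \<sigma>x t \<omega> * p t \<omega> + \<sigma>y t \<omega> * (p t \<omega>)\<^sup>2 + q t \<omega>"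
      using that(1) unfolding K_def K\<^sub>1_def by simp
    from decoupling_diffusion[OF this that(2)] show ?thesis unfolding c_def W_def .
  qed
  have drift: "a t \<omega> = - ((gy t \<omega> + p t \<omega> * by' t \<omega> + q t \<omega> * \<sigma>y t \<omega>) * W t \<omega> + (gz t \<omega> + p t \<omega> * bz t \<omega> + q t \<omega> * \<sigma>z t \<omega>) * (Z1 t \<omega> - D t \<omega> - K t \<omega> * X1 t \<omega>))" for t \<omega>
    unfolding a_def W_def by (rule decoupling_drift)
  have WT: "AE \<omega> in M. W T \<omega> = 0" using terminal unfolding W_def by eventually_elim simp
  have WS: "square_sup_integrable M T W"
  proof (rule square_sup_integrable_combine[OF weak_itoD(1)[OF X1] S2(1) weak_itoD(1)[OF Y1] S2(2) _ C0])
    show "AE \<omega> in M. \<forall>t\<in>{0..T}. \<bar>W t \<omega>\<bar> \<le> \<bar>Y1 t \<omega>\<bar> + C * \<bar>X1 t \<omega>\<bar>"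
      using pC
    proof eventually_elim
      case (elim \<omega>)
      show ?case
      proof
        fix t assume "t \<in> {0..T}"
        then have "\<bar>p t \<omega>\<bar> * \<bar>X1 t \<omega>\<bar> \<le> C * \<bar>X1 t \<omega>\<bar>" using elim by (intro mult_right_mono) auto
        then show "\<bar>W t \<omega>\<bar> \<le> \<bar>Y1 t \<omega>\<bar> + C * \<bar>X1 t \<omega>\<bar>"
          unfolding W_def using abs_triangle_ineq4[of "Y1 t \<omega>" "p t \<omega> * X1 t \<omega>"] by (simp add: abs_mult)
      qed
    qed
  qed
  let ?K = "(C + 2 * C\<^sup>2) * (1 + (1 + C\<^sup>2) / \<beta>)"
  have K0: "0 \<le> ?K" using C0 \<beta> by (intro mult_nonneg_nonneg add_nonneg_nonneg divide_nonneg_nonneg) auto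
  have bound: "AE \<omega> in M. AE t in Leb. \<bar>a t \<omega>\<bar> \<le> ?K * (\<bar>W t \<omega>\<bar> + \<bar>c t \<omega>\<bar>)"
    using AE_time_prob[OF coef] pC
  proof eventually_elim
    case (elim \<omega>)
    note pC' = elim(2)
    from elim(1) AE_Leb(2) show ?case
    proof (eventually_elim)
      case (elim t)
      have pt: "\<bar>p t \<omega>\<bar> \<le> C" using pC' elim(2) by auto
      note co = elim(1)
      have ne: "1 - p t \<omega> * \<sigma>z t \<omega> \<noteq> 0" "D t \<omega> = p t \<omega> * S t \<omega>" using co \<beta> by auto
      show ?case unfolding drift
        by (rule decoupling_drift_bound[OF _ _ _ _ _ _ pt _ \<beta> _ diffusion[OF ne]]) (use co in blast)+
    qed
  qed
  note uniq = bsde_uniqueness[OF W WT WS K0 bound]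
  show "AE \<omega> in M. \<forall>t\<in>{0..T}. Y1 t \<omega> = p t \<omega> * X1 t \<omega>" using uniq(1) unfolding W_def by eventually_elim simp
  have c0: "AE (t, \<omega>) in time_prob M T. c t \<omega> \<in> {0}"
    by (rule time_prob_AE_I[OF progressive_joint[OF weak_itoD(5)[OF W]]]) (use uniq(2) in auto)
  have W0: "AE (t, \<omega>) in time_prob M T. W t \<omega> \<in> {0}"
  proof (rule time_prob_AE_I[OF progressive_joint[OF weak_itoD(2)[OF W]]])
    show "AE \<omega> in M. AE t in Leb. W t \<omega> \<in> {0}"
      using uniq(1)
    proof eventually_elim
      case (elim \<omega>)
      from AE_Leb(2) show ?case by eventually_elim (use elim in auto)
    qed
  qed simp
  show "AE (t, \<omega>) in time_prob M T. Z1 t \<omega> = K t \<omega> * X1 t \<omega> + D t \<omega>"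
    using c0 W0 coef
  proof eventually_elim
    case (elim z)
    obtain t \<omega> where z: "z = (t, \<omega>)" by (cases z)
    have ne: "1 - p t \<omega> * \<sigma>z t \<omega> \<noteq> 0" "D t \<omega> = p t \<omega> * S t \<omega>" using elim(3) \<beta> unfolding z by auto
    have "(1 - p t \<omega> * \<sigma>z t \<omega>) * (Z1 t \<omega> - D t \<omega> - K t \<omega> * X1 t \<omega>) = 0"
      using diffusion[OF ne] elim(1,2) unfolding z by simp
    then have "Z1 t \<omega> - D t \<omega> - K t \<omega> * X1 t \<omega> = 0" using ne(1) by simp
    then show ?case unfolding z by (simp add: algebra_simps)
  qed
qed

end

lemma bounded_by_sup_norm:
  assumes "bounded_coef T U \<psi>" "t \<in> {0..T}" "u \<in> U"
  shows "\<bar>\<psi> t x y z u\<bar> \<le> sup_norm T U \<psi>"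
proof -
  obtain K where K: "\<forall>t\<in>{0..T}. \<forall>x y z. \<forall>u\<in>U. \<bar>\<psi> t x y z u\<bar> \<le> K" using assms(1) unfolding bounded_coef_def by blast
  let ?f = "\<lambda>(t, x, y, z, u). \<bar>\<psi> t x y z u\<bar>"
  have "?f (t, x, y, z, u) \<le> (SUP p\<in>{0..T} \<times> UNIV \<times> UNIV \<times> UNIV \<times> U. ?f p)"
    by (rule cSUP_upper) (use assms K in \<open>auto intro!: bdd_aboveI2[of _ _ K]\<close>)
  then show ?thesis unfolding sup_norm_def by simp
qed

theorem lemma3p13:
  fixes M :: "'a measure" and B :: "real \<Rightarrow> 'a \<Rightarrow> real" and T :: real
    and U :: "(real ^ 'k) set"
    and b \<sigma> g :: "(real ^ 'k) coef" and \<phi> :: "real \<Rightarrow> real" and x0 :: real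
    and C :: "real \<Rightarrow> real" and \<beta>0 :: real and s l :: "real \<Rightarrow> real"
    and ubar u :: "real \<Rightarrow> 'a \<Rightarrow> real ^ 'k"
    and Xbar Ybar Zbar p q \<Delta> X1 Y1 Z1 :: "real \<Rightarrow> 'a \<Rightarrow> real"
    and E :: "real set" and \<epsilon> :: real
  assumes "0 < T"
    and "prob_space M" and "complete_measure M" and "brownian_motion M B T"
    and "U \<noteq> {}"
    and A1: "A1 T U b \<sigma> g \<phi>"
    and A2: "A2 M B T U b \<sigma> g \<phi> C"
    and A4: "A4 T U b \<sigma> g \<phi> \<beta>0 s l"
    and optimal: "optimal_control M B T U b \<sigma> g \<phi> x0 ubar"
    and state: "state M B T b \<sigma> g \<phi> x0 ubar Xbar Ybar Zbar"
    and adjoint: "adjoint_solution M B T b \<sigma> g \<phi> Xbar Ybar Zbar ubar p q"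
    and p_bound: "AE \<omega> in M. \<forall>t\<in>{0..T}. \<bar>p t \<omega>\<bar> \<le> max (s 0) (- l 0)"
    and q_bounded: "\<exists>c. AE (t, \<omega>) in time_prob M T. \<bar>q t \<omega>\<bar> \<le> c"
    and u: "u \<in> admissible M B T U"
    and \<Delta>_adapted: "progressive M B T \<Delta>"
    and \<Delta>: "AE (t, \<omega>) in time_prob M T.
           \<Delta> t \<omega> = p t \<omega> * \<delta>\<sigma> \<sigma> Xbar Ybar Zbar ubar u \<Delta> t \<omega>"
    and "E \<in> sets lebesgue" and "E \<subseteq> {0..T}" and "measure lebesgue E = \<epsilon>"
    and "0 < \<epsilon>" and "\<epsilon> < T"
    and variational:
      "variational_solution M B T b \<sigma> g \<phi> Xbar Ybar Zbar ubar u q \<Delta> E X1 Y1 Z1"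
  shows "(AE \<omega> in M. \<forall>t\<in>{0..T}. Y1 t \<omega> = p t \<omega> * X1 t \<omega>) \<and>
    (AE (t, \<omega>) in time_prob M T.
       Z1 t \<omega> = K\<^sub>1 (along (D\<^sub>x \<sigma>) Xbar Ybar Zbar ubar) (along (D\<^sub>y \<sigma>) Xbar Ybar Zbar ubar)
                  (along (D\<^sub>z \<sigma>) Xbar Ybar Zbar ubar) p q t \<omega> * X1 t \<omega>
                + \<Delta> t \<omega> * indicator E t)"
proof -
  interpret brownian_setting M B T
    using assms(1-4) by (intro brownian_setting.intro brownian_setting_axioms.intro)
  let ?al = "\<lambda>\<psi>. along \<psi> Xbar Ybar Zbar ubar"
  let ?ds = "\<delta>\<sigma> \<sigma> Xbar Ybar Zbar ubar u \<Delta>"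
  let ?D = "\<lambda>t \<omega>. \<Delta> t \<omega> * indicator E t" and ?S = "\<lambda>t \<omega>. ?ds t \<omega> * indicator E t"
  define \<kappa> where "\<kappa> = max (s 0) (- l 0)"
  obtain cq where cq: "AE (t, \<omega>) in time_prob M T. \<bar>q t \<omega>\<bar> \<le> cq" using q_bounded by blast
  have bdd: "bounded_coef T U (D\<^sub>y b)" "bounded_coef T U (D\<^sub>z b)" "bounded_coef T U (D\<^sub>y \<sigma>)" "bounded_coef T U (D\<^sub>z \<sigma>)"
    "bounded_coef T U (D\<^sub>y g)" "bounded_coef T U (D\<^sub>z g)"
    using A1 unfolding A1_def A1_coef_def by blast+
  have ubar: "ubar t \<omega> \<in> U" if "t \<in> {0..T}" "\<omega> \<in> space M" for t \<omega>
    using optimal that unfolding optimal_control_def admissible_def by blast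
  have al: "\<bar>?al \<psi> t \<omega>\<bar> \<le> sup_norm T U \<psi>" if "bounded_coef T U \<psi>" "t \<in> {0..T}" "\<omega> \<in> space M" for \<psi> t \<omega>
    unfolding along_def by (rule bounded_by_sup_norm[OF that(1,2) ubar[OF that(2,3)]])
  have \<beta>: "0 < \<beta>0" "\<kappa> * sup_norm T U (D\<^sub>z \<sigma>) \<le> 1 - \<beta>0"
    using A4 unfolding A4_def Let_def L\<^sub>3_def \<kappa>_def by auto
  \<comment> \<open>One constant that bounds every coefficient that enters the linear equation for the difference.\<close>
  define Cb where "Cb = Max {\<kappa>, cq, sup_norm T U (D\<^sub>y b), sup_norm T U (D\<^sub>z b), sup_norm T U (D\<^sub>y \<sigma>),
     sup_norm T U (D\<^sub>z \<sigma>), sup_norm T U (D\<^sub>y g), sup_norm T U (D\<^sub>z g)}"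
  have Cb: "x \<le> Cb" if "x \<in> {\<kappa>, cq, sup_norm T U (D\<^sub>y b), sup_norm T U (D\<^sub>z b), sup_norm T U (D\<^sub>y \<sigma>),
     sup_norm T U (D\<^sub>z \<sigma>), sup_norm T U (D\<^sub>y g), sup_norm T U (D\<^sub>z g)}" for x
    unfolding Cb_def using that by (intro Max_ge) auto
  have var: "fbsde_solution M B T
      (\<lambda>t \<omega>. ?al (D\<^sub>x b) t \<omega> * X1 t \<omega> + ?al (D\<^sub>y b) t \<omega> * Y1 t \<omega> + ?al (D\<^sub>z b) t \<omega> * (Z1 t \<omega> - ?D t \<omega>))
      (\<lambda>t \<omega>. ?al (D\<^sub>x \<sigma>) t \<omega> * X1 t \<omega> + ?al (D\<^sub>y \<sigma>) t \<omega> * Y1 t \<omega> + ?al (D\<^sub>z \<sigma>) t \<omega> * (Z1 t \<omega> - ?D t \<omega>) + ?S t \<omega>)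
      (\<lambda>t \<omega>. ?al (D\<^sub>x g) t \<omega> * X1 t \<omega> + ?al (D\<^sub>y g) t \<omega> * Y1 t \<omega> + ?al (D\<^sub>z g) t \<omega> * (Z1 t \<omega> - ?D t \<omega>) - q t \<omega> * ?S t \<omega>)
      0 (\<lambda>\<omega>. deriv \<phi> (Xbar T \<omega>) * X1 T \<omega>) X1 Y1 Z1"
    using variational unfolding variational_solution_def Let_def mult.assoc .
  note weak = ito_process_weak_ito
  have X1: "weak_ito X1 (\<lambda>t \<omega>. ?al (D\<^sub>x b) t \<omega> * X1 t \<omega> + ?al (D\<^sub>y b) t \<omega> * Y1 t \<omega> + ?al (D\<^sub>z b) t \<omega> * (Z1 t \<omega> - ?D t \<omega>))
      (\<lambda>t \<omega>. ?al (D\<^sub>x \<sigma>) t \<omega> * X1 t \<omega> + ?al (D\<^sub>y \<sigma>) t \<omega> * Y1 t \<omega> + ?al (D\<^sub>z \<sigma>) t \<omega> * (Z1 t \<omega> - ?D t \<omega>) + ?S t \<omega>)"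
    and Y1: "weak_ito Y1 (\<lambda>t \<omega>. - (?al (D\<^sub>x g) t \<omega> * X1 t \<omega> + ?al (D\<^sub>y g) t \<omega> * Y1 t \<omega> + ?al (D\<^sub>z g) t \<omega> * (Z1 t \<omega> - ?D t \<omega>) - q t \<omega> * ?S t \<omega>)) Z1"
    and S2: "square_sup_integrable M T X1" "square_sup_integrable M T Y1"
    and Y1T: "AE \<omega> in M. Y1 T \<omega> = deriv \<phi> (Xbar T \<omega>) * X1 T \<omega>"
    using var unfolding fbsde_solution_def by (blast intro: weak)+
  have pI: "weak_ito p
           (\<lambda>t \<omega>. - (?al (D\<^sub>x g) t \<omega> + ?al (D\<^sub>y g) t \<omega> * p t \<omega> + ?al (D\<^sub>z g) t \<omega> * K\<^sub>1 (?al (D\<^sub>x \<sigma>)) (?al (D\<^sub>y \<sigma>)) (?al (D\<^sub>z \<sigma>)) p q t \<omega>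
                    + ?al (D\<^sub>x b) t \<omega> * p t \<omega> + ?al (D\<^sub>y b) t \<omega> * (p t \<omega>)\<^sup>2 + ?al (D\<^sub>z b) t \<omega> * K\<^sub>1 (?al (D\<^sub>x \<sigma>)) (?al (D\<^sub>y \<sigma>)) (?al (D\<^sub>z \<sigma>)) p q t \<omega> * p t \<omega>
                    + ?al (D\<^sub>x \<sigma>) t \<omega> * q t \<omega> + ?al (D\<^sub>y \<sigma>) t \<omega> * p t \<omega> * q t \<omega> + ?al (D\<^sub>z \<sigma>) t \<omega> * K\<^sub>1 (?al (D\<^sub>x \<sigma>)) (?al (D\<^sub>y \<sigma>)) (?al (D\<^sub>z \<sigma>)) p q t \<omega> * q t \<omega>))
           q" and pT: "AE \<omega> in M. p T \<omega> = deriv \<phi> (Xbar T \<omega>)"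
    using adjoint unfolding adjoint_solution_def Let_def by (blast intro: weak)+
  have terminal: "AE \<omega> in M. Y1 T \<omega> = p T \<omega> * X1 T \<omega>" using Y1T pT by eventually_elim simp
  have pC: "AE \<omega> in M. \<forall>t\<in>{0..T}. \<bar>p t \<omega>\<bar> \<le> Cb"
    using p_bound unfolding \<kappa>_def[symmetric] by eventually_elim (use Cb[of \<kappa>] in force)
  \<comment> \<open>The bound on \<open>p\<close> together with the smallness of \<open>\<sigma>\<^sub>z\<close> keeps \<open>1 - p * \<sigma>\<^sub>z\<close> at least \<open>\<beta>0\<close>.\<close>
  have p\<kappa>: "AE (t, \<omega>) in time_prob M T. p t \<omega> \<in> {- \<kappa>..\<kappa>}"
  proof (rule time_prob_AE_I[OF progressive_joint[OF weak_itoD(2)[OF pI]]])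
    show "AE \<omega> in M. AE t in lebesgue_on {0..T}. p t \<omega> \<in> {- \<kappa>..\<kappa>}"
      using p_bound unfolding \<kappa>_def[symmetric]
    proof eventually_elim
      case (elim \<omega>)
      show ?case using AE_Leb(2) by eventually_elim (use elim in \<open>force simp: abs_le_iff\<close>)
    qed
  qed simp
  have coef: "AE (t, \<omega>) in time_prob M T. \<bar>?al (D\<^sub>y b) t \<omega>\<bar> \<le> Cb \<and> \<bar>?al (D\<^sub>z b) t \<omega>\<bar> \<le> Cb \<and> \<bar>?al (D\<^sub>y \<sigma>) t \<omega>\<bar> \<le> Cb \<and> \<bar>?al (D\<^sub>z \<sigma>) t \<omega>\<bar> \<le> Cb \<and>
      \<bar>?al (D\<^sub>y g) t \<omega>\<bar> \<le> Cb \<and> \<bar>?al (D\<^sub>z g) t \<omega>\<bar> \<le> Cb \<and> \<bar>q t \<omega>\<bar> \<le> Cb \<and> \<beta>0 \<le> 1 - p t \<omega> * ?al (D\<^sub>z \<sigma>) t \<omega> \<and> ?D t \<omega> = p t \<omega> * ?S t \<omega>"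
    using p\<kappa> cq \<Delta> AE_space
  proof eventually_elim
    case (elim r)
    obtain t \<omega> where r: "r = (t, \<omega>)" by (cases r)
    have t: "t \<in> {0..T}" and \<omega>: "\<omega> \<in> space M" using elim(4) unfolding r by (auto simp: space_pair_measure)
    note bd = al[OF bdd(1) t \<omega>] al[OF bdd(2) t \<omega>] al[OF bdd(3) t \<omega>] al[OF bdd(4) t \<omega>] al[OF bdd(5) t \<omega>] al[OF bdd(6) t \<omega>]
    have "\<bar>p t \<omega>\<bar> \<le> \<kappa>" using elim(1) unfolding r by auto
    then have "\<bar>p t \<omega> * ?al (D\<^sub>z \<sigma>) t \<omega>\<bar> \<le> \<kappa> * sup_norm T U (D\<^sub>z \<sigma>)"
      unfolding abs_mult using bd(4) by (intro mult_mono) auto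
    then have "\<beta>0 \<le> 1 - p t \<omega> * ?al (D\<^sub>z \<sigma>) t \<omega>" using \<beta>(2) by linarith
    moreover have "?D t \<omega> = p t \<omega> * ?S t \<omega>" using elim(3) unfolding r by simp
    moreover have "\<bar>q t \<omega>\<bar> \<le> Cb" using elim(2) Cb[of cq] unfolding r by simp
    moreover have "\<bar>?al (D\<^sub>y b) t \<omega>\<bar> \<le> Cb" "\<bar>?al (D\<^sub>z b) t \<omega>\<bar> \<le> Cb" "\<bar>?al (D\<^sub>y \<sigma>) t \<omega>\<bar> \<le> Cb" "\<bar>?al (D\<^sub>z \<sigma>) t \<omega>\<bar> \<le> Cb" "\<bar>?al (D\<^sub>y g) t \<omega>\<bar> \<le> Cb" "\<bar>?al (D\<^sub>z g) t \<omega>\<bar> \<le> Cb"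
      by (rule order_trans[OF bd(1) Cb] order_trans[OF bd(2) Cb] order_trans[OF bd(3) Cb] order_trans[OF bd(4) Cb] order_trans[OF bd(5) Cb] order_trans[OF bd(6) Cb], simp)+
    ultimately show ?case unfolding r by simp
  qed
  show ?thesis
    using variational_decoupling[OF X1 Y1 pI terminal S2 pC \<beta>(1) coef] by blast
qed

end
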